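(* If $\mu$ and $\lambda$ are strict partitions then $jq_{\lambda/\mu}=jq^{\mathrm{comb}}_{\lambda/\mu}$.
   Context: Strict partitions $\lambda=(\lambda_1>\dots>\lambda_k>0)$, $|\lambda|=\sum\lambda_i$, shifted diagram $\mathsf{SD}_\lambda=\{(i,i+j-1):1\le i\le k,1\le j\le\lambda_i\}$; for strict $\mu\subseteq\lambda$, $\mathsf{SD}_{\lambda/\mu}=\mathsf{SD}_\lambda\setminus\mathsf{SD}_\mu$; diagonal boxes $(i,i)$. Primed numbers $i'=i-\tfrac12$, ordered $1'<1<2'<2<\dots$; $\beta,x_i,y_i$ commuting indeterminates. A semistandard shifted set-valued tableau of shape $\lambda$ fills each box $(i,j)$ with a nonempty finite subset $T_{ij}$ of $\{1'<1<\dots\}$ with $\max T_{ij}\le\min T_{i+1,j}$, $\max T_{ij}\le\min T_{i,j+1}$ (when boxes exist), no unprimed number in two boxes of a column, no primed number in two boxes of a row; $|T|=\sum|T_{ij}|$, ${\bf x}^T=\prod x_i^{(\#i)+(\#i')}$. $GQ_\lambda=\sum\beta^{|\lambda|-|T|}{\bf x}^T$ over all such tableaux; $GP_\lambda$ the same over those with no primed diagonal entries. $gp_\lambda,gq_\lambda$ are the unique power series with $\sum_\lambda GQ_\lambda({\bf x})gp_\lambda({\bf y})=\sum_\lambda GP_\lambda({\bf x})gq_\lambda({\bf y})=\prod_{i,j}\frac{1-\overline{x_i}y_j}{1-x_iy_j}$, $\overline{x}=\frac{-x}{1+\beta x}$. Let $\omega$ be the $\mathbb{Z}[\beta]$-linear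 involution of symmetric functions with $\omega(s_\lambda)=s_{\lambda^\top}$, and $jq_\lambda=\omega(gq_\lambda)$. With $f({\bf x},{\bf y}):=f(x_1,y_1,x_2,y_2,\dots)$, the skew functions $jq_{\lambda/\mu}$ ($\mu$ any strict partition) are defined by $jq_\lambda({\bf x},{\bf y})=\sum_\mu jq_\mu({\bf x})jq_{\lambda/\mu}({\bf y})$. A shifted bar tableau of shape $\lambda/\mu$ is a pair $(V,\Pi)$: $V$ fills each box with one element of $\{1'<1<\dots\}$, no unprimed entry repeated in a column, no primed entry repeated in a row; $\Pi$ partitions the boxes into nonempty bars of contiguous boxes in one row or column with equal entries; semistandard means weakly increasing rows and columns; $|T|$ = number of bars, ${\bf x}^T=\prod x_i^{b_i}$ ($b_i$ = bars containing $i$ or $i'$). $jq^{\mathrm{comb}}_{\lambda/\mu}=\sum(-\beta)^{|\lambda|-|\mu|-|T|}{\bf x}^T$ over all semistandard shifted bar tableaux of shape $\lambda/\mu$ (zero if $\mu\not\subseteq\lambda$).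
   Formalization: The weight of a set-valued tableau in GP is taken as β^{|T|-|λ|} instead of the printed β^{|λ|-|T|}, for which no gq satisfying the Cauchy identity exists; the expansion defining the skew functions is read as having finitely many nonzero terms. *)

theory Defs
  imports
    "HOL-Library.Poly_Mapping"
    "HOL-Library.FuncSet"
    "HOL-Library.Disjoint_Sets"
    "HOL-Computational_Algebra.Polynomial"
begin

section \<open>Power series in countably many variables\<close>

text \<open>
  Monomials are finitely supported exponent vectors; the variables are indexed from 0, so that
  index \<open>i\<close> stands for \<open>x\<^sub>i\<^sub>+\<^sub>1\<close> of the usual convention.
\<close>

type_synonym monomial = "nat \<Rightarrow>\<^sub>0 nat"

typedef 'a mpseries = "UNIV :: (monomial \<Rightarrow> 'a) set"
  morphisms coeff_of Abs_mpseries ..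

setup_lifting type_definition_mpseries

lemma coeff_of_Abs [simp]: "coeff_of (Abs_mpseries f) = f"
  by (simp add: Abs_mpseries_inverse)

lemma mpseries_eqI: "(\<And>m. coeff_of f m = coeff_of g m) \<Longrightarrow> f = g"
  by transfer auto

definition splits :: "monomial \<Rightarrow> (monomial \<times> monomial) set" where
  "splits m = {(a, b). a + b = m}"

lemma finite_splits [simp]: "finite (splits m)"
proof -
  define K where "K = Poly_Mapping.keys m"
  define B where "B = PiE K (\<lambda>i. {..Poly_Mapping.lookup m i})"
  have "finite B"
    by (auto simp: B_def K_def intro!: finite_PiE)
  have zero: "Poly_Mapping.lookup a i = 0" if "i \<notin> K" "(a, b) \<in> splits m" for a b i
  proof -
    have "Poly_Mapping.lookup (a + b) i = 0"
      using that by (simp add: splits_def K_def in_keys_iff)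
    then show ?thesis
      by (simp add: lookup_add)
  qed
  have "inj_on (\<lambda>(a, b). restrict (Poly_Mapping.lookup a) K) (splits m)"
  proof (rule inj_onI, clarify)
    fix a b c d
    assume ab: "(a, b) \<in> splits m" and cd: "(c, d) \<in> splits m"
      and eq: "restrict (Poly_Mapping.lookup a) K = restrict (Poly_Mapping.lookup c) K"
    have "Poly_Mapping.lookup a i = Poly_Mapping.lookup c i" for i
      using zero[OF _ ab, of i] zero[OF _ cd, of i] fun_cong[OF eq, of i]
      by (cases "i \<in> K") auto
    then have "a = c"
      by (intro poly_mapping_eqI)
    moreover have "a + b = c + d"
      using ab cd by (simp add: splits_def)
    ultimately show "a = c \<and> b = d"
      by simp
  qed
  moreover have "(\<lambda>(a, b). restrict (Poly_Mapping.lookup a) K) ` splits m \<subseteq> B"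
    by (auto simp: B_def splits_def lookup_add)
  ultimately show ?thesis
    using \<open>finite B\<close> by (metis finite_subset finite_imageD)
qed

instantiation mpseries :: (comm_ring_1) comm_ring_1
begin

lift_definition zero_mpseries :: "'a mpseries" is "\<lambda>_. 0" .
lift_definition one_mpseries :: "'a mpseries" is "\<lambda>m. if m = 0 then 1 else 0" .
lift_definition plus_mpseries :: "'a mpseries \<Rightarrow> 'a mpseries \<Rightarrow> 'a mpseries"
  is "\<lambda>f g m. f m + g m" .
lift_definition minus_mpseries :: "'a mpseries \<Rightarrow> 'a mpseries \<Rightarrow> 'a mpseries"
  is "\<lambda>f g m. f m - g m" .
lift_definition uminus_mpseries :: "'a mpseries \<Rightarrow> 'a mpseries"
  is "\<lambda>f m. - f m" .
lift_definition times_mpseries :: "'a mpseries \<Rightarrow> 'a mpseries \<Rightarrow> 'a mpseries"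
  is "\<lambda>f g m. \<Sum>(a, b) \<in> splits m. f a * g b" .

instance
proof
  fix f g h :: "'a mpseries"
  show "f * g * h = f * (g * h)"
  proof (transfer, rule ext)
    fix f g h :: "monomial \<Rightarrow> 'a" and m
    have "(\<Sum>(a, b)\<in>splits m. (\<Sum>(c, d)\<in>splits a. f c * g d) * h b)
        = (\<Sum>((a, b), (c, d))\<in>(SIGMA p:splits m. splits (fst p)). f c * g d * h b)"
      by (simp add: sum.Sigma split_def sum_distrib_right)
    also have "\<dots> = (\<Sum>((a, b), (c, d))\<in>(SIGMA p:splits m. splits (snd p)). f a * (g c * h d))"
      by (rule sum.reindex_bij_witness
            [where j = "\<lambda>((a, b), (c, d)). ((c, d + b), (d, b))"
               and i = "\<lambda>((a, b), (c, d)). ((a + c, d), (a, c))"])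
         (auto simp: splits_def ac_simps)
    also have "\<dots> = (\<Sum>(a, b)\<in>splits m. f a * (\<Sum>(c, d)\<in>splits b. g c * h d))"
      by (simp add: sum.Sigma split_def sum_distrib_left)
    finally show "(\<Sum>(a, b)\<in>splits m. (\<Sum>(c, d)\<in>splits a. f c * g d) * h b)
        = (\<Sum>(a, b)\<in>splits m. f a * (\<Sum>(c, d)\<in>splits b. g c * h d))" .
  qed
  show "f * g = g * f"
  proof (transfer, rule ext)
    fix f g :: "monomial \<Rightarrow> 'a" and m
    show "(\<Sum>(a, b)\<in>splits m. f a * g b) = (\<Sum>(a, b)\<in>splits m. g a * f b)"
      by (rule sum.reindex_bij_witness[where i = prod.swap and j = prod.swap])
         (auto simp: splits_def ac_simps)
  qed
  show "1 * f = f"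
  proof (transfer, rule ext)
    fix f :: "monomial \<Rightarrow> 'a" and m
    have "(\<Sum>(a, b)\<in>splits m. (if a = 0 then 1 else 0) * f b)
        = (\<Sum>(a, b)\<in>{(0 :: monomial, m)}. (if a = 0 then 1 else 0) * f b)"
      by (rule sum.mono_neutral_right[OF finite_splits]) (auto simp: splits_def split: if_splits)
    then show "(\<Sum>(a, b)\<in>splits m. (if a = 0 then 1 else 0) * f b) = f m"
      by simp
  qed
  show "(f + g) * h = f * h + g * h"
    by transfer (auto simp: sum.distrib[symmetric] split_def distrib_right)
  show "(0 :: 'a mpseries) \<noteq> 1"
    by transfer (metis zero_neq_one)
qed (transfer; auto simp: algebra_simps)+

end

lift_definition Const :: "'a::zero \<Rightarrow> 'a mpseries" is "\<lambda>c m. if m = 0 then c else 0" .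

lift_definition Var :: "nat \<Rightarrow> 'a::zero_neq_one mpseries"
  is "\<lambda>i m. if m = Poly_Mapping.single i 1 then 1 else 0" .

definition mdegree :: "monomial \<Rightarrow> nat" where
  "mdegree m = (\<Sum>i\<in>Poly_Mapping.keys m. Poly_Mapping.lookup m i)"

text \<open>Inverse of a unit of a commutative ring (such inverses are unique).\<close>

definition unit_inv :: "'a::comm_ring_1 \<Rightarrow> 'a" where
  "unit_inv a = (THE b. a * b = 1)"


section \<open>Partitions, diagrams, entries\<close>

definition is_partition :: "nat list \<Rightarrow> bool" where
  "is_partition lam \<longleftrightarrow> sorted_wrt (\<ge>) lam \<and> (\<forall>p\<in>set lam. 0 < p)"

definition strict_partition :: "nat list \<Rightarrow> bool" where
  "strict_partition lam \<longleftrightarrow> sorted_wrt (>) lam \<and> (\<forall>p\<in>set lam. 0 < p)"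

text \<open>Rows and columns are numbered from 0.\<close>

definition YD :: "nat list \<Rightarrow> (nat \<times> nat) set" where
  "YD lam = {(i, j). i < length lam \<and> j < lam ! i}"

definition SD :: "nat list \<Rightarrow> (nat \<times> nat) set" where
  "SD lam = {(i, i + j) | i j. i < length lam \<and> j < lam ! i}"

definition conjugate :: "nat list \<Rightarrow> nat list" where
  "conjugate lam = map (\<lambda>j. card {i. i < length lam \<and> j < lam ! i})
     [0..<(if lam = [] then 0 else hd lam)]"

text \<open>
  The alphabet \<open>1' < 1 < 2' < 2 < \<dots>\<close> is encoded by the natural numbers \<open>0 < 1 < 2 < 3 < \<dots>\<close>:
  \<open>2 * i\<close> encodes \<open>(i+1)'\<close> and \<open>2 * i + 1\<close> encodes \<open>i+1\<close>.  Both belong to the variable with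
  index \<open>i\<close>.
\<close>

abbreviation primed :: "nat \<Rightarrow> bool" where
  "primed e \<equiv> even e"

abbreviation var_of :: "nat \<Rightarrow> nat" where
  "var_of e \<equiv> e div 2"


section \<open>Symmetric functions over the ring of integer polynomials in beta\<close>

text \<open>The coefficient ring \<open>\<int>[\<beta>]\<close> is \<^typ>\<open>int poly\<close>.\<close>

definition beta :: "int poly" where
  "beta = [:0, 1:]"

definition Sym :: "int poly mpseries set" where
  "Sym = {f. (\<forall>\<pi> m. bij \<pi> \<longrightarrow> coeff_of f (Poly_Mapping.map_key \<pi> m) = coeff_of f m) \<and>
             (\<exists>d. \<forall>m. coeff_of f m \<noteq> 0 \<longrightarrow> mdegree m \<le> d)}"

definition SSYT :: "nat list \<Rightarrow> (nat \<times> nat \<Rightarrow> nat) set" where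
  "SSYT lam = {T \<in> YD lam \<rightarrow>\<^sub>E UNIV.
     (\<forall>i j. (i, j) \<in> YD lam \<and> (i, Suc j) \<in> YD lam \<longrightarrow> T (i, j) \<le> T (i, Suc j)) \<and>
     (\<forall>i j. (i, j) \<in> YD lam \<and> (Suc i, j) \<in> YD lam \<longrightarrow> T (i, j) < T (Suc i, j))}"

definition schur :: "nat list \<Rightarrow> int poly mpseries" where
  "schur lam = Abs_mpseries (\<lambda>m. of_nat (card {T \<in> SSYT lam.
     \<forall>i. Poly_Mapping.lookup m i = card {b \<in> YD lam. T b = i}}))"

text \<open>
  The Schur functions form a \<open>\<int>[\<beta>]\<close>-basis of \<^const>\<open>Sym\<close>, so the following properties
  determine \<open>omega\<close> on \<^const>\<open>Sym\<close> (and imply that it is an involution there); its values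
  elsewhere are irrelevant.
\<close>

definition omega :: "int poly mpseries \<Rightarrow> int poly mpseries" where
  "omega = (SOME w.
     (\<forall>f\<in>Sym. \<forall>g\<in>Sym. w (f + g) = w f + w g) \<and>
     (\<forall>c. \<forall>f\<in>Sym. w (Const c * f) = Const c * w f) \<and>
     (\<forall>lam. is_partition lam \<longrightarrow> w (schur lam) = schur (conjugate lam)))"


section \<open>The functions GP and their duals gq\<close>

definition SSVT :: "nat list \<Rightarrow> (nat \<times> nat \<Rightarrow> nat set) set" where
  "SSVT lam = {T \<in> SD lam \<rightarrow>\<^sub>E {S. finite S \<and> S \<noteq> {}}.
     (\<forall>i j. (i, j) \<in> SD lam \<and> (Suc i, j) \<in> SD lam \<longrightarrow> Max (T (i, j)) \<le> Min (T (Suc i, j))) \<and>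
     (\<forall>i j. (i, j) \<in> SD lam \<and> (i, Suc j) \<in> SD lam \<longrightarrow> Max (T (i, j)) \<le> Min (T (i, Suc j))) \<and>
     (\<forall>i i' j e. (i, j) \<in> SD lam \<and> (i', j) \<in> SD lam \<and> i \<noteq> i' \<and> \<not> primed e \<longrightarrow>
        \<not> (e \<in> T (i, j) \<and> e \<in> T (i', j))) \<and>
     (\<forall>i j j' e. (i, j) \<in> SD lam \<and> (i, j') \<in> SD lam \<and> j \<noteq> j' \<and> primed e \<longrightarrow>
        \<not> (e \<in> T (i, j) \<and> e \<in> T (i, j')))}"

definition sv_size :: "nat list \<Rightarrow> (nat \<times> nat \<Rightarrow> nat set) \<Rightarrow> nat" where
  "sv_size lam T = (\<Sum>b\<in>SD lam. card (T b))"

text \<open>The exponent of the variable with index \<open>k\<close> in the weight of \<open>T\<close>.\<close>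

definition sv_weight :: "nat list \<Rightarrow> (nat \<times> nat \<Rightarrow> nat set) \<Rightarrow> nat \<Rightarrow> nat" where
  "sv_weight lam T k = (\<Sum>b\<in>SD lam. card {e \<in> T b. var_of e = k})"

text \<open>
  The sum below is finite, since the weight bounds the entries of \<open>T\<close>.  Every box is nonempty,
  so the subtraction in the exponent of \<open>\<beta>\<close> does not truncate.  In particular
  \<open>GP lam\<close> has no terms of degree less than \<open>sum_list lam\<close>.
\<close>

definition GP :: "nat list \<Rightarrow> int poly mpseries" where
  "GP lam = Abs_mpseries (\<lambda>m. \<Sum>T | T \<in> SSVT lam \<and>
                (\<forall>i. (i, i) \<in> SD lam \<longrightarrow> (\<forall>e\<in>T (i, i). \<not> primed e)) \<and>
                (\<forall>k. Poly_Mapping.lookup m k = sv_weight lam T k).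
     beta ^ (sv_size lam T - sum_list lam))"

text \<open>
  Power series in two sets of variables \<open>x\<close> and \<open>y\<close> are represented as power series in \<open>y\<close>
  whose coefficients are power series in \<open>x\<close>.
\<close>

abbreviation xvar :: "nat \<Rightarrow> int poly mpseries mpseries" where
  "xvar i \<equiv> Const (Var i)"

abbreviation yvar :: "nat \<Rightarrow> int poly mpseries mpseries" where
  "yvar j \<equiv> Var j"

definition xbar :: "nat \<Rightarrow> int poly mpseries mpseries" where
  "xbar i = - xvar i * unit_inv (1 + Const (Const beta) * xvar i)"

definition kernel_upto :: "nat \<Rightarrow> int poly mpseries mpseries" where
  "kernel_upto N = (\<Prod>i<N. \<Prod>j<N. (1 - xbar i * yvar j) * unit_inv (1 - xvar i * yvar j))"

text \<open>
  The coefficient of \<open>x\<^sup>m y\<^sup>n\<close> in the infinite product of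
  \<open>(1 - xbar i * yvar j) / (1 - xvar i * yvar j)\<close> over all \<open>i\<close>, \<open>j\<close>:
  the eventual value of the corresponding coefficients of the finite products.
\<close>

definition kernel_coeff :: "monomial \<Rightarrow> monomial \<Rightarrow> int poly" where
  "kernel_coeff m n =
     (THE c. eventually (\<lambda>N. coeff_of (coeff_of (kernel_upto N) n) m = c) sequentially)"

text \<open>
  Comparison of the coefficients of \<open>x\<^sup>m y\<^sup>n\<close> in the Cauchy identity for \<open>GP\<close> and \<open>gq\<close>.
  Only finitely many \<open>GP lam\<close> involve a given monomial.
\<close>

definition dual_to_GP :: "(nat list \<Rightarrow> int poly mpseries) \<Rightarrow> bool" where
  "dual_to_GP g \<longleftrightarrow> (\<forall>m n.
     (\<Sum>lam | strict_partition lam \<and> coeff_of (GP lam) m \<noteq> 0.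
        coeff_of (GP lam) m * coeff_of (g lam) n) = kernel_coeff m n)"

text \<open>The values on strict partitions are uniquely determined.\<close>

definition gq :: "nat list \<Rightarrow> int poly mpseries" where
  "gq = (SOME g. dual_to_GP g)"


section \<open>The functions jq and their skew versions\<close>

definition jq :: "nat list \<Rightarrow> int poly mpseries" where
  "jq lam = omega (gq lam)"

text \<open>
  In \<open>f(x\<^sub>1, y\<^sub>1, x\<^sub>2, y\<^sub>2, \<dots>)\<close> the even indices carry the \<open>x\<close>-variables and the odd ones the
  \<open>y\<close>-variables, so every monomial \<open>k\<close> of \<open>f\<close> is \<open>x\<^sup>m y\<^sup>n\<close> for the two restrictions \<open>m\<close>, \<open>n\<close> of
  \<open>k\<close> below.  The expansion is one of symmetric functions, hence has only finitely many nonzero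
  terms.
\<close>

definition is_skew_family ::
    "nat list \<Rightarrow> (nat list \<Rightarrow> int poly mpseries) \<Rightarrow> bool" where
  "is_skew_family lam f \<longleftrightarrow>
     finite {mu. strict_partition mu \<and> f mu \<noteq> 0} \<and>
     (\<forall>k. coeff_of (jq lam) k =
        (\<Sum>mu | strict_partition mu \<and> f mu \<noteq> 0.
           coeff_of (jq mu) (Poly_Mapping.map_key (\<lambda>i. 2 * i) k) *
           coeff_of (f mu) (Poly_Mapping.map_key (\<lambda>i. 2 * i + 1) k)))"

text \<open>The values at strict partitions \<open>mu\<close> are unique, since the \<open>jq mu\<close> are linearly independent.\<close>

definition jq_skew :: "nat list \<Rightarrow> nat list \<Rightarrow> int poly mpseries" where
  "jq_skew lam = (SOME f. is_skew_family lam f)"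


section \<open>Shifted bar tableaux\<close>

definition SD_skew :: "nat list \<Rightarrow> nat list \<Rightarrow> (nat \<times> nat) set" where
  "SD_skew lam mu = SD lam - SD mu"

definition is_bar :: "(nat \<times> nat \<Rightarrow> nat) \<Rightarrow> (nat \<times> nat) set \<Rightarrow> bool" where
  "is_bar V B \<longleftrightarrow>
     B \<noteq> {} \<and> (\<exists>i a b. B = {i} \<times> {a..b} \<or> B = {a..b} \<times> {i}) \<and> (\<exists>e. \<forall>x\<in>B. V x = e)"

definition shifted_bar_tableaux ::
    "nat list \<Rightarrow> nat list \<Rightarrow> ((nat \<times> nat \<Rightarrow> nat) \<times> (nat \<times> nat) set set) set" where
  "shifted_bar_tableaux lam mu = {(V, P).
     V \<in> SD_skew lam mu \<rightarrow>\<^sub>E UNIV \<and>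
     (\<forall>i i' j. (i, j) \<in> SD_skew lam mu \<and> (i', j) \<in> SD_skew lam mu \<and> i \<noteq> i' \<and>
        \<not> primed (V (i, j)) \<longrightarrow> V (i, j) \<noteq> V (i', j)) \<and>
     (\<forall>i j j'. (i, j) \<in> SD_skew lam mu \<and> (i, j') \<in> SD_skew lam mu \<and> j \<noteq> j' \<and>
        primed (V (i, j)) \<longrightarrow> V (i, j) \<noteq> V (i, j')) \<and>
     partition_on (SD_skew lam mu) P \<and> (\<forall>B\<in>P. is_bar V B)}"

definition semistandard ::
    "nat list \<Rightarrow> nat list \<Rightarrow> (nat \<times> nat \<Rightarrow> nat) \<times> (nat \<times> nat) set set \<Rightarrow> bool" where
  "semistandard lam mu = (\<lambda>(V, P).
     (\<forall>i j j'. (i, j) \<in> SD_skew lam mu \<and> (i, j') \<in> SD_skew lam mu \<and> j \<le> j' \<longrightarrow>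
        V (i, j) \<le> V (i, j')) \<and>
     (\<forall>i i' j. (i, j) \<in> SD_skew lam mu \<and> (i', j) \<in> SD_skew lam mu \<and> i \<le> i' \<longrightarrow>
        V (i, j) \<le> V (i', j)))"

text \<open>The number of bars containing \<open>(k+1)'\<close> or \<open>k+1\<close>.\<close>

definition bar_weight :: "(nat \<times> nat \<Rightarrow> nat) \<times> (nat \<times> nat) set set \<Rightarrow> nat \<Rightarrow> nat" where
  "bar_weight = (\<lambda>(V, P) k. card {B \<in> P. \<exists>x\<in>B. var_of (V x) = k})"

text \<open>
  There are at most as many bars as boxes, so the subtractions in the exponent of \<open>-\<beta>\<close> do not
  truncate.
\<close>

definition jq_comb :: "nat list \<Rightarrow> nat list \<Rightarrow> int poly mpseries" where
  "jq_comb lam mu = Abs_mpseries (\<lambda>m. if SD mu \<subseteq> SD lam then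
     (\<Sum>T | T \<in> shifted_bar_tableaux lam mu \<and> semistandard lam mu T \<and>
            (\<forall>k. Poly_Mapping.lookup m k = bar_weight T k).
        (- beta) ^ (sum_list lam - sum_list mu - card (snd T)))
     else 0)"

end

(*
  GP and jq-comb are computed one variable at a time: adding all boxes with entries i', i to a
  strict partition is a transfer operator, and in the encoding of strict partitions by 0/1-words
  these operators are given by small finite-state transducers.  The transducers satisfy an exchange
  relation (adding GP entries and removing jq entries commute up to an explicit factor), which gives
  the Cauchy identity
    sum over lam of GP_lam(x) jq-comb_lam(t) = product of (1 + t x) / (1 - t z),  z = x / (1 + beta x).
  The exchange relations for horizontal and vertical strips expand this product, as well as the
  kernel (1 + z y) / (1 - x y), in Schur functions, and conjugating the partitions, that is, omega,
  exchanges the two expansions.  Since GP is unitriangular, omega maps gq_lam to jq-comb_lam.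
  By the Cauchy identity the variables of jq-comb may be permuted, hence split into two groups, and
  the linear independence of the jq-comb_mu then determines the skew functions.
*)
theory Submission
  imports
    Defs
    "HOL-Combinatorics.Permutations"
    "HOL-Computational_Algebra.Formal_Power_Series"
begin

unbundle fps_syntax

text \<open>\<open>gq\<close>, \<open>omega\<close> and \<open>jq_skew\<close> are chosen by a
  characterising property, so each needs existence, and \<open>gq\<close> and \<open>jq_skew\<close>
  also uniqueness. \<open>omega\<close> is specified only on series of bounded degree and cannot be
  applied to the whole kernel. Instead an x-monomial is fixed: its coefficient is a finite Schur
  expansion in y, because the factor of s_ka(y) has order at least |ka| in x. GP_lam lives in
  degrees at least |lam|, jq-comb_lam in degrees at most |lam|. Hence triangularity is needed in two
  directions (\<open>up\<close>), with leading coefficients 1 and 2^length. The obstacle in the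
  exchange relation is that words have finite length, so a moving particle may leave a word on the
  right. The sum over the later landing sites is a geometric series with ratio x (t - beta).
  Multiplication by 1 - x (t - beta) turns it into a correction term, which lies beyond any given
  order in x once the word is long enough. \<open>omega\<close> is never inverted: preimages of the
  jq-comb are built from Schur expansions and shown to satisfy the identity that defines gq.\<close>

abbreviation (input) "lookup \<equiv> Poly_Mapping.lookup"
abbreviation (input) "keys \<equiv> Poly_Mapping.keys"
abbreviation (input) "map_key \<equiv> Poly_Mapping.map_key"
abbreviation (input) "evens \<equiv> map_key (%i :: nat. 2 * i)"
abbreviation (input) "odds \<equiv> map_key (%i :: nat. 2 * i + 1)"
abbreviation (input) "cf \<equiv> coeff_of"
abbreviation (input) sz :: "nat list => nat" where "sz \<equiv> sum_list"

section \<open>Power series in countably many variables\<close>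

lemma coeff_mult: "cf (f * g) m = (\<Sum>(a, b)\<in>splits m. cf f a * cf g b)"
	by (simp add: times_mpseries.rep_eq)

lemmas coeff_simps = zero_mpseries.rep_eq one_mpseries.rep_eq plus_mpseries.rep_eq
	minus_mpseries.rep_eq uminus_mpseries.rep_eq Const.rep_eq

lemma coeff_sum: "cf (sum f A) m = (\<Sum>x\<in>A. cf (f x) m)"
	by (induction A rule: infinite_finite_induct) (auto simp: coeff_simps)

lemma keys_add_nat: "keys (a + b :: monomial) = keys a \<union> keys b"
	by (auto simp: in_keys_iff lookup_add)

lemma coeff_Const_mult [simp]: "cf (Const c * f) m = c * cf f m"
proof -
	have "cf (Const c * f) m = (\<Sum>(a, b)\<in>splits m. (if a = 0 then c else 0) * cf f b)"
		by (simp add: coeff_mult Const.rep_eq)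
	also have "... = (\<Sum>(a, b)\<in>{(0 :: monomial, m)}. (if a = 0 then c else 0) * cf f b)"
		by (rule sum.mono_neutral_right[OF finite_splits]) (auto simp: splits_def split: if_splits)
	finally show ?thesis by simp
qed

lemma Const_0 [simp]: "Const 0 = 0"
	and Const_1 [simp]: "Const 1 = 1"
	and Const_add: "Const (c + d) = Const c + Const d"
	and Const_uminus: "Const (- c) = - Const c"
	and Const_diff: "Const (c - d) = Const c - Const d"
	by (auto intro!: mpseries_eqI simp: coeff_simps)

lemma Const_mult: "Const (c * d) = Const c * Const (d :: 'a::comm_ring_1)"
	by (rule mpseries_eqI) (simp add: Const.rep_eq)

lemma Const_power: "Const (c ^ n) = Const (c :: 'a::comm_ring_1) ^ n"
	by (induction n) (auto simp: Const_mult)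

lemma Const_sum: "Const (sum f A) = (\<Sum>x\<in>A. Const (f x :: 'a::comm_ring_1))"
	by (induction A rule: infinite_finite_induct) (auto simp: Const_add)

lemma coeff_sum_Const_mult:
	"cf (\<Sum>x\<in>A. Const (c x) * f x) m = (\<Sum>x\<in>A. c x * cf (f x) m)"
	by (simp add: coeff_sum)

subsection \<open>Embedding of univariate power series\<close>

text \<open>This is the substitution of the variable with index \<open>i\<close> for
  \<open>fps_X\<close>. One-variable weights can then be studied as \<open>fps\<close>, where
  divisibility by powers of X is easy to handle.\<close>

definition emb :: "nat => 'a::comm_ring_1 fps => 'a mpseries" where
	"emb i f = Abs_mpseries (%m. if keys m <= {i} then f $ lookup m i else 0)"

lemma coeff_emb: "cf (emb i f) m =
		(if keys m <= {i} then f $ lookup m i else 0)"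
	by (simp add: emb_def)

lemma keys_subset_singleton:
	"keys (m :: monomial) <= {i} \<longleftrightarrow> m = Poly_Mapping.single i (lookup m i)"
proof
	assume a: "keys m <= {i}"
	show "m = Poly_Mapping.single i (lookup m i)"
	proof (rule poly_mapping_eqI)
		fix k show "lookup m k = lookup (Poly_Mapping.single i (lookup m i)) k"
			using a by (cases "k = i") (auto simp: lookup_single in_keys_iff subset_iff when_def)
	qed
next
	assume "m = Poly_Mapping.single i (lookup m i)"
	then show "keys m <= {i}"
		by (metis keys_single empty_subsetI subset_refl)
qed

lemma emb_add: "emb i (f + g) = emb i f + emb i g"
	and emb_uminus: "emb i (- f) = - emb i f"
	and emb_diff: "emb i (f - g) = emb i f - emb i g"
	and emb_0 [simp]: "emb i 0 = 0"
	by (auto intro!: mpseries_eqI simp: coeff_emb coeff_simps)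

lemma emb_const [simp]: "emb i (fps_const c) = Const c"
proof (rule mpseries_eqI)
	fix m :: monomial
	show "cf (emb i (fps_const c)) m = cf (Const c) m"
	proof (cases "m = 0")
		case False
		then have "lookup m i ~= 0" if "keys m <= {i}"
			using that by (metis keys_subset_singleton single_zero)
		with False show ?thesis by (auto simp: coeff_emb Const.rep_eq)
	qed (simp add: coeff_emb Const.rep_eq)
qed

lemma emb_1 [simp]: "emb i 1 = 1"
	using emb_const[of i 1] by (simp del: emb_const)

lemma emb_X [simp]: "emb i fps_X = Var i"
proof (rule mpseries_eqI)
	fix m :: monomial
	show "cf (emb i fps_X :: 'a mpseries) m = cf (Var i) m"
	proof (cases "keys m <= {i}")
		case True
		then have m: "m = Poly_Mapping.single i (lookup m i)"
			by (rule keys_subset_singleton[THEN iffD1])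
		have "m = Poly_Mapping.single i 1 \<longleftrightarrow> lookup m i = 1"
			using m by (metis lookup_single_eq)
		with True show ?thesis by (auto simp: coeff_emb Var.rep_eq fps_X_def)
	qed (auto simp: coeff_emb Var.rep_eq)
qed

lemma emb_mult: "emb i (f * g) = emb i f * emb i g"
proof (rule mpseries_eqI)
	fix m :: monomial
	show "cf (emb i (f * g)) m = cf (emb i f * emb i g) m"
	proof (cases "keys m <= {i}")
		case True
		define n where "n = lookup m i"
		have m: "m = Poly_Mapping.single i n"
			unfolding n_def using True by (rule keys_subset_singleton[THEN iffD1])
		have key: "keys a <= {i} & keys b <= {i}
				& lookup a i + lookup b i = n" if "(a, b) : splits m" for a b
			using that True keys_add_nat[of a b] by (auto simp: splits_def n_def lookup_add)
		have "(\<Sum>(a, b)\<in>splits m. cf (emb i f) a * cf (emb i g) b)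
				= (\<Sum>k=0..n. f $ k * g $ (n - k))"
		proof (rule sum.reindex_bij_witness[where
					i = "%k. (Poly_Mapping.single i k, Poly_Mapping.single i (n - k))"
					and j = "%(a, b). lookup a i"])
			fix p assume p: "p : splits m"
			obtain a b where ab: "p = (a, b)" by fastforce
			note k = key[OF p[unfolded ab]]
			have nb: "n - lookup a i = lookup b i" using k by linarith
			have "Poly_Mapping.single i (n - lookup a i) = b"
				"Poly_Mapping.single i (lookup a i) = a"
				unfolding nb using k keys_subset_singleton[THEN iffD1, symmetric] by blast+
			then show "(Poly_Mapping.single i (case p of (a, b) => lookup a i),
					Poly_Mapping.single i (n - (case p of (a, b) => lookup a i))) = p"
				by (simp add: ab)
			show "(case p of (a, b) => lookup a i) : {0..n}"
				using k by (simp add: ab)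
			show "f $ (case p of (a, b) => lookup a i) *
					g $ (n - (case p of (a, b) => lookup a i)) =
					(case p of (a, b) => cf (emb i f) a * cf (emb i g) b)"
				using k nb by (simp add: ab coeff_emb)
		qed (auto simp: splits_def m single_add[symmetric])
		then show ?thesis
			using True by (simp add: coeff_mult coeff_emb fps_mult_nth n_def)
	next
		case False
		have "\<not> (keys a <= {i} & keys b <= {i})" if "(a, b) : splits m" for a b
			using that False keys_add_nat[of a b] by (auto simp: splits_def)
		then have "(\<Sum>(a, b)\<in>splits m. cf (emb i f) a * cf (emb i g) b) = 0"
			by (intro sum.neutral) (auto simp: coeff_emb)
		with False show ?thesis by (simp add: coeff_mult coeff_emb)
	qed
qed

lemma emb_sum: "emb i (sum f A) = (\<Sum>x\<in>A. emb i (f x))"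
	by (induction A rule: infinite_finite_induct) (auto simp: emb_add)

lemma emb_prod: "emb i (prod f A) = (\<Prod>x\<in>A. emb i (f x))"
	by (induction A rule: infinite_finite_induct) (auto simp: emb_mult)

lemma emb_power: "emb i (f ^ n) = emb i f ^ n"
	by (induction n) (auto simp: emb_mult)

section \<open>Series that involve only an initial segment of the variables\<close>

definition vars_below :: "nat => 'a::zero mpseries => bool" where
	"vars_below N f \<longleftrightarrow> (\<forall>m. cf f m ~= 0 --> keys m <= {..<N})"

text \<open>A monomial factors uniquely into a part without the variable \<open>N\<close> and a
  power of that variable, so a single splitting of \<open>m\<close> contributes. This makes
  coefficients of chains computable one variable at a time.\<close>

lemma coeff_mult_emb:
	assumes "vars_below N A"
	shows "cf (A * emb N f) m = (if keys m <= {..<Suc N}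
		then cf A (Poly_Mapping.update N 0 m) * f $ lookup m N else 0)"
proof -
	define a0 b0 where "a0 = Poly_Mapping.update N 0 m"
		and "b0 = Poly_Mapping.single N (lookup m N)"
	have a0b0: "a0 + b0 = m"
		by (rule poly_mapping_eqI) (auto simp: a0_def b0_def lookup_add lookup_update lookup_single when_def)
	have z: "cf A a * cf (emb N f) b = 0" if "a + b = m" "(a, b) ~= (a0, b0)" for a b
	proof (rule ccontr)
		assume "cf A a * cf (emb N f) b ~= 0"
		then have "cf A a ~= 0" "cf (emb N f) b ~= 0"
			by auto
		then have k: "keys a <= {..<N}" "keys b <= {N}"
			using assms unfolding vars_below_def coeff_emb by (blast, metis)
		then have "lookup a N = 0"
			by (auto simp: in_keys_iff)
		then have "lookup b N = lookup m N"
			using that(1) by (auto simp: lookup_add)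
		with k have "b = b0" unfolding b0_def by (metis keys_subset_singleton)
		with that a0b0 show False by auto
	qed
	have "cf (A * emb N f) m = (\<Sum>(a, b)\<in>{(a0, b0)}. cf A a * cf (emb N f) b)"
		unfolding coeff_mult using z a0b0
		by (intro sum.mono_neutral_right[OF finite_splits]) (auto simp: splits_def)
	also have "... = cf A a0 * f $ lookup m N"
		by (simp add: coeff_emb b0_def)
	also have "cf A a0 = 0" if "\<not> keys m <= {..<Suc N}"
	proof (rule ccontr)
		assume "cf A a0 ~= 0"
		then have "keys a0 <= {..<N}" using assms by (auto simp: vars_below_def)
		then have "keys m <= {..<Suc N}"
			unfolding a0b0[symmetric] keys_add_nat by (auto simp: b0_def split: if_splits)
		with that show False by simp
	qed
	ultimately show ?thesis by (auto simp: a0_def)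
qed

lemma vars_below_mult_emb:
	assumes "vars_below N A"
	shows "vars_below (Suc N) (A * emb N f)"
	by (auto simp: vars_below_def coeff_mult_emb[OF assms])

lemma vars_below_sum: "(\<And>x. x : A ==> vars_below N (f x)) ==> vars_below N (sum f A)"
	unfolding vars_below_def coeff_sum by (meson sum.not_neutral_contains_not_neutral)

lemma vars_below_0 [simp]: "vars_below N 0"
	and vars_below_1 [simp]: "vars_below N 1"
	by (auto simp: vars_below_def coeff_simps)

lemma keys_update_zero: "keys (Poly_Mapping.update N 0 m) = keys m - {N}"
	by (auto simp: in_keys_iff lookup_update split: if_splits)

subsection \<open>Setting variables to zero and renaming variables\<close>

text \<open>As a ring homomorphism this passes through chains of operators. It serves to compare
  chains in different numbers of variables.\<close>

definition trunc :: "nat => 'a::zero mpseries => 'a mpseries" where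
	"trunc N f = Abs_mpseries (%m. if keys m <= {..<N} then cf f m else 0)"

lemma coeff_trunc: "cf (trunc N f) m = (if keys m <= {..<N} then cf f m else 0)"
	by (simp add: trunc_def)

lemma trunc_add: "trunc N (f + g) = trunc N f + trunc N (g :: 'a::comm_ring_1 mpseries)"
	and trunc_0 [simp]: "trunc N (0 :: 'a mpseries) = 0"
	and trunc_Const [simp]: "trunc N (Const c) = Const c"
	by (auto intro!: mpseries_eqI simp: coeff_trunc coeff_simps)

lemma trunc_mult: "trunc N (f * g) = trunc N f * trunc N (g :: 'a::comm_ring_1 mpseries)"
proof (rule mpseries_eqI)
	fix m
	show "cf (trunc N (f * g)) m = cf (trunc N f * trunc N g) m"
	proof (cases "keys m <= {..<N}")
		case True
		then show ?thesis
			by (auto simp: coeff_mult coeff_trunc splits_def keys_add_nat intro!: sum.cong)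
	next
		case False
		then have "\<not> (keys a <= {..<N} & keys b <= {..<N})" if "(a, b) : splits m" for a b
			using that by (auto simp: splits_def keys_add_nat)
		then have "(\<Sum>(a, b)\<in>splits m. cf (trunc N f) a * cf (trunc N g) b) = 0"
			by (intro sum.neutral) (auto simp: coeff_trunc)
		with False show ?thesis by (simp add: coeff_mult coeff_trunc)
	qed
qed

lemma trunc_1 [simp]: "trunc N (1 :: 'a::comm_ring_1 mpseries) = 1"
	by (auto intro!: mpseries_eqI simp: coeff_trunc coeff_simps)

text \<open>\<open>map_key \<pi> m\<close> reads the exponent at \<open>\<pi> i\<close>, so pulling
  back monomials substitutes x_(\<pi> i) for x_i, and not the other way round; see
  \<open>rename_Var\<close>.\<close>

definition rename :: "(nat => nat) => 'a mpseries => 'a mpseries" where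
	"rename \<pi> f = Abs_mpseries (%m. cf f (map_key \<pi> m))"

lemma coeff_rename: "cf (rename \<pi> f) m = cf f (map_key \<pi> m)"
	by (simp add: rename_def)

lemma map_key_inv:
	fixes \<pi> :: "nat => nat"
	assumes "bij \<pi>"
	shows "map_key \<pi> (map_key (inv \<pi>) m) = m"
		and "map_key (inv \<pi>) (map_key \<pi> m) = m"
proof -
	have i: "inj \<pi>" "inj (inv \<pi>)"
		using assms bij_is_inj bij_imp_bij_inv by auto
	have "inv \<pi> \<circ> \<pi> = (%x. x)" "\<pi> \<circ> inv \<pi> = (%x. x)"
		using assms by (auto simp: fun_eq_iff bij_is_inj bij_is_surj surj_f_inv_f)
	then show "map_key \<pi> (map_key (inv \<pi>) m) = m"
		and "map_key (inv \<pi>) (map_key \<pi> m) = m"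
		by (simp_all add: map_key_compose[OF i] map_key_compose[OF i(2,1)] map_key_id)
qed

lemma map_key_eq_iff:
	fixes \<pi> :: "nat => nat"
	assumes "bij \<pi>"
	shows "map_key \<pi> m = m' \<longleftrightarrow> m = map_key (inv \<pi>) m'"
	using map_key_inv[OF assms] by metis

lemma rename_add: "rename \<pi> (f + g) = rename \<pi> f + rename \<pi> (g :: 'a::comm_ring_1 mpseries)"
	and rename_0 [simp]: "rename \<pi> (0 :: 'a mpseries) = 0"
	by (auto intro!: mpseries_eqI simp: coeff_rename coeff_simps)

lemma rename_Const [simp]:
	assumes "bij \<pi>"
	shows "rename \<pi> (Const c) = Const c"
proof -
	have "map_key \<pi> m = 0 \<longleftrightarrow> m = 0" for m :: monomial
		by (metis map_key_eq_iff[OF assms] map_key_zero[OF bij_is_inj[OF bij_imp_bij_inv[OF assms]]])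
	then show ?thesis
		by (auto intro!: mpseries_eqI simp: coeff_rename coeff_simps)
qed

lemma rename_Var [simp]:
	assumes "bij \<pi>"
	shows "rename \<pi> (Var i) = Var (\<pi> i)"
proof (rule mpseries_eqI)
	fix m
	have "map_key (inv \<pi>) (Poly_Mapping.single i 1) = Poly_Mapping.single (\<pi> i) (1::nat)"
		using map_key_single[OF bij_is_inj[OF bij_imp_bij_inv[OF assms]], of "\<pi> i" "1::nat"]
		by (simp only: inv_f_f[OF bij_is_inj[OF assms]])
	then show "cf (rename \<pi> (Var i)) m = cf (Var (\<pi> i)) m"
		unfolding coeff_rename Var.rep_eq by (subst map_key_eq_iff[OF assms]) simp
qed

lemma rename_mult:
	assumes "bij \<pi>"
	shows "rename \<pi> (f * g) = rename \<pi> f * rename \<pi> (g :: 'a::comm_ring_1 mpseries)"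
proof (rule mpseries_eqI)
	fix m
	note inj = bij_is_inj[OF assms] bij_is_inj[OF bij_imp_bij_inv[OF assms]]
	have "(\<Sum>(a, b)\<in>splits (map_key \<pi> m). cf f a * cf g b) =
		(\<Sum>(a, b)\<in>splits m. cf f (map_key \<pi> a) * cf g (map_key \<pi> b))"
		by (rule sum.reindex_bij_witness[where
					i = "%(a, b). (map_key \<pi> a, map_key \<pi> b)"
					and j = "%(a, b). (map_key (inv \<pi>) a, map_key (inv \<pi>) b)"])
			 (auto simp: splits_def map_key_inv[OF assms] map_key_plus[OF inj(1), symmetric]
					map_key_plus[OF inj(2), symmetric])
	then show "cf (rename \<pi> (f * g)) m = cf (rename \<pi> f * rename \<pi> g) m"
		by (simp add: coeff_rename coeff_mult)
qed

lemma mpseries_mult_unit_inv: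
	assumes "a * b = (1 :: 'a::comm_ring_1)"
	shows "unit_inv a = b"
	unfolding unit_inv_def
proof (rule the_equality)
	show "a * b = 1" by fact
	fix c assume "a * c = 1"
	then have "b * (a * c) = b" by simp
	then show "c = b" using assms by (simp add: mult.assoc[symmetric] mult.commute[of b a])
qed

section \<open>Chains of transfer operators\<close>

lemma mult_neq_zeroD: "a * b ~= (0 :: 'a::mult_zero) ==> a ~= 0 & b ~= 0"
	by auto

text \<open>The operators only enlarge shapes. Sums over intermediate shapes can therefore be cut at
  the size of the last shape, which keeps them finite.\<close>

definition below :: "nat list set => nat => nat list set" where
	"below Sh d = {ka : Sh. sz ka <= d}"

text \<open>This is an entry of the product of the infinite matrices \<open>A 0\<close>, ...,
  \<open>A (N - 1)\<close>.\<close>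

primrec chain :: "nat list set => (nat => nat list => nat list => 'a::comm_ring_1) => nat =>
		nat list => nat list => 'a" where
	"chain Sh A 0 mu lam = (if mu = lam then 1 else 0)"
| "chain Sh A (Suc N) mu lam = (\<Sum>ka\<in>below Sh (sz lam). chain Sh A N mu ka * A N ka lam)"

text \<open>The generating function in \<open>N\<close> variables of the chains from the empty shape
  to \<open>lam\<close>. The scalar \<open>C\<close> attached to every step is 1 for tableaux; it
  collects the factors that arise from commuting operators.\<close>

definition vchain :: "nat list set => (nat list => nat list => 'a fps) => 'a fps => nat => nat list =>
		'a::comm_ring_1 mpseries" where
	"vchain Sh U C N lam = chain Sh (%i ka lam. emb i (C * U ka lam)) N [] lam"

lemma vchain_0: "vchain Sh U C 0 lam = (if lam = [] then 1 else 0)"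
	by (auto simp: vchain_def)

lemma vchain_Suc: "vchain Sh U C (Suc N) lam =
		(\<Sum>ka\<in>below Sh (sz lam). vchain Sh U C N ka * emb N (C * U ka lam))"
	by (simp add: vchain_def)

lemma vchain_factor: "vchain Sh U C N lam = (\<Prod>i<N. emb i C) * vchain Sh U 1 N lam"
	by (induction N arbitrary: lam) (auto simp: vchain_0 vchain_Suc emb_mult sum_distrib_left mult_ac)

lemma vars_below_vchain: "vars_below N (vchain Sh U C N lam)"
	by (induction N arbitrary: lam)
		 (auto simp: vchain_0 vchain_Suc intro!: vars_below_sum vars_below_mult_emb)

lemma coeff_vchain_Suc: "cf (vchain Sh U C (Suc N) lam) m =
	(if keys m <= {..<Suc N} then
		(\<Sum>ka\<in>below Sh (sz lam). cf (vchain Sh U C N ka) (Poly_Mapping.update N 0 m) *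
			 (C * U ka lam) $ lookup m N) else 0)"
	by (auto simp: vchain_Suc coeff_sum coeff_mult_emb[OF vars_below_vchain])

lemma mdegree_eq_sum:
	assumes "keys m <= {..<N}"
	shows "mdegree m = (\<Sum>i<N. lookup m i)"
	unfolding mdegree_def by (rule sum.mono_neutral_left) (use assms in \<open>auto simp: in_keys_iff\<close>)

lemma mdegree_update: "mdegree (Poly_Mapping.update N 0 m) + lookup m N = mdegree m"
proof -
	have "mdegree (Poly_Mapping.update N 0 m) = (\<Sum>i\<in>keys m - {N}. lookup m i)"
		by (auto simp: mdegree_def keys_update_zero lookup_update intro!: sum.cong)
	then show ?thesis
		by (cases "N : keys m") (auto simp: mdegree_def sum.remove[of _ N] in_keys_iff)
qed

text \<open>Associativity of the matrix product. Monotonicity of the operators reconciles the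
  different cut-offs of the intermediate sums.\<close>

lemma chain_split:
	assumes fin: "\<And>d. finite (below Sh d)"
		and low: "\<And>i ka lam. A i ka lam ~= 0 ==> sz ka <= sz lam"
		and "mu : Sh" "lam : Sh"
	shows "chain Sh A (M + N) mu lam = (\<Sum>ka\<in>below Sh (sz lam).
			chain Sh A M mu ka * chain Sh (%i. A (M + i)) N ka lam)"
	using \<open>lam : Sh\<close>
proof (induction N arbitrary: lam)
	case 0
	have "(\<Sum>ka\<in>below Sh (sz lam). chain Sh A M mu ka * (if ka = lam then 1 else 0)) =
		(\<Sum>ka\<in>{lam}. chain Sh A M mu ka * (if ka = lam then 1 else 0))"
		using 0 fin by (intro sum.mono_neutral_right) (auto simp: below_def)
	then show ?case by simp
next
	case (Suc N)
	let ?B = "below Sh (sz lam)"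
	have z: "chain Sh (%i. A (M + i)) N ka \<rho> = 0" if "\<not> sz ka <= sz \<rho>" for ka \<rho>
	proof -
		have "chain Sh (%i. A (M + i)) N ka \<rho> ~= 0 ==> sz ka <= sz \<rho>"
		proof (induction N arbitrary: \<rho>)
			case (Suc N)
			from Suc.prems obtain \<sigma> where "\<sigma> : below Sh (sz \<rho>)"
				"chain Sh (%i. A (M + i)) N ka \<sigma> * A (M + N) \<sigma> \<rho> ~= 0"
				unfolding chain.simps by (rule sum.not_neutral_contains_not_neutral)
			then have "\<sigma> : below Sh (sz \<rho>)" "chain Sh (%i. A (M + i)) N ka \<sigma> ~= 0"
				by (auto dest: mult_neq_zeroD)
			with Suc.IH[of \<sigma>] show ?case by (simp add: below_def)
		qed (auto split: if_splits)
		with that show ?thesis by blast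
	qed
	have "chain Sh A (M + Suc N) mu lam =
		(\<Sum>\<rho>\<in>?B. (\<Sum>ka\<in>below Sh (sz \<rho>). chain Sh A M mu ka * chain Sh (%i. A (M + i)) N ka \<rho>) * A (M + N) \<rho> lam)"
		unfolding add_Suc_right chain.simps
		by (rule sum.cong[OF refl]) (simp add: Suc.IH below_def)
	also have "... = (\<Sum>\<rho>\<in>?B. (\<Sum>ka\<in>?B. chain Sh A M mu ka * chain Sh (%i. A (M + i)) N ka \<rho>) * A (M + N) \<rho> lam)"
		by (intro sum.cong arg_cong2[where f = "(*)"] refl sum.mono_neutral_left fin) (auto simp: below_def z)
	also have "... = (\<Sum>ka\<in>?B. \<Sum>\<rho>\<in>?B. chain Sh A M mu ka * chain Sh (%i. A (M + i)) N ka \<rho> * A (M + N) \<rho> lam)"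
		unfolding sum_distrib_right by (rule sum.swap)
	finally show ?case by (simp add: sum_distrib_left mult.assoc)
qed

section \<open>Families of shapes closed under taking initial rows, and their dominance
  order\<close>

locale index_lists =
	fixes Sh :: "nat list set"
	assumes pos: "lam : Sh ==> 0 ~: set lam"
		and nil [simp]: "[] : Sh"
		and take: "lam : Sh ==> take j lam : Sh"
begin

lemma length_le_sum:
	assumes "lam : Sh"
	shows "length lam <= sz lam"
proof -
	have "length xs <= sz xs" if "0 ~: set xs" for xs :: "nat list"
		using that by (induction xs) (auto simp: Suc_le_eq)
	with pos[OF assms] show ?thesis by blast
qed

lemma finite_below [simp]: "finite (below Sh d)"
proof (rule finite_subset)
	show "below Sh d <= {xs. set xs <= {..d} & length xs <= d}"
	proof
		fix xs assume "xs : below Sh d"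
		then have "xs : Sh" "sz xs <= d" by (auto simp: below_def)
		moreover have "x <= sz xs" if "x : set xs" for x
			using that by (simp add: member_le_sum_list)
		ultimately show "xs : {xs. set xs <= {..d} & length xs <= d}"
			using length_le_sum[of xs] by fastforce
	qed
	show "finite {xs. set xs <= {..d} & length xs <= d}"
		by (rule finite_lists_length_le) simp
qed

lemma below_0: "below Sh 0 = {[]}"
proof -
	have "xs = []" if "xs : Sh" "sz xs = 0" for xs
		using length_le_sum[OF that(1)] that(2) by simp
	then show ?thesis by (auto simp: below_def)
qed

text \<open>A number that increases strictly in dominance order among shapes of equal size, so that
  induction along dominance can use a measure. Indices up to the size suffice, since a shape has at
  most that many parts.\<close>

definition top_sums :: "nat list => nat" where
	"top_sums lam = (\<Sum>j\<le>sz lam. sz (take j lam))"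

lemma eq_if_take_sums_eq:
	assumes "lam : Sh" "kap : Sh" "\<And>j. sz (take j lam) = sz (take j kap)"
	shows "lam = kap"
proof -
	have *: "length xs <= length ys" if "xs : Sh" "ys : Sh" "\<And>j. sz (take j xs) = sz (take j ys)" for xs ys
	proof (rule ccontr)
		assume "\<not> length xs <= length ys"
		then have l: "length ys < length xs" by simp
		then have "sz (take (Suc (length ys)) xs) = sz (take (length ys) xs) + xs ! length ys"
			by (simp add: take_Suc_conv_app_nth)
		moreover have "xs ! length ys > 0"
			using pos[OF that(1)] l by (metis gr0I nth_mem)
		ultimately show False
			using that(3)[of "length ys"] that(3)[of "Suc (length ys)"] by simp
	qed
	have len: "length lam = length kap"
		using *[OF assms] *[OF assms(2,1)] assms(3) by (simp add: order.antisym)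
	show ?thesis
	proof (rule nth_equalityI[OF len])
		fix i assume "i < length lam"
		then show "lam ! i = kap ! i"
			using assms(3)[of i] assms(3)[of "Suc i"] len by (simp add: take_Suc_conv_app_nth)
	qed
qed

lemma top_sums_less:
	assumes "lam : Sh" "kap : Sh" "sz lam = sz kap"
		and le: "\<And>j. sz (take j lam) <= sz (take j kap)" and "lam ~= kap"
	shows "top_sums lam < top_sums kap"
proof -
	obtain j where j: "sz (take j lam) ~= sz (take j kap)"
		using eq_if_take_sums_eq assms by blast
	have "j <= sz lam"
	proof (rule ccontr)
		assume "\<not> j <= sz lam"
		then have "take j lam = lam" "take j kap = kap"
			using length_le_sum assms by (metis take_all le_trans nat_le_linear)+
		with j assms(3) show False by simp
	qed
	then show ?thesis
		unfolding top_sums_def assms(3)[symmetric]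
		using le j by (intro sum_strict_mono_ex1) (auto intro!: bexI[of _ j] simp: order.strict_iff_order)
qed

lemma top_sums_le: "top_sums lam <= Suc (sz lam) * sz lam"
proof -
	have "sz (take j lam) <= sz lam" for j
		by (metis append_take_drop_id le_add1 sum_list_append)
	then have "top_sums lam <= (\<Sum>j\<le>sz lam. sz lam)"
		unfolding top_sums_def by (intro sum_mono) auto
	then show ?thesis by simp
qed

end

section \<open>Monomials whose exponents are the parts of a shape\<close>

definition list_monom :: "nat list => monomial" where
	"list_monom lam = Abs_poly_mapping (%i. if i < length lam then lam ! i else 0)"

lemma lookup_list_monom: "lookup (list_monom lam) i = (if i < length lam then lam ! i else 0)"
proof -
	have "finite {i. (if i < length lam then lam ! i else 0) ~= 0}"
		by (rule finite_subset[of _ "{..<length lam}"]) auto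
	then show ?thesis by (simp add: list_monom_def)
qed

lemma keys_list_monom: "keys (list_monom lam) <= {..<length lam}"
	by (auto simp: in_keys_iff lookup_list_monom split: if_splits)

lemma sum_list_take: "(\<Sum>i<j. if i < length lam then lam ! i else 0) = sz (take j lam)"
	for lam :: "nat list"
proof (induction j)
	case (Suc j)
	then show ?case by (cases "j < length lam") (auto simp: take_Suc_conv_app_nth)
qed auto

lemma mdegree_list_monom: "mdegree (list_monom lam) = sz lam"
	using sum_list_take[of lam "length lam"] by (simp add: mdegree_eq_sum[OF keys_list_monom] lookup_list_monom)

lemma list_monom_take:
	assumes "j < length lam"
	shows "Poly_Mapping.update j 0 (list_monom (take (Suc j) lam)) = list_monom (take j lam)"
	by (rule poly_mapping_eqI) (use assms in \<open>auto simp: lookup_update lookup_list_monom\<close>)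

text \<open>The flag \<open>up\<close> distinguishes operators whose weights have degree at least the number of added
	boxes from those whose weights have degree at most that number.\<close>

locale step_operator = index_lists Sh for Sh +
	fixes up :: bool and U :: "nat list => nat list => 'a::comm_ring_1 fps"
	assumes step: "ka : Sh ==> lam : Sh ==> U ka lam ~= 0 ==> length ka <= length lam & length lam <= Suc (length ka)
			& (\<forall>i<length ka. ka ! i <= lam ! i)"
		and size: "ka : Sh ==> lam : Sh ==> U ka lam $ r ~= 0 ==>
			(if up then sz lam <= sz ka + r else sz ka + r <= sz lam)"
		and nil_nil: "U [] [] = 1"
begin

abbreviation "V \<equiv> vchain Sh U"

lemma step_take_sum:
	assumes "ka : Sh" "lam : Sh" "U ka lam ~= 0"
	shows "sz (take j ka) <= sz (take j lam)"
proof -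
	note s = step[OF assms]
	have "(\<Sum>i<j. if i < length ka then ka ! i else 0) <= (\<Sum>i<j. if i < length lam then lam ! i else 0)"
		using s by (intro sum_mono) auto
	then show ?thesis by (simp add: sum_list_take)
qed

lemma step_sum:
	assumes "ka : Sh" "lam : Sh" "U ka lam ~= 0"
	shows "sz ka <= sz lam"
	using step_take_sum[OF assms, of "length lam"] step[OF assms] by simp

text \<open>Only the constant chain at the empty shape contributes. In \<open>cauchy_chain\<close>
  this turns the right side into a pure product.\<close>

lemma V_nil: "V C N [] = (\<Prod>i<N. emb i C)"
proof -
	have "V 1 N [] = 1"
		by (induction N) (auto simp: vchain_0 vchain_Suc below_0 nil_nil)
	then show ?thesis by (subst vchain_factor) simp
qed

lemma coeff_V_Suc_nonzero:
	assumes "cf (V C (Suc N) lam) m ~= 0"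
	obtains ka where "ka : Sh" "sz ka <= sz lam" "keys m <= {..<Suc N}"
		"cf (V C N ka) (Poly_Mapping.update N 0 m) ~= 0" "(C * U ka lam) $ lookup m N ~= 0"
proof -
	have k: "keys m <= {..<Suc N}"
		using assms by (auto simp: coeff_vchain_Suc split: if_splits)
	then have "(\<Sum>ka\<in>below Sh (sz lam). cf (V C N ka) (Poly_Mapping.update N 0 m) *
			 (C * U ka lam) $ lookup m N) ~= 0"
		using assms by (simp add: coeff_vchain_Suc)
	then obtain ka where "ka : below Sh (sz lam)"
		"cf (V C N ka) (Poly_Mapping.update N 0 m) * (C * U ka lam) $ lookup m N ~= 0"
		by (rule sum.not_neutral_contains_not_neutral)
	then show ?thesis using that[of ka] k by (auto simp: below_def dest: mult_neq_zeroD)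
qed

lemma mult_fps_nonzero:
	assumes "(C * f) $ r ~= (0 :: 'a)"
	obtains s where "s <= r" "f $ s ~= 0"
proof -
	have "(\<Sum>i=0..r. C $ i * f $ (r - i)) ~= 0" using assms by (simp add: fps_mult_nth)
	then obtain i where "C $ i * f $ (r - i) ~= 0" by (rule sum.not_neutral_contains_not_neutral)
	then show ?thesis using that[of "r - i"] by (auto dest: mult_neq_zeroD)
qed

text \<open>Multiplication by \<open>C\<close> can only raise degrees, so this bound holds for every
  \<open>C\<close>; the opposite bound \<open>V_degree_down\<close> is for
  \<open>C = 1\<close>.\<close>

lemma V_degree:
	assumes "lam : Sh" "cf (V C N lam) m ~= 0" "up"
	shows "sz lam <= mdegree m"
	using assms(1,2)
proof (induction N arbitrary: lam m)
	case 0 then show ?case by (auto simp: vchain_0 coeff_simps split: if_splits)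
next
	case (Suc N)
	obtain ka where ka: "ka : Sh" "cf (V C N ka) (Poly_Mapping.update N 0 m) ~= 0"
		"(C * U ka lam) $ lookup m N ~= 0"
		using coeff_V_Suc_nonzero[OF Suc.prems(2)] by blast
	obtain s where "s <= lookup m N" "U ka lam $ s ~= 0"
		using mult_fps_nonzero ka(3) by blast
	with size[OF ka(1) Suc.prems(1)] \<open>up\<close> Suc.IH[OF ka(1,2)] mdegree_update[of N m]
	show ?case by fastforce
qed

lemma V_degree_down:
	assumes "lam : Sh" "cf (V 1 N lam) m ~= 0" "\<not> up"
	shows "mdegree m <= sz lam"
	using assms(1,2)
proof (induction N arbitrary: lam m)
	case 0 then show ?case by (auto simp: vchain_0 coeff_simps mdegree_def split: if_splits)
next
	case (Suc N)
	obtain ka where ka: "ka : Sh" "cf (V 1 N ka) (Poly_Mapping.update N 0 m) ~= 0"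
		"U ka lam $ lookup m N ~= 0"
		using coeff_V_Suc_nonzero[OF Suc.prems(2)] by auto
	with size[OF ka(1) Suc.prems(1) ka(3)] \<open>\<not> up\<close> Suc.IH[OF ka(1,2)] mdegree_update[of N m]
	show ?case by simp
qed

text \<open>Each variable creates at most one new row.\<close>

lemma V_length:
	assumes "lam : Sh" "cf (V 1 N lam) m ~= 0"
	shows "length lam <= N"
	using assms
proof (induction N arbitrary: lam m)
	case 0 then show ?case by (auto simp: vchain_0 coeff_simps split: if_splits)
next
	case (Suc N)
	obtain ka where ka: "ka : Sh" "cf (V 1 N ka) (Poly_Mapping.update N 0 m) ~= 0"
		"U ka lam $ lookup m N ~= 0"
		using coeff_V_Suc_nonzero[OF Suc.prems(2)] by auto
	then have "U ka lam ~= 0" by auto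
	with step[OF ka(1) Suc.prems(1)] Suc.IH[OF ka(1,2)] show ?case by simp
qed

text \<open>If degree and size agree, every variable adds exactly as many boxes as its exponent
  says. The boxes of the first \<open>j\<close> variables lie in the first \<open>j\<close> rows,
  since each step creates at most one row, and rows never shrink.\<close>

lemma V_dominance:
	assumes "lam : Sh" "cf (V 1 N lam) m ~= 0" "sz lam = mdegree m"
	shows "(\<Sum>i<j. lookup m i) <= sz (take j lam)"
	using assms
proof (induction N arbitrary: lam m j)
	case 0 then show ?case by (auto simp: vchain_0 coeff_simps split: if_splits)
next
	case (Suc N)
	let ?m = "Poly_Mapping.update N 0 m"
	obtain ka where ka: "ka : Sh" "cf (V 1 N ka) ?m ~= 0" "keys m <= {..<Suc N}"
		"U ka lam $ lookup m N ~= 0"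
		using coeff_V_Suc_nonzero[OF Suc.prems(2)] by auto
	then have U: "U ka lam ~= 0" by auto
	\<comment> \<open>The size inequality of the last step and that of the preceding chain add up to an
	  equality, so both are tight.\<close>
	have eq: "sz ka = mdegree ?m"
		using size[OF ka(1) Suc.prems(1) ka(4)] V_degree[OF ka(1,2)] V_degree_down[OF ka(1,2)]
			mdegree_update[of N m] Suc.prems(3) by (cases up) auto
	show ?case
	proof (cases "j <= N")
		case True
		then have "(\<Sum>i<j. lookup m i) = (\<Sum>i<j. lookup ?m i)"
			by (intro sum.cong) (auto simp: lookup_update)
		also have "... <= sz (take j ka)" by (rule Suc.IH[OF ka(1,2) eq])
		also have "... <= sz (take j lam)" by (rule step_take_sum[OF ka(1) Suc.prems(1) U])
		finally show ?thesis .
	next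
		case False
		have "length lam <= j" using V_length[OF Suc.prems(1,2)] False by simp
		moreover have "(\<Sum>i<j. lookup m i) = mdegree m"
			using False ka(3) by (intro mdegree_eq_sum[symmetric]) auto
		ultimately show ?thesis using Suc.prems(3) by simp
	qed
qed

definition lead :: "nat list => 'a" where
	"lead lam = (\<Prod>j<length lam. U (take j lam) (take (Suc j) lam) $ (lam ! j))"

text \<open>Only the chain that adds the rows of \<open>lam\<close> one after the other produces
  this monomial: dominance bounds the partial sums of an intermediate shape from below, the growth
  of rows in a step bounds them from above.\<close>

lemma V_lead:
	assumes "lam : Sh"
	shows "cf (V 1 (length lam) lam) (list_monom lam) = lead lam"
proof -
	have "cf (V 1 j (take j lam)) (list_monom (take j lam)) =
			(\<Prod>j<j. U (take j lam) (take (Suc j) lam) $ (lam ! j))" if "j <= length lam" for j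
		using that
	proof (induction j)
		case 0
		have "list_monom [] = 0" by (rule poly_mapping_eqI) (simp add: lookup_list_monom)
		then show ?case by (simp add: vchain_0 coeff_simps)
	next
		case (Suc j)
		let ?l = "take (Suc j) lam"
		have j: "j < length lam" using Suc.prems by simp
		have Sh: "?l : Sh" "take j lam : Sh" using take assms by auto
		have k: "keys (list_monom ?l) <= {..<Suc j}"
			using keys_list_monom[of ?l] by auto
		have lk: "lookup (list_monom ?l) j = lam ! j"
			using j by (simp add: lookup_list_monom)
		have "cf (V 1 (Suc j) ?l) (list_monom ?l) = (\<Sum>ka\<in>below Sh (sz ?l).
				cf (V 1 j ka) (list_monom (take j lam)) * U ka ?l $ (lam ! j))"
			using k j lk by (simp add: coeff_vchain_Suc list_monom_take)
		also have "... = (\<Sum>ka\<in>{take j lam}.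
				cf (V 1 j ka) (list_monom (take j lam)) * U ka ?l $ (lam ! j))"
		proof (rule sum.mono_neutral_right)
			show "{take j lam} <= below Sh (sz ?l)"
				using Sh j by (auto simp: below_def take_Suc_conv_app_nth)
			show "\<forall>ka\<in>below Sh (sz ?l) - {take j lam}.
					cf (V 1 j ka) (list_monom (take j lam)) * U ka ?l $ (lam ! j) = 0"
			proof (rule ballI, rule ccontr)
				fix ka assume "ka : below Sh (sz ?l) - {take j lam}"
					and nz: "cf (V 1 j ka) (list_monom (take j lam)) * U ka ?l $ (lam ! j) ~= 0"
				then have ka: "ka : Sh" "ka ~= take j lam" by (auto simp: below_def)
				have nz1: "cf (V 1 j ka) (list_monom (take j lam)) ~= 0" and nz2: "U ka ?l $ (lam ! j) ~= 0"
					using mult_neq_zeroD[OF nz] by auto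
				then have U: "U ka ?l ~= 0" by auto
				have "sz ?l = sz (take j lam) + lam ! j" using j by (simp add: take_Suc_conv_app_nth)
				then have eq: "sz ka = sz (take j lam)"
					using size[OF ka(1) Sh(1) nz2] V_degree[OF ka(1) nz1] V_degree_down[OF ka(1) nz1]
					by (cases up) (auto simp: mdegree_list_monom)
				have len: "length ka <= j" using V_length[OF ka(1) nz1] .
				have "sz (take i ka) = sz (take i (take j lam))" for i
				proof (rule order.antisym)
					have "sz (take i ka) = sz (take (min i j) ka)"
						using len by (cases "i <= j") (auto simp: min_def)
					also have "... <= sz (take (min i j) ?l)" by (rule step_take_sum[OF ka(1) Sh(1) U])
					finally show "sz (take i ka) <= sz (take i (take j lam))"
						by (cases "i <= j") (auto simp: min_def)
					show "sz (take i (take j lam)) <= sz (take i ka)"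
						using V_dominance[OF ka(1) nz1, of i] eq sum_list_take[of "take j lam" i]
						by (simp add: mdegree_list_monom lookup_list_monom)
				qed
				then show False using eq_if_take_sums_eq[OF ka(1) Sh(2)] ka(2) by blast
			qed
		qed simp
		finally show ?case using Suc by simp
	qed
	from this[of "length lam"] show ?thesis by (simp add: lead_def)
qed

lemma V_triangular:
	assumes "lam : Sh" "ka : Sh" "cf (V 1 N ka) (list_monom lam) ~= 0"
	shows "ka = lam \<or> (if up then sz ka < sz lam else sz lam < sz ka)
		\<or> (sz ka = sz lam & top_sums lam < top_sums ka)"
proof (cases "sz ka = sz lam")
	case True
	have "sz (take j lam) <= sz (take j ka)" for j
		using V_dominance[OF assms(2,3), of j] True sum_list_take[of lam j]
		by (simp add: mdegree_list_monom lookup_list_monom)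
	with True assms top_sums_less[of lam ka] show ?thesis by fastforce
next
	case False
	then show ?thesis
		using V_degree[OF assms(2,3)] V_degree_down[OF assms(2,3)] by (cases up) (auto simp: mdegree_list_monom)
qed

text \<open>Besides \<open>lam\<close>, the coefficient at x^lam involves only smaller shapes and
  shapes of the same size that are higher in dominance order; the induction treats those first. The
  test monomials have degree at most \<open>d\<close>, which is the range that the hypothesis
  covers.\<close>

lemma independent_up:
	assumes up and "\<And>lam. lam : Sh ==> lead lam = 1"
		and eq: "\<And>N m. mdegree m <= d ==> (\<Sum>ka\<in>below Sh d. cf (V 1 N ka) m * g ka) = 0"
		and "lam : below Sh d"
	shows "g lam = 0"
	using assms(4)
\<comment> \<open>\<open>Suc d * d\<close> bounds \<open>top_sums\<close> on shapes of size at most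
  \<open>d\<close>. Subtracting from it reverses dominance, so that higher shapes come
  first.\<close>
proof (induction lam rule: wf_induct[OF wf_measures[of "[sz, %lam. Suc d * d - top_sums lam]"]])
	case (1 lam)
	then have lam: "lam : Sh" "sz lam <= d" by (auto simp: below_def)
	have "cf (V 1 (length lam) ka) (list_monom lam) * g ka = 0"
		if ka: "ka : below Sh d - {lam}" for ka
	proof (cases "cf (V 1 (length lam) ka) (list_monom lam) = 0")
		case False
		have "top_sums ka <= Suc d * d" if "sz ka = sz lam"
			using lam(2) that by (intro order_trans[OF top_sums_le] mult_le_mono) auto
		then have "(ka, lam) : measures [sz, %lam. Suc d * d - top_sums lam]"
			using V_triangular[OF lam(1) _ False] ka \<open>up\<close> by (auto simp: below_def)
		then have "g ka = 0" using 1 ka by blast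
		then show ?thesis by simp
	qed simp
	then have "(\<Sum>ka\<in>below Sh d. cf (V 1 (length lam) ka) (list_monom lam) * g ka) =
			(\<Sum>ka\<in>{lam}. cf (V 1 (length lam) ka) (list_monom lam) * g ka)"
		using 1 by (intro sum.mono_neutral_right) auto
	then show ?case
		using eq[of "list_monom lam" "length lam"] lam V_lead[OF lam(1)] assms(2) by (simp add: mdegree_list_monom)
qed

text \<open>In this direction larger shapes come first, and finiteness of the family makes the
  induction well-founded. Cancellability of the leading coefficient, instead of its being 1, covers
  the powers of 2 that occur for jq-comb.\<close>

lemma independent_down:
	assumes "\<not> up" "\<And>lam x. lam : Sh ==> lead lam * x = 0 ==> x = 0"
		and F: "finite F" "F <= Sh"
		and eq: "\<And>N m. (\<Sum>ka\<in>F. cf (V 1 N ka) m * g ka) = 0"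
		and "lam : F"
	shows "g lam = 0"
proof -
	obtain d where d: "\<And>ka. ka : F ==> sz ka <= d"
		using F(1) by (meson finite_imageI finite_nat_set_iff_bounded_le imageI)
	show ?thesis using \<open>lam : F\<close>
	proof (induction lam rule: wf_induct[OF wf_measures[of "[%lam. d - sz lam, %lam. Suc d * d - top_sums lam]"]])
		case (1 lam)
		then have lam: "lam : Sh" using F by auto
		have "cf (V 1 (length lam) ka) (list_monom lam) * g ka = 0"
			if ka: "ka : F - {lam}" for ka
		proof (cases "cf (V 1 (length lam) ka) (list_monom lam) = 0")
			case False
			have "top_sums ka <= Suc d * d"
				using d[of ka] ka by (intro order_trans[OF top_sums_le] mult_le_mono) auto
			moreover have "sz ka <= d" using d ka by auto
			ultimately have "(ka, lam) : measures [%lam. d - sz lam, %lam. Suc d * d - top_sums lam]"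
				using V_triangular[OF lam _ False] ka \<open>\<not> up\<close> subsetD[OF F(2), of ka] by auto
			then have "g ka = 0" using 1 ka by blast
			then show ?thesis by simp
		qed simp
		then have "(\<Sum>ka\<in>F. cf (V 1 (length lam) ka) (list_monom lam) * g ka) =
				(\<Sum>ka\<in>{lam}. cf (V 1 (length lam) ka) (list_monom lam) * g ka)"
			using 1 F by (intro sum.mono_neutral_right) auto
		then show ?case
			using eq[of "length lam" "list_monom lam"] lam V_lead[OF lam] assms(2)[of lam "g lam"] by simp
	qed
qed

text \<open>Both sides are coefficients in the generating function of pairs of an \<open>U\<close>-step and a
	\<open>D\<close>-step; interchanging the steps produces the factor \<open>c\<close>.\<close>

definition commutes :: "(nat list => nat list => 'a) => 'a fps => bool" where
	"commutes D c \<longleftrightarrow> (\<forall>mu\<in>Sh. D mu [] = (if mu = [] then 1 else 0)) &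
		(\<forall>mu lam. D mu lam ~= 0 --> sz mu <= sz lam) &
		(\<forall>lam\<in>Sh. \<forall>mu\<in>Sh. \<forall>r. (\<Sum>nu\<in>below Sh (sz lam + r). U lam nu $ r * D mu nu) =
			(\<Sum>rho\<in>below Sh (sz lam). D rho lam * (c * U rho mu) $ r))"

text \<open>\<open>D\<close> is moved past the steps from the last variable to the first. Each
  exchange multiplies a step by \<open>c\<close>, and at the empty shape \<open>D\<close> acts as
  the identity. A monomial of degree at most \<open>d\<close> only meets shapes of size at most
  \<open>d\<close>, so the sum may be cut there.\<close>

lemma cauchy_step:
	assumes "commutes D c" up "mu : Sh" "mdegree m <= d"
	shows "(\<Sum>lam\<in>below Sh d. cf (V C N lam) m * D mu lam) = cf (V (C * c) N mu) m"
	using assms(3,4)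
proof (induction N arbitrary: mu m)
	case 0
	have "(\<Sum>lam\<in>below Sh d. cf (V C 0 lam) m * D mu lam) =
			(\<Sum>lam\<in>{[]}. cf (V C 0 lam) m * D mu lam)"
		by (rule sum.mono_neutral_right[OF finite_below]) (auto simp: below_def vchain_0 coeff_simps)
	then show ?case using assms(1) 0 by (auto simp: commutes_def vchain_0 coeff_simps)
next
	case (Suc N)
	define m' r where "m' = Poly_Mapping.update N 0 m" and "r = lookup m N"
	have md: "mdegree m' + r <= d" using Suc.prems(2) mdegree_update[of N m] by (simp add: m'_def r_def)
	have low: "D mu lam = 0" if "\<not> sz mu <= sz lam" for mu lam
		using assms(1) that by (auto simp: commutes_def)
	show ?case
	proof (cases "keys m <= {..<Suc N}")
		case False
		have "cf (V C' (Suc N) lam) m = 0" for C' lam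
			unfolding coeff_vchain_Suc using False by (rule if_not_P)
		then show ?thesis by simp
	next
		case True
		\<comment> \<open>The exchange is a statement about the coefficients of \<open>U\<close> alone.
		  The product with \<open>C\<close> is therefore expanded, and the coefficient with index
		  \<open>r - i\<close> is exchanged.\<close>
		have key: "cf (V C N ka) m' * (\<Sum>nu\<in>below Sh d. U ka nu $ (r - i) * D mu nu) =
				cf (V C N ka) m' * (\<Sum>rho\<in>below Sh d. D rho ka * (c * U rho mu) $ (r - i))"
			if "ka : below Sh d" for i ka
		proof (cases "cf (V C N ka) m' = 0")
			case False
			have ka: "ka : Sh" using that by (auto simp: below_def)
			have "sz ka <= mdegree m'" by (rule V_degree[OF ka False \<open>up\<close>])
			then have le: "sz ka + (r - i) <= d" using md by linarith
			have "(\<Sum>nu\<in>below Sh d. U ka nu $ (r - i) * D mu nu) =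
					(\<Sum>nu\<in>below Sh (sz ka + (r - i)). U ka nu $ (r - i) * D mu nu)"
				using le size[OF ka, of _ "r - i"] \<open>up\<close>
				by (intro sum.mono_neutral_right[OF finite_below]) (auto simp: below_def dest!: mult_neq_zeroD)
			also have "... = (\<Sum>rho\<in>below Sh (sz ka). D rho ka * (c * U rho mu) $ (r - i))"
				using assms(1) ka Suc.prems(1) unfolding commutes_def by blast
			also have "... = (\<Sum>rho\<in>below Sh d. D rho ka * (c * U rho mu) $ (r - i))"
				using le low by (intro sum.mono_neutral_left[OF finite_below]) (auto simp: below_def)
			finally show ?thesis by simp
		qed simp
		have "(\<Sum>lam\<in>below Sh d. cf (V C (Suc N) lam) m * D mu lam) =
			(\<Sum>nu\<in>below Sh d. (\<Sum>ka\<in>below Sh (sz nu). cf (V C N ka) m' * (C * U ka nu) $ r) * D mu nu)"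
			using True by (simp add: coeff_vchain_Suc m'_def r_def)
		also have "... = (\<Sum>nu\<in>below Sh d. (\<Sum>ka\<in>below Sh d. cf (V C N ka) m' * (C * U ka nu) $ r) * D mu nu)"
		proof (rule sum.cong[OF refl], rule arg_cong2[where f = "(*)", OF _ refl], rule sum.mono_neutral_left[OF finite_below])
			fix nu assume nu: "nu : below Sh d"
			show "\<forall>ka\<in>below Sh d - below Sh (sz nu). cf (V C N ka) m' * (C * U ka nu) $ r = 0"
			proof
				fix ka assume "ka : below Sh d - below Sh (sz nu)"
				then have "U ka nu = 0" using step_sum[of ka nu] nu by (auto simp: below_def)
				then show "cf (V C N ka) m' * (C * U ka nu) $ r = 0" by simp
			qed
			show "below Sh (sz nu) <= below Sh d" using nu by (auto simp: below_def)
		qed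
		also have "... = (\<Sum>ka\<in>below Sh d. \<Sum>nu\<in>below Sh d. cf (V C N ka) m' * (C * U ka nu) $ r * D mu nu)"
			unfolding sum_distrib_right by (rule sum.swap)
		also have "... = (\<Sum>ka\<in>below Sh d. \<Sum>i=0..r. C $ i * (cf (V C N ka) m' *
				(\<Sum>nu\<in>below Sh d. U ka nu $ (r - i) * D mu nu)))"
		proof (rule sum.cong[OF refl])
			fix ka
			have "(\<Sum>nu\<in>below Sh d. cf (V C N ka) m' * (C * U ka nu) $ r * D mu nu) =
				(\<Sum>nu\<in>below Sh d. \<Sum>i=0..r. C $ i * (cf (V C N ka) m' * (U ka nu $ (r - i) * D mu nu)))"
				by (simp add: fps_mult_nth sum_distrib_left sum_distrib_right mult_ac)
			also have "... = (\<Sum>i=0..r. \<Sum>nu\<in>below Sh d. C $ i * (cf (V C N ka) m' * (U ka nu $ (r - i) * D mu nu)))"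
				by (rule sum.swap)
			finally show "(\<Sum>nu\<in>below Sh d. cf (V C N ka) m' * (C * U ka nu) $ r * D mu nu) =
				(\<Sum>i=0..r. C $ i * (cf (V C N ka) m' * (\<Sum>nu\<in>below Sh d. U ka nu $ (r - i) * D mu nu)))"
				by (simp add: sum_distrib_left)
		qed
		also have "... = (\<Sum>ka\<in>below Sh d. \<Sum>i=0..r. C $ i * (cf (V C N ka) m' *
				(\<Sum>rho\<in>below Sh d. D rho ka * (c * U rho mu) $ (r - i))))"
			by (intro sum.cong refl arg_cong2[where f = "(*)"] key)
		also have "... = (\<Sum>ka\<in>below Sh d. \<Sum>rho\<in>below Sh d. cf (V C N ka) m' * D rho ka * (C * (c * U rho mu)) $ r)"
		proof (rule sum.cong[OF refl])
			fix ka
			have "(\<Sum>rho\<in>below Sh d. cf (V C N ka) m' * D rho ka * (C * (c * U rho mu)) $ r) =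
				(\<Sum>rho\<in>below Sh d. \<Sum>i=0..r. C $ i * (cf (V C N ka) m' * (D rho ka * (c * U rho mu) $ (r - i))))"
				unfolding fps_mult_nth[of C "c * U rho mu" r for rho] by (simp add: sum_distrib_left sum_distrib_right mult_ac)
			also have "... = (\<Sum>i=0..r. \<Sum>rho\<in>below Sh d. C $ i * (cf (V C N ka) m' * (D rho ka * (c * U rho mu) $ (r - i))))"
				by (rule sum.swap)
			finally show "(\<Sum>i=0..r. C $ i * (cf (V C N ka) m' *
				(\<Sum>rho\<in>below Sh d. D rho ka * (c * U rho mu) $ (r - i)))) =
				(\<Sum>rho\<in>below Sh d. cf (V C N ka) m' * D rho ka * (C * (c * U rho mu)) $ r)"
				by (simp add: sum_distrib_left)
		qed
		also have "... = (\<Sum>rho\<in>below Sh d. (\<Sum>ka\<in>below Sh d. cf (V C N ka) m' * D rho ka) * (C * c * U rho mu) $ r)"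
			by (subst sum.swap) (simp add: sum_distrib_right mult.assoc)
		also have "... = (\<Sum>rho\<in>below Sh d. cf (V (C * c) N rho) m' * (C * c * U rho mu) $ r)"
			using md by (intro sum.cong refl arg_cong2[where f = "(*)"] Suc.IH) (auto simp: below_def)
		\<comment> \<open>Both cut-offs give the same sum: terms beyond \<open>d\<close> vanish by degree,
		  terms beyond the size of \<open>mu\<close> by monotonicity of the steps.\<close>
		also have "... = (\<Sum>rho\<in>below Sh (sz mu). cf (V (C * c) N rho) m' * (C * c * U rho mu) $ r)"
		proof -
			have "cf (V (C * c) N rho) m' * (C * c * U rho mu) $ r = 0"
				if "rho : Sh" "\<not> (sz rho <= d & sz rho <= sz mu)" for rho
			proof (rule ccontr)
				assume "cf (V (C * c) N rho) m' * (C * c * U rho mu) $ r ~= 0"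
				then have "cf (V (C * c) N rho) m' ~= 0" "(C * c * U rho mu) $ r ~= 0"
					using mult_neq_zeroD by blast+
				then have "cf (V (C * c) N rho) m' ~= 0" "U rho mu ~= 0" by auto
				with V_degree[OF that(1) _ \<open>up\<close>] step_sum[OF that(1) Suc.prems(1)] that(2) md
				show False by fastforce
			qed
			then have "(\<Sum>rho\<in>below Sh e. cf (V (C * c) N rho) m' * (C * c * U rho mu) $ r) =
				(\<Sum>rho\<in>below Sh d \<inter> below Sh (sz mu). cf (V (C * c) N rho) m' * (C * c * U rho mu) $ r)"
				if "e = d \<or> e = sz mu" for e
				using that by (intro sum.mono_neutral_right[OF finite_below]) (auto simp: below_def)
			then show ?thesis by simp
		qed
		also have "... = cf (V (C * c) (Suc N) mu) m"
			using True by (simp add: coeff_vchain_Suc m'_def r_def)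
		finally show ?thesis .
	qed
qed

text \<open>The operators \<open>D\<close> are absorbed one by one, each leaving its factor in
  \<open>C\<close>. For \<open>mu = []\<close> this is a Cauchy identity in the usual sense.\<close>

lemma cauchy_chain:
	assumes "\<And>j. j < M ==> commutes (D j) (c j)" up "mu : Sh" "mdegree m <= d"
	shows "(\<Sum>lam\<in>below Sh d. cf (V C N lam) m * chain Sh D M mu lam) =
		cf (V (C * (\<Prod>j<M. c j)) N mu) m"
	using assms(1)
proof (induction M arbitrary: C)
	case 0
	have "cf (V C N mu) m = 0" if "\<not> sz mu <= d"
		using V_degree[OF assms(3) _ \<open>up\<close>, of C N m] that assms(4) by fastforce
	moreover have "(\<Sum>lam\<in>below Sh d. cf (V C N lam) m * (if mu = lam then 1 else 0)) =
			(if mu : below Sh d then cf (V C N mu) m else 0)"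
		by (simp add: if_distrib[of "(*) _"] sum.delta cong: if_cong)
	ultimately show ?case using assms(3) by (auto simp: below_def)
next
	case (Suc M)
	have cM: "commutes (D M) (c M)" using Suc.prems by simp
	have low: "D M ka lam = 0" if "\<not> sz ka <= sz lam" for ka lam
		using cM that by (auto simp: commutes_def)
	have "(\<Sum>lam\<in>below Sh d. cf (V C N lam) m * chain Sh D (Suc M) mu lam) =
		(\<Sum>lam\<in>below Sh d. \<Sum>ka\<in>below Sh d. cf (V C N lam) m * (chain Sh D M mu ka * D M ka lam))"
	proof (rule sum.cong[OF refl])
		fix lam assume "lam : below Sh d"
		then have "chain Sh D (Suc M) mu lam = (\<Sum>ka\<in>below Sh d. chain Sh D M mu ka * D M ka lam)"
			unfolding chain.simps using low by (intro sum.mono_neutral_left[OF finite_below]) (auto simp: below_def)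
		then show "cf (V C N lam) m * chain Sh D (Suc M) mu lam =
			(\<Sum>ka\<in>below Sh d. cf (V C N lam) m * (chain Sh D M mu ka * D M ka lam))"
			by (simp add: sum_distrib_left)
	qed
	also have "... = (\<Sum>ka\<in>below Sh d. (\<Sum>lam\<in>below Sh d. cf (V C N lam) m * D M ka lam) * chain Sh D M mu ka)"
		unfolding sum_distrib_right by (subst sum.swap) (simp only: mult_ac)
	also have "... = (\<Sum>ka\<in>below Sh d. cf (V (C * c M) N ka) m * chain Sh D M mu ka)"
		by (intro sum.cong refl arg_cong2[where f = "(*)"] cauchy_step[OF cM \<open>up\<close> _ assms(4)]) (auto simp: below_def)
	also have "... = cf (V (C * c M * (\<Prod>j<M. c j)) N mu) m"
		using Suc by simp
	finally show ?case by (simp add: mult_ac)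
qed

end

section \<open>Transfer matrices on binary words\<close>

definition words :: "nat => bool list set" where
	"words n = {cs. length cs = n}"

lemma words_0 [simp]: "words 0 = {[]}"
	by (auto simp: words_def)

lemma finite_words [simp]: "finite (words n)"
	using finite_lists_length_eq[of "UNIV :: bool set" n] by (simp add: words_def)

lemma words_Suc: "words (Suc n) = (#) False ` words n \<union> (#) True ` words n"
proof (intro equalityI subsetI)
	fix cs assume "cs : words (Suc n)"
	then obtain c cs' where "cs = c # cs'" "length cs' = n" by (auto simp: words_def length_Suc_conv)
	then show "cs : (#) False ` words n \<union> (#) True ` words n"
		by (cases c) (auto simp: words_def)
qed (auto simp: words_def)

lemma sum_words_Suc: "(\<Sum>cs\<in>words (Suc n). g cs) = (\<Sum>c\<in>UNIV. \<Sum>cs\<in>words n. g (c # cs))"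
	unfolding words_Suc
	by (subst sum.union_disjoint) (auto simp: sum.reindex UNIV_bool add.commute)

text \<open>The weight that a finite-state transducer assigns to a pair of words read in parallel: a
  sum over runs from \<open>s\<close>, with transition weights \<open>c\<close> and final weights
  \<open>f\<close>.\<close>

fun transfer :: "('s::finite => bool => bool => 's => 'a::comm_ring_1) => ('s => 'a) => 's =>
		bool list => bool list => 'a" where
	"transfer c f s [] [] = f s"
| "transfer c f s (a # as) (b # bs) = (\<Sum>s'\<in>UNIV. c s a b s' * transfer c f s' as bs)"
| "transfer c f s _ _ = 0"

section \<open>The transducers for one variable of GP and of jq-comb\<close>

datatype ustate = UE | UL | US | UM
datatype dstate = DZ | DP | DQ

lemma UNIV_ustate: "(UNIV :: ustate set) = {UE, UL, US, UM}"
	using ustate.exhaust by auto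

lemma UNIV_dstate: "(UNIV :: dstate set) = {DZ, DP, DQ}"
	using dstate.exhaust by auto

instance ustate :: finite by standard (simp add: UNIV_ustate)
instance dstate :: finite by standard (simp add: UNIV_dstate)

lemma sum_ustate: "sum g (UNIV :: ustate set) = g UE + g UL + g US + g UM"
	by (simp add: UNIV_ustate add_ac)

lemma sum_dstate: "sum g (UNIV :: dstate set) = g DZ + g DP + g DQ"
	by (simp add: UNIV_dstate add_ac)

text \<open>A word of length \<open>n\<close> records which of the numbers \<open>1, ..., n\<close> are parts of a strict partition.
	A part that grows is a particle moving to the right; it is in state \<open>UM\<close> while moving.  The other
	states remember whether the preceding site is empty in both words (\<open>UE\<close>), has just been filled
	(\<open>UL\<close>), or was occupied before (\<open>US\<close>); this decides which corners can receive an additional entry,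
	at a cost \<open>w = 1 + \<beta> x\<close> per entry.\<close>

definition uweight :: "'a::comm_ring_1 => 'a => ustate => bool => bool => ustate => 'a" where
	"uweight w x s a b s' = (case s of
		 UM => if a = b then (if s' = UM then x else 0) else if b then (if s' = UL then 1 else 0) else 0
	 | _ => if \<not> a then (if \<not> b & s' = UE then 1 else 0)
					else if b then (if s' = US then (case s of UE => w * w | UL => w | _ => 1) else 0)
					else (if s' = UM then x * (case s of UE => w * (1 + w) | UL => 2 * w | _ => 1 + w) else 0))"

text \<open>The states \<open>DP\<close> and \<open>DQ\<close> record whether the last box passed has a primed or an unprimed entry;
	\<open>u\<close> is the weight of a box that continues a run of equal entries.\<close>

definition dweight :: "'a::comm_ring_1 => 'a => dstate => bool => bool => dstate => 'a" where
	"dweight u t s a b s' = (case s of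
		 DZ => if a = b then (if s' = DZ then 1 else 0) else if a then (if s' = DZ then 0 else t) else 0
	 | _ => if a then (if b & s' = DP then (if s = DP then u else t) else 0)
					else if b then (if s' = DZ then 1 else 0)
					else if s' = DQ then (if s = DQ then u else t) else 0)"

text \<open>The summed word is the larger word of both operators here, and the smaller word of both
  in the primed version. These are the two orders that the exchange relation compares.\<close>

lemma transfer_mult_recursion:
	"(\<Sum>cs\<in>words (Suc n). transfer c f s (a # as) cs * transfer d g z (b # bs) cs) =
	 (\<Sum>e\<in>UNIV. \<Sum>s'\<in>UNIV. \<Sum>z'\<in>UNIV. c s a e s' * d z b e z' *
			(\<Sum>cs\<in>words n. transfer c f s' as cs * transfer d g z' bs cs))"
proof -
	have "(\<Sum>cs\<in>words n. transfer c f s (a # as) (e # cs) * transfer d g z (b # bs) (e # cs)) =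
		(\<Sum>s'\<in>UNIV. \<Sum>z'\<in>UNIV. c s a e s' * d z b e z' *
			(\<Sum>cs\<in>words n. transfer c f s' as cs * transfer d g z' bs cs))" for e
	proof -
		have "(\<Sum>cs\<in>words n. transfer c f s (a # as) (e # cs) * transfer d g z (b # bs) (e # cs)) =
			(\<Sum>cs\<in>words n. \<Sum>s'\<in>UNIV. \<Sum>z'\<in>UNIV. c s a e s' * d z b e z' * (transfer c f s' as cs * transfer d g z' bs cs))"
			by (simp add: sum_product mult_ac)
		also have "... = (\<Sum>s'\<in>UNIV. \<Sum>z'\<in>UNIV. \<Sum>cs\<in>words n. c s a e s' * d z b e z' * (transfer c f s' as cs * transfer d g z' bs cs))"
			by (subst sum.swap) (rule sum.cong[OF refl], rule sum.swap)
		finally show ?thesis by (simp add: sum_distrib_left)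
	qed
	then show ?thesis by (simp add: sum_words_Suc)
qed

lemma transfer_mult_recursion':
	"(\<Sum>cs\<in>words (Suc n). transfer d g z cs (a # as) * transfer c f s cs (b # bs)) =
	 (\<Sum>e\<in>UNIV. \<Sum>s'\<in>UNIV. \<Sum>z'\<in>UNIV. c s e b s' * d z e a z' *
			(\<Sum>cs\<in>words n. transfer d g z' cs as * transfer c f s' cs bs))"
proof -
	have "(\<Sum>cs\<in>words n. transfer d g z (e # cs) (a # as) * transfer c f s (e # cs) (b # bs)) =
		(\<Sum>s'\<in>UNIV. \<Sum>z'\<in>UNIV. c s e b s' * d z e a z' *
			(\<Sum>cs\<in>words n. transfer d g z' cs as * transfer c f s' cs bs))" for e
	proof -
		have "(\<Sum>cs\<in>words n. transfer d g z (e # cs) (a # as) * transfer c f s (e # cs) (b # bs)) =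
			(\<Sum>cs\<in>words n. \<Sum>s'\<in>UNIV. \<Sum>z'\<in>UNIV. c s e b s' * d z e a z' * (transfer d g z' cs as * transfer c f s' cs bs))"
			by (simp add: sum_product mult_ac, subst sum.swap[of _ "UNIV :: 'd set"]) (simp add: mult_ac)
		also have "... = (\<Sum>s'\<in>UNIV. \<Sum>z'\<in>UNIV. \<Sum>cs\<in>words n. c s e b s' * d z e a z' * (transfer d g z' cs as * transfer c f s' cs bs))"
			by (subst sum.swap) (rule sum.cong[OF refl], rule sum.swap)
		finally show ?thesis by (simp add: sum_distrib_left)
	qed
	then show ?thesis by (simp add: sum_words_Suc)
qed

text \<open>The linear relations below form the smallest set that contains the relations between the two
	orders of the operators at the left end and is preserved when a letter is prepended to both words.\<close>

lemma exchange_relations: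
	fixes X Y :: "ustate => dstate => bool list => bool list => 'a::comm_ring_1"
	assumes w: "w = 1 + \<beta> * x" and q: "q = 1 - x * u" and n: "n = 1 + x * t" and u: "u = t - \<beta>"
		and X: "\<And>s z a b as bs. length as = length bs ==> X s z (a # as) (b # bs) = (\<Sum>e\<in>UNIV. \<Sum>s'\<in>UNIV. \<Sum>z'\<in>UNIV.
			uweight w x s a e s' * dweight u t z b e z' * X s' z' as bs)"
		and Y: "\<And>s z a b as bs. length as = length bs ==> Y s z (a # as) (b # bs) = (\<Sum>e\<in>UNIV. \<Sum>s'\<in>UNIV. \<Sum>z'\<in>UNIV.
			uweight w x s e b s' * dweight u t z e a z' * Y s' z' as bs)"
		and X0: "\<And>s z. X s z [] [] = (if s = UM then (case z of DZ => 0 | DP => w | DQ => 1) else if z = DZ then q else 0)"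
		and Y0: "\<And>s z. Y s z [] [] = (if s ~= UM & z = DZ then 1 else 0)"
		and len: "length as = length bs"
	shows "(\<forall>z. X UE z as bs = (1 + w) * X UL z as bs - w * X US z as bs) &
		(\<forall>z. Y UE z as bs = (1 + w) * Y UL z as bs - w * Y US z as bs) &
		X UM DZ as bs = n * w * Y UM DZ as bs &
		X US DP as bs = n * w * Y US DP as bs &
		X UL DP as bs = w * (w * (Y US DP as bs + Y US DQ as bs) - q * Y UL DQ as bs) &
		X UL DQ as bs = n * w * (Y UL DP as bs + Y UL DQ as bs) - X UL DP as bs &
		X US DZ as bs = q * Y UE DZ as bs + w * x * (1 + w) * (t + u) * Y UM DP as bs &
		X UM DQ as bs = Y UE DZ as bs - q * w * Y UM DP as bs &
		x * t * X UM DP as bs = w * (w * Y US DZ as bs - q * Y UL DZ as bs - x * u * q * Y UM DP as bs) &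
		X UL DZ as bs = n * w * (Y UL DZ as bs + x * t * (Y UM DP as bs + Y UM DQ as bs))
			 - x * t * X UM DQ as bs - x * t * X UM DP as bs &
		X US DQ as bs = n * (1 + w) * Y UL DP as bs + (1 + w) * q * Y UL DQ as bs
			 - w * (1 + w) * Y US DP as bs - w * q * Y US DQ as bs"
	using len
proof (induction as bs rule: list_induct2)
	case Nil
	show ?case by (auto simp: X0 Y0 w q n u algebra_simps split: dstate.splits)
next
	case (Cons a as b bs)
	note rec = X[OF Cons.hyps] Y[OF Cons.hyps]
	have dz: "(\<forall>z. P z) \<longleftrightarrow> P DZ & P DP & P DQ" for P
		using dstate.exhaust by metis
	note IH = Cons.IH[unfolded dz]
	have YE: "Y UE z as bs = (1 + w) * Y UL z as bs - w * Y US z as bs" for z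
		using Cons.IH by blast
	have XE: "X UE z as bs = (1 + w) * X UL z as bs - w * X US z as bs" for z
		using Cons.IH by blast
	have r: "X UM DZ as bs = n * w * Y UM DZ as bs"
		"X US DP as bs = n * w * Y US DP as bs"
		"X UL DP as bs = w * (w * (Y US DP as bs + Y US DQ as bs) - q * Y UL DQ as bs)"
		"X UL DQ as bs = n * w * (Y UL DP as bs + Y UL DQ as bs) - X UL DP as bs"
		"X US DZ as bs = q * Y UE DZ as bs + w * x * (1 + w) * (t + u) * Y UM DP as bs"
		"X UM DQ as bs = Y UE DZ as bs - q * w * Y UM DP as bs"
		"X UL DZ as bs = n * w * (Y UL DZ as bs + x * t * (Y UM DP as bs + Y UM DQ as bs))
			 - x * t * X UM DQ as bs - x * t * X UM DP as bs"
		"X US DQ as bs = n * (1 + w) * Y UL DP as bs + (1 + w) * q * Y UL DQ as bs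
			 - w * (1 + w) * Y US DP as bs - w * q * Y US DQ as bs"
		and r9: "x * t * X UM DP as bs = w * (w * Y US DZ as bs - q * Y UL DZ as bs - x * u * q * Y UM DP as bs)"
		using Cons.IH by blast+
	\<comment> \<open>Only the multiple \<open>x * t * X UM DP\<close> is expressed through
	  \<open>Y\<close>. The rules \<open>r9'\<close> recognise this multiple in the shapes in which it
	  appears after expansion.\<close>
	define R where "R = w * (w * Y US DZ as bs - q * Y UL DZ as bs - x * u * q * Y UM DP as bs)"
	have r9': "t * (x * X UM DP as bs) = R" "t * (x * (k * X UM DP as bs)) = k * R"
		"t * (x * (x * (k * X UM DP as bs))) = x * (k * R)"
		"t * (x * (x * (x * (k * X UM DP as bs)))) = x * (x * (k * R))" for k
		unfolding R_def r9[symmetric] by (simp_all add: mult_ac)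
	show ?case
		by (cases a; cases b; unfold dz; intro conjI;
				(simp only: rec sum_ustate sum_dstate uweight_def dweight_def UNIV_bool; simp;
				 ((simp only: XE r YE)?; (simp add: w q n u algebra_simps r9')?; (simp add: R_def w q n u algebra_simps)?)?)?)
qed

text \<open>The second summand lets a particle enter at the left end: it becomes a new part, and
  \<open>x\<close> pays for its diagonal box. Starting in \<open>UL\<close> encodes the rule for the
  diagonal: an occupied first site may receive an additional unprimed letter, but no primed
  one.\<close>

definition uop :: "'a::comm_ring_1 => 'a => (ustate => 'a) => bool list => bool list => 'a" where
	"uop w x f as bs = transfer (uweight w x) f UL as bs + x * transfer (uweight w x) f UM as bs"

text \<open>A new part of a bar tableau may begin with a primed box (\<open>DP\<close>) or with an
  unprimed one (\<open>DQ\<close>), since primes are allowed on the diagonal here.\<close>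

definition dop :: "'a::comm_ring_1 => 'a => (dstate => 'a) => bool list => bool list => 'a" where
	"dop u t g as bs = transfer (dweight u t) g DZ as bs +
		 t * (transfer (dweight u t) g DP as bs + transfer (dweight u t) g DQ as bs)"

definition ufin :: "ustate => 'a::comm_ring_1" where
	"ufin s = (if s = UM then 0 else 1)"

definition dfin :: "dstate => 'a::comm_ring_1" where
	"dfin z = (if z = DZ then 1 else 0)"

text \<open>The second sum on the left stands for the pairs with both particles in flight beyond the
  right end. If the words were continued by empty sites, both particles would have to land at the
  same later site. Each site crossed costs \<open>x * u\<close>, except that the first one after
  \<open>DP\<close> costs \<open>x * t\<close>. The tails add up to 1 / (1 - x u) after
  \<open>DQ\<close> and to w / (1 - x u) after \<open>DP\<close>; multiplied by \<open>q\<close>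
  they become the final weights 1 and \<open>w\<close>.\<close>

lemma words_exchange:
	fixes w :: "'a::comm_ring_1"
	assumes w: "w = 1 + \<beta> * x" and q: "q = 1 - x * u" and n: "n = 1 + x * t" and u: "u = t - \<beta>"
		and len: "length as = N" "length bs = N"
	shows "q * (\<Sum>cs\<in>words N. uop w x ufin as cs * dop u t dfin bs cs) +
			(\<Sum>cs\<in>words N. uop w x (%s. of_bool (s = UM)) as cs * dop u t (%z. case z of DZ => 0 | DP => w | DQ => 1) bs cs)
		= n * w * (\<Sum>cs\<in>words N. dop u t dfin cs as * uop w x ufin cs bs)"
proof -
	define S where "S = (%f g s z as bs. \<Sum>cs\<in>words (length as).
		 transfer (uweight w x) f s as cs * transfer (dweight u t) g z bs cs)"
	define fM gM where "fM = (%s. of_bool (s = UM) :: 'a)" and "gM = (%z. case z of DZ => 0 | DP => w | DQ => (1 :: 'a))"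
	define X where "X = (%s z as bs. q * S ufin dfin s z as bs + S fM gM s z as bs)"
	define Y where "Y = (%s z as bs. \<Sum>cs\<in>words (length as).
		 transfer (dweight u t) dfin z cs as * transfer (uweight w x) ufin s cs bs)"
	have Srec: "S f g s z (a # as) (b # bs) = (\<Sum>e\<in>UNIV. \<Sum>s'\<in>UNIV. \<Sum>z'\<in>UNIV.
			uweight w x s a e s' * dweight u t z b e z' * S f g s' z' as bs)" for f g s z a b as bs
		by (simp add: S_def transfer_mult_recursion)
	have rel: "(\<forall>z. X UE z as bs = (1 + w) * X UL z as bs - w * X US z as bs) &
		(\<forall>z. Y UE z as bs = (1 + w) * Y UL z as bs - w * Y US z as bs) &
		X UM DZ as bs = n * w * Y UM DZ as bs &
		X US DP as bs = n * w * Y US DP as bs &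
		X UL DP as bs = w * (w * (Y US DP as bs + Y US DQ as bs) - q * Y UL DQ as bs) &
		X UL DQ as bs = n * w * (Y UL DP as bs + Y UL DQ as bs) - X UL DP as bs &
		X US DZ as bs = q * Y UE DZ as bs + w * x * (1 + w) * (t + u) * Y UM DP as bs &
		X UM DQ as bs = Y UE DZ as bs - q * w * Y UM DP as bs &
		x * t * X UM DP as bs = w * (w * Y US DZ as bs - q * Y UL DZ as bs - x * u * q * Y UM DP as bs) &
		X UL DZ as bs = n * w * (Y UL DZ as bs + x * t * (Y UM DP as bs + Y UM DQ as bs))
			 - x * t * X UM DQ as bs - x * t * X UM DP as bs &
		X US DQ as bs = n * (1 + w) * Y UL DP as bs + (1 + w) * q * Y UL DQ as bs
			 - w * (1 + w) * Y US DP as bs - w * q * Y US DQ as bs"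
	proof (rule exchange_relations[OF w q n u])
		fix s z a b and as bs :: "bool list"
		show "X s z (a # as) (b # bs) = (\<Sum>e\<in>UNIV. \<Sum>s'\<in>UNIV. \<Sum>z'\<in>UNIV.
			uweight w x s a e s' * dweight u t z b e z' * X s' z' as bs)"
			unfolding X_def Srec by (simp add: sum_distrib_left sum.distrib[symmetric] distrib_left mult_ac)
		show "Y s z (a # as) (b # bs) = (\<Sum>e\<in>UNIV. \<Sum>s'\<in>UNIV. \<Sum>z'\<in>UNIV.
			uweight w x s e b s' * dweight u t z e a z' * Y s' z' as bs)"
			by (simp add: Y_def transfer_mult_recursion')
	qed (use len in \<open>auto simp: X_def Y_def S_def ufin_def dfin_def fM_def gM_def split: dstate.splits\<close>)
	have expand: "(\<Sum>cs\<in>words N. uop w x f as cs * dop u t g bs cs) =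
		S f g UL DZ as bs + t * (S f g UL DP as bs + S f g UL DQ as bs) + x * S f g UM DZ as bs
		+ x * t * (S f g UM DP as bs + S f g UM DQ as bs)" for f g
		using len by (simp add: S_def uop_def dop_def sum_distrib_left sum.distrib algebra_simps)
	have "q * (\<Sum>cs\<in>words N. uop w x ufin as cs * dop u t dfin bs cs) +
			(\<Sum>cs\<in>words N. uop w x fM as cs * dop u t gM bs cs) =
		X UL DZ as bs + t * (X UL DP as bs + X UL DQ as bs) + x * X UM DZ as bs
		+ x * t * (X UM DP as bs + X UM DQ as bs)"
		unfolding expand by (simp add: X_def algebra_simps)
	also have "... = n * w * (Y UL DZ as bs + t * (Y UL DP as bs + Y UL DQ as bs) + x * Y UM DZ as bs
		+ x * t * (Y UM DP as bs + Y UM DQ as bs))"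
	proof -
		have "X UL DP as bs + X UL DQ as bs = n * w * (Y UL DP as bs + Y UL DQ as bs)"
			"X UM DZ as bs = n * w * Y UM DZ as bs"
			"X UL DZ as bs = n * w * (Y UL DZ as bs + x * t * (Y UM DP as bs + Y UM DQ as bs))
				- x * t * (X UM DP as bs + X UM DQ as bs)"
			using rel by (simp_all add: algebra_simps)
		then show ?thesis by (simp add: algebra_simps)
	qed
	also have "... = n * w * (\<Sum>cs\<in>words N. dop u t dfin cs as * uop w x ufin cs bs)"
		using len by (simp add: Y_def uop_def dop_def sum_distrib_left sum.distrib algebra_simps)
	finally show ?thesis by (simp add: fM_def gM_def)
qed

text \<open>A run can end in \<open>UM\<close> only if its particle was picked up before the empty
  tail, and then it pays \<open>x\<close> at each of the \<open>k\<close> sites.\<close>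

lemma moving_dvd:
	"x ^ k dvd transfer (uweight w x) (%s. of_bool (s = UM)) s (as @ replicate k False) cs"
proof -
	have tail: "(s ~= UM --> transfer (uweight w x) (%s. of_bool (s = UM)) s (replicate k False) cs = 0) &
		x ^ k dvd transfer (uweight w x) (%s. of_bool (s = UM)) s (replicate k False) cs" for s k cs
	proof (induction k arbitrary: s cs)
		case 0 then show ?case by (cases cs) auto
	next
		case (Suc k)
		show ?case
		proof (cases cs)
			case (Cons c cs')
			show ?thesis unfolding Cons
				using Suc[of _ cs'] by (cases s; cases c) (auto simp: sum_ustate uweight_def mult_dvd_mono)
		qed auto
	qed
	show ?thesis
	proof (induction as arbitrary: s cs)
		case Nil then show ?case using tail by simp
	next
		case (Cons a as)
		then show ?case by (cases cs) (auto intro!: dvd_sum dvd_mult)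
	qed
qed

lemma uop_moving_dvd: "x ^ k dvd uop w x (%s. of_bool (s = UM)) (as @ replicate k False) cs"
	unfolding uop_def by (intro dvd_add dvd_mult moving_dvd)

section \<open>One letter at a time\<close>

text \<open>Transfer matrices for adding a single letter.  The first component of the state tells whether the
	current part is moving; the second one is the previous letter of the first word, the previous letter
	of the second word, or whether the preceding bond was crossed as well.\<close>

definition ucol :: "'a::comm_ring_1 => 'a => bool \<times> bool => bool => bool => bool \<times> bool => 'a" where
	"ucol w x s a b s' = (case s of
		 (True, p) => if b & s' = (a, a) then x else 0
	 | (False, p) => if s' = (a & \<not> b, a) & (b --> a) then (if a & b & \<not> p then w else 1) else 0)"

definition urow :: "'a::comm_ring_1 => 'a => bool \<times> bool => bool => bool => bool \<times> bool => 'a" where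
	"urow w x s a b s' = (case s of
		 (True, p) => if \<not> a & s' = (\<not> b, b) then x else 0
	 | (False, p) => if s' = (a & \<not> b, b) & (b --> a) then (if a & \<not> p then w else 1) else 0)"

definition dcol :: "'a::comm_ring_1 => 'a => bool \<times> bool => bool => bool => bool \<times> bool => 'a" where
	"dcol u t s a b s' = (case s of
		 (True, p) => if b & s' = (a, a) then (if p then u else t) else 0
	 | (False, p) => if s' = (a & \<not> b, False) & (b --> a) then 1 else 0)"

definition drow :: "'a::comm_ring_1 => 'a => bool \<times> bool => bool => bool => bool \<times> bool => 'a" where
	"drow u t s a b s' = (case s of
		 (True, p) => if \<not> a & s' = (\<not> b, \<not> b) then (if p then u else t) else 0
	 | (False, p) => if s' = (a & \<not> b, False) & (b --> a) then 1 else 0)"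

definition lfin :: "bool \<times> bool => 'a::comm_ring_1" where
	"lfin s = (if fst s then 0 else 1)"

lemma transfer_compose_recursion:
	"(\<Sum>cs\<in>words (Suc n). transfer c f s (a # as) cs * transfer d g z cs (b # bs)) =
	 (\<Sum>e\<in>UNIV. \<Sum>s'\<in>UNIV. \<Sum>z'\<in>UNIV. c s a e s' * d z e b z' *
			(\<Sum>cs\<in>words n. transfer c f s' as cs * transfer d g z' cs bs))"
proof -
	have "(\<Sum>cs\<in>words n. transfer c f s (a # as) (e # cs) * transfer d g z (e # cs) (b # bs)) =
		(\<Sum>s'\<in>UNIV. \<Sum>z'\<in>UNIV. c s a e s' * d z e b z' *
			(\<Sum>cs\<in>words n. transfer c f s' as cs * transfer d g z' cs bs))" for e
	proof -
		have "(\<Sum>cs\<in>words n. transfer c f s (a # as) (e # cs) * transfer d g z (e # cs) (b # bs)) =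
			(\<Sum>cs\<in>words n. \<Sum>s'\<in>UNIV. \<Sum>z'\<in>UNIV. c s a e s' * d z e b z' * (transfer c f s' as cs * transfer d g z' cs bs))"
			by (simp add: sum_product mult_ac)
		also have "... = (\<Sum>s'\<in>UNIV. \<Sum>z'\<in>UNIV. \<Sum>cs\<in>words n. c s a e s' * d z e b z' * (transfer c f s' as cs * transfer d g z' cs bs))"
			by (subst sum.swap) (rule sum.cong[OF refl], rule sum.swap)
		finally show ?thesis by (simp add: sum_distrib_left)
	qed
	then show ?thesis by (simp add: sum_words_Suc)
qed

lemma sum_bool: "sum g (UNIV :: bool set) = g False + g True"
	by (simp add: UNIV_bool add.commute)

lemma sum_bool_pair: "sum g (UNIV :: (bool \<times> bool) set) =
		g (False, False) + g (False, True) + g (True, False) + g (True, True)"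
proof -
	have "(UNIV :: (bool \<times> bool) set) = {(False, False), (False, True), (True, False), (True, True)}"
		by auto
	then have "sum g (UNIV :: (bool \<times> bool) set) =
			sum g {(False, False), (False, True), (True, False), (True, True)}"
		by (rule arg_cong)
	then show ?thesis by (simp add: add_ac)
qed

text \<open>This is the origin of the weights in \<open>uweight\<close>: summing over the
  intermediate word merges the two memories into one state. The two letters cannot both be in
  flight: a vertical strip moves a particle by one site, so the intermediate word is occupied there,
  while a horizontal move crosses only sites that are empty in that word.\<close>

lemma ucol_urow:
	assumes "length as = length bs"
	shows "(\<Sum>cs\<in>words (length as). transfer (ucol w x) lfin s as cs * transfer (urow w x) lfin z cs bs) =
		(case (s, z) of
			 ((False, p), (False, p')) => transfer (uweight w x) ufin (if p then if p' then US else UL else if p' then UL else UE) as bs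
		 | ((False, p), (True, p')) => x * transfer (uweight w x) ufin UM as bs
		 | ((True, p), (False, p')) => x * (if p' then 1 else w) * transfer (uweight w x) ufin UM as bs
		 | ((True, p), (True, p')) => 0)"
	using assms
proof (induction as bs arbitrary: s z rule: list_induct2)
	case Nil
	show ?case by (auto simp: lfin_def ufin_def split: prod.splits bool.splits)
next
	case (Cons a as b bs)
	show ?case
		unfolding list.size transfer_compose_recursion
		by (simp only: add_0_right add_Suc_right transfer_compose_recursion)
			 (cases s; cases z; cases "fst s"; cases "snd s"; cases "fst z"; cases "snd z"; cases a; cases b;
				simp add: Cons.IH sum_bool sum_bool_pair sum_ustate uweight_def ucol_def urow_def algebra_simps)
qed

text \<open>The memory of a single letter only decides whether the next box costs \<open>t\<close>
  or \<open>u\<close>. Apart from this factor, the state is given by which of the two letters is in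
  flight.\<close>

lemma dcol_drow:
	assumes "length as = length bs"
	shows "(\<Sum>cs\<in>words (length as). transfer (dcol u t) lfin s as cs * transfer (drow u t) lfin z cs bs) =
		(case (s, z) of
			 ((False, p), (False, p')) => transfer (dweight u t) dfin DZ as bs
		 | ((False, p), (True, p')) => (if p' then u else t) * transfer (dweight u t) dfin DQ as bs
		 | ((True, p), (False, p')) => (if p then u else t) * transfer (dweight u t) dfin DP as bs
		 | ((True, p), (True, p')) => 0)"
	using assms
proof (induction as bs arbitrary: s z rule: list_induct2)
	case Nil
	show ?case by (auto simp: lfin_def dfin_def split: prod.splits bool.splits)
next
	case (Cons a as b bs)
	show ?case
		by (simp only: list.size add_0_right add_Suc_right transfer_compose_recursion)
			 (cases s; cases z; cases "fst s"; cases "snd s"; cases "fst z"; cases "snd z"; cases a; cases b;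
				simp add: Cons.IH sum_bool sum_bool_pair sum_dstate dweight_def dcol_def drow_def algebra_simps)
qed

section \<open>Shapes described by binary words\<close>

definition ones :: "bool list => nat" where
	"ones as = length (filter id as)"

lemma ones_simps [simp]: "ones [] = 0" "ones (a # as) = of_bool a + ones as"
	by (auto simp: ones_def)

text \<open>The number of boxes on the \<open>p\<close>-th diagonal.\<close>

definition ht :: "bool list => nat => nat" where
	"ht as p = ones (drop p as)"

lemma ht_Cons [simp]: "ht (a # as) 0 = of_bool a + ht as 0" "ht (a # as) (Suc p) = ht as p"
	and ht_Nil [simp]: "ht [] p = 0"
	by (auto simp: ht_def)

lemma ht_step: "p < length as ==> ht as p = ht as (Suc p) + of_bool (as ! p)"
	by (simp add: ht_def Cons_nth_drop_Suc[symmetric])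

lemma ht_ge_length: "length as <= p ==> ht as p = 0"
	by (simp add: ht_def)

lemma ht_Suc_le: "ht as (Suc p) <= ht as p" and ht_le_Suc: "ht as p <= Suc (ht as (Suc p))"
	by (cases "p < length as"; simp add: ht_step ht_ge_length)+

lemma ht_antimono: "p <= q ==> ht as q <= ht as p"
	by (rule lift_Suc_antimono_le) (rule ht_Suc_le)

lemma ht_diff: "p <= q ==> ht as p + p <= ht as q + q"
proof (induction q rule: dec_induct)
	case (step q)
	then show ?case using ht_le_Suc[of as q] by simp
qed simp

text \<open>A strict partition has one box on diagonal \<open>p\<close> for every part larger than
  \<open>p\<close>. Describing a diagram by its diagonals, and not by its rows, fits a transducer
  that reads the possible part sizes in increasing order.\<close>

definition shape :: "bool list => (nat \<times> nat) set" where
	"shape as = {(i, i + p) | i p. i < ht as p}"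

lemma mem_shape: "(i, j) : shape as \<longleftrightarrow> i <= j & i < ht as (j - i)"
	by (auto simp: shape_def) (metis le_add_diff_inverse)

lemma mem_shape_diag [simp]: "(i, i + p) : shape as \<longleftrightarrow> i < ht as p"
	by (simp add: mem_shape)

lemma shape_left: "(i, j') : shape as ==> i <= j ==> j <= j' ==> (i, j) : shape as"
	using ht_antimono[OF diff_le_mono, of j j' as i] by (simp add: mem_shape)

lemma shape_up: "(i', j) : shape as ==> i <= i' ==> (i, j) : shape as"
proof -
	assume a: "(i', j) : shape as" "i <= i'"
	from a(2) have "j - i' <= j - i" by simp
	from ht_diff[OF this] have "ht as (j - i') + (j - i') <= ht as (j - i) + (j - i)" .
	moreover have "i' <= j" "i' < ht as (j - i')" using a(1) by (auto simp: mem_shape)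
	ultimately show ?thesis using a(2) by (simp add: mem_shape)
qed

lemma finite_shape [simp]: "finite (shape as)"
proof (rule finite_subset)
	show "shape as <= {..<ht as 0} \<times> {..<ht as 0 + length as}"
	proof
		fix b assume "b : shape as"
		then obtain i p where b: "b = (i, i + p)" "i < ht as p" by (auto simp: shape_def)
		moreover have "p < length as" using b ht_ge_length[of as p] by (metis not_less not_less0)
		ultimately show "b : {..<ht as 0} \<times> {..<ht as 0 + length as}"
			using ht_antimono[of 0 p as] by auto
	qed
qed auto

lemma shape_subset_iff: "shape as <= shape bs \<longleftrightarrow> (\<forall>p. ht as p <= ht bs p)"
proof
	assume a: "shape as <= shape bs"
	show "\<forall>p. ht as p <= ht bs p"
	proof
		fix p
		show "ht as p <= ht bs p"
		proof (cases "ht as p")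
			case (Suc i)
			then have "(i, i + p) : shape as" by simp
			with a have "(i, i + p) : shape bs" by blast
			with Suc show ?thesis by simp
		qed simp
	qed
next
	assume a: "\<forall>p. ht as p <= ht bs p"
	show "shape as <= shape bs"
	proof
		fix b assume "b : shape as"
		then obtain i p where "b = (i, i + p)" "i < ht as p" by (auto simp: shape_def)
		with a[THEN spec, of p] show "b : shape bs" by simp
	qed
qed

lemma shape_inj:
	assumes "length as = length bs" "shape as = shape bs"
	shows "as = bs"
proof (rule nth_equalityI[OF assms(1)])
	fix k assume k: "k < length as"
	have "ht as p = ht bs p" for p
		using shape_subset_iff[of as bs] shape_subset_iff[of bs as] assms(2) by (simp add: order.antisym)
	then show "as ! k = bs ! k" using ht_step[of k as] ht_step[of k bs] k assms(1) by (cases "as ! k"; cases "bs ! k") auto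
qed

text \<open>The word marks the diagonals after which the length drops. Closure to the left and
  upwards makes the diagonal lengths weakly decreasing with drops of at most one, which is exactly
  what a 0/1-word can record.\<close>

lemma ideal_is_shape:
	assumes I: "\<And>i j. (i, j) : I ==> i <= j & j - i < N" and fin: "finite I"
		and left: "\<And>i j. (i, Suc j) : I ==> i <= j ==> (i, j) : I"
		and above: "\<And>i j. (Suc i, j) : I ==> (i, j) : I"
	obtains as where "length as = N" "I = shape as"
proof -
	define h where "h = (%p. card {i. (i, i + p) : I})"
	have finh: "finite {i. (i, i + p) : I}" for p
		by (rule finite_subset[OF _ finite_imageI[OF fin, of fst]]) force
	\<comment> \<open>A step back along a diagonal is a step up followed by a step to the left.\<close>
	have down: "(i, i + p) : I" if "(i + d, i + d + p) : I" for i d p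
		using that
	proof (induction d)
		case (Suc d)
		then have "(Suc (i + d), Suc (i + d + p)) : I" by simp
		then have "(i + d, Suc (i + d + p)) : I" by (rule above)
		then have "(i + d, i + d + p) : I" by (rule left) simp
		then show ?case by (rule Suc.IH)
	qed simp
	have hI: "(i, i + p) : I \<longleftrightarrow> i < h p" for i p
	proof -
		have "{i. (i, i + p) : I} = {..<h p}"
		proof -
			have d: "j : {i. (i, i + p) : I}" if "k : {i. (i, i + p) : I}" "j <= k" for j k
				using that down[of j "k - j" p] by simp
			define S where "S = {i. (i, i + p) : I}"
			have "S = {..<card S}"
			proof (rule card_subset_eq[symmetric])
				show "finite S" using finh by (simp add: S_def)
				show "{..<card S} <= S"
				proof (rule ccontr)
					assume "\<not> {..<card S} <= S"
					then obtain j where j: "j < card S" "j ~: S" by auto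
					then have "S <= {..<j}" using d unfolding S_def by (meson lessThan_iff not_le subsetI)
					then have "card S <= j" using card_mono[of "{..<j}" S] by simp
					with j show False by simp
				qed
			qed simp
			then show ?thesis by (simp add: S_def h_def)
		qed
		then show ?thesis by auto
	qed
	have hN: "h p = 0" if "N <= p" for p
		using hI[of 0 p] I[of 0 p] that by auto
	have hs: "h (Suc p) <= h p" "h p <= Suc (h (Suc p))" for p
	proof -
		show "h (Suc p) <= h p"
		proof (rule ccontr)
			assume "\<not> h (Suc p) <= h p"
			then have "(h p, h p + Suc p) : I" unfolding hI by simp
			then have "(h p, h p + p) : I" using left[of "h p" "h p + p"] by simp
			then show False unfolding hI by simp
		qed
		show "h p <= Suc (h (Suc p))"
		proof (rule ccontr)
			assume "\<not> h p <= Suc (h (Suc p))"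
			then have "(Suc (h (Suc p)), Suc (h (Suc p)) + p) : I" unfolding hI by simp
			then have "(h (Suc p), h (Suc p) + Suc p) : I" using above[of "h (Suc p)" "h (Suc p) + Suc p"] by simp
			then show False unfolding hI by simp
		qed
	qed
	define as where "as = map (%p. h (Suc p) < h p) [0..<N]"
	have len: "length as = N" by (simp add: as_def)
	have ht: "ht as p = h p" for p
	proof (cases "p <= N")
		case True
		then show ?thesis
		proof (induction p rule: inc_induct)
			case base then show ?case using hN[of N] ht_ge_length[of as N] len by simp
		next
			case (step p)
			have "as ! p \<longleftrightarrow> h (Suc p) < h p" using step by (simp add: as_def)
			with step hs[of p] show ?case using len ht_step[of p as] by auto
		qed
	next
		case False
		then show ?thesis using hN ht_ge_length len by simp
	qed
	have "I = shape as"
	proof (intro equalityI subsetI)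
		fix b assume b: "b : I"
		obtain i j where ij: "b = (i, j)" by fastforce
		then have "i <= j" using I b by auto
		then show "b : shape as" using b hI[of i "j - i"] by (simp add: ij mem_shape ht)
	next
		fix b assume "b : shape as"
		then show "b : I" by (auto simp: shape_def ht hI)
	qed
	with len that show ?thesis by blast
qed

subsection \<open>Strips\<close>

definition hstrip :: "(nat \<times> nat) set => (nat \<times> nat) set => bool" where
	"hstrip A B \<longleftrightarrow> A <= B & (\<forall>i i' j. (i, j) : B - A --> (i', j) : B - A --> i = i')"

definition vstrip :: "(nat \<times> nat) set => (nat \<times> nat) set => bool" where
	"vstrip A B \<longleftrightarrow> A <= B & (\<forall>i j j'. (i, j) : B - A --> (i, j') : B - A --> j = j')"

text \<open>If diagonal \<open>k\<close> gains nothing, the implication keeps diagonal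
  \<open>Suc k\<close> from losing a box. If it gains one, \<open>as ! k\<close> would force a
  gained box on diagonal \<open>Suc k\<close> in the same column.\<close>

definition row_ok :: "bool list => bool list => nat => bool" where
	"row_ok as bs k \<longleftrightarrow> ht bs k = ht as k & (bs ! k --> as ! k) \<or> ht bs k = Suc (ht as k) & \<not> as ! k"

text \<open>In the second case, if \<open>bs ! k\<close> failed, diagonal \<open>Suc k\<close> would
  gain a box in the same row.\<close>

definition col_ok :: "bool list => bool list => nat => bool" where
	"col_ok as bs k \<longleftrightarrow> ht bs k = ht as k & (bs ! k --> as ! k) \<or> ht bs k = Suc (ht as k) & bs ! k"

lemma row_ok_Cons [simp]: "row_ok (a # as) (b # bs) (Suc k) = row_ok as bs k"
	"row_ok (a # as) (b # bs) 0 \<longleftrightarrow> ht bs 0 + of_bool b = ht as 0 + of_bool a & (b --> a)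
			\<or> ht bs 0 + of_bool b = Suc (ht as 0 + of_bool a) & \<not> a"
	by (auto simp: row_ok_def)

lemma col_ok_Cons [simp]: "col_ok (a # as) (b # bs) (Suc k) = col_ok as bs k"
	"col_ok (a # as) (b # bs) 0 \<longleftrightarrow> ht bs 0 + of_bool b = ht as 0 + of_bool a & (b --> a)
			\<or> ht bs 0 + of_bool b = Suc (ht as 0 + of_bool a) & b"
	by (auto simp: col_ok_def)

lemma prod_shift: "(\<Prod>k<Suc n. f k) = f 0 * (\<Prod>k<n. f (Suc k))"
	by (rule prod.lessThan_Suc_shift)

text \<open>\<open>p\<close> plays the role of a letter before the first site: False permits an
  additional letter in a corner on the diagonal, True forbids it.\<close>

definition row_val :: "'a::comm_ring_1 => 'a => bool list => bool list => bool => nat => 'a" where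
	"row_val w x as bs p k = (if ht bs k = Suc (ht as k) then x
		 else if as ! k & \<not> (if k = 0 then p else bs ! (k - 1)) then w else 1)"

definition col_val :: "'a::comm_ring_1 => 'a => bool list => bool list => bool => nat => 'a" where
	"col_val w x as bs p k = (if ht bs k = Suc (ht as k) then x
		 else if as ! k & bs ! k & \<not> (if k = 0 then p else as ! (k - 1)) then w else 1)"

lemma row_val_Cons_Suc: "row_val w x (a # as) (b # bs) p (Suc k) = row_val w x as bs b k"
	and col_val_Cons_Suc: "col_val w x (a # as) (b # bs) p (Suc k) = col_val w x as bs a k"
	by (cases k; simp add: row_val_def col_val_def)+

text \<open>A particle is in flight on arrival at site \<open>k\<close> exactly when diagonal
  \<open>k\<close> gains a box. Hence a pair of words admits at most one run, and its weight is a
  product over the diagonals.\<close>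

lemma transfer_urow:
	assumes "length as = length bs"
	shows "transfer (urow w x) lfin (h, p) as bs = (if ht bs 0 = ht as 0 + of_bool h then
		\<Prod>k<length as. if row_ok as bs k then row_val w x as bs p k else 0 else 0)"
	using assms
proof (induction as bs arbitrary: h p rule: list_induct2)
	case Nil
	then show ?case by (auto simp: lfin_def)
next
	case (Cons a as b bs)
	show ?case
		unfolding transfer.simps sum_bool_pair Cons.IH list.size add_0_right add_Suc_right prod_shift row_val_Cons_Suc
		by (cases h; cases p; cases a; cases b) (auto simp: urow_def row_val_def[of _ _ _ _ _ 0] col_val_def[of _ _ _ _ _ 0] cong: if_cong)
qed

lemma transfer_ucol:
	assumes "length as = length bs"
	shows "transfer (ucol w x) lfin (h, p) as bs = (if ht bs 0 = ht as 0 + of_bool h then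
		\<Prod>k<length as. if col_ok as bs k then col_val w x as bs p k else 0 else 0)"
	using assms
proof (induction as bs arbitrary: h p rule: list_induct2)
	case Nil
	then show ?case by (auto simp: lfin_def)
next
	case (Cons a as b bs)
	show ?case
		unfolding transfer.simps sum_bool_pair Cons.IH list.size add_0_right add_Suc_right prod_shift col_val_Cons_Suc
		by (cases h; cases p; cases a; cases b) (auto simp: ucol_def row_val_def[of _ _ _ _ _ 0] col_val_def[of _ _ _ _ _ 0] cong: if_cong)
qed

definition dval :: "'a::comm_ring_1 => 'a => bool list => bool list => bool => nat => 'a" where
	"dval u t as bs p k = (if ht bs k = Suc (ht as k) then
		 (if (if k = 0 then p else ht bs (k - 1) = Suc (ht as (k - 1))) then u else t) else 1)"

lemma dval_Cons_Suc: "dval u t (a # as) (b # bs) p (Suc k) =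
	 dval u t as bs (ht (b # bs) 0 = Suc (ht (a # as) 0)) k"
	by (cases k) (simp_all add: dval_def)

lemma dval_start: "ht bs 0 = ht as 0 ==> dval u t as bs False k = dval u t as bs True k"
	by (auto simp: dval_def)

lemma transfer_drow:
	assumes "length as = length bs"
	shows "transfer (drow u t) lfin (h, p) as bs = (if ht bs 0 = ht as 0 + of_bool h then
		\<Prod>k<length as. if row_ok as bs k then dval u t as bs p k else 0 else 0)"
	using assms
proof (induction as bs arbitrary: h p rule: list_induct2)
	case Nil
	then show ?case by (auto simp: lfin_def)
next
	case (Cons a as b bs)
	show ?case
		unfolding transfer.simps sum_bool_pair Cons.IH list.size add_0_right add_Suc_right prod_shift dval_Cons_Suc
		by (cases h; cases p; cases a; cases b) (auto simp: drow_def dval_def[of _ _ _ _ _ 0] dval_start cong: if_cong)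
qed

lemma transfer_dcol:
	assumes "length as = length bs"
	shows "transfer (dcol u t) lfin (h, p) as bs = (if ht bs 0 = ht as 0 + of_bool h then
		\<Prod>k<length as. if col_ok as bs k then dval u t as bs p k else 0 else 0)"
	using assms
proof (induction as bs arbitrary: h p rule: list_induct2)
	case Nil
	then show ?case by (auto simp: lfin_def)
next
	case (Cons a as b bs)
	show ?case
		unfolding transfer.simps sum_bool_pair Cons.IH list.size add_0_right add_Suc_right prod_shift dval_Cons_Suc
		by (cases h; cases p; cases a; cases b) (auto simp: dcol_def dval_def[of _ _ _ _ _ 0] dval_start cong: if_cong)
qed

context
	fixes as bs :: "bool list" and N
	assumes la: "length as = N" and lb: "length bs = N"
begin

lemma mem_skew: "(i, i + p) : shape bs - shape as \<longleftrightarrow> ht as p <= i & i < ht bs p"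
	by auto

lemma hstrip_iff: "hstrip (shape as) (shape bs) \<longleftrightarrow> (\<forall>k<N. row_ok as bs k)"
proof
	assume h: "hstrip (shape as) (shape bs)"
	then have le: "ht as p <= ht bs p" for p by (auto simp: hstrip_def shape_subset_iff)
	have col: False if "(i, j) : shape bs - shape as" "(i', j) : shape bs - shape as" "i ~= i'" for i i' j
		using h that by (auto simp: hstrip_def)
	show "\<forall>k<N. row_ok as bs k"
	proof (intro allI impI)
		fix k assume k: "k < N"
		note s = ht_step[of k as] ht_step[of k bs]
		have 1: "ht bs k <= Suc (ht as k)"
		proof (rule ccontr)
			assume "\<not> ht bs k <= Suc (ht as k)"
			then have a: "Suc (ht as k) < ht bs k" by simp
			then have "(Suc (ht as k), Suc (ht as k) + k) : shape bs - shape as"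
				unfolding mem_skew by simp
			moreover have "(ht as k, ht as k + Suc k) : shape bs - shape as"
				unfolding mem_skew using a ht_le_Suc[of bs k] ht_Suc_le[of as k] by simp
			ultimately show False using col[of "Suc (ht as k)" "ht as k + Suc k" "ht as k"] by simp
		qed
		have 2: "\<not> (as ! k & ht bs k = Suc (ht as k))"
		proof
			assume a: "as ! k & ht bs k = Suc (ht as k)"
			then have K: "ht as k = Suc (ht as (Suc k))" using s k la by simp
			have "(ht as k, ht as k + k) : shape bs - shape as"
				unfolding mem_skew using a by simp
			moreover have "(ht as (Suc k), ht as (Suc k) + Suc k) : shape bs - shape as"
				unfolding mem_skew using a ht_le_Suc[of bs k] K by simp
			ultimately show False using col[of "ht as k" "ht as k + k" "ht as (Suc k)"] K by simp
		qed
		have "ht bs k = ht as k ==> bs ! k ==> as ! k"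
			using s k la lb le[of "Suc k"] by (cases "as ! k") auto
		with 1 2 le[of k] show "row_ok as bs k" unfolding row_ok_def by linarith
	qed
next
	assume ok: "\<forall>k<N. row_ok as bs k"
	have le: "ht as p <= ht bs p" and le': "ht bs p <= Suc (ht as p)" for p
		using ok la lb ht_ge_length[of as p] by (cases "p < N"; force simp: row_ok_def ht_ge_length)+
	show "hstrip (shape as) (shape bs)"
		unfolding hstrip_def
	proof (intro conjI allI impI)
		show "shape as <= shape bs" using le by (simp add: shape_subset_iff)
		have *: False if a: "(i, j) : shape bs - shape as" "(i', j) : shape bs - shape as" and "i < i'" for i i' j
		proof -
			define p p' where "p = j - i" and "p' = j - i'"
			have j: "i' <= j" using a by (auto simp: mem_shape)
			then have jp: "j = i + p" "j = i' + p'" using \<open>i < i'\<close> by (auto simp: p_def p'_def)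
			have i: "ht as p = i" "ht bs p = Suc i" using a(1) le'[of p] unfolding jp(1) mem_skew by auto
			have i': "ht as p' = i'" "ht bs p' = Suc i'" using a(2) le'[of p'] unfolding jp(2) mem_skew by auto
			have "p' < p" using jp \<open>i < i'\<close> by simp
			have p'N: "p' < N" using i' lb ht_ge_length[of bs p'] by (cases "p' < N") auto
			\<comment> \<open>Since both boxes are in one column, the weakly increasing quantity
			  \<open>ht as p + p\<close> has the same value at \<open>p'\<close> and at \<open>p\<close>. It
			  is then constant in between, which forces \<open>as ! p'\<close> and so excludes a gain on
			  diagonal \<open>p'\<close>.\<close>
			have "ht as (Suc p') + Suc p' <= ht as p + p" using ht_diff[of "Suc p'" p as] \<open>p' < p\<close> by simp
			then have "as ! p'" using ht_step[of p' as] p'N la i i' jp by (cases "as ! p'") auto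
			then show False using ok p'N i' by (auto simp: row_ok_def)
		qed
		fix i i' j assume "(i, j) : shape bs - shape as" "(i', j) : shape bs - shape as"
		then show "i = i'" using *[of i j i'] *[of i' j i] by (cases i i' rule: linorder_cases) blast+
	qed
qed

lemma vstrip_iff: "vstrip (shape as) (shape bs) \<longleftrightarrow> (\<forall>k<N. col_ok as bs k)"
proof
	assume h: "vstrip (shape as) (shape bs)"
	then have le: "ht as p <= ht bs p" for p by (auto simp: vstrip_def shape_subset_iff)
	have row: False if "(i, j) : shape bs - shape as" "(i, j') : shape bs - shape as" "j ~= j'" for i j j'
		using h that by (auto simp: vstrip_def)
	show "\<forall>k<N. col_ok as bs k"
	proof (intro allI impI)
		fix k assume k: "k < N"
		note s = ht_step[of k as] ht_step[of k bs]
		have 1: "ht bs k <= Suc (ht as k)"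
		proof (rule ccontr)
			assume "\<not> ht bs k <= Suc (ht as k)"
			then have a: "Suc (ht as k) < ht bs k" by simp
			then have "(ht as k, ht as k + k) : shape bs - shape as"
				unfolding mem_skew by simp
			moreover have "(ht as k, ht as k + Suc k) : shape bs - shape as"
				unfolding mem_skew using a ht_le_Suc[of bs k] ht_Suc_le[of as k] by simp
			ultimately show False using row[of "ht as k" "ht as k + k" "ht as k + Suc k"] by simp
		qed
		have 2: "bs ! k" if a: "ht bs k = Suc (ht as k)"
		proof (rule ccontr)
			assume b: "\<not> bs ! k"
			have "(ht as k, ht as k + k) : shape bs - shape as"
				unfolding mem_skew using a by simp
			moreover have "(ht as k, ht as k + Suc k) : shape bs - shape as"
				unfolding mem_skew using a b s k lb ht_Suc_le[of as k] by simp
			ultimately show False using row[of "ht as k" "ht as k + k" "ht as k + Suc k"] by simp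
		qed
		have "ht bs k = ht as k ==> bs ! k ==> as ! k"
			using s k la lb le[of "Suc k"] by (cases "as ! k") auto
		with 1 2 le[of k] show "col_ok as bs k" unfolding col_ok_def by linarith
	qed
next
	assume ok: "\<forall>k<N. col_ok as bs k"
	have le: "ht as p <= ht bs p" and le': "ht bs p <= Suc (ht as p)" for p
		using ok la lb ht_ge_length[of as p] by (cases "p < N"; force simp: col_ok_def ht_ge_length)+
	show "vstrip (shape as) (shape bs)"
		unfolding vstrip_def
	proof (intro conjI allI impI)
		show "shape as <= shape bs" using le by (simp add: shape_subset_iff)
		have *: False if a: "(i, j) : shape bs - shape as" "(i, j') : shape bs - shape as" and "j < j'" for i j j'
		proof -
			define p p' where "p = j - i" and "p' = j' - i"
			have jp: "j = i + p" "j' = i + p'" using a by (auto simp: mem_shape p_def p'_def)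
			have i: "ht as p = i" "ht bs p = Suc i" using a(1) le'[of p] unfolding jp(1) mem_skew by auto
			have i': "ht as p' = i" "ht bs p' = Suc i" using a(2) le'[of p'] unfolding jp(2) mem_skew by auto
			have "p < p'" using jp \<open>j < j'\<close> by simp
			have pN: "p < N" using i lb ht_ge_length[of bs p] by (cases "p < N") auto
			have "bs ! p" using ok pN i by (auto simp: col_ok_def)
			moreover have "ht bs p' <= ht bs (Suc p)" using ht_antimono[of "Suc p" p' bs] \<open>p < p'\<close> by simp
			ultimately show False using ht_step[of p bs] pN lb i i' by simp
		qed
		fix i j j' assume "(i, j) : shape bs - shape as" "(i, j') : shape bs - shape as"
		then show "j = j'" using *[of i j j'] *[of i j' j] by (cases j j' rule: linorder_cases) blast+
	qed
qed

lemma prod_strip: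
	assumes "\<And>k. ht as k <= ht bs k & ht bs k <= Suc (ht as k)"
	shows "(\<Prod>b\<in>shape bs - shape as. f b) = (\<Prod>k<N. if ht bs k = Suc (ht as k) then f (ht as k, ht as k + k) else 1)"
proof -
	let ?g = "%k. (ht as k, ht as k + k)"
	have img: "shape bs - shape as = ?g ` {k : {..<N}. ht bs k = Suc (ht as k)}"
	proof (intro equalityI subsetI)
		fix b assume "b : shape bs - shape as"
		then obtain i p where b: "b = (i, i + p)" "ht as p <= i" "i < ht bs p"
			by (auto simp: shape_def)
		have "i = ht as p" "ht bs p = Suc (ht as p)" using b assms[of p] by auto
		moreover have "p < N" using b lb ht_ge_length[of bs p] by (cases "p < N") auto
		ultimately show "b : ?g ` {k : {..<N}. ht bs k = Suc (ht as k)}"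
			using b(1) by (intro image_eqI[of _ _ p]) auto
	qed auto
	have "inj_on ?g {k : {..<N}. ht bs k = Suc (ht as k)}" by (rule inj_onI) auto
	then have "(\<Prod>b\<in>shape bs - shape as. f b) = (\<Prod>k\<in>{k : {..<N}. ht bs k = Suc (ht as k)}. f (?g k))"
		unfolding img by (simp add: prod.reindex)
	also have "... = (\<Prod>k<N. if ht bs k = Suc (ht as k) then f (?g k) else 1)"
		by (rule prod.inter_filter) simp
	finally show ?thesis .
qed

end

lemma prod_if_all: "finite A ==> (\<Prod>k\<in>A. if P k then f k else (0 :: 'a::comm_semiring_1)) = (if \<forall>k\<in>A. P k then prod f A else 0)"
	by (induction A rule: finite_induct) auto

subsection \<open>Sums over the boxes containing a given letter\<close>

lemma sum_Pow_prod:
	assumes "finite C"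
	shows "(\<Sum>Y\<in>Pow C. \<Prod>b\<in>Y. f b) = (\<Prod>b\<in>C. 1 + f b :: 'a::comm_ring_1)"
	using prod_add[OF assms, of f "%_. 1"] by (simp add: add.commute)

text \<open>The possible sets of boxes containing the largest letter, if the smaller letters of a
  set-valued tableau of shape \<open>B\<close> fill the shape \<open>A\<close>. A box of
  \<open>A\<close> can also contain it when no smaller letter follows to the right or below. The ban
  on the diagonal for primed letters is the one in \<open>GP\<close>.\<close>

definition ext_sets :: "bool => (nat \<times> nat) set => (nat \<times> nat) set => (nat \<times> nat) set set" where
	"ext_sets pr A B = {X. A <= B & B - A <= X & X <= B &
		 (\<forall>i j. (i, j) : X --> (i, j) : A --> (i, Suc j) ~: A & (Suc i, j) ~: A) &
		 (if pr then (\<forall>i j j'. (i, j) : X --> (i, j') : X --> j = j') & (\<forall>i. (i, i) ~: X)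
			else \<forall>i i' j. (i, j) : X --> (i', j) : X --> i = i')}"

definition row_corners :: "(nat \<times> nat) set => (nat \<times> nat) set => (nat \<times> nat) set" where
	"row_corners A B = {(i, j) : A. (i, Suc j) ~: A & (Suc i, j) ~: A & (\<forall>i'. (i', j) : B --> (i', j) : A)}"

definition col_corners :: "(nat \<times> nat) set => (nat \<times> nat) set => (nat \<times> nat) set" where
	"col_corners A B = {(i, j) : A. i ~= j & (i, Suc j) ~: A & (Suc i, j) ~: A & (\<forall>j'. (i, j') : B --> (i, j') : A)}"

text \<open>The boxes outside the smaller shape are forced, and the choices inside are independent:
  two corners of a shape never share a column, so a corner can only conflict with forced
  boxes.\<close>

lemma ext_sets_row:
	"ext_sets False (shape as) (shape bs) = (if hstrip (shape as) (shape bs)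
		 then (%Y. (shape bs - shape as) \<union> Y) ` Pow (row_corners (shape as) (shape bs)) else {})"
proof (cases "hstrip (shape as) (shape bs)")
	case True
	let ?A = "shape as" and ?B = "shape bs" and ?C = "row_corners (shape as) (shape bs)"
	have uniq: "i = i'" if a: "(i, j) : ?C" "(i', j) : ?C" for i i' j
	proof -
		have "\<not> i < i'" if "(i, j) : ?C" "(i', j) : ?C" for i i'
			using that shape_up[of i' j as "Suc i"] by (auto simp: row_corners_def)
		with a show ?thesis by (meson linorder_neqE_nat)
	qed
	have "X : (%Y. (?B - ?A) \<union> Y) ` Pow ?C" if X: "X : ext_sets False ?A ?B" for X
	proof (rule image_eqI[of _ _ "X \<inter> ?A"])
		show "X = (?B - ?A) \<union> (X \<inter> ?A)" using X by (auto simp: ext_sets_def)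
		show "X \<inter> ?A : Pow ?C"
		proof
			show "X \<inter> ?A <= ?C"
			proof
				fix b assume "b : X \<inter> ?A"
				then obtain i j where b: "b = (i, j)" "(i, j) : X" "(i, j) : ?A" by (cases b) auto
				have "(i', j) : ?A" if "(i', j) : ?B" for i'
				proof (rule ccontr)
					assume n: "(i', j) ~: ?A"
					then have "(i', j) : X" using X that by (auto simp: ext_sets_def)
					then have "i = i'" using X b by (auto simp: ext_sets_def)
					with n b show False by simp
				qed
				then show "b : ?C" using X b by (auto simp: ext_sets_def row_corners_def)
			qed
		qed
	qed
	moreover have "(?B - ?A) \<union> Y : ext_sets False ?A ?B" if Y: "Y <= ?C" for Y
	proof -
		have CA: "?C <= ?A" by (auto simp: row_corners_def)
		have "i = i'" if "(i, j) : (?B - ?A) \<union> Y" "(i', j) : (?B - ?A) \<union> Y" for i i' j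
			using that uniq[of i j i'] True Y by (auto simp: hstrip_def row_corners_def)
		moreover have "?A <= ?B" using True by (simp add: hstrip_def)
		ultimately show ?thesis using Y CA unfolding ext_sets_def by (auto simp: row_corners_def)
	qed
	ultimately show ?thesis using True by auto
next
	case False
	have "X ~: ext_sets False (shape as) (shape bs)" for X
	proof
		assume X: "X : ext_sets False (shape as) (shape bs)"
		then have "shape as <= shape bs" "shape bs - shape as <= X"
			and "\<And>i i' j. (i, j) : X ==> (i', j) : X ==> i = i'"
			unfolding ext_sets_def by auto
		then have "hstrip (shape as) (shape bs)"
			unfolding hstrip_def by blast
		with False show False by simp
	qed
	with False show ?thesis by auto
qed

lemma ext_sets_col:
	"ext_sets True (shape as) (shape bs) = (if vstrip (shape as) (shape bs) & (\<forall>i. (i, i) : shape bs --> (i, i) : shape as)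
		 then (%Y. (shape bs - shape as) \<union> Y) ` Pow (col_corners (shape as) (shape bs)) else {})"
proof (cases "vstrip (shape as) (shape bs) & (\<forall>i. (i, i) : shape bs --> (i, i) : shape as)")
	case True
	let ?A = "shape as" and ?B = "shape bs" and ?C = "col_corners (shape as) (shape bs)"
	have uniq: "j = j'" if a: "(i, j) : ?C" "(i, j') : ?C" for i j j'
	proof -
		have "\<not> j < j'" if "(i, j) : ?C" "(i, j') : ?C" for j j'
			using that shape_left[of i j' as "Suc j"] by (auto simp: col_corners_def mem_shape)
		with a show ?thesis by (meson linorder_neqE_nat)
	qed
	have "X : (%Y. (?B - ?A) \<union> Y) ` Pow ?C" if X: "X : ext_sets True ?A ?B" for X
	proof (rule image_eqI[of _ _ "X \<inter> ?A"])
		show "X = (?B - ?A) \<union> (X \<inter> ?A)" using X by (auto simp: ext_sets_def)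
		show "X \<inter> ?A : Pow ?C"
		proof
			show "X \<inter> ?A <= ?C"
			proof
				fix b assume "b : X \<inter> ?A"
				then obtain i j where b: "b = (i, j)" "(i, j) : X" "(i, j) : ?A" by (cases b) auto
				have "(i, j') : ?A" if "(i, j') : ?B" for j'
				proof (rule ccontr)
					assume n: "(i, j') ~: ?A"
					then have "(i, j') : X" using X that by (auto simp: ext_sets_def)
					then have "j = j'" using X b by (auto simp: ext_sets_def)
					with n b show False by simp
				qed
				then show "b : ?C" using X b by (auto simp: ext_sets_def col_corners_def)
			qed
		qed
	qed
	moreover have "(?B - ?A) \<union> Y : ext_sets True ?A ?B" if Y: "Y <= ?C" for Y
	proof -
		have CA: "?C <= ?A" by (auto simp: col_corners_def)
		have "j = j'" if "(i, j) : (?B - ?A) \<union> Y" "(i, j') : (?B - ?A) \<union> Y" for i j j'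
			using that uniq[of i j j'] True Y by (auto simp: vstrip_def col_corners_def)
		moreover have "?A <= ?B" using True by (simp add: vstrip_def)
		ultimately show ?thesis using Y CA True unfolding ext_sets_def by (auto simp: col_corners_def)
	qed
	ultimately show ?thesis using True by auto
next
	case False
	have "X ~: ext_sets True (shape as) (shape bs)" for X
	proof
		assume X: "X : ext_sets True (shape as) (shape bs)"
		then have "shape as <= shape bs" "shape bs - shape as <= X"
			and "\<And>i j j'. (i, j) : X ==> (i, j') : X ==> j = j'"
			unfolding ext_sets_def by auto
		then have "vstrip (shape as) (shape bs)"
			unfolding vstrip_def by blast
		moreover have "\<forall>i. (i, i) : shape bs --> (i, i) : shape as"
			using X unfolding ext_sets_def by auto
		ultimately show False using False by simp
	qed
	with False show ?thesis by auto
qed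

text \<open>Each optional box contributes 1 or \<open>\<beta> * x\<close>; this is the source of the
  factor \<open>w\<close>.\<close>

lemma sum_strip_Pow:
	assumes S: "finite S" "S \<inter> A = {}" and C: "finite C" "C <= A"
	shows "(\<Sum>X\<in>(%Y. S \<union> Y) ` Pow C. \<Prod>b\<in>X. if b : A then \<beta> * x else x) =
		(\<Prod>b\<in>S. x) * (\<Prod>b\<in>C. 1 + \<beta> * x :: 'a::comm_ring_1)"
proof -
	have inj: "inj_on (%Y. S \<union> Y) (Pow C)"
		using S C by (intro inj_onI) blast
	have "(\<Prod>b\<in>S \<union> Y. if b : A then \<beta> * x else x) = (\<Prod>b\<in>S. x) * (\<Prod>b\<in>Y. \<beta> * x)" if "Y : Pow C" for Y
	proof -
		have fin: "finite Y" using that C finite_subset by auto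
		have "(\<Prod>b\<in>S \<union> Y. if b : A then \<beta> * x else x) =
				(\<Prod>b\<in>S. if b : A then \<beta> * x else x) * (\<Prod>b\<in>Y. if b : A then \<beta> * x else x)"
			using S C that fin by (intro prod.union_disjoint) auto
		also have "(\<Prod>b\<in>S. if b : A then \<beta> * x else x) = (\<Prod>b\<in>S. x)"
			using S by (intro prod.cong) auto
		also have "(\<Prod>b\<in>Y. if b : A then \<beta> * x else x) = (\<Prod>b\<in>Y. \<beta> * x)"
			using that C by (intro prod.cong) auto
		finally show ?thesis .
	qed
	then have "(\<Sum>X\<in>(%Y. S \<union> Y) ` Pow C. \<Prod>b\<in>X. if b : A then \<beta> * x else x) =
			(\<Sum>Y\<in>Pow C. (\<Prod>b\<in>S. x) * (\<Prod>b\<in>Y. \<beta> * x))"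
		unfolding sum.reindex[OF inj] o_def by (rule sum.cong[OF refl])
	then show ?thesis
		unfolding sum_distrib_left[symmetric] sum_Pow_prod[OF C(1)] .
qed

text \<open>Site \<open>k\<close> with \<open>as ! k\<close> stands for the row that ends on
  diagonal \<open>k\<close>. The box below its end lies on diagonal \<open>k - 1\<close>, and it
  belongs to the larger shape exactly when \<open>bs ! (k - 1)\<close>.\<close>

lemma row_corners_image:
	assumes la: "length as = N" and lb: "length bs = N" and ok: "\<forall>k<N. row_ok as bs k"
	shows "row_corners (shape as) (shape bs) = (%k. (ht as k - 1, ht as k - 1 + k)) `
		 {k : {..<N}. as ! k & \<not> (if k = 0 then False else bs ! (k - 1))}" (is "?C = ?g ` ?M")
proof (intro equalityI subsetI)
	have le: "ht as p <= ht bs p" for p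
		using ok la lb by (cases "p < N") (auto simp: row_ok_def ht_ge_length)
	have sub: "shape as <= shape bs" using le by (simp add: shape_subset_iff)
	{
		fix b assume b: "b : ?C"
		then obtain i p where ip: "b = (i, i + p)" "i < ht as p"
			by (auto simp: row_corners_def shape_def)
		have "(i, i + Suc p) ~: shape as" using b ip by (auto simp: row_corners_def)
		then have i: "ht as p = Suc i" "ht as (Suc p) = i"
			using ip ht_le_Suc[of as p] by (auto simp del: add_Suc_right)
		have pN: "p < N" using ip la ht_ge_length[of as p] by (cases "p < N") auto
		have asp: "as ! p" using ht_step[of p as] pN la i by (cases "as ! p") auto
		have "\<not> bs ! (p - 1)" if "p ~= 0"
		proof
			assume "bs ! (p - 1)"
			then have "ht bs (p - 1) = Suc (ht bs p)" using ht_step[of "p - 1" bs] that pN lb by simp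
			then have "(Suc i, Suc i + (p - 1)) : shape bs" unfolding mem_shape_diag using le[of p] i by simp
			then have "(Suc i, i + p) : shape bs" using that by simp
			then show False using b ip by (auto simp: row_corners_def)
		qed
		then show "b : ?g ` ?M" using ip i pN asp by (intro image_eqI[of _ _ p]) auto
	next
		fix b assume "b : ?g ` ?M"
		then obtain k where "k : ?M" "b = ?g k" by blast
		then have k: "k < N" "as ! k" "k ~= 0 ==> \<not> bs ! (k - 1)" "b = ?g k" by auto
		define i where "i = ht as (Suc k)"
		have i: "ht as k = Suc i" using ht_step[of k as] k la by (simp add: i_def)
		have b: "b = (i, i + k)" using k(4) i by simp
		have Lk: "ht bs k = Suc i" using ok k(1,2) i by (auto simp: row_ok_def)
		have 1: "(i, i + k) : shape as" using i by simp
		have 2: "(i, Suc (i + k)) ~: shape as"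
			using mem_shape_diag[of i "Suc k" as] i_def by simp
		have 3: "(Suc i, i + k) ~: shape bs"
		proof (cases k)
			case (Suc k')
			then have "ht bs k' = Suc i" using ht_step[of k' bs] k(1,3) lb Lk by simp
			then have "(Suc i, Suc i + k') ~: shape bs" unfolding mem_shape_diag by simp
			with Suc show ?thesis by simp
		qed (simp add: mem_shape)
		have "(i', i + k) : shape as" if "(i', i + k) : shape bs" for i'
			using shape_up[OF 1, of i'] shape_up[OF that, of "Suc i"] 3 by (cases "i' <= i") auto
		then show "b : ?C" using 1 2 3 sub b by (auto simp: row_corners_def)
	}
qed

text \<open>Now the box below the end of the row is tested in the smaller shape and the box to its
  right in the larger one. Site 0 is excluded because its corner is on the diagonal.\<close>

lemma col_corners_image:
	assumes la: "length as = N" and lb: "length bs = N" and ok: "\<forall>k<N. col_ok as bs k"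
	shows "col_corners (shape as) (shape bs) = (%k. (ht as k - 1, ht as k - 1 + k)) `
		 {k : {..<N}. ht bs k ~= Suc (ht as k) & as ! k & bs ! k & \<not> (if k = 0 then True else as ! (k - 1))}" (is "?C = ?g ` ?M")
proof (intro equalityI subsetI)
	have le: "ht as p <= ht bs p" for p
		using ok la lb by (cases "p < N") (auto simp: col_ok_def ht_ge_length)
	have sub: "shape as <= shape bs" using le by (simp add: shape_subset_iff)
	{
		fix b assume b: "b : ?C"
		then obtain i p where ip: "b = (i, i + p)" "i < ht as p"
			by (auto simp: col_corners_def shape_def)
		have "(i, i + Suc p) ~: shape as" using b ip by (auto simp: col_corners_def)
		then have i: "ht as p = Suc i" "ht as (Suc p) = i"
			using ip ht_le_Suc[of as p] by (auto simp del: add_Suc_right)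
		have pN: "p < N" using ip la ht_ge_length[of as p] by (cases "p < N") auto
		have asp: "as ! p" using ht_step[of p as] pN la i by (cases "as ! p") auto
		have p0: "p ~= 0" using b ip by (auto simp: col_corners_def)
		have prev: "\<not> as ! (p - 1)"
		proof
			assume "as ! (p - 1)"
			then have "ht as (p - 1) = Suc (ht as p)" using ht_step[of "p - 1" as] p0 pN la by simp
			then have "(Suc i, Suc i + (p - 1)) : shape as" unfolding mem_shape_diag using i by simp
			then have "(Suc i, i + p) : shape as" using p0 by simp
			then show False using b ip by (auto simp: col_corners_def)
		qed
		have "(i, i + Suc p) ~: shape bs" using b ip by (auto simp: col_corners_def)
		then have "ht bs (Suc p) = i" using le[of "Suc p"] i by (simp del: add_Suc_right)
		then have "bs ! p" "ht bs p = ht as p"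
			using ht_step[of p bs] le[of p] i pN lb by (cases "bs ! p"; simp)+
		then show "b : ?g ` ?M" using ip i pN asp prev p0 by (intro image_eqI[of _ _ p]) auto
	next
		fix b assume "b : ?g ` ?M"
		then obtain k where "k : ?M" "b = ?g k" by blast
		then have k: "k < N" "as ! k" "bs ! k" "ht bs k ~= Suc (ht as k)" "k ~= 0" "\<not> as ! (k - 1)" "b = ?g k"
			by (auto split: if_splits)
		define i where "i = ht as (Suc k)"
		have i: "ht as k = Suc i" using ht_step[of k as] k la by (simp add: i_def)
		have b: "b = (i, i + k)" using k(7) i by simp
		have Lk: "ht bs k = Suc i" using ok k(1,4) i by (auto simp: col_ok_def)
		have L: "ht bs (Suc k) = i" using ht_step[of k bs] k lb Lk by simp
		have 1: "(i, i + k) : shape as" using i by simp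
		have 2: "(i, Suc (i + k)) ~: shape as" "(i, Suc (i + k)) ~: shape bs"
			using mem_shape_diag[of i "Suc k" as] mem_shape_diag[of i "Suc k" bs] i_def L by simp_all
		have 3: "(Suc i, i + k) ~: shape as"
		proof -
			obtain k' where k': "k = Suc k'" using k(5) by (cases k) auto
			then have "ht as k' = Suc i" using ht_step[of k' as] k(1,6) la i by simp
			then have "(Suc i, Suc i + k') ~: shape as" unfolding mem_shape_diag by simp
			with k' show ?thesis by simp
		qed
		have "(i, j) : shape as" if "(i, j) : shape bs" for j
		proof (cases "j <= i + k")
			case True
			then show ?thesis using shape_left[OF 1, of j] that by (auto simp: mem_shape)
		next
			case False
			then show ?thesis using shape_left[OF that, of "Suc (i + k)"] 2 by simp
		qed
		then show "b : ?C" using 1 2 3 b k(5) by (auto simp: col_corners_def)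
	}
qed

lemma prod_image_filter:
	assumes "inj_on g {k : {..<N :: nat}. P k}"
	shows "(\<Prod>b\<in>g ` {k : {..<N}. P k}. w) = (\<Prod>k<N. if P k then w else (1 :: 'a::comm_ring_1))"
proof -
	have "(\<Prod>b\<in>g ` {k : {..<N}. P k}. w) = (\<Prod>k\<in>{k : {..<N}. P k}. w)"
		by (subst prod.reindex[OF assms]) simp
	also have "... = (\<Prod>k<N. if P k then w else 1)" by (rule prod.inter_filter) simp
	finally show ?thesis .
qed

text \<open>The start state records whether diagonal 0 gains a box, so for admissible words exactly
  one of the two values of \<open>h\<close> is consistent.\<close>

lemma transfer_start_sum:
	assumes "length as = N" "length bs = N" "\<And>h. T h = (if ht bs 0 = ht as 0 + of_bool h then (\<Prod>k<N. if P k then f k else 0) else (0 :: 'a::comm_ring_1))"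
		and "\<And>k. P k ==> ht as k <= ht bs k & ht bs k <= Suc (ht as k)"
	shows "T False + T True = (if \<forall>k<N. P k then \<Prod>k<N. f k else 0)"
proof (cases "\<forall>k<N. P k")
	case True
	have "ht bs 0 = ht as 0 \<or> ht bs 0 = Suc (ht as 0)"
		using True assms(4)[of 0] assms(1,2) by (cases "N = 0") (auto simp: ht_ge_length le_Suc_eq)
	moreover have "(\<Prod>k<N. if P k then f k else 0) = (\<Prod>k<N. f k)"
		using True by (intro prod.cong) auto
	ultimately show ?thesis using True by (auto simp: assms(3))
next
	case False
	then have "(\<Prod>k<N. if P k then f k else 0) = 0" by (subst prod_if_all) auto
	with False show ?thesis by (auto simp: assms(3))
qed

lemma row_letter_sum:
	assumes la: "length as = N" and lb: "length bs = N" and w: "w = 1 + \<beta> * (x :: 'a::comm_ring_1)"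
	shows "(\<Sum>X\<in>ext_sets False (shape as) (shape bs). \<Prod>b\<in>X. if b : shape as then \<beta> * x else x) =
		transfer (urow w x) lfin (False, False) as bs + transfer (urow w x) lfin (True, False) as bs"
proof -
	have "transfer (urow w x) lfin (False, False) as bs + transfer (urow w x) lfin (True, False) as bs =
		(if \<forall>k<N. row_ok as bs k then \<Prod>k<N. row_val w x as bs False k else 0)"
	proof (rule transfer_start_sum[OF la lb])
		show "transfer (urow w x) lfin (h, False) as bs = (if ht bs 0 = ht as 0 + of_bool h
				then \<Prod>k<N. if row_ok as bs k then row_val w x as bs False k else 0 else 0)" for h
			using la lb by (simp add: transfer_urow)
	qed (auto simp: row_ok_def)
	also have "... = (\<Sum>X\<in>ext_sets False (shape as) (shape bs). \<Prod>b\<in>X. if b : shape as then \<beta> * x else x)"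
	proof (cases "\<forall>k<N. row_ok as bs k")
		case True
		let ?M = "%k. as ! k & \<not> (if k = 0 then False else bs ! (k - 1))"
		have hs: "hstrip (shape as) (shape bs)" using hstrip_iff[OF la lb] True by simp
		have bound: "ht as k <= ht bs k & ht bs k <= Suc (ht as k)" for k
			using True la lb by (cases "k < N") (auto simp: row_ok_def ht_ge_length)
		have C: "row_corners (shape as) (shape bs) <= shape as" by (auto simp: row_corners_def)
		have inj: "inj_on (%k. (ht as k - 1, ht as k - 1 + k)) {k : {..<N}. ?M k}"
			by (rule inj_onI) auto
		have "(\<Sum>X\<in>ext_sets False (shape as) (shape bs). \<Prod>b\<in>X. if b : shape as then \<beta> * x else x) =
			(\<Prod>b\<in>shape bs - shape as. x) * (\<Prod>b\<in>row_corners (shape as) (shape bs). w)"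
			unfolding ext_sets_row if_P[OF hs] w
			by (rule sum_strip_Pow) (use C finite_subset[OF C] in auto)
		also have "... = (\<Prod>k<N. if ht bs k = Suc (ht as k) then x else 1) * (\<Prod>k<N. if ?M k then w else 1)"
			unfolding prod_strip[OF la lb bound] row_corners_image[OF la lb True] prod_image_filter[OF inj] ..
		also have "... = (\<Prod>k<N. row_val w x as bs False k)"
			unfolding prod.distrib[symmetric] using True
			by (intro prod.cong) (auto simp: row_val_def row_ok_def)
		finally show ?thesis using True by simp
	next
		case False
		then have "\<not> hstrip (shape as) (shape bs)" using hstrip_iff[OF la lb] by simp
		then have e: "ext_sets False (shape as) (shape bs) = {}" by (simp add: ext_sets_row)
		show ?thesis unfolding e if_not_P[OF False] by simp
	qed
	finally show ?thesis by simp
qed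

text \<open>A run starting with a moving particle would put a primed letter on the diagonal, so only
  the other start state occurs. The memory True bars an additional primed letter from the diagonal
  corner.\<close>

lemma col_letter_sum:
	assumes la: "length as = N" and lb: "length bs = N" and w: "w = 1 + \<beta> * (x :: 'a::comm_ring_1)"
	shows "(\<Sum>X\<in>ext_sets True (shape as) (shape bs). \<Prod>b\<in>X. if b : shape as then \<beta> * x else x) =
		transfer (ucol w x) lfin (False, True) as bs"
proof -
	have diag: "(\<forall>i. (i, i) : shape bs --> (i, i) : shape as) \<longleftrightarrow> ht bs 0 <= ht as 0"
		using mem_shape_diag[of _ 0] by (simp add: not_less[symmetric]) (metis less_irrefl less_le_trans not_less)
	show ?thesis
	proof (cases "(\<forall>k<N. col_ok as bs k) & ht bs 0 = ht as 0")
		case True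
		let ?M = "%k. ht bs k ~= Suc (ht as k) & as ! k & bs ! k & \<not> (if k = 0 then True else as ! (k - 1))"
		have ok: "\<forall>k<N. col_ok as bs k" using True by simp
		have vs: "vstrip (shape as) (shape bs)" using vstrip_iff[OF la lb] True by simp
		have bound: "ht as k <= ht bs k & ht bs k <= Suc (ht as k)" for k
			using True la lb by (cases "k < N") (auto simp: col_ok_def ht_ge_length)
		have C: "col_corners (shape as) (shape bs) <= shape as" by (auto simp: col_corners_def)
		have inj: "inj_on (%k. (ht as k - 1, ht as k - 1 + k)) {k : {..<N}. ?M k}"
			by (rule inj_onI) auto
		have cond: "vstrip (shape as) (shape bs) & (\<forall>i. (i, i) : shape bs --> (i, i) : shape as)"
			using vs True unfolding diag by simp
		have "(\<Sum>X\<in>ext_sets True (shape as) (shape bs). \<Prod>b\<in>X. if b : shape as then \<beta> * x else x) =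
			(\<Prod>b\<in>shape bs - shape as. x) * (\<Prod>b\<in>col_corners (shape as) (shape bs). w)"
			unfolding ext_sets_col if_P[OF cond] w
			by (rule sum_strip_Pow) (use C finite_subset[OF C] in auto)
		also have "... = (\<Prod>k<N. if ht bs k = Suc (ht as k) then x else 1) * (\<Prod>k<N. if ?M k then w else 1)"
			unfolding prod_strip[OF la lb bound] col_corners_image[OF la lb ok] prod_image_filter[OF inj] ..
		also have "... = (\<Prod>k<N. if col_ok as bs k then col_val w x as bs True k else 0)"
			unfolding prod.distrib[symmetric] using ok
			by (intro prod.cong) (auto simp: col_val_def col_ok_def)
		also have "... = transfer (ucol w x) lfin (False, True) as bs"
			using la lb True by (simp add: transfer_ucol)
		finally show ?thesis .
	next
		case False
		have le: "ht as 0 <= ht bs 0" if "vstrip (shape as) (shape bs)"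
			using that by (auto simp: vstrip_def shape_subset_iff)
		then have "\<not> (vstrip (shape as) (shape bs) & (\<forall>i. (i, i) : shape bs --> (i, i) : shape as))"
			using False unfolding diag vstrip_iff[OF la lb] by auto
		then have e: "ext_sets True (shape as) (shape bs) = {}" by (simp only: ext_sets_col if_False)
		have "(\<Prod>k<N. if col_ok as bs k then col_val w x as bs True k else 0) = 0 \<or> ht bs 0 ~= ht as 0"
			using False by (subst prod_if_all) auto
		then show ?thesis unfolding e using la lb by (auto simp: transfer_ucol)
	qed
qed

subsection \<open>Partitions of strips into bars\<close>

definition interval_partitions :: "nat set => nat set set set" where
	"interval_partitions M = {P. partition_on M P & (\<forall>I\<in>P. \<exists>a b. I = {a..b})}"

text \<open>A partition into intervals is determined by the set of the minima of its blocks.\<close>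

definition block :: "nat set => nat set => nat => nat set" where
	"block M T s = {k : M. s <= k & (\<forall>r\<in>T. r <= k --> r <= s)}"

text \<open>An element whose predecessor is missing from \<open>M\<close> has to start a block;
  every other element may start one or not.\<close>

lemma interval_partitions_eq:
	assumes "finite M"
	shows "bij_betw (%T. block M T ` T) {T. {k : M. k = 0 \<or> k - 1 ~: M} <= T & T <= M} (interval_partitions M)"
		(is "bij_betw ?f ?A ?B")
proof (rule bij_betw_byWitness[where f' = "(`) Min"])
	have min_block: "Min (block M T s) = s" if "T : ?A" "s : T" for T s
		using that assms by (intro Min_eqI) (auto simp: block_def)
	show "\<forall>T\<in>?A. Min ` ?f T = T"
		using min_block by (force simp: image_image)
	show "?f ` ?A <= ?B"
	proof (rule image_subsetI)
		fix T assume T: "T : ?A"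
		have finT: "finite T" using T assms finite_subset by auto
		have cover: "\<exists>s\<in>T. k : block M T s" if "k : M" for k
		proof -
			have "\<exists>s\<in>T. s <= k" using that
			proof (induction k)
				case 0 then show ?case using T by auto
			next
				case (Suc k)
				show ?case
				proof (cases "Suc k : T")
					case False
					then have "k : M" using T Suc.prems by auto
					then show ?thesis using Suc.IH by (meson le_SucI)
				qed auto
			qed
			then have ne: "{s : T. s <= k} ~= {}" "finite {s : T. s <= k}" using finT by auto
			then have "Max {s : T. s <= k} : {s : T. s <= k}" by (intro Max_in)
			moreover have "r <= Max {s : T. s <= k}" if "r : T" "r <= k" for r
				using ne that by (intro Max_ge) auto
			ultimately show ?thesis using that by (intro bexI[of _ "Max {s : T. s <= k}"]) (auto simp: block_def)
		qed
		have "partition_on M (?f T)"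
		proof (rule partition_onI)
			show "\<Union> (?f T) = M" using cover by (auto simp: block_def)
			show "disjnt p q" if pq: "p : ?f T" "q : ?f T" "p ~= q" for p q
			proof -
				obtain r s where rs: "p = block M T r" "q = block M T s" "r : T" "s : T" using pq by auto
				have "r = s" if "k : p" "k : q" for k
					using that rs by (auto simp: block_def intro: order.antisym)
				with rs pq show ?thesis by (auto simp: disjnt_def)
			qed
			have "s : block M T s" if "s : T" for s
				using T that by (auto simp: block_def)
			then show "{} ~: ?f T" by blast
		qed
		moreover have "\<exists>a b. I = {a..b}" if I: "I : ?f T" for I
		proof -
			obtain s where s: "I = block M T s" "s : T" using I by auto
			have finI: "finite I" using s assms by (auto simp: block_def)
			have sI: "s : I" using s T by (auto simp: block_def)
			have down: "k : I ==> k ~= s ==> k - 1 : I" for k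
			proof -
				assume k: "k : I" "k ~= s"
				have "k ~: T" using k s by (auto simp: block_def)
				then have "k ~= 0" "k - 1 : M" using T k s by (auto simp: block_def)
				then show "k - 1 : I" using k s by (auto simp: block_def)
			qed
			have conv: "j : I" if "k : I" "s <= j" "j <= k" for j k
				using that(3,1)
			proof (induction k rule: dec_induct)
				case (step k)
				have "k : I" using down[of "Suc k"] step \<open>s <= j\<close> by auto
				then show ?case using step by simp
			qed simp
			have maxI: "Max I : I" using finI sI by (intro Max_in) auto
			have "I = {s..Max I}"
			proof (intro equalityI subsetI)
				fix k assume k: "k : I"
				have "k <= Max I" by (rule Max_ge[OF finI k])
				moreover have "s <= k" using k unfolding s(1) block_def by simp
				ultimately show "k : {s..Max I}" by simp
			next
				fix k assume "k : {s..Max I}"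
				then show "k : I" using conv[OF maxI, of k] by simp
			qed
			then show ?thesis by blast
		qed
		ultimately show "?f T : ?B" by (auto simp: interval_partitions_def)
	qed
	show "(`) Min ` ?B <= ?A"
	proof (rule image_subsetI)
		fix P assume P: "P : ?B"
		have sub: "I <= M" "I ~= {}" "finite I" if "I : P" for I
			using P that assms finite_subset[of I M] by (auto simp: interval_partitions_def partition_on_def)
		have "k : Min ` P" if k: "k : M" "k = 0 \<or> k - 1 ~: M" for k
		proof -
			obtain I where I: "I : P" "k : I" using P k by (auto simp: interval_partitions_def partition_on_def)
			obtain a b where ab: "I = {a..b}" using P I unfolding interval_partitions_def by blast
			have "a = k"
			proof (rule ccontr)
				assume "a ~= k"
				then have "k - 1 : I" "k ~= 0" using I ab by auto
				then show False using sub(1)[OF I(1)] k by auto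
			qed
			then have "Min I = k" using I ab by (intro Min_eqI) auto
			then show ?thesis using I by auto
		qed
		moreover have "Min I : M" if "I : P" for I
			using sub[OF that] Min_in by blast
		ultimately show "Min ` P : ?A" by auto
	qed
	show "\<forall>P\<in>?B. ?f (Min ` P) = P"
	proof
		fix P assume P: "P : ?B"
		have sub: "I <= M" "I ~= {}" "finite I" if "I : P" for I
			using P that assms finite_subset[of I M] by (auto simp: interval_partitions_def partition_on_def)
		have disj: "I = J" if "I : P" "J : P" "k : I" "k : J" for I J k
			using P that by (auto simp: interval_partitions_def partition_on_def disjoint_def)
		have "block M (Min ` P) (Min I) = I" if I: "I : P" for I
		proof (intro equalityI subsetI)
			fix k assume k: "k : I"
			have "Min J <= Min I" if J: "J : P" "Min J <= k" for J
			proof (rule ccontr)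
				assume n: "\<not> Min J <= Min I"
				obtain a b where ab: "I = {a..b}" using P I unfolding interval_partitions_def by blast
				have "Min I : I" using sub[OF I] by simp
				then have "Min J : I" using n J k ab by auto
				moreover have "Min J : J" using sub[OF J(1)] by simp
				ultimately have "I = J" using disj I J by blast
				with n show False by simp
			qed
			then show "k : block M (Min ` P) (Min I)"
				using k sub[OF I] by (auto simp: block_def)
		next
			fix k assume k: "k : block M (Min ` P) (Min I)"
			then obtain J where J: "J : P" "k : J" using P by (auto simp: block_def interval_partitions_def partition_on_def)
			have "Min J <= Min I" using k J sub[OF J(1)] by (auto simp: block_def)
			moreover have "Min I <= k" using k by (auto simp: block_def)
			moreover obtain a b where ab: "J = {a..b}" using P J unfolding interval_partitions_def by blast
			moreover have "Min J : J" using sub[OF J(1)] by simp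
			ultimately have "Min I : J" using J by auto
			moreover have "Min I : I" using sub[OF I] by simp
			ultimately have "I = J" using disj I J by blast
			with J show "k : I" by simp
		qed
		then show "?f (Min ` P) = P" by (force simp: image_image)
	qed
qed

lemma partition_weight:
	assumes "finite S" "partition_on S P"
	shows "(\<Prod>B\<in>P. t * v ^ (card B - 1)) = t ^ card P * (v :: 'a::comm_ring_1) ^ (card S - card P)"
proof -
	have fin: "finite P" using assms finite_elements by blast
	have c: "card B > 0" if "B : P" for B
		using assms that by (metis card_gt_0_iff partition_on_def finite_subset Union_upper)
	have "card S = (\<Sum>B\<in>P. card B)"
		using assms by (metis card_Union_disjoint finite_subset Union_upper partition_on_def disjoint_def pairwise_def disjnt_def)
	also have "... = (\<Sum>B\<in>P. (card B - 1) + 1)" using c by (intro sum.cong) auto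
	also have "... = (\<Sum>B\<in>P. card B - 1) + card P" unfolding sum.distrib by simp
	finally have "(\<Sum>B\<in>P. card B - 1) = card S - card P" by simp
	moreover have "(\<Prod>B\<in>P. t * v ^ (card B - 1)) = t ^ card P * v ^ (\<Sum>B\<in>P. card B - 1)"
		by (simp add: prod.distrib power_sum)
	ultimately show ?thesis by simp
qed

text \<open>An element that continues a run of \<open>M\<close> either opens a block, with weight
  \<open>t\<close>, or extends the previous one, with weight \<open>v\<close>, independently of the
  other elements.\<close>

lemma sum_interval_partitions:
	assumes "finite M"
	shows "(\<Sum>P\<in>interval_partitions M. \<Prod>B\<in>P. t * v ^ (card B - 1)) =
		(\<Prod>k\<in>M. if k = 0 \<or> k - 1 ~: M then t else t + (v :: 'a::comm_ring_1))"
proof -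
	define F where "F = {k : M. k = 0 \<or> k - 1 ~: M}"
	have F: "F <= M" "finite F" using assms by (auto simp: F_def)
	have "(\<Sum>P\<in>interval_partitions M. \<Prod>B\<in>P. t * v ^ (card B - 1)) =
		(\<Sum>P\<in>interval_partitions M. t ^ card P * v ^ (card M - card P))"
		using assms by (intro sum.cong partition_weight) (auto simp: interval_partitions_def)
	also have "... = (\<Sum>T\<in>{T. F <= T & T <= M}. t ^ card (block M T ` T) * v ^ (card M - card (block M T ` T)))"
		using interval_partitions_eq[OF assms] unfolding F_def
		by (rule sum.reindex_bij_betw[symmetric])
	also have "... = (\<Sum>T\<in>{T. F <= T & T <= M}. t ^ card T * v ^ (card M - card T))"
	proof (rule sum.cong[OF refl])
		fix T assume T: "T : {T. F <= T & T <= M}"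
		have "inj_on (block M T) T"
		proof (rule inj_onI)
			fix r s assume rs: "r : T" "s : T" "block M T r = block M T s"
			then have "r : block M T s" "s : block M T r" using T by (auto simp: block_def)
			then show "r = s" by (auto simp: block_def)
		qed
		then show "t ^ card (block M T ` T) * v ^ (card M - card (block M T ` T)) = t ^ card T * v ^ (card M - card T)"
			by (simp add: card_image)
	qed
	also have "... = (\<Sum>Y\<in>Pow (M - F). t ^ card F * ((\<Prod>k\<in>Y. v) * (\<Prod>k\<in>(M - F) - Y. t)))"
	proof (rule sum.reindex_bij_witness[where i = "%Y. M - Y" and j = "%T. M - T"])
		fix T assume T: "T : {T. F <= T & T <= M}"
		have fT: "finite T" using T assms finite_subset by auto
		have "(M - F) - (M - T) = T - F" using T by auto
		moreover have "card T = card F + card (T - F)"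
			using T F fT by (metis card_Diff_subset card_mono le_add_diff_inverse mem_Collect_eq)
		moreover have "card (M - T) = card M - card T" using T fT by (simp add: card_Diff_subset)
		ultimately show "t ^ card F * ((\<Prod>k\<in>M - T. v) * (\<Prod>k\<in>(M - F) - (M - T). t)) = t ^ card T * v ^ (card M - card T)"
			by (simp add: power_add mult_ac)
	qed (use F in auto)
	also have "... = t ^ card F * (\<Prod>k\<in>M - F. v + t)"
		using assms by (subst prod_add) (auto simp: sum_distrib_left)
	also have "... = (\<Prod>k\<in>F. t) * (\<Prod>k\<in>M - F. t + v)" by (simp add: add.commute)
	also have "... = (\<Prod>k\<in>F. if k : F then t else t + v) * (\<Prod>k\<in>M - F. if k : F then t else t + v)"
		by (intro arg_cong2[where f = "(*)"] prod.cong) auto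
	also have "... = (\<Prod>k\<in>M. if k : F then t else t + v)"
		using F assms by (simp add: prod.subset_diff[of F M] mult.commute)
	also have "... = (\<Prod>k\<in>M. if k = 0 \<or> k - 1 ~: M then t else t + v)"
		by (intro prod.cong) (auto simp: F_def)
	finally show ?thesis .
qed

definition bars :: "(nat \<times> nat) set => (nat \<times> nat) set set set" where
	"bars S = {P. partition_on S P & (\<forall>B\<in>P. \<exists>i a b. B = {i} \<times> {a..b} \<or> B = {a..b} \<times> {i})}"

lemma partition_on_image:
	assumes "inj_on g M" "partition_on M Q"
	shows "partition_on (g ` M) ((`) g ` Q)"
proof (rule partition_onI)
	have sub: "I <= M" if "I : Q" for I using partition_onD1[OF assms(2)] that by blast
	show "\<Union> ((`) g ` Q) = g ` M" unfolding partition_onD1[OF assms(2)] by blast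
	show "{} ~: (`) g ` Q" using partition_onD3[OF assms(2)] by blast
	fix p q assume "p : (`) g ` Q" "q : (`) g ` Q" "p ~= q"
	then obtain I J where IJ: "p = g ` I" "q = g ` J" "I : Q" "J : Q" "I ~= J" by auto
	then have "I \<inter> J = {}" using partition_onD2[OF assms(2)] by (auto dest: disjointD)
	moreover have "g ` (I \<inter> J) = g ` I \<inter> g ` J"
		by (rule inj_on_image_Int[OF assms(1)]) (use sub IJ in auto)
	ultimately show "disjnt p q" unfolding IJ disjnt_def by simp
qed

text \<open>Bars in a strip become intervals of diagonals. The hypothesis \<open>iff\<close> is
  where the geometry of horizontal or vertical strips enters.\<close>

lemma sum_bars_transport:
	fixes g :: "nat => nat \<times> nat"
	assumes inj: "inj_on g M" and fin: "finite M"
		and iff: "\<And>I. I <= M ==> I ~= {} ==> (\<exists>a b. I = {a..b}) \<longleftrightarrow> (\<exists>i a b. g ` I = {i} \<times> {a..b} \<or> g ` I = {a..b} \<times> {i})"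
	shows "(\<Sum>P\<in>bars (g ` M). \<Prod>B\<in>P. t * v ^ (card B - 1)) =
		(\<Prod>k\<in>M. if k = 0 \<or> k - 1 ~: M then t else t + (v :: 'a::comm_ring_1))"
proof -
	define g' where "g' = the_inv_into M g"
	have g'g: "g' (g k) = k" if "k : M" for k using inj that by (simp add: g'_def the_inv_into_f_f)
	have inj': "inj_on g' (g ` M)" unfolding g'_def by (rule inj_on_the_inv_into[OF inj])
	have img': "g' ` g ` I = I" if I: "I <= M" for I
	proof -
		have "(%k. g' (g k)) ` I = (%k. k) ` I" by (rule image_cong[OF refl]) (use g'g I in blast)
		then show ?thesis unfolding image_image by simp
	qed
	have img: "g ` g' ` B = B" if B: "B <= g ` M" for B
	proof -
		have "(%b. g (g' b)) ` B = (%b. b) ` B"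
		proof (rule image_cong[OF refl])
			fix b assume "b : B"
			then obtain k where "k : M" "b = g k" using B by blast
			then show "g (g' b) = b" using g'g by simp
		qed
		then show ?thesis unfolding image_image by simp
	qed
	have subQ: "I <= M & I ~= {}" if "Q : interval_partitions M" "I : Q" for Q I
		using that by (auto simp: interval_partitions_def partition_on_def)
	have subP: "B <= g ` M & B ~= {}" if "P : bars (g ` M)" "B : P" for P B
		using that by (auto simp: bars_def partition_on_def)
	have "bij_betw ((`) ((`) g)) (interval_partitions M) (bars (g ` M))"
	proof (rule bij_betw_byWitness[where f' = "(`) ((`) g')"])
		show "\<forall>Q\<in>interval_partitions M. (`) g' ` (`) g ` Q = Q"
		proof
			fix Q assume Q: "Q : interval_partitions M"
			have "(`) g' ` (`) g ` Q = (%I. I) ` Q"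
				unfolding image_image[of "(`) g'"] by (rule image_cong[OF refl], rule img') (use subQ[OF Q] in simp)
			then show "(`) g' ` (`) g ` Q = Q" by (simp only: image_ident)
		qed
		show "\<forall>P\<in>bars (g ` M). (`) g ` (`) g' ` P = P"
		proof
			fix P assume P: "P : bars (g ` M)"
			have "(`) g ` (`) g' ` P = (%I. I) ` P"
				unfolding image_image[of "(`) g"] by (rule image_cong[OF refl], rule img) (use subP[OF P] in simp)
			then show "(`) g ` (`) g' ` P = P" by (simp only: image_ident)
		qed
		show "(`) ((`) g) ` interval_partitions M <= bars (g ` M)"
		proof (rule image_subsetI)
			fix Q assume Q: "Q : interval_partitions M"
			have "\<exists>i a b. g ` I = {i} \<times> {a..b} \<or> g ` I = {a..b} \<times> {i}" if I: "I : Q" for I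
			proof -
				have "\<exists>a b. I = {a..b}" using Q I unfolding interval_partitions_def by blast
				then show ?thesis using iff[of I] subQ[OF Q I] by blast
			qed
			moreover have "partition_on (g ` M) ((`) g ` Q)"
				by (rule partition_on_image[OF inj]) (use Q in \<open>simp add: interval_partitions_def\<close>)
			ultimately show "(`) g ` Q : bars (g ` M)"
				unfolding bars_def by simp
		qed
		show "(`) ((`) g') ` bars (g ` M) <= interval_partitions M"
		proof (rule image_subsetI)
			fix P assume P: "P : bars (g ` M)"
			have "\<exists>a b. g' ` B = {a..b}" if B: "B : P" for B
			proof -
				have "g' ` B <= M" "g' ` B ~= {}" "g ` g' ` B = B"
				proof -
					have "g' ` B <= g' ` g ` M" by (rule image_mono) (use subP[OF P B] in simp)
					then show "g' ` B <= M" unfolding img'[OF subset_refl] .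
					show "g' ` B ~= {}" using subP[OF P B] by simp
					show "g ` g' ` B = B" by (rule img) (use subP[OF P B] in simp)
				qed
				moreover have "\<exists>i a b. B = {i} \<times> {a..b} \<or> B = {a..b} \<times> {i}"
					using P B by (simp add: bars_def)
				ultimately show ?thesis using iff[of "g' ` B"] by simp
			qed
			moreover have "partition_on M ((`) g' ` P)"
				using partition_on_image[OF inj', of P] P unfolding bars_def img'[OF subset_refl] by simp
			ultimately show "(`) g' ` P : interval_partitions M"
				unfolding interval_partitions_def by simp
		qed
	qed
	then have "(\<Sum>P\<in>bars (g ` M). \<Prod>B\<in>P. t * v ^ (card B - 1)) =
			(\<Sum>Q\<in>interval_partitions M. \<Prod>B\<in>(`) g ` Q. t * v ^ (card B - 1))"
		by (rule sum.reindex_bij_betw[symmetric])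
	also have "... = (\<Sum>Q\<in>interval_partitions M. \<Prod>I\<in>Q. t * v ^ (card I - 1))"
	proof (rule sum.cong[OF refl])
		fix Q assume Q: "Q : interval_partitions M"
		have "inj_on ((`) g) Q"
		proof (rule inj_onI)
			fix I J assume "I : Q" "J : Q" "g ` I = g ` J"
			then show "I = J" using inj_on_image_eq_iff[OF inj, of I J] subQ[OF Q] by simp
		qed
		then have "(\<Prod>B\<in>(`) g ` Q. t * v ^ (card B - 1)) = (\<Prod>I\<in>Q. t * v ^ (card (g ` I) - 1))"
			by (simp add: prod.reindex)
		also have "... = (\<Prod>I\<in>Q. t * v ^ (card I - 1))"
		proof (rule prod.cong[OF refl])
			fix I assume "I : Q"
			then have "inj_on g I" using inj subQ[OF Q] inj_on_subset by blast
			then show "t * v ^ (card (g ` I) - 1) = t * v ^ (card I - 1)" by (simp add: card_image)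
		qed
		finally show "(\<Prod>B\<in>(`) g ` Q. t * v ^ (card B - 1)) = (\<Prod>I\<in>Q. t * v ^ (card I - 1))" .
	qed
	also have "... = (\<Prod>k\<in>M. if k = 0 \<or> k - 1 ~: M then t else t + v)"
		by (rule sum_interval_partitions[OF fin])
	finally show ?thesis .
qed

context
	fixes as bs :: "bool list" and N
	assumes la: "length as = N" and lb: "length bs = N"
begin

abbreviation (input) moved :: "nat set" where
	"moved \<equiv> {k : {..<N}. ht bs k = Suc (ht as k)}"

abbreviation (input) box :: "nat => nat \<times> nat" where
	"box k \<equiv> (ht as k, ht as k + k)"

lemma strip_eq_image:
	assumes "\<And>k. ht as k <= ht bs k & ht bs k <= Suc (ht as k)"
	shows "shape bs - shape as = box ` moved"
proof (intro equalityI subsetI)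
	fix b assume "b : shape bs - shape as"
	then obtain i p where b: "b = (i, i + p)" "ht as p <= i" "i < ht bs p"
		by (auto simp: shape_def)
	have "i = ht as p" "ht bs p = Suc (ht as p)" using b assms[of p] by auto
	moreover have "p < N" using b lb ht_ge_length[of bs p] by (cases "p < N") auto
	ultimately show "b : box ` moved"
		using b(1) by (intro image_eqI[of _ _ p]) auto
qed auto

lemma inj_box: "inj_on box A"
	by (rule inj_onI) auto

text \<open>Consecutive gaining diagonals of a horizontal strip lie in one row, because
  \<open>as ! k\<close> is false where a box is gained. Conversely, a vertical bar inside such a
  strip is a single box.\<close>

lemma row_interval_iff:
	assumes ok: "\<forall>k<N. row_ok as bs k" and I: "I <= moved" "I ~= {}"
	shows "(\<exists>a b. I = {a..b}) \<longleftrightarrow> (\<exists>i a b. box ` I = {i} \<times> {a..b} \<or> box ` I = {a..b} \<times> {i})"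
proof
	assume "\<exists>a b. I = {a..b}"
	then obtain a b where ab: "I = {a..b}" by blast
	have c: "ht as k = ht as a" if "a <= k" "k <= b" for k
		using that
	proof (induction k rule: dec_induct)
		case (step k)
		then have "k : I" using ab by auto
		then have "k < N" "ht bs k = Suc (ht as k)" using subsetD[OF I(1)] by auto
		then have "k < N" "\<not> as ! k" using ok by (auto simp: row_ok_def)
		then show ?case using step ht_step[of k as] la by simp
	qed simp
	have "box k = (ht as a, ht as a + k)" if "k : {a..b}" for k
		using c[of k] that by simp
	then have "box ` I = (%k. (ht as a, ht as a + k)) ` {a..b}"
		unfolding ab by (rule image_cong[OF refl])
	also have "... = {ht as a} \<times> (+) (ht as a) ` {a..b}" by blast
	also have "... = {ht as a} \<times> {ht as a + a..ht as a + b}" by (simp add: add.commute)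
	finally show "\<exists>i a b. box ` I = {i} \<times> {a..b} \<or> box ` I = {a..b} \<times> {i}" by blast
next
	assume "\<exists>i a b. box ` I = {i} \<times> {a..b} \<or> box ` I = {a..b} \<times> {i}"
	then obtain i a b where B: "box ` I = {i} \<times> {a..b} \<or> box ` I = {a..b} \<times> {i}" by blast
	have hs: "hstrip (shape as) (shape bs)" using hstrip_iff[OF la lb] ok by simp
	have bound: "ht as k <= ht bs k & ht bs k <= Suc (ht as k)" for k
		using ok la lb by (cases "k < N") (auto simp: row_ok_def ht_ge_length)
	have sub: "box ` I <= shape bs - shape as" unfolding strip_eq_image[OF bound] using I by auto
	have B': "\<exists>i a b. box ` I = {i} \<times> {a..b}"
		using B
	proof
		assume col: "box ` I = {a..b} \<times> {i}"
		have "a <= b"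
		proof (rule ccontr)
			assume "\<not> a <= b"
			then have "box ` I = {}" unfolding col by simp
			with I(2) show False by simp
		qed
		have "a = b"
		proof (rule ccontr)
			assume "a ~= b"
			have "(a, i) : box ` I" "(b, i) : box ` I" using col \<open>a <= b\<close> by auto
			with sub hs \<open>a ~= b\<close> show False unfolding hstrip_def by blast
		qed
		then have "box ` I = {a} \<times> {i..i}" using col by auto
		then show ?thesis by blast
	qed blast
	then obtain i a b where row: "box ` I = {i} \<times> {a..b}" by blast
	have "I = {a - i..b - i}"
	proof (intro equalityI subsetI)
		fix k assume "k : I"
		then have "box k : {i} \<times> {a..b}" unfolding row[symmetric] by blast
		then show "k : {a - i..b - i}" by auto
	next
		fix k assume k: "k : {a - i..b - i}"
		have "a <= b"
		proof (rule ccontr)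
			assume "\<not> a <= b"
			then have "box ` I = {}" unfolding row by simp
			with I(2) show False by simp
		qed
		then have "(i, a) : box ` I" unfolding row by simp
		then have "i <= a" by auto
		have "(i, i + k) : {i} \<times> {a..b}" using k \<open>i <= a\<close> \<open>a <= b\<close> by auto
		then have "(i, i + k) : box ` I" unfolding row .
		then show "k : I" by auto
	qed
	then show "\<exists>a b. I = {a..b}" by blast
qed

text \<open>In a vertical strip the column \<open>ht as k + k\<close> of the gained box is constant
  along a run of diagonals. Going to the next diagonal means going up, so the interval of rows is
  reversed.\<close>

lemma col_interval_iff:
	assumes ok: "\<forall>k<N. col_ok as bs k" and I: "I <= moved" "I ~= {}"
	shows "(\<exists>a b. I = {a..b}) \<longleftrightarrow> (\<exists>i a b. box ` I = {i} \<times> {a..b} \<or> box ` I = {a..b} \<times> {i})"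
proof
	assume "\<exists>a b. I = {a..b}"
	then obtain a b where ab: "I = {a..b}" by blast
	have c: "ht as k + k = ht as a + a" if "a <= k" "k <= b" for k
		using that
	proof (induction k rule: dec_induct)
		case (step k)
		then have "k : I" "Suc k : I" using ab by auto
		then have k: "k < N" "ht bs k = Suc (ht as k)" "ht bs (Suc k) = Suc (ht as (Suc k))"
			using subsetD[OF I(1)] by auto
		then have "bs ! k" using ok by (auto simp: col_ok_def)
		with k have "ht as k = Suc (ht as (Suc k))" using ht_step[of k bs] lb by simp
		then show ?case using step by simp
	qed simp
	define e where "e = ht as a + a"
	have bc: "b <= e" if "a <= b" using c[of b] that unfolding e_def by linarith
	have "box k = (e - k, e)" if "k : {a..b}" for k
		using c[of k] that unfolding e_def by auto
	then have "box ` I = (%k. (e - k, e)) ` {a..b}"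
		unfolding ab by (rule image_cong[OF refl])
	also have "... = (-) e ` {a..b} \<times> {e}" by blast
	also have "(-) e ` {a..b} = {e - b..e - a}"
	proof (intro equalityI subsetI)
		fix i assume i: "i : {e - b..e - a}"
		have "a <= b" using I(2) ab by auto
		then show "i : (-) e ` {a..b}" using i bc by (intro image_eqI[of _ _ "e - i"]) auto
	qed auto
	finally show "\<exists>i a b. box ` I = {i} \<times> {a..b} \<or> box ` I = {a..b} \<times> {i}" by blast
next
	assume "\<exists>i a b. box ` I = {i} \<times> {a..b} \<or> box ` I = {a..b} \<times> {i}"
	then obtain i a b where B: "box ` I = {i} \<times> {a..b} \<or> box ` I = {a..b} \<times> {i}" by blast
	have vs: "vstrip (shape as) (shape bs)" using vstrip_iff[OF la lb] ok by simp
	have bound: "ht as k <= ht bs k & ht bs k <= Suc (ht as k)" for k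
		using ok la lb by (cases "k < N") (auto simp: col_ok_def ht_ge_length)
	have sub: "box ` I <= shape bs - shape as" unfolding strip_eq_image[OF bound] using I by auto
	have B': "\<exists>i a b. box ` I = {a..b} \<times> {i}"
		using B
	proof
		assume row: "box ` I = {i} \<times> {a..b}"
		have "a <= b"
		proof (rule ccontr)
			assume "\<not> a <= b"
			then have "box ` I = {}" unfolding row by simp
			with I(2) show False by simp
		qed
		have "a = b"
		proof (rule ccontr)
			assume "a ~= b"
			have "(i, a) : box ` I" "(i, b) : box ` I" using row \<open>a <= b\<close> by auto
			with sub vs \<open>a ~= b\<close> show False unfolding vstrip_def by blast
		qed
		then have "box ` I = {i..i} \<times> {a}" using row by auto
		then show ?thesis by blast
	qed blast
	then obtain i a b where col: "box ` I = {a..b} \<times> {i}" by blast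
	have "I = {i - b..i - a}"
	proof (intro equalityI subsetI)
		fix k assume "k : I"
		then have "box k : {a..b} \<times> {i}" unfolding col[symmetric] by blast
		then show "k : {i - b..i - a}" by auto
	next
		fix k assume k: "k : {i - b..i - a}"
		have "a <= b"
		proof (rule ccontr)
			assume "\<not> a <= b"
			then have "box ` I = {}" unfolding col by simp
			with I(2) show False by simp
		qed
		then have "(b, i) : box ` I" unfolding col by simp
		then have "b <= i" by auto
		have "(i - k, i) : {a..b} \<times> {i}" using k \<open>b <= i\<close> \<open>a <= b\<close> by auto
		then have "(i - k, i) : box ` I" unfolding col .
		then obtain l where l: "l : I" "i - k = ht as l" "i = ht as l + l" by blast
		moreover have "k <= i" using k by auto
		ultimately have "l = k" by linarith
		with l show "k : I" by simp
	qed
	then show "\<exists>a b. I = {a..b}" by blast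
qed

lemma prod_moved:
	"(\<Prod>k\<in>moved. if k = 0 \<or> k - 1 ~: moved then t else u) = (\<Prod>k<N. dval u t as bs False k)"
proof -
	have "(\<Prod>k\<in>moved. if k = 0 \<or> k - 1 ~: moved then t else u) =
		(\<Prod>k<N. if ht bs k = Suc (ht as k) then (if k = 0 \<or> k - 1 ~: moved then t else u) else 1)"
		by (rule prod.inter_filter) simp
	also have "... = (\<Prod>k<N. dval u t as bs False k)"
		by (rule prod.cong) (auto simp: dval_def)
	finally show ?thesis .
qed

text \<open>For \<open>v = - \<beta>\<close> the weight \<open>t + v\<close> of a continuing box is
  the \<open>u = t - \<beta>\<close> of \<open>exchange_relations\<close>.\<close>

lemma row_bars_sum:
	fixes t v :: "'a::comm_ring_1"
	shows "(if hstrip (shape as) (shape bs) then \<Sum>P\<in>bars (shape bs - shape as). \<Prod>B\<in>P. t * v ^ (card B - 1) else 0) =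
		transfer (drow (t + v) t) lfin (False, False) as bs + transfer (drow (t + v) t) lfin (True, False) as bs"
proof -
	have "transfer (drow (t + v) t) lfin (False, False) as bs + transfer (drow (t + v) t) lfin (True, False) as bs =
		(if \<forall>k<N. row_ok as bs k then \<Prod>k<N. dval (t + v) t as bs False k else 0)"
	proof (rule transfer_start_sum[OF la lb])
		show "transfer (drow (t + v) t) lfin (h, False) as bs = (if ht bs 0 = ht as 0 + of_bool h
				then \<Prod>k<N. if row_ok as bs k then dval (t + v) t as bs False k else 0 else 0)" for h
			using la lb by (simp add: transfer_drow)
	qed (auto simp: row_ok_def)
	also have "... = (if hstrip (shape as) (shape bs) then \<Sum>P\<in>bars (shape bs - shape as). \<Prod>B\<in>P. t * v ^ (card B - 1) else 0)"
	proof (cases "\<forall>k<N. row_ok as bs k")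
		case True
		have bound: "ht as k <= ht bs k & ht bs k <= Suc (ht as k)" for k
			using True la lb by (cases "k < N") (auto simp: row_ok_def ht_ge_length)
		have "(\<Sum>P\<in>bars (shape bs - shape as). \<Prod>B\<in>P. t * v ^ (card B - 1)) =
				(\<Prod>k\<in>moved. if k = 0 \<or> k - 1 ~: moved then t else t + v)"
			unfolding strip_eq_image[OF bound]
			by (rule sum_bars_transport[OF inj_box _ row_interval_iff[OF True]]) simp_all
		also have "... = (\<Prod>k<N. dval (t + v) t as bs False k)" by (rule prod_moved)
		finally show ?thesis using True hstrip_iff[OF la lb] by simp
	next
		case False
		then have "\<not> hstrip (shape as) (shape bs)" using hstrip_iff[OF la lb] by simp
		then show ?thesis unfolding if_not_P[OF False] by simp
	qed
	finally show ?thesis by simp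
qed

lemma col_bars_sum:
	fixes t v :: "'a::comm_ring_1"
	shows "(if vstrip (shape as) (shape bs) then \<Sum>P\<in>bars (shape bs - shape as). \<Prod>B\<in>P. t * v ^ (card B - 1) else 0) =
		transfer (dcol (t + v) t) lfin (False, False) as bs + transfer (dcol (t + v) t) lfin (True, False) as bs"
proof -
	have "transfer (dcol (t + v) t) lfin (False, False) as bs + transfer (dcol (t + v) t) lfin (True, False) as bs =
		(if \<forall>k<N. col_ok as bs k then \<Prod>k<N. dval (t + v) t as bs False k else 0)"
	proof (rule transfer_start_sum[OF la lb])
		show "transfer (dcol (t + v) t) lfin (h, False) as bs = (if ht bs 0 = ht as 0 + of_bool h
				then \<Prod>k<N. if col_ok as bs k then dval (t + v) t as bs False k else 0 else 0)" for h
			using la lb by (simp add: transfer_dcol)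
	qed (auto simp: col_ok_def)
	also have "... = (if vstrip (shape as) (shape bs) then \<Sum>P\<in>bars (shape bs - shape as). \<Prod>B\<in>P. t * v ^ (card B - 1) else 0)"
	proof (cases "\<forall>k<N. col_ok as bs k")
		case True
		have bound: "ht as k <= ht bs k & ht bs k <= Suc (ht as k)" for k
			using True la lb by (cases "k < N") (auto simp: col_ok_def ht_ge_length)
		have "(\<Sum>P\<in>bars (shape bs - shape as). \<Prod>B\<in>P. t * v ^ (card B - 1)) =
				(\<Prod>k\<in>moved. if k = 0 \<or> k - 1 ~: moved then t else t + v)"
			unfolding strip_eq_image[OF bound]
			by (rule sum_bars_transport[OF inj_box _ col_interval_iff[OF True]]) simp_all
		also have "... = (\<Prod>k<N. dval (t + v) t as bs False k)" by (rule prod_moved)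
		finally show ?thesis using True vstrip_iff[OF la lb] by simp
	next
		case False
		then have "\<not> vstrip (shape as) (shape bs)" using vstrip_iff[OF la lb] by simp
		then show ?thesis unfolding if_not_P[OF False] by simp
	qed
	finally show ?thesis by simp
qed

end

section \<open>Strict partitions\<close>

abbreviation Strict :: "nat list set" where
	"Strict \<equiv> {lam. strict_partition lam}"

text \<open>Site \<open>k\<close> stands for the part \<open>k + 1\<close>. On strict partitions
  with all parts at most \<open>N\<close> the encoding is injective
  (\<open>word_inj\<close>).\<close>

definition word :: "nat => nat list => bool list" where
	"word N lam = map (%k. Suc k : set lam) [0..<N]"

lemma length_word [simp]: "length (word N lam) = N"
	by (simp add: word_def)

lemma word_in_words [simp]: "word N lam : words N"
	by (simp add: words_def)

text \<open>The parts larger than \<open>p\<close> form an initial segment of the list, and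
  strictness makes counting them as a set the same as counting positions.\<close>

lemma nth_strict_iff:
	fixes lam :: "nat list"
	assumes "sorted_wrt (>) lam"
	shows "i < length lam & p < lam ! i \<longleftrightarrow> i < card {a : set lam. p < a}"
	using assms
proof (induction lam arbitrary: i)
	case (Cons x xs)
	have set_eq: "{a : set (x # xs). p < a} = (if p < x then insert x {a : set xs. p < a} else {a : set xs. p < a})"
		by auto
	have less: "y < x" if "y : set xs" for y using Cons.prems that by simp
	have "x ~: set xs" using less[of x] by auto
	then have c: "card {a : set (x # xs). p < a} = of_bool (p < x) + card {a : set xs. p < a}"
		unfolding set_eq by simp
	have z: "card {a : set xs. p < a} = 0" if n: "\<not> p < x"
	proof -
		have "\<not> p < a" if "a : set xs" for a using less[OF that] n by simp
		then have "{a : set xs. p < a} = {}" by blast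
		then show ?thesis by simp
	qed
	show ?case
	proof (cases i)
		case 0 then show ?thesis unfolding c using z by (cases "p < x") auto
	next
		case (Suc j)
		have "j < length xs & p < xs ! j \<longleftrightarrow> j < card {a : set xs. p < a}"
			using Cons.IH[of j] Cons.prems by simp
		note IH = this
		show ?thesis
		proof (cases "p < x")
			case True
			then show ?thesis unfolding c Suc using IH by simp
		next
			case False
			have "\<not> (j < length xs & p < xs ! j)" using IH unfolding z[OF False] by simp
			then show ?thesis unfolding c Suc z[OF False] using False by simp
		qed
	qed
qed simp

lemma ht_word:
	assumes "\<forall>p\<in>set lam. p <= N"
	shows "ht (word N lam) p = card {a : set lam. p < a}"
proof (cases "p <= N")
	case True
	then show ?thesis
	proof (induction p rule: inc_induct)
		case base
		have "{a : set lam. N < a} = {}" using assms by force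
		then show ?case by (simp add: ht_ge_length)
	next
		case (step p)
		have "{a : set lam. p < a} = (if Suc p : set lam then insert (Suc p) {a : set lam. Suc p < a} else {a : set lam. Suc p < a})"
		proof -
			have "p < a \<longleftrightarrow> a = Suc p \<or> Suc p < a" for a by arith
			then show ?thesis by auto
		qed
		then have "card {a : set lam. p < a} = card {a : set lam. Suc p < a} + of_bool (Suc p : set lam)"
			by simp
		then show ?case using step ht_step[of p "word N lam"] by (simp add: word_def)
	qed
next
	case False
	then have "{a : set lam. p < a} = {}" using assms by force
	then have "card {a : set lam. p < a} = 0" by simp
	then show ?thesis using False by (simp add: ht_ge_length)
qed

lemma SD_word:
	assumes "strict_partition lam" "\<forall>p\<in>set lam. p <= N"
	shows "SD lam = shape (word N lam)"
	using nth_strict_iff[of lam] assms unfolding SD_def shape_def strict_partition_def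
	by (simp add: ht_word)

lemma parts_le: "p : set lam ==> p <= sz (lam :: nat list)"
	by (simp add: member_le_sum_list)

lemma SD_word_sum:
	assumes "strict_partition lam" "sz lam <= N"
	shows "SD lam = shape (word N lam)"
	using assms parts_le by (intro SD_word) (auto intro: order_trans)

lemma card_SD: "card (SD lam) = sz lam"
proof -
	have "SD lam = (%(i, j). (i, i + j)) ` (SIGMA i:{..<length lam}. {..<lam ! i})"
	proof (intro equalityI subsetI)
		fix b assume "b : SD lam"
		then obtain i j where "b = (i, i + j)" "i < length lam" "j < lam ! i" unfolding SD_def by blast
		then show "b : (%(i, j). (i, i + j)) ` (SIGMA i:{..<length lam}. {..<lam ! i})"
			by (intro image_eqI[of _ _ "(i, j)"]) auto
	qed (auto simp: SD_def)
	moreover have "inj_on (%(i, j). (i, i + j :: nat)) (SIGMA i:{..<length lam}. {..<lam ! i})"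
		by (rule inj_onI) auto
	ultimately have "card (SD lam) = (\<Sum>i<length lam. lam ! i)" by (simp add: card_image)
	then show ?thesis by (simp add: sum_list_sum_nth atLeast0LessThan)
qed

lemma strict_eqI:
	assumes "strict_partition lam" "strict_partition mu" "set lam = set mu"
	shows "lam = mu"
proof -
	have "sorted_wrt (<) (rev lam)" "sorted_wrt (<) (rev mu)"
		using assms by (simp_all add: strict_partition_def sorted_wrt_rev)
	then have "rev lam = rev mu" using assms(3) by (intro strict_sorted_equal) auto
	then show ?thesis by simp
qed

lemma word_inj:
	assumes "strict_partition lam" "strict_partition mu" "\<forall>p\<in>set lam. p <= N" "\<forall>p\<in>set mu. p <= N"
		and "word N lam = word N mu"
	shows "lam = mu"
proof (rule strict_eqI[OF assms(1,2)])
	have "Suc k : set lam \<longleftrightarrow> Suc k : set mu" if "k < N" for k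
		using arg_cong[OF assms(5), of "%w. w ! k"] that by (simp add: word_def)
	then have "p : set lam \<longleftrightarrow> p : set mu" for p
		using assms(1-4) by (cases p) (auto simp: strict_partition_def Suc_le_eq)
	then show "set lam = set mu" by blast
qed

lemma word_surj:
	assumes "length as = N"
	obtains lam where "strict_partition lam" "\<forall>p\<in>set lam. p <= N" "word N lam = as"
proof -
	define lam where "lam = rev (map Suc (filter (%k. as ! k) [0..<N]))"
	have "sorted_wrt (<) (map Suc (filter (%k. as ! k) [0..<N]))"
		by (simp add: sorted_wrt_map sorted_wrt_filter)
	then have "strict_partition lam" by (auto simp: strict_partition_def lam_def sorted_wrt_rev)
	moreover have "\<forall>p\<in>set lam. p <= N" by (auto simp: lam_def)
	moreover have "word N lam = as"
		by (rule nth_equalityI) (auto simp: word_def lam_def assms)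
	ultimately show ?thesis by (rule that)
qed

lemma SD_inj:
	assumes "strict_partition lam" "strict_partition mu" "SD lam = SD mu"
	shows "lam = mu"
proof -
	define N where "N = sz lam + sz mu"
	have "shape (word N lam) = shape (word N mu)"
		using assms by (simp add: N_def SD_word_sum[symmetric])
	then have w: "word N lam = word N mu" by (intro shape_inj) simp_all
	show ?thesis
		by (rule word_inj[OF assms(1,2) _ _ w]) (auto simp: N_def intro: order_trans[OF parts_le])
qed

lemma finite_SD [simp]: "finite (SD lam)"
proof (rule finite_subset)
	show "SD lam <= {..<length lam} \<times> {..<length lam + sz lam}"
	proof
		fix b assume "b : SD lam"
		then obtain i j where b: "b = (i, i + j)" "i < length lam" "j < lam ! i" unfolding SD_def by blast
		then have "j < sz lam" using parts_le[of "lam ! i" lam] by simp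
		with b show "b : {..<length lam} \<times> {..<length lam + sz lam}" by simp
	qed
qed simp

lemma SD_geom:
	assumes "strict_partition lam"
	shows "(i, j) : SD lam ==> i <= j"
		and "(i, j') : SD lam ==> i <= j ==> j <= j' ==> (i, j) : SD lam"
		and "(i', j) : SD lam ==> i <= i' ==> (i, j) : SD lam"
	using shape_left[of i j' _ j] shape_up[of i' j _ i] mem_shape[of i j]
	unfolding SD_word_sum[OF assms order_refl] by auto

text \<open>This supplies the shape that remains when the largest letter is removed from a
  tableau.\<close>

lemma ideal_strict:
	assumes lam: "strict_partition lam" and I: "I <= SD lam"
		and left: "\<And>i j. (i, Suc j) : I ==> i <= j ==> (i, j) : I"
		and above: "\<And>i j. (Suc i, j) : I ==> (i, j) : I"
	obtains kap where "strict_partition kap" "SD kap = I" "sz kap <= sz lam"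
proof -
	have b: "i <= j & j - i < sz lam" if "(i, j) : I" for i j
	proof -
		have "(i, j) : SD lam" using that I by blast
		then obtain p where p: "j = i + p" "i < length lam" "p < lam ! i" unfolding SD_def by blast
		then have "p < sz lam" using parts_le[of "lam ! i" lam] by simp
		with p show ?thesis by simp
	qed
	have fin: "finite I" using I finite_SD finite_subset by blast
	obtain as where as: "length as = sz lam" "I = shape as"
		using ideal_is_shape[OF b fin left above] by blast
	obtain kap where kap: "strict_partition kap" "\<forall>p\<in>set kap. p <= sz lam" "word (sz lam) kap = as"
		using word_surj[OF as(1)] by blast
	have e: "SD kap = I" using SD_word[OF kap(1,2)] kap(3) as(2) by simp
	then have "sz kap <= sz lam"
		using card_mono[OF finite_SD I] by (simp add: card_SD[symmetric])
	with kap e that show ?thesis by blast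
qed

interpretation Strict: index_lists Strict
proof
	fix lam :: "nat list" and j
	show "[] : Strict" by (simp add: strict_partition_def)
	assume lam: "lam : Strict"
	then show "0 ~: set lam" by (auto simp: strict_partition_def)
	show "take j lam : Strict" using lam
		by (auto simp: strict_partition_def sorted_wrt_take dest: in_set_takeD)
qed

subsection \<open>Set-valued tableaux\<close>

text \<open>The tableaux of \<open>GP\<close> with letters below \<open>E\<close>. Comparing
  elements of neighbouring boxes, in place of \<open>Max\<close> and \<open>Min\<close>, makes the
  conditions stable under deleting a letter.\<close>

definition sv_tableaux :: "nat list => nat => (nat \<times> nat => nat set) set" where
	"sv_tableaux lam E = {T : SD lam \<rightarrow>\<^sub>E {S. S ~= {} & S <= {..<E}}.
		 (\<forall>i j e e'. (i, j) : SD lam --> (Suc i, j) : SD lam --> e : T (i, j) --> e' : T (Suc i, j) --> e <= e') &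
		 (\<forall>i j e e'. (i, j) : SD lam --> (i, Suc j) : SD lam --> e : T (i, j) --> e' : T (i, Suc j) --> e <= e') &
		 (\<forall>i i' j e. (i, j) : SD lam --> (i', j) : SD lam --> \<not> primed e --> e : T (i, j) --> e : T (i', j) --> i = i') &
		 (\<forall>i j j' e. (i, j) : SD lam --> (i, j') : SD lam --> primed e --> e : T (i, j) --> e : T (i, j') --> j = j') &
		 (\<forall>i e. (i, i) : SD lam --> e : T (i, i) --> \<not> primed e)}"

text \<open>The power of \<open>\<beta>\<close> is the excess of the box over a single letter. Boxes
  are nonempty, so the product over all boxes has the exponent of \<open>GP\<close> without
  truncation.\<close>

definition box_wt :: "'a::comm_ring_1 => (nat => 'a) => nat set => 'a" where
	"box_wt \<beta> z S = \<beta> ^ (card S - 1) * (\<Prod>e\<in>S. z e)"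

definition sv_sum :: "'a::comm_ring_1 => (nat => 'a) => nat => nat list => 'a" where
	"sv_sum \<beta> z E lam = (\<Sum>T\<in>sv_tableaux lam E. \<Prod>b\<in>SD lam. box_wt \<beta> z (T b))"

definition ext_sum :: "'a::comm_ring_1 => nat => 'a => nat list => nat list => 'a" where
	"ext_sum \<beta> E x kap lam = (\<Sum>X\<in>ext_sets (primed E) (SD kap) (SD lam). \<Prod>b\<in>X. if b : SD kap then \<beta> * x else x)"

lemma finite_sv_tableaux: "finite (sv_tableaux lam E)"
proof (rule finite_subset)
	show "sv_tableaux lam E <= SD lam \<rightarrow>\<^sub>E Pow {..<E}"
	proof
		fix T assume "T : sv_tableaux lam E"
		then have "T : SD lam \<rightarrow>\<^sub>E {S. S ~= {} & S <= {..<E}}"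
			unfolding sv_tableaux_def mem_Collect_eq by (rule conjunct1)
		then show "T : SD lam \<rightarrow>\<^sub>E Pow {..<E}" by (simp add: PiE_iff)
	qed
qed (intro finite_PiE; simp)

lemma finite_ext_sets: "finite B ==> finite (ext_sets pr A B)"
	by (rule finite_subset[of _ "Pow B"]) (auto simp: ext_sets_def)

lemma sv_tableauxD:
	assumes "T : sv_tableaux lam E"
	shows "T : extensional (SD lam)" "\<And>b. b : SD lam ==> T b ~= {}" "\<And>b e. b : SD lam ==> e : T b ==> e < E"
		"\<And>i j e e'. (i, j) : SD lam ==> (Suc i, j) : SD lam ==> e : T (i, j) ==> e' : T (Suc i, j) ==> e <= e'"
		"\<And>i j e e'. (i, j) : SD lam ==> (i, Suc j) : SD lam ==> e : T (i, j) ==> e' : T (i, Suc j) ==> e <= e'"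
		"\<And>i i' j e. (i, j) : SD lam ==> (i', j) : SD lam ==> \<not> primed e ==> e : T (i, j) ==> e : T (i', j) ==> i = i'"
		"\<And>i j j' e. (i, j) : SD lam ==> (i, j') : SD lam ==> primed e ==> e : T (i, j) ==> e : T (i, j') ==> j = j'"
		"\<And>i e. (i, i) : SD lam ==> e : T (i, i) ==> \<not> primed e"
proof -
	note a = assms[unfolded sv_tableaux_def mem_Collect_eq]
	note a1 = conjunct1[OF a] and b1 = conjunct2[OF a]
	note a2 = conjunct1[OF b1] and b2 = conjunct2[OF b1]
	note a3 = conjunct1[OF b2] and b3 = conjunct2[OF b2]
	note a4 = conjunct1[OF b3] and b4 = conjunct2[OF b3]
	note a5 = conjunct1[OF b4] and a6 = conjunct2[OF b4]
	show "T : extensional (SD lam)" "\<And>b. b : SD lam ==> T b ~= {}" "\<And>b e. b : SD lam ==> e : T b ==> e < E"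
		using a1 by (auto simp: PiE_iff)
	show "\<And>i j e e'. (i, j) : SD lam ==> (Suc i, j) : SD lam ==> e : T (i, j) ==> e' : T (Suc i, j) ==> e <= e'"
		using a2 by blast
	show "\<And>i j e e'. (i, j) : SD lam ==> (i, Suc j) : SD lam ==> e : T (i, j) ==> e' : T (i, Suc j) ==> e <= e'"
		using a3 by blast
	show "\<And>i i' j e. (i, j) : SD lam ==> (i', j) : SD lam ==> \<not> primed e ==> e : T (i, j) ==> e : T (i', j) ==> i = i'"
		using a4 by blast
	show "\<And>i j j' e. (i, j) : SD lam ==> (i, j') : SD lam ==> primed e ==> e : T (i, j) ==> e : T (i, j') ==> j = j'"
		using a5 by blast
	show "\<And>i e. (i, i) : SD lam ==> e : T (i, i) ==> \<not> primed e"
		using a6 by blast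
qed

lemma sv_tableauxI:
	assumes "T : extensional (SD lam)" "\<And>b. b : SD lam ==> T b ~= {}" "\<And>b e. b : SD lam ==> e : T b ==> e < E"
		"\<And>i j e e'. (i, j) : SD lam ==> (Suc i, j) : SD lam ==> e : T (i, j) ==> e' : T (Suc i, j) ==> e <= e'"
		"\<And>i j e e'. (i, j) : SD lam ==> (i, Suc j) : SD lam ==> e : T (i, j) ==> e' : T (i, Suc j) ==> e <= e'"
		"\<And>i i' j e. (i, j) : SD lam ==> (i', j) : SD lam ==> \<not> primed e ==> e : T (i, j) ==> e : T (i', j) ==> i = i'"
		"\<And>i j j' e. (i, j) : SD lam ==> (i, j') : SD lam ==> primed e ==> e : T (i, j) ==> e : T (i, j') ==> j = j'"
		"\<And>i e. (i, i) : SD lam ==> e : T (i, i) ==> \<not> primed e"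
	shows "T : sv_tableaux lam E"
proof -
	have t: "T : SD lam \<rightarrow>\<^sub>E {S. S ~= {} & S <= {..<E}}"
		using assms(1-3) by (auto simp: PiE_iff)
	show ?thesis unfolding sv_tableaux_def mem_Collect_eq
		by (intro conjI allI impI; (rule t | (rule assms(4-8); assumption)))
qed

text \<open>Removing the largest letter \<open>E\<close> from a tableau leaves a tableau of a smaller shape together with
	the set of boxes that contained \<open>E\<close>.\<close>

lemma sv_sum_Suc:
	assumes lam: "strict_partition lam"
	shows "sv_sum \<beta> z (Suc E) lam =
		(\<Sum>kap\<in>below Strict (sz lam). sv_sum \<beta> z E kap * ext_sum \<beta> E (z E) kap lam)"
proof -
	\<comment> \<open>\<open>mk\<close> inserts \<open>E\<close> into the boxes of \<open>X\<close>,
	  and \<open>sp\<close> undoes this. \<open>low T\<close> is the region filled by smaller letters,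
	  and \<open>kp T\<close> is the strict partition with that diagram.\<close>
	define mk where "mk = (%(kap, T, X). \<lambda>b\<in>SD lam. (if b : SD kap then T b else {}) \<union> (if b : X then {E} else {}))"
	define low where "low = (%T. {b : SD lam. \<exists>e\<in>T b. e < E})"
	define kp where "kp = (%T. THE kap. strict_partition kap & SD kap = low T)"
	define sp where "sp = (%T :: nat \<times> nat => nat set. (kp T, \<lambda>b\<in>low T. T b \<inter> {..<E}, {b : SD lam. E : T b}))"
	define I where "I = (SIGMA kap:below Strict (sz lam). sv_tableaux kap E \<times> ext_sets (primed E) (SD kap) (SD lam))"
	have kp_eq: "kp T = kap" if "strict_partition kap" "SD kap = low T" for T kap
		unfolding kp_def using that by (intro the_equality) (auto intro: SD_inj)
	have "sv_sum \<beta> z (Suc E) lam = (\<Sum>(kap, T, X)\<in>I. (\<Prod>b\<in>SD kap. box_wt \<beta> z (T b)) * (\<Prod>b\<in>X. if b : SD kap then \<beta> * z E else z E))"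
		unfolding sv_sum_def
	proof (rule sum.reindex_bij_witness[where i = mk and j = sp])
		fix T assume T: "T : sv_tableaux lam (Suc E)"
		note D = sv_tableauxD[OF T]
		have "\<exists>kap. strict_partition kap & SD kap = low T & sz kap <= sz lam"
		proof (rule ideal_strict[OF lam, of "low T"])
			fix i j assume a: "(i, Suc j) : low T" "i <= j"
			then have b: "(i, Suc j) : SD lam" by (simp add: low_def)
			have c: "(i, j) : SD lam" using SD_geom(2)[OF lam b, of j] a by simp
			obtain e where e: "e : T (i, Suc j)" "e < E" using a by (auto simp: low_def)
			obtain e' where e': "e' : T (i, j)" using D(2)[OF c] by blast
			have "e' < E" using D(5)[OF c b e' e(1)] e(2) by simp
			then show "(i, j) : low T" using c e' unfolding low_def by blast
		next
			fix i j assume a: "(Suc i, j) : low T"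
			then have b: "(Suc i, j) : SD lam" by (simp add: low_def)
			have c: "(i, j) : SD lam" using SD_geom(3)[OF lam b, of i] by simp
			obtain e where e: "e : T (Suc i, j)" "e < E" using a by (auto simp: low_def)
			obtain e' where e': "e' : T (i, j)" using D(2)[OF c] by blast
			have "e' < E" using D(4)[OF c b e' e(1)] e(2) by simp
			then show "(i, j) : low T" using c e' unfolding low_def by blast
		qed (auto simp: low_def)
		then obtain kap where kap: "strict_partition kap" "SD kap = low T" "sz kap <= sz lam" by blast
		have kpT: "kp T = kap" by (rule kp_eq[OF kap(1,2)])
		have sub: "SD kap <= SD lam" unfolding kap(2) by (auto simp: low_def)
		have nlow: "T b = {E}" if "b : SD lam" "b ~: SD kap" for b
		proof -
			have "e = E" if "e : T b" for e
				using D(3)[OF \<open>b : SD lam\<close> that] that \<open>b : SD lam\<close> \<open>b ~: SD kap\<close> unfolding kap(2) low_def by force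
			with D(2)[OF that(1)] show ?thesis by blast
		qed
		show "mk (sp T) = T"
		proof
			fix b
			show "mk (sp T) b = T b"
			proof (cases "b : SD lam")
				case True
				show ?thesis
				proof (cases "b : SD kap")
					case True
					have "T b = T b \<inter> {..<E} \<union> (if E : T b then {E} else {})"
						using D(3)[OF \<open>b : SD lam\<close>] by (auto simp: less_Suc_eq)
					then show ?thesis using True \<open>b : SD lam\<close> by (simp add: mk_def sp_def kpT kap(2))
				next
					case False
					then show ?thesis using \<open>b : SD lam\<close> nlow[of b] by (simp add: mk_def sp_def kpT)
				qed
			next
				case False
				then show ?thesis using extensional_arb[OF D(1) False] by (simp add: mk_def sp_def)
			qed
		qed
		define T' where "T' = (\<lambda>b\<in>low T. T b \<inter> {..<E})"
		have m: "e : T' b \<longleftrightarrow> e : T b & e < E" if "b : SD kap" for b e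
			using that unfolding kap(2) T'_def by simp
		have kl: "b : SD lam" if "b : SD kap" for b using sub that by blast
		have T': "T' : sv_tableaux kap E"
		proof (rule sv_tableauxI)
			show "T' : extensional (SD kap)" unfolding kap(2) T'_def by simp
			show "T' b ~= {}" if "b : SD kap" for b
				using that unfolding kap(2) T'_def low_def by auto
			show "e < E" if "b : SD kap" "e : T' b" for b e using m that by blast
			show "e <= e'" if "(i, j) : SD kap" "(Suc i, j) : SD kap" "e : T' (i, j)" "e' : T' (Suc i, j)" for i j e e'
				using D(4)[OF kl[OF that(1)] kl[OF that(2)]] m[OF that(1)] m[OF that(2)] that(3,4) by blast
			show "e <= e'" if "(i, j) : SD kap" "(i, Suc j) : SD kap" "e : T' (i, j)" "e' : T' (i, Suc j)" for i j e e'
				using D(5)[OF kl[OF that(1)] kl[OF that(2)]] m[OF that(1)] m[OF that(2)] that(3,4) by blast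
			show "i = i'" if "(i, j) : SD kap" "(i', j) : SD kap" "\<not> primed e" "e : T' (i, j)" "e : T' (i', j)" for i i' j e
				using D(6)[OF kl[OF that(1)] kl[OF that(2)] that(3)] m[OF that(1)] m[OF that(2)] that(4,5) by blast
			show "j = j'" if "(i, j) : SD kap" "(i, j') : SD kap" "primed e" "e : T' (i, j)" "e : T' (i, j')" for i j j' e
				using D(7)[OF kl[OF that(1)] kl[OF that(2)] that(3)] m[OF that(1)] m[OF that(2)] that(4,5) by blast
			show "\<not> primed e" if "(i, i) : SD kap" "e : T' (i, i)" for i e
				using D(8)[OF kl[OF that(1)]] m[OF that(1)] that(2) by blast
		qed
		have X: "{b : SD lam. E : T b} : ext_sets (primed E) (SD kap) (SD lam)"
		proof -
			have r: "(i, Suc j) ~: SD kap" if "(i, j) : SD lam" "E : T (i, j)" for i j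
				using D(5)[of i j E] that unfolding kap(2) low_def by force
			have d: "(Suc i, j) ~: SD kap" if "(i, j) : SD lam" "E : T (i, j)" for i j
				using D(4)[of i j E] that unfolding kap(2) low_def by force
			have "SD lam - SD kap <= {b : SD lam. E : T b}" using nlow by auto
			then show ?thesis using sub r d D(6)[of _ _ _ E] D(7)[of _ _ _ E] D(8)[of _ E]
				unfolding ext_sets_def by auto
		qed
		show "sp T : I"
			unfolding I_def sp_def kpT T'_def[symmetric] using kap T' X by (simp add: below_def)
		show "(case sp T of (kap, T, X) => (\<Prod>b\<in>SD kap. box_wt \<beta> z (T b)) * (\<Prod>b\<in>X. if b : SD kap then \<beta> * z E else z E))
			= (\<Prod>b\<in>SD lam. box_wt \<beta> z (T b))"
		proof -
			have fT: "finite (T b)" if "b : SD lam" for b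
				using D(3)[OF that] by (intro finite_subset[of "T b" "{..<Suc E}"]) auto
			have "(\<Prod>b\<in>SD lam. box_wt \<beta> z (T b)) = (\<Prod>b\<in>SD lam. (if b : SD kap then box_wt \<beta> z (T b \<inter> {..<E}) else 1) *
					(if E : T b then if b : SD kap then \<beta> * z E else z E else 1))"
			proof (rule prod.cong[OF refl])
				fix b assume b: "b : SD lam"
				show "box_wt \<beta> z (T b) = (if b : SD kap then box_wt \<beta> z (T b \<inter> {..<E}) else 1) *
					(if E : T b then if b : SD kap then \<beta> * z E else z E else 1)"
				proof (cases "b : SD kap")
					case False
					then show ?thesis using nlow[OF b] by (simp add: box_wt_def)
				next
					case True
					have ne: "T b \<inter> {..<E} ~= {}" using True unfolding kap(2) by (auto simp: low_def)
					then have "card (T b \<inter> {..<E}) > 0" using fT[OF b] by (simp add: card_gt_0_iff)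
					show ?thesis
					proof (cases "E : T b")
						case e: True
						have Tb: "T b = insert E (T b \<inter> {..<E})" using D(3)[OF b] e by (auto simp: less_Suc_eq)
						have "box_wt \<beta> z (insert E (T b \<inter> {..<E})) = box_wt \<beta> z (T b \<inter> {..<E}) * (\<beta> * z E)"
							using \<open>card (T b \<inter> {..<E}) > 0\<close> fT[OF b] by (cases "card (T b \<inter> {..<E})") (auto simp: box_wt_def mult_ac)
						then show ?thesis using Tb True e by simp
					next
						case e: False
						have "T b = T b \<inter> {..<E}" using D(3)[OF b] e by (auto simp: less_Suc_eq)
						then show ?thesis using True e by simp
					qed
				qed
			qed
			also have "... = (\<Prod>b\<in>SD lam. if b : SD kap then box_wt \<beta> z (T b \<inter> {..<E}) else 1) *
					(\<Prod>b\<in>SD lam. if E : T b then if b : SD kap then \<beta> * z E else z E else 1)"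
				by (rule prod.distrib)
			also have "(\<Prod>b\<in>SD lam. if b : SD kap then box_wt \<beta> z (T b \<inter> {..<E}) else 1) =
					(\<Prod>b\<in>SD kap. box_wt \<beta> z (T b \<inter> {..<E}))"
				using sub by (intro prod.mono_neutral_cong_right) auto
			also have "(\<Prod>b\<in>SD lam. if E : T b then if b : SD kap then \<beta> * z E else z E else 1) =
					(\<Prod>b\<in>{b : SD lam. E : T b}. if b : SD kap then \<beta> * z E else z E)"
				by (rule prod.inter_filter[symmetric]) simp
			also have "(\<Prod>b\<in>SD kap. box_wt \<beta> z (T b \<inter> {..<E})) = (\<Prod>b\<in>SD kap. box_wt \<beta> z ((\<lambda>b\<in>low T. T b \<inter> {..<E}) b))"
				by (rule prod.cong) (auto simp: kap(2))
			finally show ?thesis by (simp add: sp_def kpT)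
		qed
	next
		fix p assume p: "p : I"
		obtain kap T X where pe: "p = (kap, T, X)" using prod_cases3 by blast
		have kap: "strict_partition kap" and T: "T : sv_tableaux kap E" and X: "X : ext_sets (primed E) (SD kap) (SD lam)"
			using p by (auto simp: I_def pe below_def)
		note D = sv_tableauxD[OF T]
		have sub: "SD kap <= SD lam" "SD lam - SD kap <= X" "X <= SD lam" using X by (auto simp: ext_sets_def)
		have corner: "(i, Suc j) ~: SD kap" "(Suc i, j) ~: SD kap" if "(i, j) : X" "(i, j) : SD kap" for i j
			using X that unfolding ext_sets_def by blast+
		have mem: "e : mk p b \<longleftrightarrow> (b : SD kap & e : T b \<or> b : X & e = E)" if "b : SD lam" for b e
			using that by (simp add: mk_def pe)
		have lt: "e ~= E" if "b : SD kap" "e : T b" for b e using D(3)[OF that] by simp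
		show "mk p : sv_tableaux lam (Suc E)"
		proof (rule sv_tableauxI)
			show "mk p : extensional (SD lam)" by (simp add: mk_def pe)
			show "mk p b ~= {}" if "b : SD lam" for b
			proof (cases "b : SD kap")
				case True
				then show ?thesis using D(2)[OF True] mem[OF that] by blast
			next
				case False
				then show ?thesis using sub(2) mem[OF that, of E] that by blast
			qed
			show "e < Suc E" if "b : SD lam" "e : mk p b" for b e
				using that mem[OF that(1)] D(3)[of b e] by auto
			show "e <= e'" if h: "(i, j) : SD lam" "(Suc i, j) : SD lam" "e : mk p (i, j)" "e' : mk p (Suc i, j)" for i j e e'
			proof (cases "(Suc i, j) : SD kap & e' : T (Suc i, j)")
				case True
				then have k: "(i, j) : SD kap" using SD_geom(3)[OF kap, of "Suc i" j i] by simp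
				then have "(i, j) ~: X" using corner(2)[of i j] True by blast
				then have "e : T (i, j)" using h(3) mem[OF h(1)] by blast
				then show ?thesis using D(4)[OF k] True by blast
			next
				case False
				then have "e' = E" using h(4) mem[OF h(2)] by blast
				then show ?thesis using h(3) mem[OF h(1)] D(3)[of "(i, j)" e] by auto
			qed
			show "e <= e'" if h: "(i, j) : SD lam" "(i, Suc j) : SD lam" "e : mk p (i, j)" "e' : mk p (i, Suc j)" for i j e e'
			proof (cases "(i, Suc j) : SD kap & e' : T (i, Suc j)")
				case True
				then have k: "(i, j) : SD kap" using SD_geom(2)[OF kap, of i "Suc j" j] SD_geom(1)[OF lam h(1)] by simp
				then have "(i, j) ~: X" using corner(1)[of i j] True by blast
				then have "e : T (i, j)" using h(3) mem[OF h(1)] by blast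
				then show ?thesis using D(5)[OF k] True by blast
			next
				case False
				then have "e' = E" using h(4) mem[OF h(2)] by blast
				then show ?thesis using h(3) mem[OF h(1)] D(3)[of "(i, j)" e] by auto
			qed
			show "i = i'" if h: "(i, j) : SD lam" "(i', j) : SD lam" "\<not> primed e" "e : mk p (i, j)" "e : mk p (i', j)" for i i' j e
			proof (cases "e = E")
				case True
				then have "(i, j) : X" "(i', j) : X" using h mem lt by blast+
				then show ?thesis using X h(3) True by (simp add: ext_sets_def)
			next
				case False
				then have "(i, j) : SD kap" "(i', j) : SD kap" "e : T (i, j)" "e : T (i', j)" using h mem by blast+
				then show ?thesis using D(6) h(3) by blast
			qed
			show "j = j'" if h: "(i, j) : SD lam" "(i, j') : SD lam" "primed e" "e : mk p (i, j)" "e : mk p (i, j')" for i j j' e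
			proof (cases "e = E")
				case True
				then have "(i, j) : X" "(i, j') : X" using h mem lt by blast+
				then show ?thesis using X h(3) True by (simp add: ext_sets_def)
			next
				case False
				then have "(i, j) : SD kap" "(i, j') : SD kap" "e : T (i, j)" "e : T (i, j')" using h mem by blast+
				then show ?thesis using D(7) h(3) by blast
			qed
			show "\<not> primed e" if h: "(i, i) : SD lam" "e : mk p (i, i)" for i e
			proof (cases "e = E")
				case True
				then have "(i, i) : X" using h mem lt by blast
				then show ?thesis using X True by (auto simp: ext_sets_def)
			next
				case False
				then have "(i, i) : SD kap" "e : T (i, i)" using h mem by blast+
				then show ?thesis using D(8) by blast
			qed
		qed
		have lowmk: "low (mk p) = SD kap"
		proof (intro equalityI subsetI)
			fix b assume "b : low (mk p)"
			then show "b : SD kap" using mem[of b] by (auto simp: low_def)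
		next
			fix b assume b: "b : SD kap"
			then obtain e where "e : T b" using D(2) by blast
			moreover have "b : SD lam" using b sub by blast
			ultimately show "b : low (mk p)" using b D(3)[OF b] mem[of b e] unfolding low_def by blast
		qed
		have "kp (mk p) = kap" by (rule kp_eq[OF kap lowmk[symmetric]])
		moreover have "(\<lambda>b\<in>low (mk p). mk p b \<inter> {..<E}) = T"
		proof
			fix b
			show "(\<lambda>b\<in>low (mk p). mk p b \<inter> {..<E}) b = T b"
			proof (cases "b : SD kap")
				case True
				then have "b : SD lam" using sub by blast
				then have "mk p b \<inter> {..<E} = T b" using D(3)[OF True] True by (auto simp: mem[OF \<open>b : SD lam\<close>])
				then show ?thesis using True by (simp add: lowmk)
			next
				case False
				then show ?thesis using extensional_arb[OF D(1) False] by (simp add: lowmk)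
			qed
		qed
		moreover have "{b : SD lam. E : mk p b} = X"
			using mem lt sub(3) by blast
		ultimately show "sp (mk p) = p" by (simp add: sp_def pe)
	qed
	also have "... = (\<Sum>kap\<in>below Strict (sz lam). \<Sum>(T, X)\<in>sv_tableaux kap E \<times> ext_sets (primed E) (SD kap) (SD lam).
			(\<Prod>b\<in>SD kap. box_wt \<beta> z (T b)) * (\<Prod>b\<in>X. if b : SD kap then \<beta> * z E else z E))"
		unfolding I_def by (rule sum.Sigma[symmetric]) (auto intro!: finite_sv_tableaux finite_ext_sets)
	also have "... = (\<Sum>kap\<in>below Strict (sz lam). sv_sum \<beta> z E kap * ext_sum \<beta> E (z E) kap lam)"
		unfolding sv_sum_def ext_sum_def sum_product sum.cartesian_product ..
	finally show ?thesis .
qed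

lemma sv_sum_0:
	assumes "strict_partition lam"
	shows "sv_sum \<beta> z 0 lam = (if [] = lam then 1 else 0)"
proof (cases lam)
	case Nil
	have "SD [] = {}" by (simp add: SD_def)
	then have "sv_tableaux [] 0 = {%_. undefined}" by (auto simp: sv_tableaux_def)
	then show ?thesis using Nil \<open>SD [] = {}\<close> by (simp add: sv_sum_def)
next
	case (Cons p ps)
	then have "(0, 0) : SD lam" using assms by (auto simp: SD_def strict_partition_def)
	then have "sv_tableaux lam 0 = {}" by (auto simp: sv_tableaux_def PiE_iff)
	then show ?thesis using Cons by (simp add: sv_sum_def)
qed

lemma sv_sum_chain:
	assumes "strict_partition lam"
	shows "sv_sum \<beta> z E lam = chain Strict (%e. ext_sum \<beta> e (z e)) E [] lam"
	using assms
proof (induction E arbitrary: lam)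
	case (Suc E)
	show ?case unfolding sv_sum_Suc[OF Suc.prems] chain.simps
		by (rule sum.cong[OF refl]) (simp add: Suc.IH below_def)
qed (simp add: sv_sum_0)

subsection \<open>Shifted bar tableaux\<close>

definition bar_tableaux :: "nat list => nat list => nat => ((nat \<times> nat => nat) \<times> (nat \<times> nat) set set) set" where
	"bar_tableaux mu lam E = {(V, P) : shifted_bar_tableaux lam mu.
		 SD mu <= SD lam & semistandard lam mu (V, P) & (\<forall>b\<in>SD_skew lam mu. V b < E)}"

text \<open>The entries of a bar are all equal, and \<open>Min\<close> selects their common
  value.\<close>

definition bar_wt :: "'a::comm_ring_1 => (nat => 'a) => (nat \<times> nat => nat) => (nat \<times> nat) set => 'a" where
	"bar_wt v z V B = z (Min (V ` B)) * v ^ (card B - 1)"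

definition bar_sum :: "'a::comm_ring_1 => (nat => 'a) => nat => nat list => nat list => 'a" where
	"bar_sum v z E mu lam = (\<Sum>(V, P)\<in>bar_tableaux mu lam E. \<Prod>B\<in>P. bar_wt v z V B)"

definition strip_sum :: "'a::comm_ring_1 => nat => 'a => nat list => nat list => 'a" where
	"strip_sum v E t kap lam = (if (if primed E then vstrip (SD kap) (SD lam) else hstrip (SD kap) (SD lam))
		 then \<Sum>Q\<in>bars (SD lam - SD kap). \<Prod>B\<in>Q. t * v ^ (card B - 1) else 0)"

lemma bar_tableauxD:
	assumes "(V, P) : bar_tableaux mu lam E"
	shows "SD mu <= SD lam" "V : extensional (SD lam - SD mu)" "\<And>b. b : SD lam - SD mu ==> V b < E"
		"\<And>i i' j. (i, j) : SD lam - SD mu ==> (i', j) : SD lam - SD mu ==> i ~= i' ==> \<not> primed (V (i, j)) ==> V (i, j) ~= V (i', j)"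
		"\<And>i j j'. (i, j) : SD lam - SD mu ==> (i, j') : SD lam - SD mu ==> j ~= j' ==> primed (V (i, j)) ==> V (i, j) ~= V (i, j')"
		"partition_on (SD lam - SD mu) P" "\<And>B. B : P ==> is_bar V B"
		"\<And>i j j'. (i, j) : SD lam - SD mu ==> (i, j') : SD lam - SD mu ==> j <= j' ==> V (i, j) <= V (i, j')"
		"\<And>i i' j. (i, j) : SD lam - SD mu ==> (i', j) : SD lam - SD mu ==> i <= i' ==> V (i, j) <= V (i', j)"
proof -
	have a: "SD mu <= SD lam" "(V, P) : shifted_bar_tableaux lam mu" "semistandard lam mu (V, P)"
		"\<forall>b\<in>SD_skew lam mu. V b < E"
		using assms by (simp_all add: bar_tableaux_def)
	note s = a(2)[unfolded shifted_bar_tableaux_def mem_Collect_eq case_prod_conv SD_skew_def]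
	note ss = a(3)[unfolded semistandard_def case_prod_conv SD_skew_def]
	note s1 = conjunct1[OF s] and t1 = conjunct2[OF s]
	note s2 = conjunct1[OF t1] and t2 = conjunct2[OF t1]
	note s3 = conjunct1[OF t2] and t3 = conjunct2[OF t2]
	show "SD mu <= SD lam" by (rule a(1))
	show "V : extensional (SD lam - SD mu)" using s1 by (simp add: PiE_iff)
	show "\<And>b. b : SD lam - SD mu ==> V b < E" using a(4) by (simp add: SD_skew_def)
	show "\<And>i i' j. (i, j) : SD lam - SD mu ==> (i', j) : SD lam - SD mu ==> i ~= i' ==> \<not> primed (V (i, j)) ==> V (i, j) ~= V (i', j)"
		using s2 by blast
	show "\<And>i j j'. (i, j) : SD lam - SD mu ==> (i, j') : SD lam - SD mu ==> j ~= j' ==> primed (V (i, j)) ==> V (i, j) ~= V (i, j')"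
		using s3 by blast
	show "partition_on (SD lam - SD mu) P" by (rule conjunct1[OF t3])
	show "\<And>B. B : P ==> is_bar V B" using conjunct2[OF t3] by blast
	show "\<And>i j j'. (i, j) : SD lam - SD mu ==> (i, j') : SD lam - SD mu ==> j <= j' ==> V (i, j) <= V (i, j')"
		using conjunct1[OF ss] by blast
	show "\<And>i i' j. (i, j) : SD lam - SD mu ==> (i', j) : SD lam - SD mu ==> i <= i' ==> V (i, j) <= V (i', j)"
		using conjunct2[OF ss] by blast
qed

lemma bar_tableauxI:
	assumes "SD mu <= SD lam" "V : extensional (SD lam - SD mu)" "\<And>b. b : SD lam - SD mu ==> V b < E"
		"\<And>i i' j. (i, j) : SD lam - SD mu ==> (i', j) : SD lam - SD mu ==> i ~= i' ==> \<not> primed (V (i, j)) ==> V (i, j) ~= V (i', j)"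
		"\<And>i j j'. (i, j) : SD lam - SD mu ==> (i, j') : SD lam - SD mu ==> j ~= j' ==> primed (V (i, j)) ==> V (i, j) ~= V (i, j')"
		"partition_on (SD lam - SD mu) P" "\<And>B. B : P ==> is_bar V B"
		"\<And>i j j'. (i, j) : SD lam - SD mu ==> (i, j') : SD lam - SD mu ==> j <= j' ==> V (i, j) <= V (i, j')"
		"\<And>i i' j. (i, j) : SD lam - SD mu ==> (i', j) : SD lam - SD mu ==> i <= i' ==> V (i, j) <= V (i', j)"
	shows "(V, P) : bar_tableaux mu lam E"
proof -
	have e: "V : (SD lam - SD mu) \<rightarrow>\<^sub>E UNIV" using assms(2) by (simp add: PiE_iff)
	have "(V, P) : shifted_bar_tableaux lam mu"
		unfolding shifted_bar_tableaux_def mem_Collect_eq case_prod_conv SD_skew_def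
	proof (intro conjI allI ballI impI; (elim conjE)?)
	qed (use e assms(4-7) in \<open>blast\<close>)+
	moreover have "semistandard lam mu (V, P)"
		unfolding semistandard_def case_prod_conv SD_skew_def using assms(8,9) by blast
	ultimately show ?thesis
		using assms(1,3) by (simp add: bar_tableaux_def SD_skew_def)
qed

lemma is_bar_cong: "(\<And>b. b : B ==> V b = V' b) ==> is_bar V B = is_bar V' B"
	by (simp add: is_bar_def)

lemma finite_bar_tableaux: "finite (bar_tableaux mu lam E)"
proof (rule finite_subset)
	show "bar_tableaux mu lam E <= ((SD lam - SD mu) \<rightarrow>\<^sub>E {..<E}) \<times> Pow (Pow (SD lam - SD mu))"
	proof
		fix T assume T: "T : bar_tableaux mu lam E"
		obtain V P where VP: "T = (V, P)" by fastforce
		note D = bar_tableauxD[OF T[unfolded VP]]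
		have "P <= Pow (SD lam - SD mu)" using partition_onD1[OF D(6)] by blast
		then show "T : ((SD lam - SD mu) \<rightarrow>\<^sub>E {..<E}) \<times> Pow (Pow (SD lam - SD mu))"
			using D(2,3) by (simp add: VP PiE_iff)
	qed
qed (intro finite_cartesian_product finite_PiE; simp)

lemma finite_bars: "finite S ==> finite (bars S)"
	by (rule finite_subset[of _ "Pow (Pow S)"]) (auto simp: bars_def partition_on_def)

text \<open>The boxes with the largest letter form a vertical or a horizontal strip, depending on
  the parity of \<open>E\<close>. Since a bar has constant entries, it lies inside or outside that
  strip, so the partition into bars splits into two independent ones.\<close>

lemma bar_sum_Suc:
	assumes lam: "strict_partition lam" and mu: "strict_partition mu"
	shows "bar_sum v z (Suc E) mu lam =
		(\<Sum>kap\<in>below Strict (sz lam). bar_sum v z E mu kap * strip_sum v E (z E) kap lam)"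
proof -
	define strip where "strip = (%kap. if primed E then vstrip (SD kap) (SD lam) else hstrip (SD kap) (SD lam))"
	define mk where "mk = (%(kap, (V, P), Q). (\<lambda>b\<in>SD lam - SD mu. if b : SD kap then V b else E, P \<union> Q) ::
		(nat \<times> nat => nat) \<times> (nat \<times> nat) set set)"
	define low where "low = (%V :: nat \<times> nat => nat. SD mu \<union> {b : SD lam - SD mu. V b < E})"
	define kp where "kp = (%V. THE kap. strict_partition kap & SD kap = low V)"
	define sp where "sp = (%(V, P). (kp V, (\<lambda>b\<in>low V - SD mu. V b, {B : P. B <= low V}), {B : P. \<not> B <= low V}))"
	define I where "I = (SIGMA kap:{kap : below Strict (sz lam). strip kap}. bar_tableaux mu kap E \<times> bars (SD lam - SD kap))"
	have kp_eq: "kp V = kap" if "strict_partition kap" "SD kap = low V" for V kap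
		unfolding kp_def using that by (intro the_equality) (auto intro: SD_inj)
	have "bar_sum v z (Suc E) mu lam = (\<Sum>(kap, (V, P), Q)\<in>I. (\<Prod>B\<in>P. bar_wt v z V B) * (\<Prod>B\<in>Q. z E * v ^ (card B - 1)))"
		unfolding bar_sum_def
	proof (rule sum.reindex_bij_witness[where i = mk and j = sp])
		fix T assume T: "T : bar_tableaux mu lam (Suc E)"
		obtain V P where VP: "T = (V, P)" by fastforce
		note D = bar_tableauxD[OF T[unfolded VP]]
		have "\<exists>kap. strict_partition kap & SD kap = low V & sz kap <= sz lam"
		proof (rule ideal_strict[OF lam, of "low V"])
			show "low V <= SD lam" using D(1) by (auto simp: low_def)
		next
			fix i j assume a: "(i, Suc j) : low V" "i <= j"
			then have b: "(i, Suc j) : SD lam" using D(1) by (auto simp: low_def)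
			have c: "(i, j) : SD lam" using SD_geom(2)[OF lam b, of j] a by simp
			show "(i, j) : low V"
			proof (cases "(i, j) : SD mu")
				case False
				have "(i, Suc j) ~: SD mu" using SD_geom(2)[OF mu, of i "Suc j" j] a False by auto
				then have "V (i, Suc j) < E" "(i, Suc j) : SD lam - SD mu" using a by (auto simp: low_def)
				then have "V (i, j) < E" using D(8)[of i j "Suc j"] c False by fastforce
				then show ?thesis using c False by (simp add: low_def)
			qed (simp add: low_def)
		next
			fix i j assume a: "(Suc i, j) : low V"
			then have b: "(Suc i, j) : SD lam" using D(1) by (auto simp: low_def)
			have c: "(i, j) : SD lam" using SD_geom(3)[OF lam b, of i] by simp
			show "(i, j) : low V"
			proof (cases "(i, j) : SD mu")
				case False
				have "(Suc i, j) ~: SD mu" using SD_geom(3)[OF mu, of "Suc i" j i] False by auto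
				then have "V (Suc i, j) < E" "(Suc i, j) : SD lam - SD mu" using a by (auto simp: low_def)
				then have "V (i, j) < E" using D(9)[of i j "Suc i"] c False by fastforce
				then show ?thesis using c False by (simp add: low_def)
			qed (simp add: low_def)
		qed blast
		then obtain kap where kap: "strict_partition kap" "SD kap = low V" "sz kap <= sz lam" by blast
		have kpV: "kp V = kap" by (rule kp_eq[OF kap(1,2)])
		have sub: "SD mu <= SD kap" "SD kap <= SD lam" unfolding kap(2) using D(1) by (auto simp: low_def)
		have VE: "V b = E" if "b : SD lam" "b ~: SD kap" for b
			using D(3)[of b] that unfolding kap(2) low_def by (auto simp: less_Suc_eq)
		have Vlt: "V b < E" if "b : SD kap - SD mu" for b
			using that unfolding kap(2) low_def by auto
		have Pb: "B <= SD lam - SD mu" "B ~= {}" if "B : P" for B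
			using partition_onD1[OF D(6)] partition_onD3[OF D(6)] that by blast+
		\<comment> \<open>A bar that leaves \<open>kap\<close> has the constant entry \<open>E\<close>,
		  whereas all entries inside \<open>kap\<close> are smaller.\<close>
		have dich: "B \<inter> SD kap = {}" if B: "B : P" "\<not> B <= SD kap" for B
		proof -
			obtain e where e: "\<forall>x\<in>B. V x = e" using D(7)[OF B(1)] unfolding is_bar_def by blast
			obtain b where b: "b : B" "b ~: SD kap" using B(2) by blast
			have "b : SD lam" using b(1) Pb(1)[OF B(1)] by blast
			then have "e = E" using VE[OF _ b(2)] e b(1) by simp
			have "False" if "x : B" "x : SD kap" for x
			proof -
				have "x : SD kap - SD mu" using that Pb(1)[OF B(1)] by blast
				then have "V x < E" by (rule Vlt)
				with e that(1) \<open>e = E\<close> show False by simp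
			qed
			then show ?thesis by blast
		qed
		have spT: "sp T = (kap, (\<lambda>b\<in>SD kap - SD mu. V b, {B : P. B <= SD kap}), {B : P. \<not> B <= SD kap})"
			by (simp add: sp_def VP kpV kap(2))
		show "mk (sp T) = T"
		proof -
			have "(\<lambda>b\<in>SD lam - SD mu. if b : SD kap then (\<lambda>b\<in>SD kap - SD mu. V b) b else E) = V"
			proof
				fix b
				show "(\<lambda>b\<in>SD lam - SD mu. if b : SD kap then (\<lambda>b\<in>SD kap - SD mu. V b) b else E) b = V b"
				proof (cases "b : SD lam - SD mu")
					case True
					then show ?thesis using VE[of b] by simp
				next
					case False
					then show ?thesis using extensional_arb[OF D(2) False] by auto
				qed
			qed
			moreover have "{B : P. B <= SD kap} \<union> {B : P. \<not> B <= SD kap} = P" by blast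
			ultimately show ?thesis unfolding spT mk_def by (simp only: case_prod_conv VP)
		qed
		have T': "(\<lambda>b\<in>SD kap - SD mu. V b, {B : P. B <= SD kap}) : bar_tableaux mu kap E"
		proof -
			define V' where "V' = (\<lambda>b\<in>SD kap - SD mu. V b)"
			have V': "V' b = V b" if "b : SD kap - SD mu" for b using that by (simp add: V'_def)
			have kl: "b : SD lam - SD mu" if "b : SD kap - SD mu" for b using that sub by blast
			have "(V', {B : P. B <= SD kap}) : bar_tableaux mu kap E"
			proof (rule bar_tableauxI)
				show "SD mu <= SD kap" by (rule sub(1))
				show "V' : extensional (SD kap - SD mu)" by (simp add: V'_def)
				show "V' b < E" if "b : SD kap - SD mu" for b using Vlt[OF that] V'[OF that] by simp
				show "V' (i, j) ~= V' (i', j)" if "(i, j) : SD kap - SD mu" "(i', j) : SD kap - SD mu" "i ~= i'" "\<not> primed (V' (i, j))" for i i' j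
					using D(4)[OF kl[OF that(1)] kl[OF that(2)] that(3)] that(4) V'[OF that(1)] V'[OF that(2)] by simp
				show "V' (i, j) ~= V' (i, j')" if "(i, j) : SD kap - SD mu" "(i, j') : SD kap - SD mu" "j ~= j'" "primed (V' (i, j))" for i j j'
					using D(5)[OF kl[OF that(1)] kl[OF that(2)] that(3)] that(4) V'[OF that(1)] V'[OF that(2)] by simp
				show "partition_on (SD kap - SD mu) {B : P. B <= SD kap}"
				proof (rule partition_onI)
					show "\<Union> {B : P. B <= SD kap} = SD kap - SD mu"
					proof (intro equalityI subsetI)
						fix b assume "b : \<Union> {B : P. B <= SD kap}"
						then obtain B where "B : P" "B <= SD kap" "b : B" by blast
						then show "b : SD kap - SD mu" using Pb(1) by blast
					next
						fix b assume b: "b : SD kap - SD mu"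
						then obtain B where B: "B : P" "b : B" using partition_onD1[OF D(6)] kl by blast
						then have "B <= SD kap" using dich[OF B(1)] b by blast
						with B show "b : \<Union> {B : P. B <= SD kap}" by blast
					qed
					show "disjnt p q" if "p : {B : P. B <= SD kap}" "q : {B : P. B <= SD kap}" "p ~= q" for p q
						using partition_onD2[OF D(6)] that by (auto simp: disjoint_def disjnt_def)
					show "{} ~: {B : P. B <= SD kap}" using partition_onD3[OF D(6)] by simp
				qed
				show "is_bar V' B" if "B : {B : P. B <= SD kap}" for B
				proof -
					have "V' b = V b" if "b : B" for b
						using V'[of b] Pb(1)[of B] \<open>B : {B : P. B <= SD kap}\<close> that by blast
					then show ?thesis using is_bar_cong[of B V' V] D(7) that by simp
				qed
				show "V' (i, j) <= V' (i, j')" if "(i, j) : SD kap - SD mu" "(i, j') : SD kap - SD mu" "j <= j'" for i j j'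
					using D(8)[OF kl[OF that(1)] kl[OF that(2)] that(3)] V'[OF that(1)] V'[OF that(2)] by simp
				show "V' (i, j) <= V' (i', j)" if "(i, j) : SD kap - SD mu" "(i', j) : SD kap - SD mu" "i <= i'" for i i' j
					using D(9)[OF kl[OF that(1)] kl[OF that(2)] that(3)] V'[OF that(1)] V'[OF that(2)] by simp
			qed
			then show ?thesis by (simp add: V'_def)
		qed
		have strip: "strip kap"
		proof (cases "primed E")
			case True
			have "j = j'" if "(i, j) : SD lam - SD kap" "(i, j') : SD lam - SD kap" for i j j'
				using D(5)[of i j j'] VE[of "(i, j)"] VE[of "(i, j')"] that sub True by auto
			then show ?thesis using True sub by (auto simp: strip_def vstrip_def)
		next
			case False
			have "i = i'" if "(i, j) : SD lam - SD kap" "(i', j) : SD lam - SD kap" for i i' j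
				using D(4)[of i j i'] VE[of "(i, j)"] VE[of "(i', j)"] that sub False by auto
			then show ?thesis using False sub by (auto simp: strip_def hstrip_def)
		qed
		have Q: "{B : P. \<not> B <= SD kap} : bars (SD lam - SD kap)"
		proof -
			have "partition_on (SD lam - SD kap) {B : P. \<not> B <= SD kap}"
			proof (rule partition_onI)
				show "\<Union> {B : P. \<not> B <= SD kap} = SD lam - SD kap"
				proof (intro equalityI subsetI)
					fix b assume "b : \<Union> {B : P. \<not> B <= SD kap}"
					then obtain B where "B : P" "\<not> B <= SD kap" "b : B" by blast
					then show "b : SD lam - SD kap" using Pb(1)[of B] dich[of B] by blast
				next
					fix b assume b: "b : SD lam - SD kap"
					then have "b : SD lam - SD mu" using sub by blast
					then obtain B where B: "B : P" "b : B" using partition_onD1[OF D(6)] by blast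
					with b show "b : \<Union> {B : P. \<not> B <= SD kap}" by blast
				qed
				show "disjnt p q" if "p : {B : P. \<not> B <= SD kap}" "q : {B : P. \<not> B <= SD kap}" "p ~= q" for p q
					using partition_onD2[OF D(6)] that by (auto simp: disjoint_def disjnt_def)
				show "{} ~: {B : P. \<not> B <= SD kap}" by simp
			qed
			moreover have "\<exists>i a b. B = {i} \<times> {a..b} \<or> B = {a..b} \<times> {i}" if "B : P" for B
				using D(7)[OF that] unfolding is_bar_def by simp
			ultimately show ?thesis unfolding bars_def by simp
		qed
		show "sp T : I"
			unfolding I_def spT using kap T' Q strip by (simp add: below_def)
		show "(%(kap, (V, P), Q). (\<Prod>B\<in>P. bar_wt v z V B) * (\<Prod>B\<in>Q. z E * v ^ (card B - 1))) (sp T)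
			= (case T of (V, P) => \<Prod>B\<in>P. bar_wt v z V B)"
		proof -
			have finP: "finite P"
				using finite_elements[OF _ D(6)] by simp
			have "(\<Prod>B\<in>P. bar_wt v z V B) =
					(\<Prod>B\<in>{B : P. B <= SD kap}. bar_wt v z V B) * (\<Prod>B\<in>{B : P. \<not> B <= SD kap}. bar_wt v z V B)"
				using finP by (subst prod.union_disjoint[symmetric]) (auto intro!: prod.cong)
			also have "(\<Prod>B\<in>{B : P. B <= SD kap}. bar_wt v z V B) =
					(\<Prod>B\<in>{B : P. B <= SD kap}. bar_wt v z (\<lambda>b\<in>SD kap - SD mu. V b) B)"
			proof (rule prod.cong[OF refl])
				fix B assume B: "B : {B : P. B <= SD kap}"
				have "(\<lambda>b\<in>SD kap - SD mu. V b) ` B = V ` B"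
					using Pb(1)[of B] B by (intro image_cong) auto
				then show "bar_wt v z V B = bar_wt v z (\<lambda>b\<in>SD kap - SD mu. V b) B" by (simp add: bar_wt_def)
			qed
			also have "(\<Prod>B\<in>{B : P. \<not> B <= SD kap}. bar_wt v z V B) =
					(\<Prod>B\<in>{B : P. \<not> B <= SD kap}. z E * v ^ (card B - 1))"
			proof (rule prod.cong[OF refl])
				fix B assume B: "B : {B : P. \<not> B <= SD kap}"
				have "V b = E" if "b : B" for b
					using Pb(1)[of B] dich[of B] B that VE[of b] by blast
				then have "V ` B = {E}" using Pb(2)[of B] B by auto
				then show "bar_wt v z V B = z E * v ^ (card B - 1)" by (simp add: bar_wt_def)
			qed
			finally show ?thesis unfolding spT by (simp only: case_prod_conv VP)
		qed
	next
		fix p assume p: "p : I"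
		obtain kap V P Q where pe: "p = (kap, (V, P), Q)" by (metis prod.exhaust)
		have kap: "strict_partition kap" and T: "(V, P) : bar_tableaux mu kap E" and Q: "Q : bars (SD lam - SD kap)"
			and st: "strip kap"
			using p by (auto simp: I_def pe below_def)
		note D = bar_tableauxD[OF T]
		have sub: "SD mu <= SD kap" "SD kap <= SD lam"
			using D(1) st by (auto simp: strip_def vstrip_def hstrip_def split: if_splits)
		define W where "W = (\<lambda>b\<in>SD lam - SD mu. if b : SD kap then V b else E)"
		have mkp: "mk p = (W, P \<union> Q)" by (simp add: mk_def pe W_def)
		have W1: "W b = V b" if "b : SD kap - SD mu" for b using that sub by (auto simp: W_def)
		have W2: "W b = E" if "b : SD lam - SD kap" for b using that sub by (auto simp: W_def)
		have W1E: "W b < E" if "b : SD kap - SD mu" for b using W1[OF that] D(3)[OF that] by simp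
		have cases: "b : SD kap - SD mu \<or> b : SD lam - SD kap" if "b : SD lam - SD mu" for b using that by blast
		have Qp: "partition_on (SD lam - SD kap) Q" using Q by (simp add: bars_def)
		have Qs: "B <= SD lam - SD kap" "B ~= {}" if "B : Q" for B
			using partition_onD1[OF Qp] partition_onD3[OF Qp] that by blast+
		have Ps: "B <= SD kap - SD mu" "B ~= {}" if "B : P" for B
			using partition_onD1[OF D(6)] partition_onD3[OF D(6)] that by blast+
		show "mk p : bar_tableaux mu lam (Suc E)"
			unfolding mkp
		proof (rule bar_tableauxI)
			show "SD mu <= SD lam" using sub by blast
			show "W : extensional (SD lam - SD mu)" by (simp add: W_def)
			show "W b < Suc E" if "b : SD lam - SD mu" for b
				using cases[OF that] W1E[of b] W2[of b] by fastforce
			show "W (i, j) ~= W (i', j)" if h: "(i, j) : SD lam - SD mu" "(i', j) : SD lam - SD mu" "i ~= i'" "\<not> primed (W (i, j))" for i i' j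
				using cases[OF h(1)] cases[OF h(2)]
			proof (elim disjE)
				assume a: "(i, j) : SD kap - SD mu" "(i', j) : SD kap - SD mu"
				show ?thesis using D(4)[OF a h(3)] h(4) W1[OF a(1)] W1[OF a(2)] by simp
			next
				assume a: "(i, j) : SD kap - SD mu" "(i', j) : SD lam - SD kap"
				show ?thesis using W1E[OF a(1)] W2[OF a(2)] by simp
			next
				assume a: "(i, j) : SD lam - SD kap" "(i', j) : SD kap - SD mu"
				show ?thesis using W1E[OF a(2)] W2[OF a(1)] by simp
			next
				assume a: "(i, j) : SD lam - SD kap" "(i', j) : SD lam - SD kap"
				then have "\<not> primed E" using W2[OF a(1)] h(4) by simp
				then have "i = i'" using st a unfolding strip_def hstrip_def by simp
				with h(3) show ?thesis by simp
			qed
			show "W (i, j) ~= W (i, j')" if h: "(i, j) : SD lam - SD mu" "(i, j') : SD lam - SD mu" "j ~= j'" "primed (W (i, j))" for i j j'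
				using cases[OF h(1)] cases[OF h(2)]
			proof (elim disjE)
				assume a: "(i, j) : SD kap - SD mu" "(i, j') : SD kap - SD mu"
				show ?thesis using D(5)[OF a h(3)] h(4) W1[OF a(1)] W1[OF a(2)] by simp
			next
				assume a: "(i, j) : SD kap - SD mu" "(i, j') : SD lam - SD kap"
				show ?thesis using W1E[OF a(1)] W2[OF a(2)] by simp
			next
				assume a: "(i, j) : SD lam - SD kap" "(i, j') : SD kap - SD mu"
				show ?thesis using W1E[OF a(2)] W2[OF a(1)] by simp
			next
				assume a: "(i, j) : SD lam - SD kap" "(i, j') : SD lam - SD kap"
				then have "primed E" using W2[OF a(1)] h(4) by simp
				then have "j = j'" using st a unfolding strip_def vstrip_def by simp
				with h(3) show ?thesis by simp
			qed
			show "partition_on (SD lam - SD mu) (P \<union> Q)"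
			proof (rule partition_onI)
				show "\<Union> (P \<union> Q) = SD lam - SD mu"
					unfolding Union_Un_distrib partition_onD1[OF D(6), symmetric] partition_onD1[OF Qp, symmetric] using sub by blast
				show "{} ~: P \<union> Q" using partition_onD3[OF D(6)] partition_onD3[OF Qp] by simp
				show "disjnt p q" if h: "p : P \<union> Q" "q : P \<union> Q" "p ~= q" for p q
				proof (cases "p : P"; cases "q : P")
					assume "p : P" "q : P"
					then show ?thesis using partition_onD2[OF D(6)] h(3) by (auto simp: disjoint_def disjnt_def)
				next
					assume "p : P" "q ~: P"
					then show ?thesis using Ps(1)[of p] Qs(1)[of q] h unfolding disjnt_def by blast
				next
					assume "p ~: P" "q : P"
					then show ?thesis using Ps(1)[of q] Qs(1)[of p] h unfolding disjnt_def by blast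
				next
					assume "p ~: P" "q ~: P"
					then show ?thesis using partition_onD2[OF Qp] h by (auto simp: disjoint_def disjnt_def)
				qed
			qed
			show "is_bar W B" if "B : P \<union> Q" for B
			proof (cases "B : P")
				case True
				then show ?thesis using is_bar_cong[of B W V] W1 Ps(1)[OF True] D(7)[OF True] by blast
			next
				case False
				then have B: "B : Q" using that by blast
				have "\<forall>b\<in>B. W b = E" using W2 Qs(1)[OF B] by blast
				moreover have "\<exists>i a b. B = {i} \<times> {a..b} \<or> B = {a..b} \<times> {i}" using Q B by (simp add: bars_def)
				ultimately show ?thesis using Qs(2)[OF B] unfolding is_bar_def by simp
			qed
			show "W (i, j) <= W (i, j')" if h: "(i, j) : SD lam - SD mu" "(i, j') : SD lam - SD mu" "j <= j'" for i j j'
			proof (cases "(i, j') : SD kap")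
				case True
				then have k: "(i, j) : SD kap"
					using SD_geom(2)[OF kap True, of j] SD_geom(1)[OF lam, of i j] h by simp
				show ?thesis using D(8)[of i j j'] h k True W1[of "(i, j)"] W1[of "(i, j')"] by simp
			next
				case False
				then have "W (i, j') = E" using W2 h by simp
				moreover have "W (i, j) <= E" using cases[OF h(1)] W1E[of "(i, j)"] W2[of "(i, j)"] by fastforce
				ultimately show ?thesis by simp
			qed
			show "W (i, j) <= W (i', j)" if h: "(i, j) : SD lam - SD mu" "(i', j) : SD lam - SD mu" "i <= i'" for i i' j
			proof (cases "(i', j) : SD kap")
				case True
				then have k: "(i, j) : SD kap"
					using SD_geom(3)[OF kap True, of i] h by simp
				show ?thesis using D(9)[of i j i'] h k True W1[of "(i, j)"] W1[of "(i', j)"] by simp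
			next
				case False
				then have "W (i', j) = E" using W2 h by simp
				moreover have "W (i, j) <= E" using cases[OF h(1)] W1E[of "(i, j)"] W2[of "(i, j)"] by fastforce
				ultimately show ?thesis by simp
			qed
		qed
		have lowW: "low W = SD kap"
		proof (intro equalityI subsetI)
			fix b assume b: "b : low W"
			show "b : SD kap"
			proof (rule ccontr)
				assume n: "b ~: SD kap"
				then have "b : SD lam - SD kap" "W b < E" using b sub unfolding low_def by blast+
				then show False using W2 by simp
			qed
		next
			fix b assume "b : SD kap"
			then show "b : low W" using W1E[of b] sub unfolding low_def by blast
		qed
		have "kp W = kap" by (rule kp_eq[OF kap lowW[symmetric]])
		moreover have "(\<lambda>b\<in>SD kap - SD mu. W b) = V"
		proof
			fix b
			show "(\<lambda>b\<in>SD kap - SD mu. W b) b = V b"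
			proof (cases "b : SD kap - SD mu")
				case True
				then show ?thesis using W1[OF True] by simp
			next
				case False
				then show ?thesis unfolding restrict_apply if_not_P[OF False] by (rule extensional_arb[OF D(2), symmetric])
			qed
		qed
		moreover have "{B : P \<union> Q. B <= SD kap} = P"
		proof (intro equalityI subsetI)
			fix B assume "B : {B : P \<union> Q. B <= SD kap}"
			then show "B : P" using Qs[of B] by blast
		next
			fix B assume "B : P"
			then show "B : {B : P \<union> Q. B <= SD kap}" using Ps(1)[of B] by blast
		qed
		moreover have "{B : P \<union> Q. \<not> B <= SD kap} = Q"
		proof (intro equalityI subsetI)
			fix B assume "B : {B : P \<union> Q. \<not> B <= SD kap}"
			then show "B : Q" using Ps(1)[of B] by blast
		next
			fix B assume "B : Q"
			then show "B : {B : P \<union> Q. \<not> B <= SD kap}" using Qs[of B] by blast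
		qed
		ultimately show "sp (mk p) = p"
			unfolding mkp unfolding sp_def pe case_prod_conv lowW by (simp only:)
	qed
	also have "... = (\<Sum>kap\<in>{kap : below Strict (sz lam). strip kap}. \<Sum>((V, P), Q)\<in>bar_tableaux mu kap E \<times> bars (SD lam - SD kap).
			(\<Prod>B\<in>P. bar_wt v z V B) * (\<Prod>B\<in>Q. z E * v ^ (card B - 1)))"
		unfolding I_def by (rule sum.Sigma[symmetric]) (auto intro!: finite_bar_tableaux finite_bars)
	also have "... = (\<Sum>kap\<in>{kap : below Strict (sz lam). strip kap}. bar_sum v z E mu kap *
			(\<Sum>Q\<in>bars (SD lam - SD kap). \<Prod>B\<in>Q. z E * v ^ (card B - 1)))"
		unfolding bar_sum_def sum_product sum.cartesian_product by (simp add: case_prod_unfold)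
	also have "... = (\<Sum>kap\<in>below Strict (sz lam). if strip kap then bar_sum v z E mu kap *
			(\<Sum>Q\<in>bars (SD lam - SD kap). \<Prod>B\<in>Q. z E * v ^ (card B - 1)) else 0)"
		by (rule sum.inter_filter) simp
	also have "... = (\<Sum>kap\<in>below Strict (sz lam). bar_sum v z E mu kap * strip_sum v E (z E) kap lam)"
		by (rule sum.cong) (auto simp: strip_sum_def strip_def)
	finally show ?thesis .
qed

lemma bar_sum_0:
	assumes "strict_partition lam" "strict_partition mu"
	shows "bar_sum v z 0 mu lam = (if mu = lam then 1 else 0)"
proof (cases "mu = lam")
	case True
	have "bar_tableaux lam lam 0 = {(%_. undefined, {})}"
	proof (intro equalityI subsetI)
		fix T assume T: "T : bar_tableaux lam lam 0"
		obtain V P where VP: "T = (V, P)" by fastforce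
		note D = bar_tableauxD[OF T[unfolded VP]]
		have "P = {}" using partition_onD1[OF D(6)] partition_onD3[OF D(6)] by auto
		moreover have "V = (%_. undefined)" using D(2) by simp
		ultimately show "T : {(%_. undefined, {})}" by (simp add: VP)
	next
		fix T :: "(nat \<times> nat => nat) \<times> (nat \<times> nat) set set" assume "T : {(%_. undefined, {})}"
		then show "T : bar_tableaux lam lam 0" by (simp, intro bar_tableauxI) (simp_all add: partition_on_def)
	qed
	then show ?thesis using True by (simp add: bar_sum_def)
next
	case False
	have "bar_tableaux mu lam 0 = {}"
	proof (rule ccontr)
		assume "bar_tableaux mu lam 0 ~= {}"
		then obtain V P where T: "(V, P) : bar_tableaux mu lam 0" by fastforce
		note D = bar_tableauxD[OF T]
		have "SD lam - SD mu = {}" using D(3) by blast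
		then have "SD lam = SD mu" using D(1) by blast
		then show False using SD_inj[OF assms] False by simp
	qed
	then show ?thesis using False by (simp add: bar_sum_def)
qed

lemma bar_sum_chain:
	assumes "strict_partition lam" "strict_partition mu"
	shows "bar_sum v z E mu lam = chain Strict (%e. strip_sum v e (z e)) E mu lam"
	using assms(1)
proof (induction E arbitrary: lam)
	case (Suc E)
	show ?case unfolding bar_sum_Suc[OF Suc.prems assms(2)] chain.simps
		by (rule sum.cong[OF refl]) (simp add: Suc.IH below_def)
qed (simp add: bar_sum_0 assms(2))

section \<open>The transfer operators of one variable\<close>

text \<open>The letters \<open>2 * i\<close> and \<open>Suc (2 * i)\<close> belong to one variable,
  so their two steps are fused into one.\<close>

lemma chain_pairs:
	assumes fin: "\<And>d. finite (below Sh d)"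
		and low: "\<And>i ka lam. A i ka lam ~= 0 ==> sz ka <= sz lam"
	shows "chain Sh A (2 * N) mu lam =
		chain Sh (%i ka lam. \<Sum>nu\<in>below Sh (sz lam). A (2 * i) ka nu * A (Suc (2 * i)) nu lam) N mu lam"
proof (induction N arbitrary: lam)
	case (Suc N)
	let ?B = "below Sh (sz lam)"
	have "chain Sh A (2 * Suc N) mu lam =
			(\<Sum>nu\<in>?B. (\<Sum>ka\<in>below Sh (sz nu). chain Sh A (2 * N) mu ka * A (2 * N) ka nu) * A (Suc (2 * N)) nu lam)"
		by simp
	also have "... = (\<Sum>nu\<in>?B. (\<Sum>ka\<in>?B. chain Sh A (2 * N) mu ka * A (2 * N) ka nu) * A (Suc (2 * N)) nu lam)"
	proof (rule sum.cong[OF refl], rule arg_cong2[where f = "(*)", OF _ refl], rule sum.mono_neutral_left[OF fin])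
		fix nu assume nu: "nu : ?B"
		show "below Sh (sz nu) <= ?B" using nu by (auto simp: below_def)
		show "\<forall>ka\<in>?B - below Sh (sz nu). chain Sh A (2 * N) mu ka * A (2 * N) ka nu = 0"
		proof
			fix ka assume "ka : ?B - below Sh (sz nu)"
			then have "\<not> sz ka <= sz nu" by (auto simp: below_def)
			then have "A (2 * N) ka nu = 0" using low by blast
			then show "chain Sh A (2 * N) mu ka * A (2 * N) ka nu = 0" by simp
		qed
	qed
	also have "... = (\<Sum>ka\<in>?B. \<Sum>nu\<in>?B. chain Sh A (2 * N) mu ka * A (2 * N) ka nu * A (Suc (2 * N)) nu lam)"
		unfolding sum_distrib_right by (rule sum.swap)
	finally show ?case by (simp add: Suc sum_distrib_left mult.assoc)
qed simp

text \<open>Sums over shapes become sums over words of fixed length. Some words encode shapes larger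
  than \<open>d\<close>, so these must be known to carry no weight.\<close>

lemma sum_below_words:
	assumes "d <= N" "\<And>cs. cs : words N ==> f cs ~= 0 ==> card (shape cs) <= d"
	shows "(\<Sum>nu\<in>below Strict d. f (word N nu)) = (\<Sum>cs\<in>words N. f cs)"
proof -
	have parts: "\<forall>p\<in>set nu. p <= N" if "nu : below Strict d" for nu
		using that assms(1) parts_le[of _ nu] by (force simp: below_def)
	have inj: "inj_on (word N) (below Strict d)"
	proof (rule inj_onI)
		fix nu rho assume a: "nu : below Strict d" "rho : below Strict d" "word N nu = word N rho"
		show "nu = rho"
			by (rule word_inj[OF _ _ parts[OF a(1)] parts[OF a(2)] a(3)]) (use a in \<open>auto simp: below_def\<close>)
	qed
	have "(\<Sum>nu\<in>below Strict d. f (word N nu)) = (\<Sum>cs\<in>word N ` below Strict d. f cs)"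
		by (simp add: sum.reindex[OF inj])
	also have "... = (\<Sum>cs\<in>words N. f cs)"
	proof (rule sum.mono_neutral_left)
		show "word N ` below Strict d <= words N" by auto
		show "\<forall>cs\<in>words N - word N ` below Strict d. f cs = 0"
		proof
			fix cs assume cs: "cs : words N - word N ` below Strict d"
			then have "length cs = N" by (simp add: words_def)
			then obtain nu where nu: "strict_partition nu" "\<forall>p\<in>set nu. p <= N" "word N nu = cs" by (rule word_surj)
			have "card (shape cs) = sz nu" using SD_word[OF nu(1,2)] nu(3) by (simp add: card_SD[symmetric])
			moreover have "nu ~: below Strict d" using cs nu(3) by blast
			ultimately have "\<not> card (shape cs) <= d" using nu(1) by (simp add: below_def)
			then show "f cs = 0" using assms(2) cs by blast
		qed
	qed simp
	finally show ?thesis .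
qed

definition gp_step :: "'a::comm_ring_1 => 'a => nat list => nat list => 'a" where
	"gp_step \<beta> x ka lam = (\<Sum>nu\<in>below Strict (sz lam). ext_sum \<beta> 0 x ka nu * ext_sum \<beta> 1 x nu lam)"

definition jq_step :: "'a::comm_ring_1 => 'a => nat list => nat list => 'a" where
	"jq_step v t ka lam = (\<Sum>nu\<in>below Strict (sz lam). strip_sum v 0 t ka nu * strip_sum v 1 t nu lam)"

lemma ext_sum_parity: "ext_sum \<beta> (2 * i) x = ext_sum \<beta> 0 x" "ext_sum \<beta> (Suc (2 * i)) x = ext_sum \<beta> 1 x"
	and strip_sum_parity: "strip_sum v (2 * i) t = strip_sum v 0 t" "strip_sum v (Suc (2 * i)) t = strip_sum v 1 t"
	by (auto simp: fun_eq_iff ext_sum_def strip_sum_def)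

lemma ext_sum_subset: "ext_sum \<beta> E x ka lam ~= 0 ==> SD ka <= SD lam"
	by (rule ccontr) (simp add: ext_sum_def ext_sets_def)

lemma strip_sum_subset: "strip_sum v E t ka lam ~= 0 ==> SD ka <= SD lam"
	by (auto simp: strip_sum_def vstrip_def hstrip_def split: if_splits)

lemma SD_subset_sum: "SD ka <= SD lam ==> sz ka <= sz lam"
	unfolding card_SD[symmetric] by (rule card_mono[OF finite_SD])

lemma ext_sum_sum: "ext_sum \<beta> E x ka lam ~= 0 ==> sz ka <= sz lam"
	and strip_sum_sum: "strip_sum v E t ka lam ~= 0 ==> sz ka <= sz lam"
	using SD_subset_sum ext_sum_subset strip_sum_subset by blast+

lemma gp_step_subset:
	assumes "gp_step \<beta> x ka lam ~= 0" shows "SD ka <= SD lam"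
proof -
	obtain nu where "ext_sum \<beta> 0 x ka nu * ext_sum \<beta> 1 x nu lam ~= 0"
		using assms unfolding gp_step_def by (rule sum.not_neutral_contains_not_neutral)
	then show ?thesis using ext_sum_subset[of \<beta> 0 x ka nu] ext_sum_subset[of \<beta> 1 x nu lam] mult_neq_zeroD by blast
qed

lemma jq_step_subset:
	assumes "jq_step v t ka lam ~= 0" shows "SD ka <= SD lam"
proof -
	obtain nu where "strip_sum v 0 t ka nu * strip_sum v 1 t nu lam ~= 0"
		using assms unfolding jq_step_def by (rule sum.not_neutral_contains_not_neutral)
	then show ?thesis using strip_sum_subset[of v 0 t ka nu] strip_sum_subset[of v 1 t nu lam] mult_neq_zeroD by blast
qed

text \<open>The primed letter is the smaller one, so its vertical strip is added first. The two
  single-letter sums are then fused by \<open>ucol_urow\<close>.\<close>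

lemma gp_step_word:
	assumes s: "strict_partition ka" "strict_partition lam" and N: "sz ka <= N" "sz lam <= N"
	shows "gp_step \<beta> x ka lam = uop (1 + \<beta> * x) x ufin (word N ka) (word N lam)"
proof -
	let ?w = "1 + \<beta> * x"
	define f where "f = (%cs. transfer (ucol ?w x) lfin (False, True) (word N ka) cs *
			(transfer (urow ?w x) lfin (False, False) cs (word N lam) + transfer (urow ?w x) lfin (True, False) cs (word N lam)))"
	have "ext_sum \<beta> 0 x ka nu * ext_sum \<beta> 1 x nu lam = f (word N nu)" if nu: "nu : below Strict (sz lam)" for nu
	proof -
		have w: "SD ka = shape (word N ka)" "SD nu = shape (word N nu)" "SD lam = shape (word N lam)"
			using s N nu by (auto simp: below_def intro!: SD_word_sum)
		show ?thesis unfolding f_def ext_sum_def w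
			using row_letter_sum[of "word N nu" N "word N lam" "1 + \<beta> * x" \<beta> x, OF length_word length_word refl]
				col_letter_sum[of "word N ka" N "word N nu" "1 + \<beta> * x" \<beta> x, OF length_word length_word refl] by simp
	qed
	then have "gp_step \<beta> x ka lam = (\<Sum>nu\<in>below Strict (sz lam). f (word N nu))"
		unfolding gp_step_def by (rule sum.cong[OF refl])
	also have "... = (\<Sum>cs\<in>words N. f cs)"
	proof (rule sum_below_words[OF N(2)])
		fix cs assume cs: "cs : words N" "f cs ~= 0"
		then have "transfer (urow ?w x) lfin (False, False) cs (word N lam) + transfer (urow ?w x) lfin (True, False) cs (word N lam) ~= 0"
			unfolding f_def by (auto dest: mult_neq_zeroD)
		then have "(\<Sum>X\<in>ext_sets False (shape cs) (shape (word N lam)). \<Prod>b\<in>X. if b : shape cs then \<beta> * x else x) ~= 0"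
			using row_letter_sum[of cs N "word N lam" ?w \<beta> x] cs(1) by (simp add: words_def)
		then have "ext_sets False (shape cs) (shape (word N lam)) ~= {}" by (metis sum.empty)
		then have "shape cs <= shape (word N lam)" unfolding ext_sets_def by blast
		then show "card (shape cs) <= sz lam"
			using card_mono[OF finite_shape] SD_word_sum[OF s(2) N(2)] by (metis card_SD)
	qed
	also have "... = uop ?w x ufin (word N ka) (word N lam)"
		using ucol_urow[of "word N ka" "word N lam" ?w x "(False, True)" "(False, False)"]
			ucol_urow[of "word N ka" "word N lam" ?w x "(False, True)" "(True, False)"]
		by (simp add: f_def distrib_left sum.distrib uop_def)
	finally show ?thesis .
qed

lemma jq_step_word:
	assumes s: "strict_partition ka" "strict_partition lam" and N: "sz ka <= N" "sz lam <= N"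
	shows "jq_step v t ka lam = dop (t + v) t dfin (word N ka) (word N lam)"
proof -
	define f where "f = (%cs. (transfer (dcol (t + v) t) lfin (False, False) (word N ka) cs + transfer (dcol (t + v) t) lfin (True, False) (word N ka) cs) *
			(transfer (drow (t + v) t) lfin (False, False) cs (word N lam) + transfer (drow (t + v) t) lfin (True, False) cs (word N lam)))"
	have "strip_sum v 0 t ka nu * strip_sum v 1 t nu lam = f (word N nu)" if nu: "nu : below Strict (sz lam)" for nu
	proof -
		have w: "SD ka = shape (word N ka)" "SD nu = shape (word N nu)" "SD lam = shape (word N lam)"
			using s N nu by (auto simp: below_def intro!: SD_word_sum)
		show ?thesis unfolding f_def strip_sum_def w
			using row_bars_sum[of "word N nu" N "word N lam" t v, OF length_word length_word]
				col_bars_sum[of "word N ka" N "word N nu" t v, OF length_word length_word] by simp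
	qed
	then have "jq_step v t ka lam = (\<Sum>nu\<in>below Strict (sz lam). f (word N nu))"
		unfolding jq_step_def by (rule sum.cong[OF refl])
	also have "... = (\<Sum>cs\<in>words N. f cs)"
	proof (rule sum_below_words[OF N(2)])
		fix cs assume cs: "cs : words N" "f cs ~= 0"
		then have "transfer (drow (t + v) t) lfin (False, False) cs (word N lam) + transfer (drow (t + v) t) lfin (True, False) cs (word N lam) ~= 0"
			unfolding f_def by (auto dest: mult_neq_zeroD)
		then have "hstrip (shape cs) (shape (word N lam))"
			using row_bars_sum[of cs N "word N lam" t v] cs(1) by (auto simp: words_def split: if_splits)
		then have "shape cs <= shape (word N lam)" by (simp add: hstrip_def)
		then show "card (shape cs) <= sz lam"
			using card_mono[OF finite_shape] SD_word_sum[OF s(2) N(2)] by (metis card_SD)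
	qed
	also have "... = dop (t + v) t dfin (word N ka) (word N lam)"
		using dcol_drow[of "word N ka" "word N lam" "t + v" t "(False, False)" "(False, False)"]
			dcol_drow[of "word N ka" "word N lam" "t + v" t "(False, False)" "(True, False)"]
			dcol_drow[of "word N ka" "word N lam" "t + v" t "(True, False)" "(False, False)"]
			dcol_drow[of "word N ka" "word N lam" "t + v" t "(True, False)" "(True, False)"]
		by (simp add: f_def distrib_left distrib_right sum.distrib dop_def add_ac)
	finally show ?thesis .
qed

text \<open>Every box outside the smaller shape contains the letter and contributes a factor
  \<open>x\<close>.\<close>

lemma ext_sum_dvd: "x ^ (sz lam - sz ka) dvd ext_sum \<beta> E x ka lam"
proof (cases "SD ka <= SD lam")
	case True
	show ?thesis unfolding ext_sum_def
	proof (rule dvd_sum)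
		fix X assume X: "X : ext_sets (primed E) (SD ka) (SD lam)"
		then have sub: "SD lam - SD ka <= X" "X <= SD lam" by (auto simp: ext_sets_def)
		have "finite X" using sub(2) finite_SD finite_subset by blast
		then have c: "sz lam - sz ka <= card X"
			using card_mono[OF _ sub(1)] card_Diff_subset[OF finite_SD True] by (simp add: card_SD)
		have "(\<Prod>b\<in>X. x) dvd (\<Prod>b\<in>X. if b : SD ka then \<beta> * x else x)"
			by (rule prod_dvd_prod) auto
		then have "x ^ card X dvd (\<Prod>b\<in>X. if b : SD ka then \<beta> * x else x)" by simp
		then show "x ^ (sz lam - sz ka) dvd (\<Prod>b\<in>X. if b : SD ka then \<beta> * x else x)"
			using le_imp_power_dvd[OF c] dvd_trans by blast
	qed
next
	case False
	then have "ext_sum \<beta> E x ka lam = 0" using ext_sum_subset by blast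
	then show ?thesis by simp
qed

lemma gp_step_dvd: "x ^ (sz lam - sz ka) dvd gp_step \<beta> x ka lam"
	unfolding gp_step_def
proof (rule dvd_sum)
	fix nu
	show "x ^ (sz lam - sz ka) dvd ext_sum \<beta> 0 x ka nu * ext_sum \<beta> 1 x nu lam"
	proof (cases "ext_sum \<beta> 0 x ka nu = 0 \<or> ext_sum \<beta> 1 x nu lam = 0")
		case False
		then have "sz ka <= sz nu" "sz nu <= sz lam" using ext_sum_sum by blast+
		then have e: "x ^ (sz lam - sz ka) = x ^ (sz nu - sz ka) * x ^ (sz lam - sz nu)"
			by (simp flip: power_add)
		show ?thesis unfolding e by (rule mult_dvd_mono[OF ext_sum_dvd ext_sum_dvd])
	qed auto
qed

lemma fps_X_power_dvd_nth: "fps_X ^ k dvd f ==> r < k ==> f $ r = (0 :: 'a::comm_ring_1)"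
	by (auto elim!: dvdE simp: fps_X_power_mult_nth)

text \<open>The degree in X counts bars, and there are at most as many bars as boxes.\<close>

lemma strip_sum_nth:
	assumes "strip_sum (fps_const v) E fps_X ka lam $ r ~= (0 :: 'a::comm_ring_1)"
	shows "sz ka + r <= sz lam"
proof -
	have ne: "strip_sum (fps_const v) E fps_X ka lam ~= 0" using assms by auto
	have sub: "SD ka <= SD lam" by (rule strip_sum_subset[OF ne])
	have "strip_sum (fps_const v) E fps_X ka lam =
			(\<Sum>Q\<in>bars (SD lam - SD ka). \<Prod>B\<in>Q. fps_X * fps_const v ^ (card B - 1))"
		using ne unfolding strip_sum_def by (simp split: if_splits)
	then have "(\<Sum>Q\<in>bars (SD lam - SD ka). (\<Prod>B\<in>Q. fps_X * fps_const v ^ (card B - 1)) $ r) ~= 0"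
		using assms by (simp add: fps_sum_nth)
	then obtain Q where Q: "Q : bars (SD lam - SD ka)" "(\<Prod>B\<in>Q. fps_X * fps_const v ^ (card B - 1)) $ r ~= 0"
		by (rule sum.not_neutral_contains_not_neutral)
	have p: "partition_on (SD lam - SD ka) Q" using Q(1) by (simp add: bars_def)
	have fin: "finite (SD lam - SD ka)" by simp
	have "(fps_X ^ card Q * fps_const v ^ (card (SD lam - SD ka) - card Q)) $ r ~= 0"
		using Q(2) unfolding partition_weight[OF fin p] .
	then have "r = card Q" by (simp add: fps_const_power fps_X_power_mult_nth split: if_splits)
	moreover have "card Q <= card (SD lam - SD ka)"
	proof -
		have finB: "finite B" if "B : Q" for B
		proof -
			have "B <= SD lam - SD ka" using that partition_onD1[OF p] by blast
			then show ?thesis by (rule finite_subset[OF _ fin])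
		qed
		have "card Q = (\<Sum>B\<in>Q. 1)" by simp
		also have "... <= (\<Sum>B\<in>Q. card B)"
		proof (rule sum_mono)
			fix B assume "B : Q"
			then have "B ~= {}" "B <= SD lam - SD ka" using partition_onD1[OF p] partition_onD3[OF p] by blast+
			then show "1 <= card B" using finB[OF \<open>B : Q\<close>] by (simp add: Suc_le_eq card_gt_0_iff)
		qed
		also have "... = card (\<Union>Q)"
		proof (rule card_Union_disjoint[symmetric])
			show "pairwise disjnt Q" using partition_onD2[OF p] unfolding disjoint_def pairwise_def disjnt_def by blast
		qed (rule finB)
		also have "\<Union>Q = SD lam - SD ka" using partition_onD1[OF p] by simp
		finally show ?thesis .
	qed
	moreover have "card (SD lam - SD ka) = sz lam - sz ka"
		using card_Diff_subset[OF finite_SD sub] by (simp add: card_SD)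
	moreover have "sz ka <= sz lam" by (rule SD_subset_sum[OF sub])
	ultimately show ?thesis by simp
qed

lemma jq_step_nth:
	assumes "jq_step (fps_const v) fps_X ka lam $ r ~= (0 :: 'a::comm_ring_1)"
	shows "sz ka + r <= sz lam"
proof -
	have "(\<Sum>nu\<in>below Strict (sz lam). (strip_sum (fps_const v) 0 fps_X ka nu * strip_sum (fps_const v) 1 fps_X nu lam) $ r) ~= 0"
		using assms by (simp add: jq_step_def fps_sum_nth)
	then obtain nu where "(strip_sum (fps_const v) 0 fps_X ka nu * strip_sum (fps_const v) 1 fps_X nu lam) $ r ~= 0"
		by (rule sum.not_neutral_contains_not_neutral)
	then have "(\<Sum>i=0..r. strip_sum (fps_const v) 0 fps_X ka nu $ i * strip_sum (fps_const v) 1 fps_X nu lam $ (r - i)) ~= 0"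
		by (simp add: fps_mult_nth)
	then obtain i where i: "i : {0..r}" "strip_sum (fps_const v) 0 fps_X ka nu $ i * strip_sum (fps_const v) 1 fps_X nu lam $ (r - i) ~= 0"
		by (rule sum.not_neutral_contains_not_neutral)
	have "sz ka + i <= sz nu" "sz nu + (r - i) <= sz lam"
		using strip_sum_nth[of v 0 ka nu i] strip_sum_nth[of v 1 nu lam "r - i"] mult_neq_zeroD[OF i(2)] by blast+
	with i(1) show ?thesis by simp
qed

subsection \<open>Number of parts and leading coefficients\<close>

text \<open>Particles are conserved, except for one that may already be in flight at the start.
  Hence one variable adds at most one part.\<close>

lemma transfer_uweight_ones:
	"length as = length bs ==> transfer (uweight w x) ufin s as bs ~= 0 ==> ones bs = ones as + of_bool (s = UM)"
proof (induction as bs arbitrary: s rule: list_induct2)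
	case Nil then show ?case by (auto simp: ufin_def split: if_splits)
next
	case (Cons a as b bs)
	obtain s' where s': "uweight w x s a b s' * transfer (uweight w x) ufin s' as bs ~= 0"
		using Cons.prems unfolding transfer.simps by (rule sum.not_neutral_contains_not_neutral)
	then have "ones bs = ones as + of_bool (s' = UM)" "uweight w x s a b s' ~= 0"
		using Cons.IH[of s'] mult_neq_zeroD[OF s'] by auto
	then show ?case by (cases s; cases s'; cases a; cases b) (auto simp: uweight_def split: if_splits)
qed

lemma transfer_dweight_ones:
	"length as = length bs ==> transfer (dweight u t) dfin s as bs ~= 0 ==> ones bs = ones as + of_bool (s ~= DZ)"
proof (induction as bs arbitrary: s rule: list_induct2)
	case Nil then show ?case by (auto simp: dfin_def split: if_splits)
next
	case (Cons a as b bs)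
	obtain s' where s': "dweight u t s a b s' * transfer (dweight u t) dfin s' as bs ~= 0"
		using Cons.prems unfolding transfer.simps by (rule sum.not_neutral_contains_not_neutral)
	then have "ones bs = ones as + of_bool (s' ~= DZ)" "dweight u t s a b s' ~= 0"
		using Cons.IH[of s'] mult_neq_zeroD[OF s'] by auto
	then show ?case by (cases s; cases s'; cases a; cases b) (auto simp: dweight_def split: if_splits)
qed

lemma uop_ones: "length as = length bs ==> uop w x ufin as bs ~= 0 ==> ones bs <= Suc (ones as)"
	using transfer_uweight_ones[of as bs w x UL] transfer_uweight_ones[of as bs w x UM]
	by (cases "transfer (uweight w x) ufin UL as bs = 0"; cases "transfer (uweight w x) ufin UM as bs = 0") (auto simp: uop_def)

lemma dop_ones: "length as = length bs ==> dop u t dfin as bs ~= 0 ==> ones bs <= Suc (ones as)"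
	using transfer_dweight_ones[of as bs u t DZ] transfer_dweight_ones[of as bs u t DP] transfer_dweight_ones[of as bs u t DQ]
	by (cases "transfer (dweight u t) dfin DZ as bs = 0"; cases "transfer (dweight u t) dfin DP as bs = 0";
			cases "transfer (dweight u t) dfin DQ as bs = 0") (auto simp: dop_def)

lemma ones_word:
	assumes "strict_partition lam" "sz lam <= N"
	shows "ones (word N lam) = length lam"
proof -
	have "sorted_wrt (>) lam" "0 ~: set lam" using assms(1) by (auto simp: strict_partition_def)
	then have "distinct lam" by (auto simp: distinct_conv_nth sorted_wrt_iff_nth_less) (metis less_irrefl linorder_neqE_nat)
	have "ones (word N lam) = ht (word N lam) 0" by (simp add: ht_def)
	also have "... = card {a : set lam. 0 < a}"
		using assms(2) parts_le[of _ lam] by (intro ht_word) (auto intro: order_trans)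
	also have "{a : set lam. 0 < a} = set lam" using \<open>0 ~: set lam\<close> by (auto intro: gr0I)
	finally show ?thesis using \<open>distinct lam\<close> by (simp add: distinct_card)
qed

lemma SD_subset_rows:
	assumes "strict_partition ka" "SD ka <= SD lam" "i < length ka"
	shows "i < length lam" "ka ! i <= lam ! i"
proof -
	have pos: "ka ! i > 0" using assms(1,3) by (simp add: strict_partition_def)
	have "(i, i + (ka ! i - 1)) : SD ka"
		unfolding SD_def by (intro CollectI exI[of _ i] exI[of _ "ka ! i - 1"]) (use assms(3) pos in simp)
	then have "(i, i + (ka ! i - 1)) : SD lam" using assms(2) by blast
	then have "i < length lam & ka ! i - 1 < lam ! i" unfolding SD_def by auto
	with pos show "i < length lam" "ka ! i <= lam ! i" by auto
qed

lemma SD_subset_length: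
	assumes "strict_partition ka" "SD ka <= SD lam"
	shows "length ka <= length lam"
	using SD_subset_rows(1)[OF assms, of "length ka - 1"] by (cases "length ka") auto

text \<open>The new row is the smallest part so far. The two words differ only at its site, and all
  earlier sites are empty.\<close>

lemma words_take:
	assumes lam: "strict_partition lam" and j: "j < length lam"
	obtains p rest where "lam ! j = Suc p"
		"word (sz lam) (take j lam) = replicate p False @ False # rest"
		"word (sz lam) (take (Suc j) lam) = replicate p False @ True # rest"
proof -
	obtain p where p: "lam ! j = Suc p" using lam j by (metis strict_partition_def gr0_implies_Suc nth_mem)
	let ?N = "sz lam"
	have big: "a > Suc p" if "a : set (take j lam)" for a
	proof -
		obtain i where "i < j" "a = lam ! i" using \<open>a : set (take j lam)\<close> j by (auto simp: in_set_conv_nth)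
		then have "lam ! j < a" using lam j by (simp add: strict_partition_def sorted_wrt_iff_nth_less)
		then show ?thesis using p by simp
	qed
	have nb: "Suc i ~: set (take j lam)" if "i < p" for i
	proof
		assume "Suc i : set (take j lam)"
		then have "Suc p < Suc i" by (rule big)
		with that show False by simp
	qed
	have t: "set (take (Suc j) lam) = insert (Suc p) (set (take j lam))" using j p by (simp add: take_Suc_conv_app_nth)
	have pN: "p < ?N" using parts_le[OF nth_mem[OF j]] p by simp
	let ?r = "map (%k. Suc k : set (take j lam)) [Suc p..<?N]"
	have split: "[0..<?N] = [0..<p] @ p # [Suc p..<?N]"
		using pN by (metis less_imp_add_positive upt_add_eq_append upt_conv_Cons le0 less_or_eq_imp_le add_0 le_add_diff_inverse)
	have "word ?N (take j lam) = replicate p False @ False # ?r"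
		unfolding word_def split by (auto simp: map_replicate_trivial simp: nb intro!: nth_equalityI dest: big)
	moreover have "word ?N (take (Suc j) lam) = replicate p False @ True # ?r"
		unfolding word_def split t by (auto simp: nb intro!: nth_equalityI dest: big)
	ultimately show ?thesis using that p by blast
qed

lemma transfer_replicate_UM:
	"transfer (uweight w x) ufin UM (replicate p False @ as) (replicate p False @ bs) = x ^ p * transfer (uweight w x) ufin UM as bs"
	by (induction p) (auto simp: sum_ustate uweight_def mult.assoc)

text \<open>Without a particle in flight an empty site cannot become occupied.\<close>

lemma transfer_replicate_UE:
	"transfer (uweight w x) ufin UE (replicate p False @ False # as) (replicate p False @ True # bs) = 0"
	by (induction p) (auto simp: sum_ustate uweight_def)

lemma transfer_replicate_UL:
	"transfer (uweight w x) ufin UL (replicate p False @ False # as) (replicate p False @ True # bs) = 0"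
	using transfer_replicate_UE by (cases p) (auto simp: sum_ustate uweight_def)

lemma transfer_same_nth_0:
	assumes "w $ 0 = (1 :: 'a::comm_ring_1)" "s ~= UM"
	shows "transfer (uweight w x) ufin s as as $ 0 = 1"
	using assms(2)
proof (induction as arbitrary: s)
	case (Cons a as)
	then show ?case using assms(1) by (cases s; cases a) (auto simp: sum_ustate uweight_def fps_mult_nth)
qed (auto simp: ufin_def)

lemma transfer_replicate_DZ:
	"transfer (dweight u t) dfin DZ (replicate p False @ False # as) (replicate p False @ True # bs) = 0"
	by (induction p) (auto simp: sum_dstate dweight_def)

lemma transfer_replicate_DQ:
	"transfer (dweight u t) dfin DQ (replicate p False @ as) (replicate p False @ bs) = u ^ p * transfer (dweight u t) dfin DQ as bs"
	by (induction p) (auto simp: sum_dstate dweight_def mult.assoc)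

lemma transfer_same_DZ: "transfer (dweight u t) dfin DZ as as = 1"
	by (induction as) (auto simp: sum_dstate dweight_def dfin_def)

lemma strict_take: "strict_partition lam ==> strict_partition (take j lam)"
	using Strict.take[of lam j] by simp

lemma sum_list_take_le: "sz (take j lam) <= sz (lam :: nat list)"
	by (metis append_take_drop_id le_add1 sum_list_append)

text \<open>The new particle pays \<open>x\<close> on entering and at each of the \<open>p\<close>
  empty sites it crosses. The rest of the word stays unchanged, and its weight has constant term
  1.\<close>

lemma gp_step_lead:
	assumes lam: "strict_partition lam" and j: "j < length lam"
	shows "gp_step (fps_const b) fps_X (take j lam) (take (Suc j) lam) $ (lam ! j) = (1 :: 'a::comm_ring_1)"
proof -
	obtain p rest where r: "lam ! j = Suc p"
		"word (sz lam) (take j lam) = replicate p False @ False # rest"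
		"word (sz lam) (take (Suc j) lam) = replicate p False @ True # rest"
		by (rule words_take[OF assms])
	let ?w = "1 + fps_const b * fps_X"
	have "gp_step (fps_const b) fps_X (take j lam) (take (Suc j) lam) =
			uop ?w fps_X ufin (replicate p False @ False # rest) (replicate p False @ True # rest)"
		unfolding r(2,3)[symmetric] by (intro gp_step_word strict_take lam sum_list_take_le)
	also have "... = fps_X ^ Suc p * transfer (uweight ?w fps_X) ufin UL rest rest"
		by (simp add: uop_def transfer_replicate_UL transfer_replicate_UM sum_ustate uweight_def mult.assoc)
	finally show ?thesis
		unfolding r(1) using transfer_same_nth_0[of ?w UL fps_X rest] by (simp only: fps_X_power_mult_nth) simp
qed

lemma fps_X_minus_power_nth:
	"(fps_X + fps_const v) ^ n $ n = (1 :: 'a::comm_ring_1) & (\<forall>k>n. (fps_X + fps_const v) ^ n $ k = 0)"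
proof (induction n)
	case (Suc n)
	have "(fps_X + fps_const v) ^ Suc n $ Suc k = (fps_X + fps_const v) ^ n $ k + v * (fps_X + fps_const v) ^ n $ Suc k" for k
		by (simp add: distrib_right)
	then have e: "(fps_X + fps_const v) ^ Suc n $ k = (fps_X + fps_const v) ^ n $ (k - 1) + v * (fps_X + fps_const v) ^ n $ k" if "k > 0" for k
		using that by (cases k) auto
	show ?case using Suc e[of "Suc n"] e by auto
qed simp

text \<open>In top degree every box is a bar of its own. The 2 counts the choice of a prime on the
  diagonal box of the new row.\<close>

lemma jq_step_lead:
	assumes lam: "strict_partition lam" and j: "j < length lam"
	shows "jq_step (fps_const v) fps_X (take j lam) (take (Suc j) lam) $ (lam ! j) = (2 :: 'a::comm_ring_1)"
proof -
	obtain p rest where r: "lam ! j = Suc p"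
		"word (sz lam) (take j lam) = replicate p False @ False # rest"
		"word (sz lam) (take (Suc j) lam) = replicate p False @ True # rest"
		by (rule words_take[OF assms])
	let ?u = "fps_X + fps_const v"
	have "jq_step (fps_const v) fps_X (take j lam) (take (Suc j) lam) =
			dop ?u fps_X dfin (replicate p False @ False # rest) (replicate p False @ True # rest)"
		unfolding r(2,3)[symmetric] by (intro jq_step_word strict_take lam sum_list_take_le)
	also have "... $ Suc p = 2"
	proof (cases p)
		case 0
		then show ?thesis by (simp add: dop_def sum_dstate dweight_def transfer_same_DZ distrib_left)
	next
		case (Suc k)
		have "dop ?u fps_X dfin (replicate p False @ False # rest) (replicate p False @ True # rest) =
				fps_X * (fps_X * ?u ^ k + ?u ^ Suc k)"
			unfolding Suc dop_def transfer_replicate_DZ transfer_replicate_DQ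
			by (simp add: sum_dstate dweight_def transfer_replicate_DQ transfer_same_DZ mult_ac)
		then show ?thesis using fps_X_minus_power_nth[of v k] fps_X_minus_power_nth[of v "Suc k"] Suc by simp
	qed
	finally show ?thesis unfolding r(1) .
qed

lemma step_operator_gp: "step_operator Strict True (gp_step (fps_const b) (fps_X :: 'a::comm_ring_1 fps))"
proof
	fix ka lam :: "nat list" and r
	assume s: "ka : Strict" "lam : Strict"
	show "length ka <= length lam & length lam <= Suc (length ka) & (\<forall>i<length ka. ka ! i <= lam ! i)"
		if ne: "gp_step (fps_const b) fps_X ka lam ~= (0 :: 'a fps)"
	proof -
		have sub: "SD ka <= SD lam" by (rule gp_step_subset[OF ne])
		let ?N = "sz ka + sz lam"
		have "uop (1 + fps_const b * fps_X) fps_X ufin (word ?N ka) (word ?N lam) ~= 0"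
			using ne gp_step_word[of ka lam ?N "fps_const b" fps_X] s by simp
		then have "ones (word ?N lam) <= Suc (ones (word ?N ka))" by (intro uop_ones) auto
		then show ?thesis using ones_word[of ka ?N] ones_word[of lam ?N] s SD_subset_length[OF _ sub] SD_subset_rows(2)[OF _ sub]
			by auto
	qed
	show "if True then sz lam <= sz ka + r else sz ka + r <= sz lam"
		if "gp_step (fps_const b) fps_X ka lam $ r ~= (0 :: 'a)"
	proof -
		have "sz lam <= sz ka + r"
		proof (rule ccontr)
			assume "\<not> sz lam <= sz ka + r"
			then have "r < sz lam - sz ka" by simp
			then have "gp_step (fps_const b) fps_X ka lam $ r = (0 :: 'a)" by (rule fps_X_power_dvd_nth[OF gp_step_dvd])
			with that show False by simp
		qed
		then show ?thesis by simp
	qed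
next
	show "gp_step (fps_const b) fps_X [] [] = (1 :: 'a fps)"
		using gp_step_word[of "[]" "[]" 0 "fps_const b" "fps_X :: 'a fps"] by (simp add: strict_partition_def uop_def ufin_def word_def)
qed

lemma step_operator_jq: "step_operator Strict False (jq_step (fps_const b) (fps_X :: 'a::comm_ring_1 fps))"
proof
	fix ka lam :: "nat list" and r
	assume s: "ka : Strict" "lam : Strict"
	show "length ka <= length lam & length lam <= Suc (length ka) & (\<forall>i<length ka. ka ! i <= lam ! i)"
		if ne: "jq_step (fps_const b) fps_X ka lam ~= (0 :: 'a fps)"
	proof -
		have sub: "SD ka <= SD lam" by (rule jq_step_subset[OF ne])
		let ?N = "sz ka + sz lam"
		have "dop (fps_X + fps_const b) fps_X dfin (word ?N ka) (word ?N lam) ~= 0"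
			using ne jq_step_word[of ka lam ?N "fps_const b" fps_X] s by simp
		then have "ones (word ?N lam) <= Suc (ones (word ?N ka))" by (intro dop_ones) auto
		then show ?thesis using ones_word[of ka ?N] ones_word[of lam ?N] s SD_subset_length[OF _ sub] SD_subset_rows(2)[OF _ sub]
			by auto
	qed
	show "if False then sz lam <= sz ka + r else sz ka + r <= sz lam"
		if "jq_step (fps_const b) fps_X ka lam $ r ~= (0 :: 'a)"
		using jq_step_nth[OF that] by simp
next
	show "jq_step (fps_const b) fps_X [] [] = (1 :: 'a fps)"
		using jq_step_word[of "[]" "[]" 0 "fps_const b" "fps_X :: 'a fps"] by (simp add: strict_partition_def dop_def dfin_def word_def)
qed

subsection \<open>Commutation\<close>

lemma transfer_hom:
	assumes h: "\<And>x y. h (x + y) = h x + h y" "\<And>x y. h (x * y) = h x * h y" "h 0 = 0"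
		and c: "\<And>s a b s'. c' s a b s' = h (c s a b s')" "\<And>s. f' s = h (f s)"
	shows "transfer c' f' s as bs = h (transfer c f s as bs)"
proof -
	have hs: "h (sum g A) = (\<Sum>x\<in>A. h (g x))" for g and A :: "'s set"
		by (induction A rule: infinite_finite_induct) (auto simp: h)
	show ?thesis
		by (induction as bs arbitrary: s rule: list_induct2') (simp_all add: c h hs)
qed

text \<open>In the commutation relation \<open>x\<close> is the formal variable and \<open>t\<close>
  an element of the coefficient ring, so the jq operator consists of constants.\<close>

lemma dop_const: "dop (fps_const u) (fps_const t) dfin as bs = fps_const (dop u t dfin as bs)"
proof -
	have "transfer (dweight (fps_const u) (fps_const t)) dfin z as bs = fps_const (transfer (dweight u t) dfin z as bs)" for z
		by (rule transfer_hom) (auto simp: dweight_def dfin_def split: dstate.splits)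
	then show ?thesis by (simp add: dop_def)
qed

lemma word_append:
	assumes "\<forall>p\<in>set lam. p <= N"
	shows "word (N + k) lam = word N lam @ replicate k False"
proof (rule nth_equalityI)
	fix i assume "i < length (word (N + k) lam)"
	then show "word (N + k) lam ! i = (word N lam @ replicate k False) ! i"
		using assms by (cases "i < N") (auto simp: word_def nth_append)
qed simp

text \<open>The geometric series 1 / (1 - a X).\<close>

definition geom :: "'a::comm_ring_1 => 'a fps" where
	"geom a = Abs_fps (%k. a ^ k)"

lemma geom_inverse: "(1 - fps_const a * fps_X) * geom a = 1"
proof (rule fps_ext)
	fix n
	show "((1 - fps_const a * fps_X) * geom a) $ n = 1 $ n"
		by (cases n) (auto simp: algebra_simps geom_def fps_mult_left_const_nth mult.assoc)
qed

text \<open>Since 1 - (t - b) x = (1 + b x) (1 - t z) for z = x / (1 + b x), this is (1 + t x) / (1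
  - t z). It is kept in the form in which \<open>words_exchange\<close> delivers it.\<close>

definition jq_factor :: "'a::comm_ring_1 => 'a => 'a fps" where
	"jq_factor b t = (1 + fps_X * fps_const t) * (1 + fps_const b * fps_X) * geom (t - b)"

text \<open>\<open>words_exchange\<close> is applied to words so long that particles beyond the
  right end only affect coefficients above \<open>r\<close>; the factor \<open>q\<close> is then
  cancelled by \<open>geom (t - b)\<close>.\<close>

lemma commutes_jq:
	fixes b t :: "'a::comm_ring_1"
	shows "step_operator.commutes Strict (gp_step (fps_const b) fps_X) (jq_step (- b) t) (jq_factor b t)"
	unfolding step_operator.commutes_def[OF step_operator_gp]
proof (intro conjI allI ballI impI)
	fix mu :: "nat list" assume mu: "mu : Strict"
	show "jq_step (- b) t mu [] = (if mu = [] then 1 else 0)"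
	proof (cases "mu = []")
		case True
		then show ?thesis using jq_step_word[of "[]" "[]" 0 "- b" t] by (simp add: strict_partition_def dop_def dfin_def word_def)
	next
		case False
		then have "\<not> SD mu <= SD []" using SD_subset_length[of mu "[]"] mu by auto
		then show ?thesis using jq_step_subset False by fastforce
	qed
next
	fix mu lam :: "nat list" assume "jq_step (- b) t mu lam ~= 0"
	then show "sz mu <= sz lam" using jq_step_subset SD_subset_sum by blast
next
	fix lam mu :: "nat list" and r assume s: "lam : Strict" "mu : Strict"
	\<comment> \<open>At least \<open>sz mu + r + 1\<close> empty sites follow the parts of
	  \<open>lam\<close>, so \<open>T\<close> is divisible by a power of X above \<open>r\<close>.
	  \<open>N\<close> also bounds the sizes \<open>sz mu\<close> and
	  \<open>sz lam + r\<close>.\<close>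
	define N where "N = sz lam + (sz mu + r + 1)"
	let ?as = "word N lam" and ?bs = "word N mu" and ?x = "fps_X :: 'a fps"
	let ?w = "1 + fps_const b * ?x" and ?u = "fps_const (t - b)" and ?t = "fps_const t"
	let ?q = "1 - ?x * ?u" and ?n = "1 + ?x * ?t"
	define T where "T = (\<Sum>cs\<in>words N. uop ?w ?x (%s. of_bool (s = UM)) ?as cs * dop ?u ?t (%z. case z of DZ => 0 | DP => ?w | DQ => 1) ?bs cs)"
	define L where "L = (\<Sum>cs\<in>words N. uop ?w ?x ufin ?as cs * dop ?u ?t dfin ?bs cs)"
	define R where "R = (\<Sum>cs\<in>words N. dop ?u ?t dfin cs ?as * uop ?w ?x ufin cs ?bs)"
	have ex: "?q * L + T = ?n * ?w * R"
		unfolding L_def T_def R_def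
		by (rule words_exchange[OF refl refl refl]) simp_all
	have parts: "\<forall>p\<in>set lam. p <= sz lam" using parts_le by blast
	have wa: "?as = word (sz lam) lam @ replicate (sz mu + r + 1) False"
		unfolding N_def by (rule word_append[OF parts])
	have "fps_X ^ (sz mu + r + 1) dvd T"
		unfolding T_def wa by (intro dvd_sum dvd_mult2 uop_moving_dvd)
	then have "fps_X ^ (sz mu + r + 1) dvd geom (t - b) * T" by simp
	then have T0: "(geom (t - b) * T) $ r = 0" by (rule fps_X_power_dvd_nth) simp
	have "geom (t - b) * (?q * L + T) = jq_factor b t * R"
		unfolding ex jq_factor_def by (simp only: mult_ac)
	moreover have "geom (t - b) * (?q * L) = L"
		using geom_inverse[of "t - b"] by (simp add: mult.assoc[symmetric] mult.commute[of "geom (t - b)"] mult.commute[of fps_X])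
	ultimately have LR: "L $ r = (jq_factor b t * R) $ r"
		using T0 by (simp add: distrib_left) (metis add.right_neutral fps_add_nth)
	have N: "sz lam <= N" "sz mu <= N" "sz lam + r <= N" by (simp_all add: N_def)
	have "L $ r = (\<Sum>cs\<in>words N. uop ?w ?x ufin ?as cs $ r * dop (t - b) t dfin ?bs cs)"
		unfolding L_def by (simp add: fps_sum_nth dop_const)
	also have "... = (\<Sum>nu\<in>below Strict (sz lam + r). uop ?w ?x ufin ?as (word N nu) $ r * dop (t - b) t dfin ?bs (word N nu))"
	proof (rule sum_below_words[symmetric, OF N(3)])
		fix cs assume cs: "cs : words N" "uop ?w ?x ufin ?as cs $ r * dop (t - b) t dfin ?bs cs ~= 0"
		then have "length cs = N" by (simp add: words_def)
		then obtain nu where nu: "strict_partition nu" "\<forall>p\<in>set nu. p <= N" "word N nu = cs" by (rule word_surj)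
		show "card (shape cs) <= sz lam + r"
		proof -
			\<comment> \<open>The parts of \<open>nu\<close> are at most \<open>N\<close>, but its size may
			  exceed \<open>N\<close>. Hence \<open>gp_step_word\<close> is used with longer words; the added
			  empty sites do not change \<open>uop\<close>.\<close>
			define M where "M = N + sz nu"
			have pad: "uop ?w ?x ufin (as @ replicate k False) (cs @ replicate k False) = uop ?w ?x ufin as cs"
				if "length as = length cs" for as cs k
			proof -
				have "transfer (uweight ?w ?x) ufin s (replicate k False) (replicate k False) = ufin s" for s
					by (induction k arbitrary: s) (auto simp: sum_ustate uweight_def ufin_def split: ustate.splits)
				note pad0 = this
				have "transfer (uweight ?w ?x) ufin s (as @ replicate k False) (cs @ replicate k False) = transfer (uweight ?w ?x) ufin s as cs" for s
					using that by (induction as cs arbitrary: s rule: list_induct2) (simp_all add: pad0)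
				then show ?thesis by (simp add: uop_def)
			qed
			have "gp_step (fps_const b) ?x lam nu = uop ?w ?x ufin (word M lam) (word M nu)"
				using s nu by (intro gp_step_word) (auto simp: M_def N_def)
			also have "word M lam = ?as @ replicate (sz nu) False"
				unfolding M_def by (rule word_append) (use parts_le[of _ lam] N(1) in \<open>force intro: order_trans\<close>)
			also have "word M nu = cs @ replicate (sz nu) False"
				unfolding M_def nu(3)[symmetric] by (rule word_append[OF nu(2)])
			also have "uop ?w ?x ufin (?as @ replicate (sz nu) False) (cs @ replicate (sz nu) False) = uop ?w ?x ufin ?as cs"
				by (rule pad) (simp add: \<open>length cs = N\<close>)
			finally have "gp_step (fps_const b) ?x lam nu $ r ~= 0" using mult_neq_zeroD[OF cs(2)] by simp
			then have "sz nu <= sz lam + r"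
				using step_operator.size[OF step_operator_gp s(1), of nu b r] nu(1) by simp
			then show ?thesis using SD_word[OF nu(1,2)] nu(3) by (simp add: card_SD[symmetric])
		qed
	qed
	also have "... = (\<Sum>nu\<in>below Strict (sz lam + r). gp_step (fps_const b) fps_X lam nu $ r * jq_step (- b) t mu nu)"
	proof (rule sum.cong[OF refl])
		fix nu assume "nu : below Strict (sz lam + r)"
		then have nu: "strict_partition nu" "sz nu <= N" using N by (auto simp: below_def)
		show "uop ?w ?x ufin ?as (word N nu) $ r * dop (t - b) t dfin ?bs (word N nu) =
				gp_step (fps_const b) fps_X lam nu $ r * jq_step (- b) t mu nu"
			using gp_step_word[of lam nu N "fps_const b" ?x] jq_step_word[of mu nu N "- b" t] s nu N by simp
	qed
	finally have lhs: "L $ r = (\<Sum>nu\<in>below Strict (sz lam + r). gp_step (fps_const b) fps_X lam nu $ r * jq_step (- b) t mu nu)" .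
	have "R = (\<Sum>rho\<in>below Strict (sz lam). dop ?u ?t dfin (word N rho) ?as * uop ?w ?x ufin (word N rho) ?bs)"
		unfolding R_def
	proof (rule sum_below_words[symmetric, OF N(1)])
		fix cs assume cs: "cs : words N" "dop ?u ?t dfin cs ?as * uop ?w ?x ufin cs ?bs ~= 0"
		then have len: "length cs = N" by (simp add: words_def)
		have "dop (t - b) t dfin cs ?as ~= 0" using mult_neq_zeroD[OF cs(2)] by (auto simp: dop_const)
		\<comment> \<open>\<open>dcol_drow\<close> is read backwards: an intermediate word witnesses that
		  the shape of \<open>cs\<close> is contained in that of \<open>lam\<close>, which bounds its
		  size.\<close>
		have "(\<Sum>ds\<in>words N. (transfer (dcol (t - b) t) lfin (False, False) cs ds + transfer (dcol (t - b) t) lfin (True, False) cs ds) *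
			(transfer (drow (t - b) t) lfin (False, False) ds ?as + transfer (drow (t - b) t) lfin (True, False) ds ?as)) = dop (t - b) t dfin cs ?as"
			using dcol_drow[of cs ?as "t - b" t "(False, False)" "(False, False)"]
				dcol_drow[of cs ?as "t - b" t "(False, False)" "(True, False)"]
				dcol_drow[of cs ?as "t - b" t "(True, False)" "(False, False)"]
				dcol_drow[of cs ?as "t - b" t "(True, False)" "(True, False)"] len
			by (simp add: distrib_left distrib_right sum.distrib dop_def add_ac)
		then obtain ds where ds: "ds : words N" "(transfer (dcol (t - b) t) lfin (False, False) cs ds + transfer (dcol (t - b) t) lfin (True, False) cs ds) *
			(transfer (drow (t - b) t) lfin (False, False) ds ?as + transfer (drow (t - b) t) lfin (True, False) ds ?as) ~= 0"
			using \<open>dop (t - b) t dfin cs ?as ~= 0\<close> by (metis (no_types, lifting) sum.not_neutral_contains_not_neutral)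
		have "vstrip (shape cs) (shape ds)" "hstrip (shape ds) (shape ?as)"
			using mult_neq_zeroD[OF ds(2)] col_bars_sum[of cs N ds t "- b"] row_bars_sum[of ds N ?as t "- b"] ds(1) len
			by (auto simp: words_def split: if_splits)
		then have "shape cs <= shape ?as" by (auto simp: vstrip_def hstrip_def)
		then show "card (shape cs) <= sz lam"
			using card_mono[OF finite_shape] SD_word_sum[of lam N] s N(1) by (metis card_SD mem_Collect_eq)
	qed
	also have "... = (\<Sum>rho\<in>below Strict (sz lam). fps_const (jq_step (- b) t rho lam) * gp_step (fps_const b) fps_X rho mu)"
	proof (rule sum.cong[OF refl])
		fix rho assume "rho : below Strict (sz lam)"
		then have rho: "strict_partition rho" "sz rho <= N" using N by (auto simp: below_def)
		show "dop ?u ?t dfin (word N rho) ?as * uop ?w ?x ufin (word N rho) ?bs =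
				fps_const (jq_step (- b) t rho lam) * gp_step (fps_const b) fps_X rho mu"
			using gp_step_word[of rho mu N "fps_const b" ?x] jq_step_word[of rho lam N "- b" t] s rho N by (simp add: dop_const)
	qed
	finally have R: "R = (\<Sum>rho\<in>below Strict (sz lam). fps_const (jq_step (- b) t rho lam) * gp_step (fps_const b) fps_X rho mu)" .
	have "(jq_factor b t * R) $ r = (\<Sum>rho\<in>below Strict (sz lam).
			(fps_const (jq_step (- b) t rho lam) * (jq_factor b t * gp_step (fps_const b) fps_X rho mu)) $ r)"
		unfolding R sum_distrib_left fps_sum_nth[symmetric] by (simp only: mult.left_commute)
	then have "(jq_factor b t * R) $ r = (\<Sum>rho\<in>below Strict (sz lam).
			jq_step (- b) t rho lam * (jq_factor b t * gp_step (fps_const b) fps_X rho mu) $ r)"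
		by simp
	with LR lhs show "(\<Sum>nu\<in>below Strict (sz lam + r). gp_step (fps_const b) fps_X lam nu $ r * jq_step (- b) t mu nu) =
		(\<Sum>rho\<in>below Strict (sz lam). jq_step (- b) t rho lam * (jq_factor b t * gp_step (fps_const b) fps_X rho mu) $ r)"
		by simp
qed

section \<open>Partitions and Pieri operators\<close>

abbreviation Par :: "nat list set" where
	"Par \<equiv> {lam. is_partition lam}"

text \<open>Rows beyond the length read as 0, so shapes of different lengths can be compared row by
  row.\<close>

definition row :: "nat list => nat => nat" where
	"row lam i = (if i < length lam then lam ! i else 0)"

lemma row_ge_length [simp]: "length lam <= i ==> row lam i = 0"
	by (simp add: row_def)

lemma row_pos_iff: "lam : Par ==> 0 < row lam i \<longleftrightarrow> i < length lam"
	by (auto simp: row_def is_partition_def)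

lemma row_antimono:
	assumes "lam : Par" "i <= j" shows "row lam j <= row lam i"
proof (cases "i < j & j < length lam")
	case True
	then show ?thesis using assms(1) by (auto simp: row_def is_partition_def sorted_wrt_iff_nth_less)
qed (use assms(2) in \<open>auto simp: row_def order.order_iff_strict\<close>)

lemma row_inj:
	assumes "lam : Par" "mu : Par" "\<And>i. row lam i = row mu i"
	shows "lam = mu"
proof (rule nth_equalityI)
	show len: "length lam = length mu"
		using row_pos_iff[OF assms(1)] row_pos_iff[OF assms(2)] assms(3) by (metis linorder_neqE_nat less_irrefl)
	show "lam ! i = mu ! i" if "i < length lam" for i using assms(3)[of i] that len by (simp add: row_def)
qed

lemma sum_row: "length lam <= n ==> (\<Sum>i<n. row lam i) = sz lam"
	using sum_list_take[of lam n] by (simp add: row_def)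

definition of_rows :: "nat => (nat => nat) => nat list" where
	"of_rows n f = map f [0..<card {i. i < n & 0 < f i}]"

lemma of_rows:
	assumes mono: "\<And>i. f (Suc i) <= f i" and 0: "\<And>i. n <= i ==> f i = 0"
	shows "of_rows n f : Par" "row (of_rows n f) = f" "length (of_rows n f) <= n"
proof -
	define c where "c = card {i. i < n & 0 < f i}"
	have anti: "i <= j ==> f j <= f i" for i j using lift_Suc_antimono_le[of f i j] mono by blast
	define k where "k = (LEAST k. f k = 0)"
	have k: "f k = 0" unfolding k_def by (rule LeastI[of "%k. f k = 0" n]) (simp add: 0)
	have k1: "0 < f i" if "i < k" for i using not_less_Least[of i "%k. f k = 0"] that by (simp add: k_def)
	have k2: "f i = 0" if "k <= i" for i using anti[OF that] k by simp
	have kn: "k <= n" unfolding k_def by (rule Least_le) (simp add: 0)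
	have e: "{i. i < n & 0 < f i} = {..<k}"
	proof (intro equalityI subsetI)
		fix i assume "i : {i. i < n & 0 < f i}" then show "i : {..<k}" using k2[of i] by (cases "k <= i") auto
	next
		fix i assume "i : {..<k}" then show "i : {i. i < n & 0 < f i}" using k1[of i] kn by simp
	qed
	have ck: "c = k" unfolding c_def e by simp
	have l: "of_rows n f = map f [0..<c]" by (simp add: of_rows_def c_def)
	have "sorted_wrt (\<ge>) (map f [0..<c])"
		unfolding sorted_wrt_iff_nth_less
	proof (intro allI impI)
		fix i j assume "i < j" "j < length (map f [0..<c])"
		then show "map f [0..<c] ! j <= map f [0..<c] ! i" using anti[of i j] by simp
	qed
	moreover have "0 < p" if "p : set (map f [0..<c])" for p
	proof -
		from that have "\<exists>i<c. p = f i" by auto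
		then show ?thesis using k1 ck by auto
	qed
	ultimately show "of_rows n f : Par" unfolding l is_partition_def by blast
	show "row (of_rows n f) = f"
	proof
		fix i show "row (of_rows n f) i = f i" unfolding l row_def using k2[of i] ck by simp
	qed
	show "length (of_rows n f) <= n" unfolding l using kn ck by simp
qed

interpretation Par: index_lists Par
proof
	fix lam :: "nat list" and j
	show "[] : Par" by (simp add: is_partition_def)
	assume "lam : Par"
	then show "0 ~: set lam" "take j lam : Par"
		by (auto simp: is_partition_def sorted_wrt_take dest: in_set_takeD)
qed

text \<open>The interlacing form of a horizontal strip: no two added boxes share a column.\<close>

definition hor :: "nat list => nat list => bool" where
	"hor ka lam \<longleftrightarrow> (\<forall>i. row ka i <= row lam i & row lam (Suc i) <= row ka i)"

definition ver :: "nat list => nat list => bool" where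
	"ver ka lam \<longleftrightarrow> (\<forall>i. row ka i <= row lam i & row lam i <= Suc (row ka i))"

definition hor_step :: "'a::comm_ring_1 => nat list => nat list => 'a" where
	"hor_step t ka lam = (if hor ka lam then t ^ (sz lam - sz ka) else 0)"

definition ver_step :: "'a::comm_ring_1 => nat list => nat list => 'a" where
	"ver_step t ka lam = (if ver ka lam then t ^ (sz lam - sz ka) else 0)"

lemma sum_list_row_mono:
	assumes "\<And>i. row ka i <= row lam i"
	shows "sz ka <= sz lam"
	using sum_mono[of "{..<length ka + length lam}" "row ka" "row lam"] assms by (simp add: sum_row)

lemma hor_sum: "hor ka lam ==> sz ka <= sz lam"
	and ver_sum: "ver ka lam ==> sz ka <= sz lam"
	by (auto simp: hor_def ver_def intro: sum_list_row_mono)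

lemma step_operator_hor: "step_operator Par True (hor_step (fps_X :: 'a::comm_ring_1 fps))"
proof
	fix ka lam :: "nat list" and r
	assume s: "ka : Par" "lam : Par"
	show "length ka <= length lam & length lam <= Suc (length ka) & (\<forall>i<length ka. ka ! i <= lam ! i)"
		if "hor_step fps_X ka lam ~= (0 :: 'a fps)"
	proof -
		have h: "row ka i <= row lam i" "row lam (Suc i) <= row ka i" for i
			using that by (auto simp: hor_step_def hor_def split: if_splits)
		have "length ka <= length lam"
		proof (rule ccontr)
			assume "\<not> length ka <= length lam"
			then have "0 < row ka (length lam)" using row_pos_iff[OF s(1)] by simp
			then show False using h(1)[of "length lam"] by simp
		qed
		moreover have "length lam <= Suc (length ka)"
		proof (rule ccontr)
			assume "\<not> length lam <= Suc (length ka)"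
			then have "0 < row lam (Suc (length ka))" using row_pos_iff[OF s(2)] by simp
			then show False using h(2)[of "length ka"] by simp
		qed
		moreover have "ka ! i <= lam ! i" if "i < length ka" for i
			using h(1)[of i] that calculation(1) by (simp add: row_def)
		ultimately show ?thesis by blast
	qed
	show "if True then sz lam <= sz ka + r else sz ka + r <= sz lam"
		if "hor_step fps_X ka lam $ r ~= (0 :: 'a)"
		using that by (auto simp: hor_step_def fps_X_power_nth split: if_splits)
qed (simp add: hor_step_def hor_def)

lemma lead_hor: "lam : Par ==> step_operator.lead (hor_step (fps_X :: 'a::comm_ring_1 fps)) lam = 1"
	unfolding step_operator.lead_def[OF step_operator_hor]
proof (rule prod.neutral, rule ballI)
	fix j assume lam: "lam : Par" and "j : {..<length lam}"
	then have j: "j < length lam" by simp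
	have r: "row (take k lam) i = (if i < k then row lam i else 0)" for k i by (simp add: row_def)
	have "hor (take j lam) (take (Suc j) lam)"
		unfolding hor_def r using row_antimono[OF lam] by auto
	moreover have "sz (take (Suc j) lam) - sz (take j lam) = lam ! j"
		using j by (simp add: take_Suc_conv_app_nth)
	ultimately show "hor_step fps_X (take j lam) (take (Suc j) lam) $ (lam ! j) = (1 :: 'a)"
		by (simp add: hor_step_def fps_X_power_nth)
qed

lemma hor_nil: "mu : Par ==> hor mu [] \<longleftrightarrow> mu = []" and ver_nil: "mu : Par ==> ver mu [] \<longleftrightarrow> mu = []"
proof -
	have e: "row [] i = 0" for i by simp
	have "mu = []" if "mu : Par" "row mu 0 = 0" using row_pos_iff[OF that(1), of 0] that(2) by simp
	then show "mu : Par ==> hor mu [] \<longleftrightarrow> mu = []" "mu : Par ==> ver mu [] \<longleftrightarrow> mu = []"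
		by (auto simp: hor_def ver_def e)
qed

text \<open>Row \<open>k + 1\<close> of \<open>nu\<close> and row \<open>k\<close> of
  \<open>rho\<close> range over the same interval, from the maximum of the rows \<open>k + 1\<close>
  to the minimum of the rows \<open>k\<close> of \<open>lam\<close> and \<open>mu\<close>.
  Reflection in these intervals is the bijection. Row 0 of \<open>nu\<close> is only bounded below;
  it absorbs the remaining boxes, and their number is nonnegative exactly when
  \<open>sz mu <= sz rho + r\<close>.\<close>

lemma hor_exchange_card:
	assumes lam: "lam : Par" and mu: "mu : Par"
	shows "card {nu : Par. hor lam nu & hor mu nu & sz nu = sz lam + r} =
		card {rho : Par. hor rho lam & hor rho mu & sz mu <= sz rho + r}"
proof -
	define n where "n = length lam + length mu"
	define mn mx where "mn k = min (row lam k) (row mu k)" and "mx k = max (row lam k) (row mu k)" for k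
	have mx: "mx k <= x \<longleftrightarrow> row lam k <= x & row mu k <= x" and mn: "x <= mn k \<longleftrightarrow> x <= row lam k & x <= row mu k"
		and mnx: "mn k <= mx k" "mn k + mx k = row lam k + row mu k" for k x
		by (auto simp: mn_def mx_def)
	define up where "up = (%rho k. case k of 0 => mx 0 + (sz rho + r - sz mu) | Suc k => mn k + mx (Suc k) - row rho k)"
	define dn where "dn = (%nu k. mn k + mx (Suc k) - row nu (Suc k))"
	have z: "mn k = 0" "mx k = 0" if "n <= k" for k using that by (simp_all add: n_def mn_def mx_def)
	have tot: "(\<Sum>k<n. mn k + mx (Suc k)) + mx 0 = sz lam + sz mu"
	proof -
		have "(\<Sum>k<n. mx (Suc k)) + mx 0 = (\<Sum>k<Suc n. mx k)" unfolding sum.lessThan_Suc_shift by simp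
		also have "... = (\<Sum>k<n. mx k)" using z[of n] by simp
		finally have "(\<Sum>k<n. mn k + mx (Suc k)) + mx 0 = (\<Sum>k<n. mn k + mx k)"
			by (simp add: sum.distrib)
		also have "... = (\<Sum>k<n. row lam k + row mu k)" by (simp only: mnx)
		finally show ?thesis by (simp add: sum.distrib sum_row n_def)
	qed
	let ?A = "{nu : Par. hor lam nu & hor mu nu & sz nu = sz lam + r}"
	let ?B = "{rho : Par. hor rho lam & hor rho mu & sz mu <= sz rho + r}"
	have len: "length rho <= n" if "rho : Par" "\<And>i. n <= i ==> row rho i = 0" for rho
		using row_pos_iff[OF that(1), of n] that(2)[of n] by simp
	have A: "mx k <= row nu k" "row nu (Suc k) <= mn k" if "nu : ?A" for nu k
		using that by (auto simp: hor_def mx mn)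
	have B: "mx (Suc k) <= row rho k" "row rho k <= mn k" if "rho : ?B" for rho k
		using that by (auto simp: hor_def mx mn)
	have u: "of_rows (Suc n) (up rho) : Par" "row (of_rows (Suc n) (up rho)) = up rho" if "rho : ?B" for rho
	proof -
		have p1: "up rho (Suc i) <= up rho i" for i
		proof -
			have "up rho (Suc i) <= mn i" using B(1)[OF that, of i] by (simp add: up_def)
			also have "... <= mx i" by (rule mnx)
			also have "... <= up rho i"
				using B(2)[OF that, of "i - 1"] by (cases i) (simp_all add: up_def)
			finally show ?thesis .
		qed
		have p2: "up rho i = 0" if "Suc n <= i" for i
			using that z[of i] z[of "i - 1"] by (cases i) (simp_all add: up_def)
		show "of_rows (Suc n) (up rho) : Par" "row (of_rows (Suc n) (up rho)) = up rho"
			using of_rows[of "up rho" "Suc n", OF p1 p2] by blast+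
	qed
	have d: "of_rows n (dn nu) : Par" "row (of_rows n (dn nu)) = dn nu" if "nu : ?A" for nu
	proof -
		have p1: "dn nu (Suc i) <= dn nu i" for i
		proof -
			have "dn nu (Suc i) <= mn (Suc i)" using A(1)[OF that, of "Suc (Suc i)"] by (simp add: dn_def)
			also have "... <= mx (Suc i)" by (rule mnx)
			also have "... <= dn nu i" using A(2)[OF that, of i] by (simp add: dn_def)
			finally show ?thesis .
		qed
		have p2: "dn nu i = 0" if "n <= i" for i
			using that z[of i] z[of "Suc i"] by (simp add: dn_def)
		show "of_rows n (dn nu) : Par" "row (of_rows n (dn nu)) = dn nu"
			using of_rows[of "dn nu" n, OF p1 p2] by blast+
	qed
	have sd: "sz rho + (\<Sum>k<n. row nu (Suc k)) + mx 0 = sz lam + sz mu"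
		if "rho : Par" "\<And>k. row rho k + row nu (Suc k) = mn k + mx (Suc k)" for rho nu
	proof -
		have "length rho <= n"
		proof (rule len[OF that(1)])
			fix i assume "n <= i" then show "row rho i = 0" using that(2)[of i] z[of i] z[of "Suc i"] by simp
		qed
		then have "sz rho = (\<Sum>k<n. row rho k)" by (simp add: sum_row)
		then have "sz rho + (\<Sum>k<n. row nu (Suc k)) = (\<Sum>k<n. mn k + mx (Suc k))"
			by (simp only: that(2) flip: sum.distrib)
		then show ?thesis using tot by simp
	qed
	have sn: "sz nu = row nu 0 + (\<Sum>k<n. row nu (Suc k))"
		if "nu : Par" "row nu (Suc n) = 0" for nu
	proof -
		have "length nu <= Suc n" using row_pos_iff[OF that(1), of "Suc n"] that(2) by simp
		then have "sz nu = (\<Sum>k<Suc n. row nu k)" by (simp only: sum_row)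
		then show ?thesis unfolding sum.lessThan_Suc_shift by simp
	qed
	have "bij_betw (%rho. of_rows (Suc n) (up rho)) ?B ?A"
	proof (rule bij_betw_byWitness[where f' = "%nu. of_rows n (dn nu)"])
		have uA: "of_rows (Suc n) (up rho) : ?A" if rho: "rho : ?B" for rho
		proof -
			let ?nu = "of_rows (Suc n) (up rho)"
			have b: "mx (Suc k) <= row rho k" "row rho k <= mn k" for k using B[OF rho] by auto
			have r: "row rho k + row ?nu (Suc k) = mn k + mx (Suc k)" for k
				unfolding u(2)[OF rho] unfolding up_def using b[of k] by simp
			have "sz ?nu = row ?nu 0 + (\<Sum>k<n. row ?nu (Suc k))"
				using r[of n] z[of n] z[of "Suc n"] by (intro sn u(1)[OF rho]) simp
			moreover have "sz rho + (\<Sum>k<n. row ?nu (Suc k)) + mx 0 = sz lam + sz mu"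
				using rho by (intro sd r) simp
			moreover have "row ?nu 0 = mx 0 + (sz rho + r - sz mu)" unfolding u(2)[OF rho] unfolding up_def by simp
			moreover have "sz mu <= sz rho + r" using rho by simp
			ultimately have "sz ?nu = sz lam + r" by linarith
			moreover have "mx k <= row ?nu k" for k
				using r[of "k - 1"] b[of "k - 1"] \<open>row ?nu 0 = _\<close> by (cases k) auto
			moreover have "row ?nu (Suc k) <= mn k" for k using r[of k] b[of k] by linarith
			ultimately show ?thesis using u(1)[OF rho] by (simp add: hor_def mx mn)
		qed
		have dB: "of_rows n (dn nu) : ?B" if nu: "nu : ?A" for nu
		proof -
			let ?rho = "of_rows n (dn nu)"
			have a: "mx k <= row nu k" "row nu (Suc k) <= mn k" for k using A[OF nu] by auto
			have r: "row ?rho k + row nu (Suc k) = mn k + mx (Suc k)" for k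
				unfolding d(2)[OF nu] unfolding dn_def using a(2)[of k] by simp
			have "sz nu = row nu 0 + (\<Sum>k<n. row nu (Suc k))"
				using a(2)[of n] z(1)[of n] nu by (intro sn) simp_all
			moreover have "sz ?rho + (\<Sum>k<n. row nu (Suc k)) + mx 0 = sz lam + sz mu"
				by (intro sd r d(1)[OF nu])
			ultimately have "sz mu <= sz ?rho + r" using a(1)[of 0] nu by simp
			moreover have "mx (Suc k) <= row ?rho k" "row ?rho k <= mn k" for k
				using r[of k] a(1)[of "Suc k"] a(2)[of k] by linarith+
			ultimately show ?thesis using d(1)[OF nu] by (simp add: hor_def mx mn)
		qed
		show "\<forall>rho\<in>?B. of_rows n (dn (of_rows (Suc n) (up rho))) = rho"
		proof
			fix rho assume rho: "rho : ?B"
			show "of_rows n (dn (of_rows (Suc n) (up rho))) = rho"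
			proof (rule row_inj)
				show "of_rows n (dn (of_rows (Suc n) (up rho))) : Par" using d(1)[OF uA[OF rho]] .
				show "rho : Par" using rho by simp
				show "row (of_rows n (dn (of_rows (Suc n) (up rho)))) i = row rho i" for i
					unfolding d(2)[OF uA[OF rho]] unfolding dn_def u(2)[OF rho] unfolding up_def using B[OF rho, of i] by simp
			qed
		qed
		show "\<forall>nu\<in>?A. of_rows (Suc n) (up (of_rows n (dn nu))) = nu"
		proof
			fix nu assume nu: "nu : ?A"
			show "of_rows (Suc n) (up (of_rows n (dn nu))) = nu"
			proof (rule row_inj)
				let ?rho = "of_rows n (dn nu)"
				show "of_rows (Suc n) (up ?rho) : Par" using u(1)[OF dB[OF nu]] .
				show "nu : Par" using nu by simp
				have a: "mx k <= row nu k" "row nu (Suc k) <= mn k" for k using A[OF nu] by auto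
				have r: "row ?rho k + row nu (Suc k) = mn k + mx (Suc k)" for k
					unfolding d(2)[OF nu] unfolding dn_def using a(2)[of k] by simp
				have "sz nu = row nu 0 + (\<Sum>k<n. row nu (Suc k))"
					using a(2)[of n] z(1)[of n] nu by (intro sn) simp_all
				moreover have "sz ?rho + (\<Sum>k<n. row nu (Suc k)) + mx 0 = sz lam + sz mu"
					by (intro sd r d(1)[OF nu])
				moreover have "sz nu = sz lam + r" using nu by simp
				moreover have "sz mu <= sz ?rho + r" using dB[OF nu] by simp
				ultimately have n0: "mx 0 + (sz ?rho + r - sz mu) = row nu 0" by linarith
				show "row (of_rows (Suc n) (up ?rho)) i = row nu i" for i
				proof (cases i)
					case 0 then show ?thesis unfolding u(2)[OF dB[OF nu]] unfolding up_def using n0 by simp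
				next
					case (Suc j)
					have "mn j + mx (Suc j) - row ?rho j = row nu (Suc j)" using r[of j] by linarith
					then show ?thesis unfolding u(2)[OF dB[OF nu]] unfolding up_def Suc by simp
				qed
			qed
		qed
		show "(%rho. of_rows (Suc n) (up rho)) ` ?B <= ?A" using uA by blast
		show "(%nu. of_rows n (dn nu)) ` ?A <= ?B" using dB by blast
	qed
	then show ?thesis by (rule bij_betw_same_card[symmetric])
qed

lemma sum_of_bool_const:
	assumes "finite A" "\<And>x. x : A ==> f x = (if P x then c else 0)"
	shows "sum f A = of_nat (card {x : A. P x}) * (c :: 'a::comm_ring_1)"
proof -
	have "sum f A = (\<Sum>x\<in>{x : A. P x}. c)" unfolding sum.inter_filter[OF assms(1)] by (rule sum.cong) (use assms(2) in auto)
	then show ?thesis by simp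
qed

text \<open>All terms carry the same power of \<open>t\<close>, so only their numbers have to agree.
  The inequality in \<open>hor_exchange_card\<close> describes where the product with the geometric
  series has a nonzero coefficient.\<close>

lemma commutes_hor:
	fixes t :: "'a::comm_ring_1"
	shows "step_operator.commutes Par (hor_step fps_X) (hor_step t) (geom t)"
	unfolding step_operator.commutes_def[OF step_operator_hor]
proof (intro conjI allI ballI impI)
	fix mu :: "nat list" assume "mu : Par"
	then show "hor_step t mu [] = (if mu = [] then 1 else 0)" by (auto simp: hor_step_def hor_nil)
next
	fix mu lam :: "nat list" assume "hor_step t mu lam ~= 0"
	then show "sz mu <= sz lam" by (auto simp: hor_step_def hor_sum split: if_splits)
next
	fix lam mu :: "nat list" and r assume s: "lam : Par" "mu : Par"
	let ?c = "t ^ (sz lam + r - sz mu)"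
	have "(\<Sum>nu\<in>below Par (sz lam + r). hor_step fps_X lam nu $ r * hor_step t mu nu) =
		of_nat (card {nu : below Par (sz lam + r). hor lam nu & hor mu nu & sz nu = sz lam + r}) * ?c"
	proof (rule sum_of_bool_const)
		fix nu
		have "hor lam nu ==> sz lam <= sz nu" by (rule hor_sum)
		then show "hor_step fps_X lam nu $ r * hor_step t mu nu =
			(if hor lam nu & hor mu nu & sz nu = sz lam + r then ?c else 0)"
			by (auto simp: hor_step_def fps_X_power_nth)
	qed simp
	also have "{nu : below Par (sz lam + r). hor lam nu & hor mu nu & sz nu = sz lam + r} =
			{nu : Par. hor lam nu & hor mu nu & sz nu = sz lam + r}" by (auto simp: below_def)
	also note hor_exchange_card[OF s]
	also have "{rho : Par. hor rho lam & hor rho mu & sz mu <= sz rho + r} =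
			{rho : below Par (sz lam). hor rho lam & hor rho mu & sz mu <= sz rho + r}"
		using hor_sum by (auto simp: below_def)
	also have "of_nat (card ...) * ?c = (\<Sum>rho\<in>below Par (sz lam). hor_step t rho lam * (geom t * hor_step fps_X rho mu) $ r)"
	proof (rule sum_of_bool_const[symmetric])
		fix rho
		show "hor_step t rho lam * (geom t * hor_step fps_X rho mu) $ r =
			(if hor rho lam & hor rho mu & sz mu <= sz rho + r then ?c else 0)"
		proof (cases "hor rho lam & hor rho mu")
			case True
			then have le: "sz rho <= sz lam" "sz rho <= sz mu" using hor_sum by auto
			have "(geom t * hor_step fps_X rho mu) $ r = (if r < sz mu - sz rho then 0 else t ^ (r - (sz mu - sz rho)))"
				using True by (simp add: hor_step_def geom_def fps_X_power_mult_right_nth)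
			moreover have "t ^ (sz lam - sz rho) * t ^ (r - (sz mu - sz rho)) = ?c" if "sz mu <= sz rho + r"
				unfolding power_add[symmetric] using le that by (intro arg_cong[where f = "power t"]) linarith
			ultimately show ?thesis using True le by (auto simp: hor_step_def)
		qed (auto simp: hor_step_def)
	qed simp
	finally show "(\<Sum>nu\<in>below Par (sz lam + r). hor_step fps_X lam nu $ r * hor_step t mu nu) =
		(\<Sum>rho\<in>below Par (sz lam). hor_step t rho lam * (geom t * hor_step fps_X rho mu) $ r)" .
qed

lemma card_subsets_add:
	assumes "finite F"
	shows "card {S. S <= F & C + card S = E} = (if C <= E then card F choose (E - C) else 0)"
proof (cases "C <= E")
	case True
	then have "{S. S <= F & C + card S = E} = {S. S <= F & card S = E - C}" by auto
	then show ?thesis using n_subsets[OF assms] True by simp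
next
	case False
	then have "{S. S <= F & C + card S = E} = {}" by auto
	then show ?thesis using False by simp
qed

text \<open>Rows with \<open>row lam i = Suc (row mu i)\<close> are forced in \<open>nu\<close> and
  in \<open>rho\<close>. In the others \<open>nu\<close> chooses between mu_i and mu_i + 1, and
  \<open>rho\<close> between lam_i and lam_i - 1, as far as interlacing permits. As
  \<open>nu\<close> has one more free row than \<open>rho\<close>, the identity is Pascal's
  rule.\<close>

lemma ver_exchange_card:
	assumes lam: "lam : Par" and mu: "mu : Par"
	shows "card {nu : Par. hor lam nu & ver mu nu & sz nu = sz lam + r} =
		card {rho : Par. ver rho lam & hor rho mu & sz mu = sz rho + r} +
		card {rho : Par. ver rho lam & hor rho mu & Suc (sz mu) = sz rho + r}"
proof (cases "\<forall>i. row lam i <= Suc (row mu i) & row mu (Suc i) <= row lam i")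
	\<comment> \<open>Both inequalities are necessary for either side to have a member, so here all
	  sets are empty.\<close>
	case False
	have "row lam i <= Suc (row mu i) & row mu (Suc i) <= row lam i" if "hor lam nu" "ver mu nu" for nu i
	proof -
		have "row lam i <= row nu i" "row nu i <= Suc (row mu i)" "row mu (Suc i) <= row nu (Suc i)" "row nu (Suc i) <= row lam i"
			using that by (auto simp: hor_def ver_def)
		then show ?thesis by linarith
	qed
	then have 1: "{nu : Par. hor lam nu & ver mu nu & sz nu = sz lam + r} = {}" using False by blast
	have "row lam i <= Suc (row mu i) & row mu (Suc i) <= row lam i" if "hor rho mu" "ver rho lam" for rho i
	proof -
		have "row rho i <= row lam i" "row lam i <= Suc (row rho i)" "row rho i <= row mu i" "row mu (Suc i) <= row rho i"
			using that by (auto simp: hor_def ver_def)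
		then show ?thesis by linarith
	qed
	then have 2: "{rho : Par. ver rho lam & hor rho mu & Q rho} = {}" for Q using False by blast
	show ?thesis unfolding 1 2 by simp
next
	case True
	then have G: "row lam i <= Suc (row mu i)" "row mu (Suc i) <= row lam i" for i by auto
	define n where "n = length lam + length mu"
	have z: "row lam k = 0" "row mu k = 0" if "n <= k" for k using that by (simp_all add: n_def)
	have lm: "row lam (Suc k) <= row lam k" "row mu (Suc k) <= row mu k" for k using row_antimono lam mu by auto
	define A0 where "A0 = {i. i < Suc n & row lam i = Suc (row mu i)}"
	have A0: "i : A0 \<longleftrightarrow> row lam i = Suc (row mu i)" for i
		using z[of i] by (cases "i < Suc n") (auto simp: A0_def)
	have finA: "finite A0" by (simp add: A0_def)
	define Fn where "Fn = {i. i < Suc n & row lam i <= row mu i & (i = 0 \<or> row mu i < row lam (i - 1))}"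
	define Fr where "Fr = {i. i < n & row lam i <= row mu i & row mu (Suc i) < row lam i}"
	have fin: "finite Fn" "finite Fr" by (simp_all add: Fn_def Fr_def)
	have Fn: "i : Fn \<longleftrightarrow> row lam i <= row mu i & (i = 0 \<or> row mu i < row lam (i - 1))" for i
		using z(1)[of "i - 1"] by (cases "i < Suc n") (auto simp: Fn_def)
	have Fr: "i : Fr \<longleftrightarrow> row lam i <= row mu i & row mu (Suc i) < row lam i" for i
		using z(1)[of i] by (cases "i < n") (auto simp: Fr_def)
	\<comment> \<open>Freedom of row \<open>k\<close> in \<open>rho\<close> and of row
	  \<open>k + 1\<close> in \<open>nu\<close> both ask for mu_(k+1) < lam_k. The other conditions,
	  \<open>row lam i <= row mu i\<close>, telescope, and at \<open>n\<close> both rows are 0.\<close>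
	have "card {i. i < Suc k & i : Fn} = card {i. i < k & i : Fr} + of_bool (row lam k <= row mu k)" for k
	proof (induction k)
		case 0
		have "{i. i < Suc 0 & i : Fn} = (if row lam 0 <= row mu 0 then {0} else {})" by (auto simp: Fn)
		then show ?case by simp
	next
		case (Suc k)
		have "{i. i < Suc (Suc k) & i : Fn} = (if Suc k : Fn then insert (Suc k) {i. i < Suc k & i : Fn} else {i. i < Suc k & i : Fn})"
			"{i. i < Suc k & i : Fr} = (if k : Fr then insert k {i. i < k & i : Fr} else {i. i < k & i : Fr})"
			by (auto simp: less_Suc_eq)
		then have "card {i. i < Suc (Suc k) & i : Fn} = card {i. i < Suc k & i : Fn} + of_bool (Suc k : Fn)"
			"card {i. i < Suc k & i : Fr} = card {i. i < k & i : Fr} + of_bool (k : Fr)"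
			by simp_all
		moreover have "of_bool (row lam k <= row mu k) + of_bool (Suc k : Fn) = of_bool (k : Fr) + (of_bool (row lam (Suc k) <= row mu (Suc k)) :: nat)"
			using G(2)[of k] lm(1)[of k] lm(2)[of k] by (auto simp: Fn Fr)
		ultimately show ?case using Suc.IH by linarith
	qed
	from this[of n] have cF: "card Fn = Suc (card Fr)"
		using z[of n] by (simp add: Fn_def Fr_def conj_commute cong: conj_cong)
	define up where "up = (%S i. if row lam i = Suc (row mu i) \<or> i : S then Suc (row mu i) else row mu i)"
	define dn where "dn = (%S i. if row lam i = Suc (row mu i) \<or> i : S then row lam i - 1 else row lam i)"
	have len: "length rho <= k" if "rho : Par" "row rho k = 0" for rho k
		using row_pos_iff[OF that(1), of k] that(2) by simp
	have u: "of_rows (Suc n) (up S) : Par & row (of_rows (Suc n) (up S)) = up S & hor lam (of_rows (Suc n) (up S)) &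
			ver mu (of_rows (Suc n) (up S)) & sz (of_rows (Suc n) (up S)) = card A0 + sz mu + card S" if S: "S <= Fn" for S
	proof -
		let ?nu = "of_rows (Suc n) (up S)"
		have S': "row lam i <= row mu i & (i = 0 \<or> row mu i < row lam (i - 1))" if "i : S" for i using S that Fn by blast
		have h1: "row lam i <= up S i" for i using G(1)[of i] by (auto simp: up_def)
		have h2: "up S (Suc i) <= row lam i" for i
			using G(2)[of i] lm(1)[of i] S'[of "Suc i"] by (auto simp: up_def)
		have p1: "up S (Suc i) <= up S i" for i using h1[of i] h2[of i] by linarith
		have p2: "up S i = 0" if "Suc n <= i" for i
			using that z[of i] z(1)[of "i - 1"] S'[of i] by (auto simp: up_def)
		have o: "of_rows (Suc n) (up S) : Par" "row (of_rows (Suc n) (up S)) = up S" "length (of_rows (Suc n) (up S)) <= Suc n"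
			using of_rows[of "up S" "Suc n", OF p1 p2] by blast+
		have "sz ?nu = (\<Sum>i<Suc n. up S i)" using sum_row[OF o(3)] by (simp only: o(2))
		also have "... = (\<Sum>i<Suc n. row mu i + of_bool (i : A0 \<union> S))" by (rule sum.cong) (auto simp: up_def A0)
		also have "... = sz mu + card (A0 \<union> S)"
		proof -
			have "A0 \<union> S <= {..<Suc n}" using S by (auto simp: A0_def Fn_def)
			then have "(\<Sum>i<Suc n. of_bool (i : A0 \<union> S)) = card (A0 \<union> S)"
				by (simp add: Int_absorb1 del: Un_iff sum.lessThan_Suc)
			moreover have "(\<Sum>i<Suc n. row mu i) = sz mu" by (rule sum_row) (simp add: n_def)
			ultimately show ?thesis unfolding sum.distrib by simp
		qed
		also have "card (A0 \<union> S) = card A0 + card S"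
		proof (rule card_Un_disjoint[OF finA finite_subset[OF S fin(1)]])
			have "i ~: S" if "i : A0" for i using S'[of i] that A0[of i] by auto
			then show "A0 \<inter> S = {}" by blast
		qed
		finally have e: "sz ?nu = card A0 + sz mu + card S" by linarith
		have "hor lam ?nu" unfolding hor_def o(2) using h1 h2 by blast
		moreover have "ver mu ?nu" unfolding ver_def o(2) by (simp add: up_def)
		ultimately show ?thesis using o(1,2) e by blast
	qed
	have d: "of_rows n (dn S) : Par & row (of_rows n (dn S)) = dn S & ver (of_rows n (dn S)) lam &
			hor (of_rows n (dn S)) mu & sz (of_rows n (dn S)) + card A0 + card S = sz lam" if S: "S <= Fr" for S
	proof -
		let ?rho = "of_rows n (dn S)"
		have S': "row lam i <= row mu i & row mu (Suc i) < row lam i" if "i : S" for i using S that Fr by blast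
		have h1: "dn S i <= row mu i" for i using G(1)[of i] S'[of i] by (auto simp: dn_def)
		have h2: "row mu (Suc i) <= dn S i" for i
			using G(2)[of i] lm(2)[of i] S'[of i] by (auto simp: dn_def)
		have p1: "dn S (Suc i) <= dn S i" for i using h1[of "Suc i"] h2[of i] by linarith
		have p2: "dn S i = 0" if "n <= i" for i using h1[of i] z(2)[OF that] by simp
		have o: "of_rows n (dn S) : Par" "row (of_rows n (dn S)) = dn S" "length (of_rows n (dn S)) <= n"
			using of_rows[of "dn S" "n", OF p1 p2] by blast+
		have l: "dn S i + of_bool (i : A0 \<union> S) = row lam i" for i using S'[of i] by (auto simp: dn_def A0)
		have "sz ?rho = (\<Sum>i<Suc n. dn S i)" using o(2,3) sum_row[of ?rho "Suc n"] by simp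
		then have "sz ?rho + (\<Sum>i<Suc n. of_bool (i : A0 \<union> S)) = (\<Sum>i<Suc n. row lam i)"
			by (simp only: l flip: sum.distrib)
		moreover have "A0 \<union> S <= {..<Suc n}" using S by (auto simp: A0_def Fr_def)
		then have "(\<Sum>i<Suc n. of_bool (i : A0 \<union> S)) = card (A0 \<union> S)"
			by (simp add: Int_absorb1 del: Un_iff sum.lessThan_Suc)
		moreover have "(\<Sum>i<Suc n. row lam i) = sz lam" by (rule sum_row) (simp add: n_def)
		moreover have "card (A0 \<union> S) = card A0 + card S"
		proof (rule card_Un_disjoint[OF finA finite_subset[OF S fin(2)]])
			have "i ~: S" if "i : A0" for i using S'[of i] that A0[of i] by auto
			then show "A0 \<inter> S = {}" by blast
		qed
		ultimately have e: "sz ?rho + card A0 + card S = sz lam" by linarith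
		have "row lam i <= Suc (dn S i) & dn S i <= row lam i" for i using l[of i] by (cases "i : A0 \<union> S") (simp_all del: Un_iff)
		then have "ver ?rho lam" unfolding ver_def o(2) by blast
		moreover have "hor ?rho mu" unfolding hor_def o(2) using h1 h2 by blast
		ultimately show ?thesis using o(1,2) e by blast
	qed
	have A: "card {nu : Par. hor lam nu & ver mu nu & sz nu = sz lam + r} =
			card {S. S <= Fn & (card A0 + sz mu) + card S = sz lam + r}" (is "card ?A = card ?P")
	proof -
		let ?S = "%nu. {i. row nu i = Suc (row mu i) & row lam i <= row mu i}"
		have nu: "?S nu <= Fn & up (?S nu) = row nu" if "hor lam nu" "ver mu nu" for nu
		proof -
			have b: "row lam i <= row nu i" "row nu (Suc i) <= row lam i" "row mu i <= row nu i" "row nu i <= Suc (row mu i)" for i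
				using that by (auto simp: hor_def ver_def)
			have "?S nu <= Fn"
			proof
				fix i assume "i : ?S nu" then show "i : Fn" using b(2)[of "i - 1"] by (cases i) (auto simp: Fn)
			qed
			moreover have "up (?S nu) i = row nu i" for i using b[of i] G(1)[of i] by (auto simp: up_def)
			ultimately show ?thesis by blast
		qed
		have recover: "of_rows (Suc n) (up (?S nu)) = nu" if "nu : ?A" for nu
		proof (rule row_inj)
			have h: "hor lam nu" "ver mu nu" using that by auto
			show "of_rows (Suc n) (up (?S nu)) : Par" using u nu[OF h] by blast
			show "nu : Par" using that by simp
			have "row (of_rows (Suc n) (up (?S nu))) = up (?S nu)" using u[of "?S nu"] nu[OF h] by blast
			then show "row (of_rows (Suc n) (up (?S nu))) i = row nu i" for i using nu[OF h] by simp
		qed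
		have "bij_betw (%S. of_rows (Suc n) (up S)) ?P ?A"
		proof (rule bij_betw_byWitness[where f' = ?S])
			show "\<forall>S\<in>?P. ?S (of_rows (Suc n) (up S)) = S"
			proof
				fix S assume "S : ?P"
				then have S: "S <= Fn" by simp
				then have r: "row (of_rows (Suc n) (up S)) = up S" using u by blast
				have S': "row lam i <= row mu i" if "i : S" for i using S that Fn by blast
				show "?S (of_rows (Suc n) (up S)) = S" unfolding r
				proof (intro equalityI subsetI)
					fix i assume "i : {i. up S i = Suc (row mu i) & row lam i <= row mu i}"
					then show "i : S" unfolding up_def by (auto split: if_splits)
				next
					fix i assume "i : S"
					then show "i : {i. up S i = Suc (row mu i) & row lam i <= row mu i}" using S' by (simp add: up_def)
				qed
			qed
			show "\<forall>nu\<in>?A. of_rows (Suc n) (up (?S nu)) = nu" using recover by blast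
			show "(%S. of_rows (Suc n) (up S)) ` ?P <= ?A"
			proof
				fix nu assume "nu : (%S. of_rows (Suc n) (up S)) ` ?P"
				then obtain S where S: "S <= Fn" "(card A0 + sz mu) + card S = sz lam + r" "nu = of_rows (Suc n) (up S)" by blast
				have "nu : Par & hor lam nu & ver mu nu & sz nu = card A0 + sz mu + card S"
					unfolding S(3) using u[OF S(1)] by blast
				then show "nu : ?A" using S(2) by simp
			qed
			show "?S ` ?A <= ?P"
			proof
				fix S assume "S : ?S ` ?A"
				then obtain nu where n: "nu : ?A" and S: "S = ?S nu" by blast
				then have "S <= Fn" using nu by blast
				have e: "of_rows (Suc n) (up S) = nu" unfolding S by (rule recover[OF n])
				have "sz nu = card A0 + sz mu + card S" using u[OF \<open>S <= Fn\<close>] unfolding e by blast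
				then show "S : ?P" using \<open>S <= Fn\<close> n by simp
			qed
		qed
		then show ?thesis by (rule bij_betw_same_card[symmetric])
	qed
	have B: "card {rho : Par. ver rho lam & hor rho mu & k + sz mu = sz rho + r} =
			card {S. S <= Fr & (k + (card A0 + sz mu)) + card S = sz lam + r}" (is "card ?B = card ?P") for k
	proof -
		let ?S = "%rho. {i. Suc (row rho i) = row lam i & row lam i <= row mu i}"
		have nu: "?S rho <= Fr & dn (?S rho) = row rho" if "ver rho lam" "hor rho mu" for rho
		proof -
			have b: "row rho i <= row mu i" "row mu (Suc i) <= row rho i" "row rho i <= row lam i" "row lam i <= Suc (row rho i)" for i
				using that by (auto simp: hor_def ver_def)
			have "?S rho <= Fr"
			proof
				fix i assume "i : ?S rho" then show "i : Fr" using b(2)[of i] by (auto simp: Fr)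
			qed
			moreover have "dn (?S rho) i = row rho i" for i using b[of i] G(1)[of i] by (auto simp: dn_def)
			ultimately show ?thesis by blast
		qed
		have recover: "of_rows n (dn (?S rho)) = rho" if "rho : ?B" for rho
		proof (rule row_inj)
			have h: "ver rho lam" "hor rho mu" using that by auto
			show "of_rows n (dn (?S rho)) : Par" using d nu[OF h] by blast
			show "rho : Par" using that by simp
			have "row (of_rows n (dn (?S rho))) = dn (?S rho)" using d[of "?S rho"] nu[OF h] by blast
			then show "row (of_rows n (dn (?S rho))) i = row rho i" for i using nu[OF h] by simp
		qed
		have "bij_betw (%S. of_rows n (dn S)) ?P ?B"
		proof (rule bij_betw_byWitness[where f' = ?S])
			show "\<forall>S\<in>?P. ?S (of_rows n (dn S)) = S"
			proof
				fix S assume "S : ?P"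
				then have S: "S <= Fr" by simp
				then have r: "row (of_rows n (dn S)) = dn S" using d by blast
				have S': "row lam i <= row mu i & 0 < row lam i" if "i : S" for i
				proof -
					have "i : Fr" using S that by blast
					then show ?thesis using Fr[of i] by simp
				qed
				show "?S (of_rows n (dn S)) = S" unfolding r
				proof (intro equalityI subsetI)
					fix i assume "i : {i. Suc (dn S i) = row lam i & row lam i <= row mu i}"
					then show "i : S" unfolding dn_def by (auto split: if_splits)
				next
					fix i assume "i : S"
					then show "i : {i. Suc (dn S i) = row lam i & row lam i <= row mu i}" using S'[of i] by (simp add: dn_def)
				qed
			qed
			show "\<forall>rho\<in>?B. of_rows n (dn (?S rho)) = rho" using recover by blast
			show "(%S. of_rows n (dn S)) ` ?P <= ?B"
			proof
				fix rho assume "rho : (%S. of_rows n (dn S)) ` ?P"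
				then obtain S where S: "S <= Fr" "(k + (card A0 + sz mu)) + card S = sz lam + r" "rho = of_rows n (dn S)" by blast
				have "rho : Par & ver rho lam & hor rho mu & sz rho + card A0 + card S = sz lam"
					unfolding S(3) using d[OF S(1)] by blast
				then show "rho : ?B" using S(2) by simp
			qed
			show "?S ` ?B <= ?P"
			proof
				fix S assume "S : ?S ` ?B"
				then obtain rho where n: "rho : ?B" and S: "S = ?S rho" by blast
				then have "S <= Fr" using nu by blast
				have e: "of_rows n (dn S) = rho" unfolding S by (rule recover[OF n])
				have "sz rho + card A0 + card S = sz lam" using d[OF \<open>S <= Fr\<close>] unfolding e by blast
				then show "S : ?P" using \<open>S <= Fr\<close> n by simp
			qed
		qed
		then show ?thesis by (rule bij_betw_same_card[symmetric])
	qed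
	let ?C = "card A0 + sz mu" and ?E = "sz lam + r"
	have "(if ?C <= ?E then Suc (card Fr) choose (?E - ?C) else 0) =
			(if ?C <= ?E then card Fr choose (?E - ?C) else 0) + (if 1 + ?C <= ?E then card Fr choose (?E - (1 + ?C)) else 0)"
	proof (cases "1 + ?C <= ?E")
		case True
		then have "?E - ?C = Suc (?E - (1 + ?C))" by simp
		then show ?thesis using True by simp
	next
		case False
		then show ?thesis by (cases "?C <= ?E") auto
	qed
	then show ?thesis
		using A B[of 0] B[of 1] unfolding card_subsets_add[OF fin(1)] card_subsets_add[OF fin(2)] cF by simp
qed

text \<open>The two counts of \<open>ver_exchange_card\<close> belong to the two terms of the factor
  1 + t X.\<close>

lemma commutes_ver:
	fixes t :: "'a::comm_ring_1"
	shows "step_operator.commutes Par (hor_step fps_X) (ver_step t) (1 + fps_const t * fps_X)"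
	unfolding step_operator.commutes_def[OF step_operator_hor]
proof (intro conjI allI ballI impI)
	fix mu :: "nat list" assume "mu : Par"
	then show "ver_step t mu [] = (if mu = [] then 1 else 0)" by (auto simp: ver_step_def ver_nil)
next
	fix mu lam :: "nat list" assume "ver_step t mu lam ~= 0"
	then show "sz mu <= sz lam" by (auto simp: ver_step_def ver_sum split: if_splits)
next
	fix lam mu :: "nat list" and r assume s: "lam : Par" "mu : Par"
	let ?c = "t ^ (sz lam + r - sz mu)"
	have "(\<Sum>nu\<in>below Par (sz lam + r). hor_step fps_X lam nu $ r * ver_step t mu nu) =
		of_nat (card {nu : below Par (sz lam + r). hor lam nu & ver mu nu & sz nu = sz lam + r}) * ?c"
	proof (rule sum_of_bool_const)
		fix nu
		have "hor lam nu ==> sz lam <= sz nu" by (rule hor_sum)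
		then show "hor_step fps_X lam nu $ r * ver_step t mu nu =
			(if hor lam nu & ver mu nu & sz nu = sz lam + r then ?c else 0)"
			by (auto simp: hor_step_def ver_step_def fps_X_power_nth)
	qed simp
	also have "{nu : below Par (sz lam + r). hor lam nu & ver mu nu & sz nu = sz lam + r} =
			{nu : Par. hor lam nu & ver mu nu & sz nu = sz lam + r}" by (auto simp: below_def)
	also note ver_exchange_card[OF s]
	also have "{rho : Par. ver rho lam & hor rho mu & sz mu = sz rho + r} =
			{rho : below Par (sz lam). ver rho lam & hor rho mu & sz mu = sz rho + r}"
		using ver_sum by (auto simp: below_def)
	also have "{rho : Par. ver rho lam & hor rho mu & Suc (sz mu) = sz rho + r} =
			{rho : below Par (sz lam). ver rho lam & hor rho mu & Suc (sz mu) = sz rho + r}"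
		using ver_sum by (auto simp: below_def)
	also have "of_nat (card {rho : below Par (sz lam). ver rho lam & hor rho mu & sz mu = sz rho + r} +
			card {rho : below Par (sz lam). ver rho lam & hor rho mu & Suc (sz mu) = sz rho + r}) * ?c =
		(\<Sum>rho\<in>below Par (sz lam). if ver rho lam & hor rho mu & sz mu = sz rho + r then ?c else 0) +
		(\<Sum>rho\<in>below Par (sz lam). if ver rho lam & hor rho mu & Suc (sz mu) = sz rho + r then ?c else 0)"
		unfolding of_nat_add distrib_right
		by (intro arg_cong2[where f = "(+)"] sum_of_bool_const[symmetric] Par.finite_below refl)
	also have "... = (\<Sum>rho\<in>below Par (sz lam). ver_step t rho lam * ((1 + fps_const t * fps_X) * hor_step fps_X rho mu) $ r)"
		unfolding sum.distrib[symmetric]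
	proof (rule sum.cong[OF refl])
		fix rho
		show "(if ver rho lam & hor rho mu & sz mu = sz rho + r then ?c else 0) +
				(if ver rho lam & hor rho mu & Suc (sz mu) = sz rho + r then ?c else 0) =
			ver_step t rho lam * ((1 + fps_const t * fps_X) * hor_step fps_X rho mu) $ r"
		proof (cases "ver rho lam & hor rho mu")
			case True
			then have le: "sz rho <= sz lam" "sz rho <= sz mu" using hor_sum ver_sum by auto
			have "((1 + fps_const t * fps_X) * hor_step fps_X rho mu) $ r =
				(if r = sz mu - sz rho then 1 else 0) + t * (if r = Suc (sz mu - sz rho) then 1 else 0)"
				using True by (simp add: hor_step_def distrib_right mult.assoc fps_X_power_nth flip: power_Suc)
			then show ?thesis using True le
				by (auto simp: ver_step_def simp flip: power_Suc power_Suc2)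
					 (auto simp: Suc_diff_le simp flip: power_Suc intro!: arg_cong[where f = "power t"])
		qed (auto simp: hor_step_def ver_step_def)
	qed
	finally show "(\<Sum>nu\<in>below Par (sz lam + r). hor_step fps_X lam nu $ r * ver_step t mu nu) =
		(\<Sum>rho\<in>below Par (sz lam). ver_step t rho lam * ((1 + fps_const t * fps_X) * hor_step fps_X rho mu) $ r)" .
qed

subsection \<open>Conjugation\<close>

lemma YD_row: "YD lam = {(i, j). j < row lam i}"
	by (auto simp: YD_def row_def split: if_splits)

lemma down_closed_lessThan:
	assumes "finite S" "\<And>i i'. i : S ==> i' <= i ==> i' : S"
	shows "S = {..<card S :: nat}"
proof (cases "S = {}")
	case False
	have "S = {..<Suc (Max S)}"
	proof (intro equalityI subsetI)
		fix i assume "i : S" then show "i : {..<Suc (Max S)}" using Max_ge[OF assms(1)] by (simp add: less_Suc_eq_le)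
	next
		fix i assume "i : {..<Suc (Max S)}"
		then show "i : S" using assms(2)[OF Max_in[OF assms(1) False]] by simp
	qed
	then show ?thesis by (metis card_lessThan)
qed simp

text \<open>Rows decrease weakly, so column \<open>j\<close> meets an initial segment of the rows;
  its length is the new row \<open>j\<close>.\<close>

lemma conjugate:
	assumes lam: "lam : Par"
	shows "conjugate lam : Par" "i < row (conjugate lam) j \<longleftrightarrow> j < row lam i"
proof -
	define c where "c = (%j. card {i. j < row lam i})"
	have set_eq: "{i. i < length lam & j < lam ! i} = {i. j < row lam i}" for j by (auto simp: row_def)
	have c: "i < c j \<longleftrightarrow> j < row lam i" for i j
	proof -
		have "finite {i. j < row lam i}" by (rule finite_subset[of _ "{..<length lam}"]) (auto simp: row_def)
		moreover have "i' : {i. j < row lam i}" if "i : {i. j < row lam i}" "i' <= i" for i i'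
			using row_antimono[OF lam that(2)] that(1) by simp
		ultimately have "{i. j < row lam i} = {..<card {i. j < row lam i}}"
			by (rule down_closed_lessThan)
		then show ?thesis unfolding c_def by blast
	qed
	have "(if lam = [] then 0 else hd lam) = row lam 0" by (cases lam) (simp_all add: row_def)
	then have l: "conjugate lam = map c [0..<row lam 0]" unfolding conjugate_def set_eq c_def by simp
	have r: "row (conjugate lam) j = c j"
		using c[of 0 j] by (auto simp: l row_def)
	show "i < row (conjugate lam) j \<longleftrightarrow> j < row lam i" unfolding r by (rule c)
	have "c j <= c i" if "i < j" for i j
	proof (rule ccontr)
		assume "\<not> c j <= c i"
		then have "j < row lam (c i)" using c[of "c i" j] by simp
		then have "c i < c i" using c[of "c i" i] that by simp
		then show False by simp
	qed
	moreover have "0 < c j" if "j < row lam 0" for j using c[of 0 j] that by simp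
	ultimately show "conjugate lam : Par"
		unfolding l by (auto simp: is_partition_def sorted_wrt_iff_nth_less)
qed

lemma conjugate_conjugate [simp]: "lam : Par ==> conjugate (conjugate lam) = lam"
proof (rule row_inj)
	assume lam: "lam : Par"
	show "conjugate (conjugate lam) : Par" using lam conjugate(1) by blast
	have "i < row (conjugate (conjugate lam)) j \<longleftrightarrow> i < row lam j" for i j
		using conjugate(2)[OF conjugate(1)[OF lam]] conjugate(2)[OF lam] by simp
	then show "row (conjugate (conjugate lam)) j = row lam j" for j by (meson linorder_neqE_nat less_irrefl)
qed

lemma sum_conjugate [simp]:
	assumes "lam : Par"
	shows "sz (conjugate lam) = sz lam"
proof -
	have c: "card (YD mu) = sz mu" for mu
	proof -
		have "YD mu = (SIGMA i:{..<length mu}. {..<row mu i})" by (auto simp: YD_row row_def split: if_splits)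
		then show ?thesis by (simp add: sum_row)
	qed
	have "YD (conjugate lam) = prod.swap ` YD lam"
		using conjugate(2)[OF assms] by (auto simp: YD_row image_iff)
	then show ?thesis unfolding c[symmetric] by (simp add: card_image)
qed

lemma le_iff_less: "a <= (b :: nat) \<longleftrightarrow> (\<forall>i. i < a --> i < b)"
	and le_Suc_iff_less: "a <= Suc b \<longleftrightarrow> (\<forall>i. Suc i < a --> i < b)"
	by (auto intro: leI)

lemma ver_conjugate:
	assumes "ka : Par" "lam : Par"
	shows "ver (conjugate ka) (conjugate lam) \<longleftrightarrow> hor ka lam"
	unfolding ver_def hor_def le_iff_less[of "row (conjugate ka) _"] le_Suc_iff_less conjugate(2)[OF assms(1)] conjugate(2)[OF assms(2)]
		le_iff_less[of "row ka _"] le_iff_less[of "row lam _"] by blast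

lemma hor_conjugate:
	assumes "ka : Par" "lam : Par"
	shows "hor (conjugate ka) (conjugate lam) \<longleftrightarrow> ver ka lam"
	using ver_conjugate[OF conjugate(1)[OF assms(1)] conjugate(1)[OF assms(2)]] assms by simp

lemma conjugate_below: "bij_betw conjugate (below Par d) (below Par d)"
	by (rule bij_betw_byWitness[where f' = conjugate]) (auto simp: below_def dest: conjugate(1)[simplified])

text \<open>Conjugation permutes the shapes of bounded size and interchanges horizontal and vertical
  strips, so it passes through the matrix product. Applied to the kernel, it is the combinatorial
  form of \<open>omega\<close>.\<close>

lemma chain_conjugate:
	assumes "\<And>i. i < N ==> (\<exists>t. A i = hor_step t & A' i = ver_step t) \<or> (\<exists>t. A i = ver_step t & A' i = hor_step t)"
		and "mu : Par" "lam : Par"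
	shows "chain Par A' N (conjugate mu) (conjugate lam) = chain Par A N mu lam"
	using assms(1,3)
proof (induction N arbitrary: lam)
	case 0
	have "conjugate mu = conjugate lam \<longleftrightarrow> mu = lam" using assms(2) 0 by (metis conjugate_conjugate)
	then show ?case by simp
next
	case (Suc N)
	have s: "A' N (conjugate ka) (conjugate lam) = A N ka lam" if "ka : Par" for ka
		using Suc.prems(1)[of N] Suc.prems(2) that
		by (auto simp: hor_step_def ver_step_def hor_conjugate ver_conjugate)
	have "chain Par A' (Suc N) (conjugate mu) (conjugate lam) =
			(\<Sum>ka\<in>below Par (sz lam). chain Par A' N (conjugate mu) (conjugate ka) * A' N (conjugate ka) (conjugate lam))"
		unfolding chain.simps sum_conjugate[OF Suc.prems(2)]
		by (rule sum.reindex_bij_betw[OF conjugate_below, symmetric])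
	also have "... = chain Par A (Suc N) mu lam"
		unfolding chain.simps by (rule sum.cong[OF refl]) (use Suc in \<open>simp add: below_def s\<close>)
	finally show ?case .
qed

section \<open>Schur functions\<close>

lemma coeff_Var: "cf (Var i :: 'a::comm_ring_1 mpseries) m = (if m = Poly_Mapping.single i 1 then 1 else 0)"
	by (simp add: Var.rep_eq)

lemma coeff_prod_Var:
	assumes "finite S"
	shows "cf (\<Prod>b\<in>S. Var (g b) :: 'a::comm_ring_1 mpseries) m =
		(if \<forall>i. lookup m i = card {b : S. g b = i} then 1 else 0)"
proof -
	define w where "w = (%T. \<Sum>b\<in>T. Poly_Mapping.single (g b) (1 :: nat))"
	have P: "(\<Prod>b\<in>T. Var (g b) :: 'a mpseries) = Abs_mpseries (%m. if m = w T then 1 else 0)" if "finite T" for T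
		using that
	proof (induction T rule: finite_induct)
		case empty
		show ?case by (rule mpseries_eqI) (simp add: w_def coeff_simps)
	next
		case (insert b T)
		show ?case
		proof (rule mpseries_eqI)
			fix m
			have "cf (\<Prod>b\<in>insert b T. Var (g b) :: 'a mpseries) m =
					(\<Sum>(p, q)\<in>splits m. (if p = Poly_Mapping.single (g b) 1 then 1 else 0) * (if q = w T then 1 else 0))"
				using insert by (simp add: coeff_mult coeff_Var)
			also have "... = (\<Sum>pq\<in>splits m. if pq = (Poly_Mapping.single (g b) 1, w T) then 1 else 0)"
				by (rule sum.cong) (auto split: if_splits)
			also have "... = (if (Poly_Mapping.single (g b) 1, w T) : splits m then 1 else 0)"
				by (simp add: sum.delta)
			also have "(Poly_Mapping.single (g b) 1, w T) : splits m \<longleftrightarrow> m = w (insert b T)"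
				using insert by (auto simp: splits_def w_def)
			finally show "cf (\<Prod>b\<in>insert b T. Var (g b) :: 'a mpseries) m =
					cf (Abs_mpseries (%m. if m = w (insert b T) then 1 else 0)) m" by simp
		qed
	qed
	have l: "lookup (w S) i = card {b : S. g b = i}" for i
	proof -
		have "lookup (w S) i = (\<Sum>b\<in>S. if g b = i then 1 else 0)"
			unfolding w_def lookup_sum by (rule sum.cong) (auto simp: lookup_single when_def)
		also have "... = card {b : S. g b = i}" using assms by (simp add: sum.If_cases Int_def)
		finally show ?thesis .
	qed
	have "m = w S \<longleftrightarrow> (\<forall>i. lookup m i = card {b : S. g b = i})"
		unfolding l[symmetric] by (metis poly_mapping_eqI)
	then show ?thesis unfolding P[OF assms] by simp
qed

section \<open>Semistandard tableaux as chains of horizontal strips\<close>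

definition ssyt_below :: "nat list => nat => (nat \<times> nat => nat) set" where
	"ssyt_below lam E = {T : SSYT lam. \<forall>b\<in>YD lam. T b < E}"

lemma finite_YD [simp]: "finite (YD lam)"
	by (rule finite_subset[of _ "SIGMA i:{..<length lam}. {..<lam ! i}"]) (auto simp: YD_def)

lemma card_YD: "card (YD mu) = sz mu"
proof -
	have "YD mu = (SIGMA i:{..<length mu}. {..<row mu i})" by (auto simp: YD_row row_def split: if_splits)
	then show ?thesis by (simp add: sum_row)
qed

lemma finite_ssyt_below: "finite (ssyt_below lam E)"
proof (rule finite_subset)
	show "ssyt_below lam E <= YD lam \<rightarrow>\<^sub>E {..<E}" by (auto simp: ssyt_below_def SSYT_def PiE_iff extensional_def)
qed (intro finite_PiE; simp)

lemma SSYT_D: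
	assumes "T : SSYT lam" "lam : Par"
	shows "j' < row lam i ==> j <= j' ==> T (i, j) <= T (i, j')"
		and "j < row lam (Suc i) ==> T (i, j) < T (Suc i, j)"
		and "T : extensional (YD lam)"
proof -
	have a: "T (i, j) <= T (i, Suc j)" if "Suc j < row lam i" for i j
		using assms(1) that by (auto simp: SSYT_def YD_row)
	show "j' < row lam i ==> j <= j' ==> T (i, j) <= T (i, j')"
	proof (induction "j' - j" arbitrary: j')
		case (Suc d)
		then obtain k where k: "j' = Suc k" "d = k - j" "j <= k" by (cases j') auto
		then show ?case using Suc.hyps(1)[of k] a[of k i] Suc.prems by simp
	qed simp
	show "j < row lam (Suc i) ==> T (i, j) < T (Suc i, j)"
		using assms row_antimono[OF assms(2), of i "Suc i"] by (auto simp: SSYT_def YD_row)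
	show "T : extensional (YD lam)" using assms(1) by (auto simp: SSYT_def PiE_iff)
qed

text \<open>Rows increase, so the entries below \<open>E\<close> fill a diagram. Columns increase
  strictly, so the box above any box has an entry below \<open>E\<close>, and the boxes with entry
  \<open>E\<close> form a horizontal strip.\<close>

lemma ssyt_low_part:
	assumes lam: "lam : Par" and T: "T : ssyt_below lam (Suc E)"
	obtains kap where "kap : Par" "hor kap lam" "YD kap = {b : YD lam. T b < E}" "restrict T (YD kap) : ssyt_below kap E"
proof -
	have TS: "T : SSYT lam" and TE: "\<And>b. b : YD lam ==> T b <= E" using T by (auto simp: ssyt_below_def)
	note D = SSYT_D[OF TS lam]
	define f where "f = (%i. card {j. j < row lam i & T (i, j) < E})"
	have f: "j < f i \<longleftrightarrow> j < row lam i & T (i, j) < E" for i j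
	proof -
		have "{j. j < row lam i & T (i, j) < E} = {..<card {j. j < row lam i & T (i, j) < E}}"
		proof (rule down_closed_lessThan)
			fix j j' assume "j : {j. j < row lam i & T (i, j) < E}" "j' <= j"
			then show "j' : {j. j < row lam i & T (i, j) < E}" using D(1)[of j i j'] by simp
		qed simp
		then show ?thesis unfolding f_def by blast
	qed
	have f1: "row lam (Suc i) <= f i" for i
	proof (rule ccontr)
		assume "\<not> row lam (Suc i) <= f i"
		then have l: "f i < row lam (Suc i)" by simp
		have "T (i, f i) < T (Suc i, f i)" by (rule D(2)[OF l])
		also have "... <= E" using l by (intro TE) (simp add: YD_row)
		finally have "f i < f i" using l row_antimono[OF lam, of i "Suc i"] f[of "f i" i] by simp
		then show False by simp
	qed
	have f2: "f i <= row lam i" for i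
	proof (rule ccontr)
		assume "\<not> f i <= row lam i"
		then have "row lam i < f i" by simp
		then show False unfolding f by simp
	qed
	have p1: "f (Suc i) <= f i" for i using f1[of i] f2[of "Suc i"] by simp
	have p2: "f i = 0" if "length lam <= i" for i using f2[of i] that by simp
	define kap where "kap = of_rows (length lam) f"
	have kap: "kap : Par" "row kap = f" unfolding kap_def using of_rows[of f "length lam", OF p1 p2] by blast+
	have Y: "YD kap = {b : YD lam. T b < E}" by (auto simp: YD_row kap(2) f)
	show ?thesis
	proof (rule that[OF kap(1) _ Y])
		show "hor kap lam" using f1 f2 by (simp add: hor_def kap(2))
		have "restrict T (YD kap) : SSYT kap"
			unfolding SSYT_def
		proof (intro CollectI conjI allI impI)
			fix i j assume a: "(i, j) : YD kap & (i, Suc j) : YD kap"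
			then have "T (i, j) <= T (i, Suc j)" using D(1)[of "Suc j" i j] unfolding Y by (simp add: YD_row)
			then show "restrict T (YD kap) (i, j) <= restrict T (YD kap) (i, Suc j)" using a by simp
		next
			fix i j assume a: "(i, j) : YD kap & (Suc i, j) : YD kap"
			then have "T (i, j) < T (Suc i, j)" using D(2)[of j i] unfolding Y by (simp add: YD_row)
			then show "restrict T (YD kap) (i, j) < restrict T (YD kap) (Suc i, j)" using a by simp
		qed simp
		then show "restrict T (YD kap) : ssyt_below kap E" by (simp add: ssyt_below_def Y)
	qed
qed

lemma ssyt_extend:
	assumes lam: "lam : Par" and kap: "kap : Par" and h: "hor kap lam" and T: "T : ssyt_below kap E"
	defines "T' \<equiv> \<lambda>b\<in>YD lam. if b : YD kap then T b else E"
	shows "T' : ssyt_below lam (Suc E)" "YD kap = {b : YD lam. T' b < E}" "restrict T' (YD kap) = T"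
proof -
	have TS: "T : SSYT kap" and TE: "\<And>b. b : YD kap ==> T b < E" using T by (auto simp: ssyt_below_def)
	note D = SSYT_D[OF TS kap]
	have sub: "YD kap <= YD lam" using h unfolding YD_row hor_def by (auto intro: less_le_trans)
	show Y: "YD kap = {b : YD lam. T' b < E}" using sub TE by (auto simp: T'_def)
	show "restrict T' (YD kap) = T"
	proof
		fix b show "restrict T' (YD kap) b = T b"
			using sub extensional_arb[OF D(3), of b] by (cases "b : YD kap") (auto simp: T'_def)
	qed
	have "T' : SSYT lam"
		unfolding SSYT_def
	proof (intro CollectI conjI allI impI)
		show "T' : YD lam \<rightarrow>\<^sub>E UNIV" by (simp add: T'_def)
	next
		fix i j assume a: "(i, j) : YD lam & (i, Suc j) : YD lam"
		show "T' (i, j) <= T' (i, Suc j)"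
		proof (cases "(i, Suc j) : YD kap")
			case True
			then have "(i, j) : YD kap" by (simp add: YD_row)
			then show ?thesis using a True D(1)[of "Suc j" i j] by (simp add: T'_def YD_row)
		next
			case False
			have "T' (i, j) <= E" using a TE[of "(i, j)"] by (auto simp: T'_def)
			then show ?thesis using a False by (simp add: T'_def)
		qed
	next
		fix i j assume a: "(i, j) : YD lam & (Suc i, j) : YD lam"
		then have ij: "(i, j) : YD kap" using h unfolding hor_def YD_row by (auto intro: less_le_trans)
		show "T' (i, j) < T' (Suc i, j)"
		proof (cases "(Suc i, j) : YD kap")
			case True
			then show ?thesis using a ij D(2)[of j i] by (simp add: T'_def YD_row)
		next
			case False
			then show ?thesis using a ij TE[OF ij] by (simp add: T'_def)
		qed
	qed
	then show "T' : ssyt_below lam (Suc E)" using TE by (auto simp: ssyt_below_def T'_def less_Suc_eq)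
qed

definition ssyt_sum :: "(nat => 'a::comm_ring_1) => nat => nat list => 'a" where
	"ssyt_sum z E lam = (\<Sum>T\<in>ssyt_below lam E. \<Prod>b\<in>YD lam. z (T b))"

lemma ssyt_sum_Suc:
	assumes lam: "lam : Par"
	shows "ssyt_sum z (Suc E) lam = (\<Sum>kap\<in>below Par (sz lam). ssyt_sum z E kap * hor_step (z E) kap lam)"
proof -
	let ?K = "{kap : below Par (sz lam). hor kap lam}"
	let ?I = "SIGMA kap:?K. ssyt_below kap E"
	define mk where "mk = (%(kap, T). \<lambda>b\<in>YD lam. if b : YD kap then T b else E)"
	have YD_inj: "kap = kap'" if "kap : Par" "kap' : Par" "YD kap = YD kap'" for kap kap'
	proof (rule row_inj[OF that(1,2)])
		fix i
		have "j < row kap i \<longleftrightarrow> j < row kap' i" for j using that(3) unfolding YD_row by blast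
		then show "row kap i = row kap' i" by (meson linorder_neqE_nat less_irrefl)
	qed
	have bij: "bij_betw mk ?I (ssyt_below lam (Suc E))"
		unfolding bij_betw_def
	proof
		show "inj_on mk ?I"
		proof (rule inj_onI)
			fix p p' assume p: "p : ?I" "p' : ?I" "mk p = mk p'"
			obtain kap T kap' T' where e: "p = (kap, T)" "p' = (kap', T')" by fastforce
			have K: "kap : Par" "hor kap lam" "T : ssyt_below kap E" "kap' : Par" "hor kap' lam" "T' : ssyt_below kap' E"
				using p(1,2) unfolding e mem_Sigma_iff below_def by blast+
			note x = ssyt_extend[OF lam K(1-3)] and x' = ssyt_extend[OF lam K(4-6)]
			have m: "mk p = (\<lambda>b\<in>YD lam. if b : YD kap then T b else E)" "mk p' = (\<lambda>b\<in>YD lam. if b : YD kap' then T' b else E)"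
				by (simp_all add: mk_def e)
			have a: "YD kap = {b : YD lam. mk p b < E}" "YD kap' = {b : YD lam. mk p' b < E}"
				unfolding m by (rule x(2), rule x'(2))
			have r: "restrict (mk p) (YD kap) = T" "restrict (mk p') (YD kap') = T'"
				unfolding m by (rule x(3), rule x'(3))
			have "YD kap = YD kap'" unfolding a p(3) ..
			then have k: "kap = kap'" by (rule YD_inj[OF K(1,4)])
			have "T = T'" unfolding r[symmetric] p(3) k ..
			then show "p = p'" using k e by simp
		qed
		show "mk ` ?I = ssyt_below lam (Suc E)"
		proof (intro equalityI subsetI)
			fix T assume "T : mk ` ?I"
			then obtain kap S where "kap : ?K" "S : ssyt_below kap E" and T: "T = mk (kap, S)" by auto
			then show "T : ssyt_below lam (Suc E)"
				using ssyt_extend(1)[OF lam, of kap S E] by (simp add: mk_def below_def)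
		next
			fix T assume T: "T : ssyt_below lam (Suc E)"
			obtain kap where k: "kap : Par" "hor kap lam" "YD kap = {b : YD lam. T b < E}" "restrict T (YD kap) : ssyt_below kap E"
				using ssyt_low_part[OF lam T] .
			have "T = mk (kap, restrict T (YD kap))"
			proof
				fix b
				have "T b = E" if "b : YD lam" "b ~: YD kap" using T that k(3) by (auto simp: ssyt_below_def less_Suc_eq)
				moreover have "T : SSYT lam" using T by (simp add: ssyt_below_def)
				then have "T b = undefined" if "b ~: YD lam" using extensional_arb[OF SSYT_D(3)[OF _ lam] that] by blast
				ultimately show "T b = mk (kap, restrict T (YD kap)) b" by (auto simp: mk_def)
			qed
			moreover have "(kap, restrict T (YD kap)) : ?I" using k hor_sum[OF k(2)] by (simp add: below_def)
			ultimately show "T : mk ` ?I" by blast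
		qed
	qed
	have "ssyt_sum z (Suc E) lam = (\<Sum>p\<in>?I. \<Prod>b\<in>YD lam. z (mk p b))"
		unfolding ssyt_sum_def by (rule sum.reindex_bij_betw[OF bij, symmetric])
	also have "... = (\<Sum>(kap, T)\<in>?I. (\<Prod>b\<in>YD kap. z (T b)) * z E ^ (sz lam - sz kap))"
	proof (rule sum.cong[OF refl])
		fix p assume "p : ?I"
		then obtain kap T where p: "p = (kap, T)" and h: "hor kap lam" by auto
		have sub: "YD kap <= YD lam" using h unfolding YD_row hor_def by (auto intro: less_le_trans)
		have "(\<Prod>b\<in>YD lam. z (mk p b)) = (\<Prod>b\<in>YD lam - YD kap. z (mk p b)) * (\<Prod>b\<in>YD kap. z (mk p b))"
			by (rule prod.subset_diff[OF sub finite_YD])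
		also have "(\<Prod>b\<in>YD lam - YD kap. z (mk p b)) = (\<Prod>b\<in>YD lam - YD kap. z E)" by (rule prod.cong) (auto simp: mk_def p)
		also have "... = z E ^ (sz lam - sz kap)"
			by (simp add: card_Diff_subset[OF finite_YD sub] card_YD)
		also have "(\<Prod>b\<in>YD kap. z (mk p b)) = (\<Prod>b\<in>YD kap. z (T b))"
			by (rule prod.cong) (use sub in \<open>auto simp: mk_def p\<close>)
		finally show "(\<Prod>b\<in>YD lam. z (mk p b)) = (case p of (kap, T) => (\<Prod>b\<in>YD kap. z (T b)) * z E ^ (sz lam - sz kap))"
			by (simp add: p mult.commute)
	qed
	also have "... = (\<Sum>kap\<in>?K. \<Sum>T\<in>ssyt_below kap E. (\<Prod>b\<in>YD kap. z (T b)) * z E ^ (sz lam - sz kap))"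
		by (rule sum.Sigma[symmetric]) (auto simp: finite_ssyt_below)
	also have "... = (\<Sum>kap\<in>?K. ssyt_sum z E kap * z E ^ (sz lam - sz kap))"
		by (simp add: ssyt_sum_def sum_distrib_right)
	also have "... = (\<Sum>kap\<in>below Par (sz lam). if hor kap lam then ssyt_sum z E kap * z E ^ (sz lam - sz kap) else 0)"
		by (rule sum.inter_filter) simp
	also have "... = (\<Sum>kap\<in>below Par (sz lam). ssyt_sum z E kap * hor_step (z E) kap lam)"
		by (rule sum.cong) (auto simp: hor_step_def)
	finally show ?thesis .
qed

lemma ssyt_sum_chain:
	assumes "lam : Par"
	shows "ssyt_sum z E lam = chain Par (%e. hor_step (z e)) E [] lam"
	using assms
proof (induction E arbitrary: lam)
	case 0
	show ?case
	proof (cases "lam = []")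
		case True
		have "ssyt_below [] 0 = {%_. undefined}" by (auto simp: ssyt_below_def SSYT_def YD_def)
		then show ?thesis by (simp add: True ssyt_sum_def YD_def)
	next
		case False
		then have "(0, 0) : YD lam" using row_pos_iff[OF 0, of 0] by (simp add: YD_row)
		then have "ssyt_below lam 0 = {}" by (auto simp: ssyt_below_def)
		then show ?thesis using False by (simp add: ssyt_sum_def)
	qed
next
	case (Suc E)
	show ?case unfolding ssyt_sum_Suc[OF Suc.prems] chain.simps
		by (rule sum.cong[OF refl]) (simp add: Suc.IH below_def)
qed

definition ssyt_count :: "nat list => monomial => nat" where
	"ssyt_count lam m = card {T : SSYT lam. \<forall>i. lookup m i = card {b : YD lam. T b = i}}"

lemma coeff_schur: "cf (schur lam) m = of_nat (ssyt_count lam m)"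
	by (simp add: schur_def ssyt_count_def)

lemma chain_hom:
	fixes h :: "'a::comm_ring_1 => 'b::comm_ring_1"
	assumes h: "\<And>x y. h (x + y) = h x + h y" "\<And>x y. h (x * y) = h x * h y" "h 0 = 0" "h 1 = 1"
	shows "h (chain Sh A N mu lam) = chain Sh (%i ka lam. h (A i ka lam)) N mu lam"
proof -
	have hs: "h (sum g B) = (\<Sum>x\<in>B. h (g x))" for g and B :: "nat list set"
		by (induction B rule: infinite_finite_induct) (auto simp: h)
	show ?thesis by (induction N arbitrary: lam) (simp_all add: hs h)
qed

lemma emb_hor_step: "emb i (hor_step fps_X ka lam) = hor_step (Var i :: 'a::comm_ring_1 mpseries) ka lam"
	by (simp add: hor_step_def emb_power)

lemma vchain_hor: "vchain Par (hor_step fps_X) 1 N lam = chain Par (%j. hor_step (Var j :: 'a::comm_ring_1 mpseries)) N [] lam"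
	by (simp add: vchain_def emb_hor_step)

text \<open>A monomial in the first \<open>N\<close> variables is only produced by tableaux with
  entries below \<open>N\<close>, so the chain in \<open>N\<close> variables already has the full
  Schur coefficient.\<close>

lemma coeff_vchain_hor:
	assumes "lam : Par"
	shows "cf (vchain Par (hor_step fps_X) 1 N lam) m =
		(if keys m <= {..<N} then of_nat (ssyt_count lam m) else (0 :: 'a::comm_ring_1))"
proof (cases "keys m <= {..<N}")
	case True
	have "cf (vchain Par (hor_step fps_X) 1 N lam) m = cf (ssyt_sum Var N lam) m"
		by (simp add: vchain_hor ssyt_sum_chain[OF assms])
	also have "... = (\<Sum>T\<in>ssyt_below lam N. if \<forall>i. lookup m i = card {b : YD lam. T b = i} then 1 else 0)"
		by (simp add: ssyt_sum_def coeff_sum coeff_prod_Var)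
	also have "... = of_nat (card {T : ssyt_below lam N. \<forall>i. lookup m i = card {b : YD lam. T b = i}})"
		by (subst sum.inter_filter[symmetric]) (simp_all add: finite_ssyt_below)
	also have "{T : ssyt_below lam N. \<forall>i. lookup m i = card {b : YD lam. T b = i}} =
			{T : SSYT lam. \<forall>i. lookup m i = card {b : YD lam. T b = i}}"
	proof (intro equalityI subsetI)
		fix T assume T: "T : {T : SSYT lam. \<forall>i. lookup m i = card {b : YD lam. T b = i}}"
		have "T b < N" if "b : YD lam" for b
		proof -
			have "{c : YD lam. T c = T b} ~= {}" using that by blast
			then have "0 < card {c : YD lam. T c = T b}" by (simp add: card_gt_0_iff)
			moreover have "lookup m (T b) = card {c : YD lam. T c = T b}" using T by blast
			ultimately have "lookup m (T b) ~= 0" by linarith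
			then have "T b : keys m" unfolding in_keys_iff .
			then show ?thesis using True by auto
		qed
		then show "T : {T : ssyt_below lam N. \<forall>i. lookup m i = card {b : YD lam. T b = i}}"
			using T by (simp add: ssyt_below_def)
	qed (simp add: ssyt_below_def)
	finally show ?thesis using True by (simp add: ssyt_count_def)
next
	case False
	then show ?thesis using vars_below_vchain[of N Par "hor_step fps_X" 1 lam] by (auto simp: vars_below_def)
qed


lemma chain_cong:
	assumes "\<And>i ka lam. i < N ==> A i ka lam = B i ka lam"
	shows "chain Sh A N mu lam = chain Sh B N mu lam"
	using assms by (induction N arbitrary: lam) simp_all

lemma trunc_Var: "trunc N (Var j :: 'a::comm_ring_1 mpseries) = (if j < N then Var j else 0)"
	by (rule mpseries_eqI) (auto simp: coeff_trunc coeff_Var coeff_simps split: if_splits)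

lemma hor_step_hom:
	assumes "\<And>x y. h (x * y) = h x * h y" "h 0 = 0" "h 1 = 1"
	shows "h (hor_step t ka lam) = hor_step (h t) ka lam" "h (ver_step t ka lam) = ver_step (h t) ka lam"
proof -
	have "h (t ^ n) = h t ^ n" for n by (induction n) (simp_all add: assms)
	then show "h (hor_step t ka lam) = hor_step (h t) ka lam" "h (ver_step t ka lam) = ver_step (h t) ka lam"
		by (simp_all add: hor_step_def ver_step_def assms)
qed

section \<open>Tableau generating functions as chains\<close>

lemma emb_gp_step: "emb i (gp_step (fps_const b) fps_X ka lam) = gp_step (Const b) (Var i) ka (lam :: nat list)"
proof -
	have "emb i (ext_sum (fps_const b) E fps_X ka lam) = ext_sum (Const b) E (Var i) ka lam" for E ka lam
		unfolding ext_sum_def emb_sum emb_prod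
		by (intro sum.cong prod.cong refl) (simp add: emb_mult)
	then show ?thesis unfolding gp_step_def by (simp add: emb_sum emb_mult)
qed

lemma jq_step_hom:
	fixes h :: "'a::comm_ring_1 => 'b::comm_ring_1"
	assumes h: "\<And>x y. h (x + y) = h x + h y" "\<And>x y. h (x * y) = h x * h y" "h 0 = 0" "h 1 = 1"
	shows "h (jq_step v t ka lam) = jq_step (h v) (h t) ka lam"
proof -
	have hs: "h (sum g B) = (\<Sum>x\<in>B. h (g x))" for g and B :: "'c set"
		by (induction B rule: infinite_finite_induct) (auto simp: h)
	have hp: "h (prod g B) = (\<Prod>x\<in>B. h (g x))" for g and B :: "'c set"
		by (induction B rule: infinite_finite_induct) (auto simp: h)
	have hpow: "h (x ^ n) = h x ^ n" for x n by (induction n) (auto simp: h)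
	have hs': "h (sum g B) = (\<Sum>x\<in>B. h (g x))" for g and B :: "(nat \<times> nat) set set set"
		by (induction B rule: infinite_finite_induct) (auto simp: h)
	have hp': "h (prod g B) = (\<Prod>x\<in>B. h (g x))" for g and B :: "(nat \<times> nat) set set"
		by (induction B rule: infinite_finite_induct) (auto simp: h)
	have hl: "h (sum g B) = (\<Sum>x\<in>B. h (g x))" for g and B :: "nat list set"
		by (induction B rule: infinite_finite_induct) (auto simp: h)
	have s: "h (strip_sum v E t ka lam) = strip_sum (h v) E (h t) ka lam" for E ka lam
		unfolding strip_sum_def if_distrib[of h] h(3) hs' hp' h(2) hpow ..
	show ?thesis unfolding jq_step_def hl h(2) s ..
qed

lemma emb_jq_step: "emb i (jq_step (fps_const b) fps_X ka lam) = jq_step (Const b) (Var i) ka lam"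
proof -
	show ?thesis using jq_step_hom[of "emb i" "fps_const b" fps_X ka lam, OF emb_add emb_mult emb_0 emb_1] by simp
qed

lemma vchain_gp: "vchain Strict (gp_step (fps_const b) fps_X) 1 N lam = chain Strict (%i. gp_step (Const b) (Var i)) N [] lam"
	by (simp add: vchain_def emb_gp_step)

lemma vchain_jq: "vchain Strict (jq_step (fps_const b) fps_X) 1 N lam = chain Strict (%i. jq_step (Const b) (Var i)) N [] lam"
	by (simp add: vchain_def emb_jq_step)

lemma chain_gp_sv_sum:
	assumes "strict_partition lam"
	shows "chain Strict (%i. gp_step b (x i)) N [] lam = sv_sum b (%e. x (e div 2)) (2 * N) lam"
proof -
	have "sv_sum b (%e. x (e div 2)) (2 * N) lam = chain Strict (%e. ext_sum b e (x (e div 2))) (2 * N) [] lam"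
		by (rule sv_sum_chain[OF assms])
	also have "... = chain Strict (%i ka lam. \<Sum>nu\<in>below Strict (sz lam). ext_sum b (2 * i) (x (2 * i div 2)) ka nu *
			ext_sum b (Suc (2 * i)) (x (Suc (2 * i) div 2)) nu lam) N [] lam"
		by (rule chain_pairs[OF Strict.finite_below]) (rule ext_sum_sum)
	also have "... = chain Strict (%i. gp_step b (x i)) N [] lam"
		unfolding ext_sum_parity gp_step_def by simp
	finally show ?thesis by simp
qed

lemma chain_jq_bar_sum:
	assumes "strict_partition lam" "strict_partition mu"
	shows "chain Strict (%i. jq_step b (x i)) N mu lam = bar_sum b (%e. x (e div 2)) (2 * N) mu lam"
proof -
	have "bar_sum b (%e. x (e div 2)) (2 * N) mu lam = chain Strict (%e. strip_sum b e (x (e div 2))) (2 * N) mu lam"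
		by (rule bar_sum_chain[OF assms])
	also have "... = chain Strict (%i ka lam. \<Sum>nu\<in>below Strict (sz lam). strip_sum b (2 * i) (x (2 * i div 2)) ka nu *
			strip_sum b (Suc (2 * i)) (x (Suc (2 * i) div 2)) nu lam) N mu lam"
		by (rule chain_pairs[OF Strict.finite_below]) (rule strip_sum_sum)
	also have "... = chain Strict (%i. jq_step b (x i)) N mu lam"
		unfolding strip_sum_parity jq_step_def by simp
	finally show ?thesis by simp
qed

lemma SSVT_iff:
	assumes E: "\<And>b e. b : SD lam ==> e : T b ==> e < E"
	shows "T : SSVT lam & (\<forall>i. (i, i) : SD lam --> (\<forall>e\<in>T (i, i). \<not> primed e)) \<longleftrightarrow> T : sv_tableaux lam E"
proof
	assume a: "T : SSVT lam & (\<forall>i. (i, i) : SD lam --> (\<forall>e\<in>T (i, i). \<not> primed e))"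
	note s = conjunct1[OF a, unfolded SSVT_def mem_Collect_eq]
	note s1 = conjunct1[OF s] and r1 = conjunct2[OF s]
	note s2 = conjunct1[OF r1] and r2 = conjunct2[OF r1]
	note s3 = conjunct1[OF r2] and r3 = conjunct2[OF r2]
	note s4 = conjunct1[OF r3] and s5 = conjunct2[OF r3]
	have fin: "finite (T b)" "T b ~= {}" if "b : SD lam" for b using s1 that by (auto simp: PiE_iff)
	have mm: "e <= e'" if "Max (T b) <= Min (T c)" "b : SD lam" "c : SD lam" "e : T b" "e' : T c" for b c e e'
		using Max_ge[OF fin(1)[OF that(2)] that(4)] Min_le[OF fin(1)[OF that(3)] that(5)] that(1) by simp
	show "T : sv_tableaux lam E"
	proof (rule sv_tableauxI)
		show "T : extensional (SD lam)" using s1 by (simp add: PiE_iff)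
		show "\<And>b. b : SD lam ==> T b ~= {}" by (rule fin(2))
		show "\<And>b e. b : SD lam ==> e : T b ==> e < E" by (rule E)
		show "e <= e'" if "(i, j) : SD lam" "(Suc i, j) : SD lam" "e : T (i, j)" "e' : T (Suc i, j)" for i j e e'
			using mm[OF _ that] s2 that by blast
		show "e <= e'" if "(i, j) : SD lam" "(i, Suc j) : SD lam" "e : T (i, j)" "e' : T (i, Suc j)" for i j e e'
			using mm[OF _ that] s3 that by blast
		show "i = i'" if "(i, j) : SD lam" "(i', j) : SD lam" "\<not> primed e" "e : T (i, j)" "e : T (i', j)" for i i' j e
			using s4 that by blast
		show "j = j'" if "(i, j) : SD lam" "(i, j') : SD lam" "primed e" "e : T (i, j)" "e : T (i, j')" for i j j' e
			using s5 that by blast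
		show "\<not> primed e" if "(i, i) : SD lam" "e : T (i, i)" for i e using conjunct2[OF a] that by blast
	qed
next
	assume T: "T : sv_tableaux lam E"
	note D = sv_tableauxD[OF T]
	have fin: "finite (T b)" "T b ~= {}" if "b : SD lam" for b
	proof -
		have "T b <= {..<E}" using D(3) that by blast
		then show "finite (T b)" by (rule finite_subset) simp
		show "T b ~= {}" by (rule D(2)[OF that])
	qed
	have "T : SSVT lam"
		unfolding SSVT_def mem_Collect_eq
	proof (intro conjI allI impI)
		show "T : SD lam \<rightarrow>\<^sub>E {S. finite S & S ~= {}}" using D(1) fin by (simp add: PiE_iff)
		show "Max (T (i, j)) <= Min (T (Suc i, j))" if "(i, j) : SD lam & (Suc i, j) : SD lam" for i j
		proof -
			have a: "(i, j) : SD lam" "(Suc i, j) : SD lam" using that by blast+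
			show ?thesis by (rule D(4)[OF a Max_in[OF fin[OF a(1)]] Min_in[OF fin[OF a(2)]]])
		qed
		show "Max (T (i, j)) <= Min (T (i, Suc j))" if "(i, j) : SD lam & (i, Suc j) : SD lam" for i j
		proof -
			have a: "(i, j) : SD lam" "(i, Suc j) : SD lam" using that by blast+
			show ?thesis by (rule D(5)[OF a Max_in[OF fin[OF a(1)]] Min_in[OF fin[OF a(2)]]])
		qed
		show "\<not> (e : T (i, j) & e : T (i', j))" if "(i, j) : SD lam & (i', j) : SD lam & i ~= i' & \<not> primed e" for i i' j e
			using D(6)[of i j i' e] that by blast
		show "\<not> (e : T (i, j) & e : T (i, j'))" if "(i, j) : SD lam & (i, j') : SD lam & j ~= j' & primed e" for i j j' e
			using D(7)[of i j j' e] that by blast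
	qed
	then show "T : SSVT lam & (\<forall>i. (i, i) : SD lam --> (\<forall>e\<in>T (i, i). \<not> primed e))" using D(8) by blast
qed

lemma card_posI: "finite A ==> x : A ==> 0 < card A"
	by (auto simp: card_gt_0_iff)

text \<open>Variable \<open>i\<close> has the letters \<open>2 * i\<close> and
  \<open>2 * i + 1\<close>. A tableau whose weight involves only the first \<open>N\<close>
  variables is therefore among those with letters below \<open>2 * N\<close>, to which the chains
  apply.\<close>

lemma keys_bound:
	fixes e N :: nat
	assumes "keys m <= {..<N}" "lookup m (e div 2) ~= 0"
	shows "e < 2 * N"
proof -
	have "e div 2 : keys m" using assms(2) by (simp add: in_keys_iff)
	then have "e div 2 < N" using assms(1) by blast
	then show ?thesis by simp
qed

lemma coeff_prod_box_wt:
	assumes T: "T : sv_tableaux lam E"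
	shows "cf (\<Prod>b\<in>SD lam. box_wt (Const \<beta>) (%e. Var (e div 2)) (T b)) m =
		(if \<forall>k. lookup m k = sv_weight lam T k then \<beta> ^ (sv_size lam T - sz lam) else (0 :: 'a::comm_ring_1))"
proof -
	note D = sv_tableauxD[OF T]
	have fin: "finite (T b)" if "b : SD lam" for b
	proof -
		have "T b <= {..<E}" using D(3) that by blast
		then show "finite (T b)" by (rule finite_subset) simp
	qed
	have pos: "1 <= card (T b)" if "b : SD lam" for b
		using fin[OF that] D(2)[OF that] by (simp add: Suc_le_eq card_gt_0_iff)
	have "(\<Sum>b\<in>SD lam. card (T b) - 1) + card (SD lam) = (\<Sum>b\<in>SD lam. card (T b))"
	proof -
		have "(\<Sum>b\<in>SD lam. card (T b) - 1) + card (SD lam) = (\<Sum>b\<in>SD lam. (card (T b) - 1) + 1)" by (simp only: sum.distrib card_eq_sum)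
		also have "... = (\<Sum>b\<in>SD lam. card (T b))" 
		proof (rule sum.cong[OF refl])
			fix b assume "b : SD lam" then show "card (T b) - 1 + 1 = card (T b)" using pos[of b] by simp
		qed
		finally show ?thesis .
	qed
	then have size: "(\<Sum>b\<in>SD lam. card (T b) - 1) = sv_size lam T - sz lam"
		unfolding sv_size_def card_SD by simp
	let ?S = "SIGMA b:SD lam. T b"
	have "(\<Prod>b\<in>SD lam. box_wt (Const \<beta>) (%e. Var (e div 2)) (T b) :: 'a mpseries) =
			Const (\<beta> ^ (sv_size lam T - sz lam)) * (\<Prod>b\<in>SD lam. \<Prod>e\<in>T b. Var (e div 2))"
		unfolding box_wt_def prod.distrib size[symmetric] Const_power by (simp add: power_sum)
	also have "(\<Prod>b\<in>SD lam. \<Prod>e\<in>T b. Var (e div 2) :: 'a mpseries) = (\<Prod>p\<in>?S. Var (snd p div 2))"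
		using fin by (simp add: prod.Sigma case_prod_unfold)
	finally have e: "(\<Prod>b\<in>SD lam. box_wt (Const \<beta>) (%e. Var (e div 2)) (T b) :: 'a mpseries) =
			Const (\<beta> ^ (sv_size lam T - sz lam)) * (\<Prod>p\<in>?S. Var (snd p div 2))" .
	have finS: "finite ?S" using fin by simp
	have w: "card {p : ?S. snd p div 2 = k} = sv_weight lam T k" for k
	proof -
		have "{p : ?S. snd p div 2 = k} = (SIGMA b:SD lam. {e : T b. e div 2 = k})" by auto
		then show ?thesis unfolding sv_weight_def using fin by simp
	qed
	show ?thesis unfolding e coeff_Const_mult coeff_prod_Var[OF finS] w by simp
qed

lemma coeff_vchain_gp:
	assumes lam: "strict_partition lam"
	shows "cf (vchain Strict (gp_step (fps_const b) fps_X) 1 N lam) m = (if keys m <= {..<N} then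
		(\<Sum>T | T : SSVT lam & (\<forall>i. (i, i) : SD lam --> (\<forall>e\<in>T (i, i). \<not> primed e)) &
			(\<forall>k. lookup m k = sv_weight lam T k). b ^ (sv_size lam T - sz lam)) else (0 :: 'a::comm_ring_1))"
proof (cases "keys m <= {..<N}")
	case True
	let ?w = "%T. \<forall>k. lookup m k = sv_weight lam T k"
	have "cf (vchain Strict (gp_step (fps_const b) fps_X) 1 N lam) m =
			(\<Sum>T\<in>sv_tableaux lam (2 * N). cf (\<Prod>b'\<in>SD lam. box_wt (Const b) (%e. Var (e div 2)) (T b')) m)"
		by (simp add: vchain_gp chain_gp_sv_sum[OF lam] sv_sum_def coeff_sum)
	also have "... = (\<Sum>T\<in>sv_tableaux lam (2 * N). if ?w T then b ^ (sv_size lam T - sz lam) else 0)"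
		by (rule sum.cong[OF refl]) (rule coeff_prod_box_wt)
	also have "... = (\<Sum>T\<in>{T : sv_tableaux lam (2 * N). ?w T}. b ^ (sv_size lam T - sz lam))"
		by (rule sum.inter_filter[symmetric]) (rule finite_sv_tableaux)
	also have "{T : sv_tableaux lam (2 * N). ?w T} =
		{T. T : SSVT lam & (\<forall>i. (i, i) : SD lam --> (\<forall>e\<in>T (i, i). \<not> primed e)) & ?w T}" (is "?L = ?R")
	proof (intro equalityI subsetI)
		fix T assume T: "T : ?L"
		then have "T : sv_tableaux lam (2 * N)" by simp
		then show "T : ?R" using SSVT_iff[of lam T "2 * N"] sv_tableauxD(3)[of T lam "2 * N"] T by blast
	next
		fix T assume T: "T : ?R"
		have "e < 2 * N" if be: "b : SD lam" "e : T b" for b e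
		proof (rule keys_bound[OF True])
			have TS: "T : SSVT lam" and w: "?w T" using T by blast+
			have "finite (T b)" using TS be(1) unfolding SSVT_def by (auto simp: PiE_iff)
			then have "0 < card {e' : T b. e' div 2 = e div 2}"
				using be(2) by (intro card_posI[of _ e]) simp_all
			also have "... <= sv_weight lam T (e div 2)"
				unfolding sv_weight_def by (rule member_le_sum[OF be(1)]) simp_all
			finally show "lookup m (e div 2) ~= 0" using w by simp
		qed
		then show "T : ?L" using SSVT_iff[of lam T "2 * N"] T by blast
	qed
	finally show ?thesis using True by simp
next
	case False
	then show ?thesis using vars_below_vchain[of N Strict "gp_step (fps_const b) fps_X" 1 lam] by (auto simp: vars_below_def)
qed

text \<open>In the second version the coefficients lie in a ring of series, which is where the
  Cauchy identity with the variables of jq-comb is stated.\<close>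

lemma coeff_vchain_GP:
	assumes "strict_partition lam"
	shows "cf (vchain Strict (gp_step (fps_const beta) fps_X) 1 N lam) m = (if keys m <= {..<N} then cf (GP lam) m else 0)"
		and "cf (vchain Strict (gp_step (fps_const (Const beta)) fps_X) 1 N lam) m =
			(if keys m <= {..<N} then Const (cf (GP lam) m) else 0)"
	unfolding coeff_vchain_gp[OF assms] by (simp_all add: GP_def Const_sum Const_power)

lemma coeff_prod_bar_wt:
	assumes T: "(V, P) : bar_tableaux mu lam E"
	shows "cf (\<Prod>B\<in>P. bar_wt (Const v) (%e. Var (e div 2)) V B) m =
		(if \<forall>k. lookup m k = bar_weight (V, P) k then v ^ (sz lam - sz mu - card P) else (0 :: 'a::comm_ring_1))"
proof -
	note D = bar_tableauxD[OF T]
	have fin: "finite (SD lam - SD mu)" by simp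
	have finP: "finite P" using finite_elements[OF fin D(6)] .
	have c: "card (SD lam - SD mu) = sz lam - sz mu"
		using card_Diff_subset[OF finite_SD D(1)] by (simp add: card_SD)
	\<comment> \<open>\<open>partition_weight\<close> with \<open>t = 1\<close> collects the powers of
	  \<open>v\<close>; the variables of the bars are treated separately.\<close>
	have "(\<Prod>B\<in>P. 1 * Const v ^ (card B - 1)) = (1 :: 'a mpseries) ^ card P * Const v ^ (card (SD lam - SD mu) - card P)"
		by (rule partition_weight[OF fin D(6)])
	then have w: "(\<Prod>B\<in>P. Const v ^ (card B - 1)) = (Const (v ^ (sz lam - sz mu - card P)) :: 'a mpseries)"
		unfolding c Const_power by simp
	have e: "(\<Prod>B\<in>P. bar_wt (Const v) (%e. Var (e div 2)) V B :: 'a mpseries) =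
			Const (v ^ (sz lam - sz mu - card P)) * (\<Prod>B\<in>P. Var (Min (V ` B) div 2))"
		unfolding bar_wt_def prod.distrib w by (rule mult.commute)
	have "{B : P. Min (V ` B) div 2 = k} = {B : P. \<exists>x\<in>B. V x div 2 = k}" for k
	proof -
		have "Min (V ` B) div 2 = k \<longleftrightarrow> (\<exists>x\<in>B. V x div 2 = k)" if "B : P" for B
		proof -
			have "is_bar V B" by (rule D(7)[OF that])
			then obtain a where "B ~= {}" "\<forall>x\<in>B. V x = a" unfolding is_bar_def by blast
			then have "V ` B = {a}" by auto
			then show ?thesis using \<open>B ~= {}\<close> \<open>\<forall>x\<in>B. V x = a\<close> by auto
		qed
		then show ?thesis by blast
	qed
	then have b: "card {B : P. Min (V ` B) div 2 = k} = bar_weight (V, P) k" for k by (simp add: bar_weight_def)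
	show ?thesis unfolding e coeff_Const_mult coeff_prod_Var[OF finP] b by simp
qed

lemma coeff_chain_jq:
	assumes lam: "strict_partition lam" and mu: "strict_partition mu" and N: "keys m <= {..<N}"
	shows "cf (chain Strict (%i. jq_step (Const (- beta)) (Var i)) N mu lam) m = cf (jq_comb lam mu) m"
proof -
	let ?w = "%T. \<forall>k. lookup m k = bar_weight T k"
	let ?f = "%T. (- beta) ^ (sz lam - sz mu - card (snd T))"
	have "cf (chain Strict (%i. jq_step (Const (- beta)) (Var i)) N mu lam) m =
			(\<Sum>(V, P)\<in>bar_tableaux mu lam (2 * N). cf (\<Prod>B\<in>P. bar_wt (Const (- beta)) (%e. Var (e div 2)) V B) m)"
		by (simp add: chain_jq_bar_sum[OF lam mu] bar_sum_def coeff_sum case_prod_unfold)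
	also have "... = (\<Sum>T\<in>bar_tableaux mu lam (2 * N). if ?w T then ?f T else 0)"
	proof (rule sum.cong[OF refl])
		fix T assume "T : bar_tableaux mu lam (2 * N)"
		then show "(case T of (V, P) => cf (\<Prod>B\<in>P. bar_wt (Const (- beta)) (%e. Var (e div 2)) V B) m) = (if ?w T then ?f T else 0)"
			using coeff_prod_bar_wt[of "fst T" "snd T" mu lam "2 * N" "- beta" m] by (simp add: case_prod_unfold)
	qed
	also have "... = (\<Sum>T\<in>{T : bar_tableaux mu lam (2 * N). ?w T}. ?f T)"
		by (rule sum.inter_filter[symmetric]) (rule finite_bar_tableaux)
	also have "... = cf (jq_comb lam mu) m"
	proof (cases "SD mu <= SD lam")
		case True
		have "{T : bar_tableaux mu lam (2 * N). ?w T} = {T. T : shifted_bar_tableaux lam mu & semistandard lam mu T & ?w T}" (is "?L = ?R")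
		proof (intro equalityI subsetI)
			fix T assume "T : ?L"
			then show "T : ?R" unfolding bar_tableaux_def by auto
		next
			fix T assume T: "T : ?R"
			obtain V P where VP: "T = (V, P)" by fastforce
			have P: "partition_on (SD_skew lam mu) P" using T unfolding VP shifted_bar_tableaux_def by blast
			have finP: "finite P" by (rule finite_elements[OF _ P]) (simp add: SD_skew_def)
			have "V b < 2 * N" if b: "b : SD_skew lam mu" for b
			proof (rule keys_bound[OF N])
				obtain B where B: "B : P" "b : B" using partition_onD1[OF P] b by blast
				then have "B : {B : P. \<exists>x\<in>B. V x div 2 = V b div 2}" by blast
				moreover have "finite {B : P. \<exists>x\<in>B. V x div 2 = V b div 2}" using finP by simp
				ultimately have "0 < card {B : P. \<exists>x\<in>B. V x div 2 = V b div 2}" by (rule card_posI[rotated])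
				then show "lookup m (V b div 2) ~= 0" using T by (simp add: VP bar_weight_def)
			qed
			then show "T : ?L" using T True unfolding VP bar_tableaux_def by blast
		qed
		then show ?thesis using True by (simp add: jq_comb_def)
	next
		case False
		then have "bar_tableaux mu lam (2 * N) = {}" unfolding bar_tableaux_def by blast
		then show ?thesis using False by (simp add: jq_comb_def)
	qed
	finally show ?thesis .
qed

text \<open>A chain in \<open>N\<close> variables involves no others, which is expressed by its
  being fixed under \<open>trunc N\<close>.\<close>

lemma coeff_chain_jq_all:
	assumes lam: "strict_partition lam" and mu: "strict_partition mu"
	shows "cf (chain Strict (%i. jq_step (Const (- beta)) (Var i)) N mu lam) m =
		(if keys m <= {..<N} then cf (jq_comb lam mu) m else 0)"
proof -
	let ?c = "chain Strict (%i. jq_step (Const (- beta)) (Var i)) N mu lam"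
	have t0: "trunc N (0 :: int poly mpseries) = 0" by (rule mpseries_eqI) (simp add: coeff_trunc coeff_simps)
	have tc: "trunc N (Const c) = (Const c :: int poly mpseries)" for c
		by (rule mpseries_eqI) (auto simp: coeff_trunc Const.rep_eq)
	have "trunc N ?c = chain Strict (%i ka lam. trunc N (jq_step (Const (- beta)) (Var i) ka lam)) N mu lam"
		by (rule chain_hom[OF trunc_add trunc_mult t0 trunc_1])
	also have "... = ?c"
		by (rule chain_cong) (simp add: jq_step_hom[of "trunc N", OF trunc_add trunc_mult t0 trunc_1] tc trunc_Var)
	finally show ?thesis using coeff_chain_jq[OF lam mu] coeff_trunc[of N ?c m] by metis
qed

section \<open>Symmetric functions and the involution omega\<close>

text \<open>By the Cauchy identity, pairing a chain of \<open>D\<close>-operators with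
  \<open>V\<close> depends only on the product of their factors, not on their order. Independence of
  the \<open>V\<close> carries this over to the chain. The argument gives symmetry of the Schur
  functions and of jq-comb alike.\<close>

lemma (in step_operator) chain_permute:
	assumes comm: "\<And>j. j < M ==> commutes (D j) (c j)" and up and lead: "\<And>lam. lam : Sh ==> lead lam = 1"
		and pi: "\<pi> permutes {..<M}" and mu: "mu : Sh" and lam: "lam : Sh"
	shows "chain Sh (%j. D (\<pi> j)) M mu lam = chain Sh D M mu lam"
proof -
	define g where "g = (%ka. chain Sh (%j. D (\<pi> j)) M mu ka - chain Sh D M mu ka)"
	have "g lam = 0"
	proof (rule independent_up[OF \<open>up\<close> lead])
		fix N m assume m: "mdegree m <= sz lam"
		have cp: "commutes (D (\<pi> j)) (c (\<pi> j))" if "j < M" for j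
			using comm[of "\<pi> j"] permutes_in_image[OF pi, of j] that by simp
		have "(\<Prod>j<M. c (\<pi> j)) = (\<Prod>j<M. c j)" using prod.permute[OF pi, of c] by (simp add: o_def)
		then have "(\<Sum>ka\<in>below Sh (sz lam). cf (V 1 N ka) m * chain Sh (%j. D (\<pi> j)) M mu ka) =
				(\<Sum>ka\<in>below Sh (sz lam). cf (V 1 N ka) m * chain Sh D M mu ka)"
			using cauchy_chain[of M "%j. D (\<pi> j)" "%j. c (\<pi> j)", OF cp \<open>up\<close> mu m, of 1 N] cauchy_chain[of M D c, OF comm \<open>up\<close> mu m, of 1 N]
			by simp
		then show "(\<Sum>ka\<in>below Sh (sz lam). cf (V 1 N ka) m * g ka) = 0"
			by (simp add: g_def right_diff_distrib sum_subtractf)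
	qed (use lam in \<open>simp_all add: below_def\<close>)
	then show ?thesis by (simp add: g_def)
qed

lemma lookup_map_key: "inj f ==> lookup (map_key f m) i = lookup m (f i)"
	by (simp add: map_key.rep_eq)

lemma schur_permute:
	assumes pi: "\<pi> permutes {..<N}" and m: "keys m <= {..<N}" and lam: "lam : Par"
	shows "cf (schur lam) (map_key \<pi> m) = cf (schur lam) m"
proof -
	have bij: "bij \<pi>" and inj: "inj \<pi>" using pi permutes_bij permutes_inj by blast+
	define W where "W = chain Par (%j. hor_step (Var j :: int poly mpseries)) N [] lam"
	have r0: "rename \<pi> (0 :: int poly mpseries) = 0" by (rule mpseries_eqI) (simp add: coeff_rename coeff_simps)
	have r1: "rename \<pi> (1 :: int poly mpseries) = 1"
		by (metis Const_1 rename_Const bij)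
	have "rename \<pi> W = chain Par (%j ka lam. rename \<pi> (hor_step (Var j) ka lam)) N [] lam"
		unfolding W_def using bij by (intro chain_hom rename_add rename_mult r0 r1)
	also have "... = chain Par (%j. hor_step (Var (\<pi> j))) N [] lam"
		using bij by (simp add: hor_step_hom(1)[of "rename \<pi>", OF rename_mult[OF bij] r0 r1])
	also have "... = W" unfolding W_def
		by (rule step_operator.chain_permute[OF step_operator_hor commutes_hor TrueI _ pi Par.nil lam]) (rule lead_hor)
	finally have "cf W (map_key \<pi> m) = cf W m" by (metis coeff_rename)
	moreover have "keys (map_key \<pi> m) <= {..<N}"
	proof
		fix i assume "i : keys (map_key \<pi> m)"
		then have "\<pi> i : keys m" by (simp add: in_keys_iff lookup_map_key[OF inj])
		then show "i : {..<N}" using m permutes_in_image[OF pi, of i] by blast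
	qed
	moreover have "W = vchain Par (hor_step fps_X) 1 N lam" by (simp add: W_def vchain_hor)
	ultimately show ?thesis using m coeff_vchain_hor[OF lam, of N _, where ?'a = "int poly"] by (simp add: coeff_schur)
qed

lemma extend_permutation:
	assumes inj: "inj_on f K" and K: "K <= {..<N}" and fK: "f ` K <= {..<N :: nat}"
	obtains \<sigma> where "\<sigma> permutes {..<N}" "\<And>i. i : K ==> \<sigma> i = f i"
proof -
	have "card ({..<N} - K) = card ({..<N} - f ` K)"
		using K fK finite_subset[OF K] finite_subset[OF fK] card_image[OF inj] by (simp add: card_Diff_subset)
	then obtain g where g: "bij_betw g ({..<N} - K) ({..<N} - f ` K)"
		using finite_same_card_bij[of "{..<N} - K" "{..<N} - f ` K"] by auto
	define s where "s = (%i. if i : K then f i else if i < N then g i else i)"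
	have "bij_betw s K (f ` K)" using inj by (simp add: s_def bij_betw_def inj_on_def)
	moreover have "bij_betw s ({..<N} - K) ({..<N} - f ` K)"
		using bij_betw_cong[of "{..<N} - K" s g] g by (simp add: s_def)
	ultimately have "bij_betw s (K \<union> ({..<N} - K)) (f ` K \<union> ({..<N} - f ` K))"
		by (rule bij_betw_combine) blast
	moreover have "K \<union> ({..<N} - K) = {..<N}" "f ` K \<union> ({..<N} - f ` K) = {..<N}" using K fK by blast+
	ultimately have "bij_betw s {..<N} {..<N}" by simp
	moreover have "s i = i" if "i ~: {..<N}" for i using that K by (auto simp: s_def)
	ultimately have "s permutes {..<N}" by (rule bij_imp_permutes)
	then show ?thesis using that[of s] by (simp add: s_def)
qed

lemma keys_bounded: obtains N where "keys (m :: monomial) <= {..<N}"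
proof -
	obtain N where "\<forall>i\<in>keys m. i < N" using finite_nat_set_iff_bounded[of "keys m"] by auto
	then show ?thesis using that by blast
qed

text \<open>\<open>Sym\<close> demands invariance under all bijections. Only the finitely many
  variables of the monomial matter, so the bijection is replaced by a permutation of an initial
  segment that agrees with it there.\<close>

lemma schur_bij:
	assumes bij: "bij \<pi>" and lam: "lam : Par"
	shows "cf (schur lam) (map_key \<pi> m) = cf (schur lam) m"
proof -
	have inj: "inj \<pi>" using bij by (rule bij_is_inj)
	let ?K = "keys (map_key \<pi> m)"
	have K: "i : ?K \<longleftrightarrow> \<pi> i : keys m" for i by (simp add: in_keys_iff lookup_map_key[OF inj])
	have pK: "keys m = \<pi> ` ?K"
	proof (intro equalityI subsetI)
		fix j assume "j : keys m"
		moreover obtain i where "j = \<pi> i" using bij by (metis bij_pointE)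
		ultimately show "j : \<pi> ` ?K" using K by blast
	qed (use K in blast)
	obtain N1 where N1: "?K <= {..<N1}" by (rule keys_bounded)
	obtain N2 where N2: "keys m <= {..<N2}" by (rule keys_bounded)
	define N where "N = max N1 N2"
	have N: "?K <= {..<N}" "keys m <= {..<N}" using N1 N2 by (auto simp: N_def)
	obtain \<sigma> where s: "\<sigma> permutes {..<N}" "\<And>i. i : ?K ==> \<sigma> i = \<pi> i"
		by (rule extend_permutation[of \<pi> ?K N]) (use inj N pK in \<open>auto intro: inj_on_subset\<close>)
	have injs: "inj \<sigma>" using s(1) by (rule permutes_inj)
	have "map_key \<sigma> m = map_key \<pi> m"
	proof (rule poly_mapping_eqI)
		fix i
		show "lookup (map_key \<sigma> m) i = lookup (map_key \<pi> m) i"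
		proof (cases "i : ?K")
			case True then show ?thesis using s(2) by (simp add: lookup_map_key inj injs)
		next
			case False
			have "\<sigma> i ~: keys m"
			proof
				assume "\<sigma> i : keys m"
				then obtain k where "k : ?K" "\<sigma> i = \<pi> k" using pK by blast
				then have "\<sigma> i = \<sigma> k" using s(2) by simp
				then show False using injs False \<open>k : ?K\<close> by (metis injD)
			qed
			moreover have "\<pi> i ~: keys m" using False K by blast
			ultimately show ?thesis by (simp add: lookup_map_key inj injs in_keys_iff)
		qed
	qed
	then show ?thesis using schur_permute[OF s(1) N(2) lam] by simp
qed

lemma ssyt_count_degree:
	assumes "ssyt_count lam m ~= 0" shows "mdegree m = sz lam"
proof -
	have "{T : SSYT lam. \<forall>i. lookup m i = card {b : YD lam. T b = i}} ~= {}"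
		using assms unfolding ssyt_count_def by (metis card.empty)
	then obtain T where T: "\<And>i. lookup m i = card {b : YD lam. T b = i}" by blast
	have "mdegree m = (\<Sum>i\<in>keys m. card {b : YD lam. T b = i})" by (simp add: mdegree_def T)
	also have "... = card (\<Union>i\<in>keys m. {b : YD lam. T b = i})"
		by (rule card_UN_disjoint[symmetric]) auto
	also have "(\<Union>i\<in>keys m. {b : YD lam. T b = i}) = YD lam"
	proof (intro equalityI subsetI)
		fix b assume b: "b : YD lam"
		then have "{c : YD lam. T c = T b} ~= {}" by blast
		then have "0 < card {c : YD lam. T c = T b}" by (simp add: card_gt_0_iff)
		moreover have "lookup m (T b) = card {c : YD lam. T c = T b}" by (rule T)
		ultimately have "lookup m (T b) ~= 0" by linarith
		then have "T b : keys m" unfolding in_keys_iff .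
		then show "b : (\<Union>i\<in>keys m. {b : YD lam. T b = i})" using b by blast
	qed blast
	finally show ?thesis by (simp add: card_YD)
qed

lemma schur_degree: "cf (schur lam) m ~= 0 ==> mdegree m = sz lam"
	using ssyt_count_degree by (auto simp: coeff_schur)

section \<open>The Schur functions as a basis of the symmetric functions\<close>

lemma schur_Sym: "lam : Par ==> schur lam : Sym"
	unfolding Sym_def using schur_bij schur_degree by (intro CollectI conjI allI impI exI[of _ "sz lam"]) auto

lemma Sym_0 [simp]: "0 : Sym"
	by (simp add: Sym_def coeff_simps)

lemma Sym_add:
	assumes "f : Sym" "g : Sym" shows "f + g : Sym"
proof -
	obtain d e where d: "\<And>m. cf f m ~= 0 ==> mdegree m <= d" and e: "\<And>m. cf g m ~= 0 ==> mdegree m <= e"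
		using assms unfolding Sym_def by blast
	have "mdegree m <= max d e" if "cf (f + g) m ~= 0" for m
	proof -
		have "cf f m ~= 0 \<or> cf g m ~= 0" using that by (auto simp: coeff_simps)
		then show ?thesis using d[of m] e[of m] by auto
	qed
	moreover have "cf (f + g) (map_key \<pi> m) = cf (f + g) m" if "bij \<pi>" for \<pi> m
		using assms that unfolding Sym_def by (simp add: coeff_simps)
	ultimately show ?thesis unfolding Sym_def by blast
qed

lemma Sym_scale:
	assumes "f : Sym" shows "Const c * f : Sym"
proof -
	obtain d where d: "\<And>m. cf f m ~= 0 ==> mdegree m <= d" using assms unfolding Sym_def by blast
	have "mdegree m <= d" if "cf (Const c * f) m ~= 0" for m
		using d[of m] that by auto
	moreover have "cf (Const c * f) (map_key \<pi> m) = cf (Const c * f) m" if "bij \<pi>" for \<pi> m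
		using assms that unfolding Sym_def by simp
	ultimately show ?thesis unfolding Sym_def by blast
qed

lemma Sym_sum: "(\<And>x. x : A ==> f x : Sym) ==> sum f A : Sym"
	by (induction A rule: infinite_finite_induct) (simp_all add: Sym_add)

text \<open>Hence a symmetric series is determined by its coefficients at x^lam for partitions
  \<open>lam\<close>.\<close>

lemma exists_sorting:
	fixes m :: monomial
	obtains \<pi> lam where "bij \<pi>" "lam : Par" "map_key \<pi> m = list_monom lam"
proof -
	define ks where "ks = rev (sort_key (lookup m) (sorted_list_of_set (keys m)))"
	have set: "set ks = keys m" and dist: "distinct ks" by (simp_all add: ks_def)
	have sorted: "sorted (map (lookup m) (rev ks))" by (simp add: ks_def)
	define lam where "lam = map (lookup m) ks"
	have len: "length lam = length ks" by (simp add: lam_def)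
	have "sorted_wrt (\<ge>) lam" using sorted unfolding lam_def rev_map[symmetric] sorted_wrt_rev by simp
	moreover have "0 < p" if "p : set lam" for p using that set by (auto simp: lam_def in_keys_iff)
	ultimately have lam: "lam : Par" by (simp add: is_partition_def)
	obtain N where N: "keys m <= {..<N}" by (rule keys_bounded)
	have lenN: "length ks <= N" using card_mono[OF _ N] distinct_card[OF dist] set by simp
	obtain \<sigma> where s: "\<sigma> permutes {..<N}" "\<And>i. i : {..<length ks} ==> \<sigma> i = ks ! i"
	proof (rule extend_permutation[of "(!) ks" "{..<length ks}" N])
		show "inj_on ((!) ks) {..<length ks}" using dist by (simp add: inj_on_nth)
		show "(!) ks ` {..<length ks} <= {..<N}" using N set by (force simp: set_conv_nth)
	qed (use lenN in auto)
	have inj: "inj \<sigma>" using s(1) by (rule permutes_inj)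
	have "map_key \<sigma> m = list_monom lam"
	proof (rule poly_mapping_eqI)
		fix i
		show "lookup (map_key \<sigma> m) i = lookup (list_monom lam) i"
		proof (cases "i < length ks")
			case True then show ?thesis using s(2)[of i] by (simp add: lookup_map_key[OF inj] lookup_list_monom lam_def)
		next
			case False
			have "\<sigma> i ~: keys m"
			proof
				assume "\<sigma> i : keys m"
				then obtain k where k: "k < length ks" "\<sigma> i = ks ! k" using set by (metis in_set_conv_nth)
				then have "\<sigma> i = \<sigma> k" using s(2)[of k] by simp
				then show False using inj False k(1) by (metis injD)
			qed
			then show ?thesis using False len by (simp add: lookup_map_key[OF inj] lookup_list_monom in_keys_iff)
		qed
	qed
	with that lam permutes_bij[OF s(1)] show ?thesis by blast
qed

text \<open>An element of largest rank is added last. Its unknown occurs in none of the earlier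
  equations and can be chosen to satisfy its own.\<close>

lemma triangular_solve:
	fixes T :: "'b => 'b => 'a::comm_ring_1" and rank :: "'b => nat"
	assumes "finite F" "\<And>x. x : F ==> T x x = 1" "\<And>x y. x : F ==> y : F ==> T x y ~= 0 ==> x = y \<or> rank x < rank y"
	shows "\<exists>a. \<forall>y\<in>F. (\<Sum>x\<in>F. a x * T x y) = b y"
	using assms
proof (induction F rule: finite_ranking_induct[where f = rank])
	case (insert z F)
	show ?case
	proof (cases "z : F")
		case True
		then have e: "insert z F = F" by blast
		show ?thesis unfolding e by (rule insert.IH) (use insert.prems in auto)
	next
		case False
		obtain a where a: "\<And>y. y : F ==> (\<Sum>x\<in>F. a x * T x y) = b y"
			using insert.IH insert.prems by (metis insertCI)
		define a' where "a' = a(z := b z - (\<Sum>x\<in>F. a x * T x z))"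
		have s: "(\<Sum>x\<in>insert z F. a' x * T x y) = a' z * T z y + (\<Sum>x\<in>F. a x * T x y)" for y
		proof -
			have "(\<Sum>x\<in>F. a' x * T x y) = (\<Sum>x\<in>F. a x * T x y)" by (rule sum.cong) (use False in \<open>auto simp: a'_def\<close>)
			then show ?thesis using insert.hyps(1) False by simp
		qed
		have "(\<Sum>x\<in>insert z F. a' x * T x y) = b y" if "y : insert z F" for y
		proof (cases "y = z")
			case True
			have "T z z = 1" using insert.prems(1) by simp
			then show ?thesis unfolding s True by (simp add: a'_def)
		next
			case False
			then have y: "y : F" using that by simp
			have "T z y = 0" using insert.prems(2)[of z y] insert.hyps(2)[OF y] False y by fastforce
			then show ?thesis unfolding s using a[OF y] by simp
		qed
		then show ?thesis by blast
	qed
qed simp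

definition schur_expansion :: "nat => (nat list => int poly) => int poly mpseries" where
	"schur_expansion d a = (\<Sum>ka\<in>below Par d. Const (a ka) * schur ka)"

definition dual_expansion :: "nat => (nat list => int poly) => int poly mpseries" where
	"dual_expansion d a = (\<Sum>ka\<in>below Par d. Const (a ka) * schur (conjugate ka))"

text \<open>Requiring zeros outside the range of summation makes an expansion determine its
  coefficient function, and allows the bound \<open>d\<close> to be raised.\<close>

definition supp_below :: "nat => (nat list => int poly) => bool" where
	"supp_below d a \<longleftrightarrow> (\<forall>ka. ka ~: below Par d --> a ka = 0)"

lemma coeff_schur_expansion: "cf (schur_expansion d a) n = (\<Sum>ka\<in>below Par d. a ka * cf (schur ka) n)"
	and coeff_dual_expansion: "cf (dual_expansion d a) n = (\<Sum>ka\<in>below Par d. a ka * cf (schur (conjugate ka)) n)"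
	by (simp_all add: schur_expansion_def dual_expansion_def coeff_sum)

lemma below_mono: "d <= e ==> below Sh d <= below Sh e"
	by (auto simp: below_def)

lemma expansion_mono:
	assumes "supp_below d a" "d <= e"
	shows "supp_below e a" "schur_expansion e a = schur_expansion d a" "dual_expansion e a = dual_expansion d a"
proof -
	show "supp_below e a" using assms below_mono[OF assms(2), of Par] unfolding supp_below_def by blast
	have z: "Const (a ka) * f = 0" if "ka : below Par e - below Par d" for ka f
	proof -
		have "a ka = 0" using that assms(1) unfolding supp_below_def by blast
		then show ?thesis by simp
	qed
	show "schur_expansion e a = schur_expansion d a" "dual_expansion e a = dual_expansion d a"
		unfolding schur_expansion_def dual_expansion_def
		using below_mono[OF assms(2), of Par] z by (intro sum.mono_neutral_right Par.finite_below; blast)+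
qed

lemma schur_independent:
	assumes "\<And>n. mdegree n <= d ==> (\<Sum>ka\<in>below Par d. a ka * cf (schur ka) n) = 0" "ka : below Par d"
	shows "a ka = 0"
proof (rule step_operator.independent_up[OF step_operator_hor TrueI lead_hor _ assms(2)])
	fix N n assume n: "mdegree n <= d"
	have "(\<Sum>ka\<in>below Par d. cf (vchain Par (hor_step fps_X) 1 N ka) n * a ka) =
			(\<Sum>ka\<in>below Par d. if keys n <= {..<N} then a ka * cf (schur ka) n else 0)"
		by (rule sum.cong[OF refl]) (simp add: below_def coeff_vchain_hor coeff_schur mult.commute)
	then show "(\<Sum>ka\<in>below Par d. cf (vchain Par (hor_step fps_X) 1 N ka) n * a ka) = 0"
		using assms(1)[OF n] by (cases "keys n <= {..<N}") simp_all
qed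

lemma expansion_unique:
	assumes "supp_below d a" "supp_below e b" "schur_expansion d a = schur_expansion e b"
	shows "a = b"
proof
	fix ka
	let ?d = "max d e"
	note A = expansion_mono[OF assms(1), of ?d, simplified] and B = expansion_mono[OF assms(2), of ?d, simplified]
	show "a ka = b ka"
	proof (cases "ka : below Par ?d")
		case True
		have "a ka - b ka = 0"
		proof (rule schur_independent[OF _ True])
			fix n
			have "cf (schur_expansion ?d a) n = cf (schur_expansion ?d b) n" using A(2) B(2) assms(3) by simp
			then show "(\<Sum>ka\<in>below Par ?d. (a ka - b ka) * cf (schur ka) n) = 0"
				by (simp add: coeff_schur_expansion left_diff_distrib sum_subtractf)
		qed
		then show ?thesis by simp
	next
		case False
		then show ?thesis using A(1) B(1) unfolding supp_below_def by simp
	qed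
qed

lemma expansion_Sym: "schur_expansion d a : Sym"
	unfolding schur_expansion_def by (intro Sym_sum Sym_scale schur_Sym) (simp add: below_def)

text \<open>Coefficients are matched at the monomials of partitions. Within each degree this system
  is unitriangular, by the leading terms of the Schur functions.\<close>

lemma Sym_expansion:
	assumes f: "f : Sym"
	obtains d a where "supp_below d a" "f = schur_expansion d a"
proof -
	obtain d where d: "\<And>m. cf f m ~= 0 ==> mdegree m <= d" using f unfolding Sym_def by blast
	let ?F = "below Par d" and ?B = "Suc d * d"
	have V: "cf (vchain Par (hor_step fps_X) 1 (length y) x) (list_monom y) = cf (schur x) (list_monom y)" if "x : Par" for x y
		using coeff_vchain_hor[OF that, of "length y" "list_monom y"] keys_list_monom[of y] by (simp add: coeff_schur)
	have "\<exists>a. \<forall>y\<in>?F. (\<Sum>x\<in>?F. a x * cf (schur x) (list_monom y)) = cf f (list_monom y)"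
	proof (rule triangular_solve[where rank = "%x. ?B - Par.top_sums x"])
		fix x assume "x : ?F"
		then have x: "x : Par" by (simp add: below_def)
		show "cf (schur x) (list_monom x) = 1"
			using V[OF x, of x] step_operator.V_lead[OF step_operator_hor x, where ?'a = "int poly"] lead_hor[OF x, where ?'a = "int poly"] by simp
	next
		fix x y assume xy: "x : ?F" "y : ?F" "cf (schur x) (list_monom y) ~= 0"
		then have x: "x : Par" "sz x <= d" and y: "y : Par" by (auto simp: below_def)
		have "sz x = sz y" using schur_degree[OF xy(3)] by (simp add: mdegree_list_monom)
		moreover have "cf (vchain Par (hor_step fps_X) 1 (length y) x) (list_monom y) ~= (0 :: int poly)" using xy(3) V[OF x(1)] by simp
		ultimately have "x = y \<or> Par.top_sums y < Par.top_sums x"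
			using step_operator.V_triangular[OF step_operator_hor y x(1)] by auto
		moreover have "Par.top_sums x <= ?B"
			using x(2) by (intro order_trans[OF Par.top_sums_le] mult_le_mono) auto
		ultimately show "x = y \<or> ?B - Par.top_sums x < ?B - Par.top_sums y" by auto
	qed simp
	then obtain a where a: "\<And>y. y : ?F ==> (\<Sum>x\<in>?F. a x * cf (schur x) (list_monom y)) = cf f (list_monom y)" by blast
	define a' where "a' = (%x. if x : ?F then a x else 0)"
	have s: "supp_below d a'" by (simp add: supp_below_def a'_def)
	have c: "cf (schur_expansion d a') n = (\<Sum>x\<in>?F. a x * cf (schur x) n)" for n
		unfolding coeff_schur_expansion by (rule sum.cong) (simp_all add: a'_def)
	have lm: "cf f (list_monom y) = cf (schur_expansion d a') (list_monom y)" if y: "y : Par" for y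
	proof (cases "y : ?F")
		case True then show ?thesis unfolding c using a by simp
	next
		case False
		then have "d < sz y" using y by (simp add: below_def)
		then have "cf f (list_monom y) = 0" using d[of "list_monom y"] by (auto simp: mdegree_list_monom)
		moreover have "a x * cf (schur x) (list_monom y) = 0" if "x : ?F" for x
			using schur_degree[of x "list_monom y"] that \<open>d < sz y\<close> by (auto simp: below_def mdegree_list_monom)
		then have "cf (schur_expansion d a') (list_monom y) = 0" unfolding c by (intro sum.neutral) blast
		ultimately show ?thesis by simp
	qed
	have "f = schur_expansion d a'"
	proof (rule mpseries_eqI)
		fix m :: monomial
		obtain \<pi> :: "nat => nat" and y where p: "bij \<pi>" "y : Par" "map_key \<pi> m = list_monom y"
			by (rule exists_sorting[of m])
		have "cf g m = cf g (list_monom y)" if "g : Sym" for g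
			using that p unfolding Sym_def by (metis (mono_tags, lifting) mem_Collect_eq)
		then show "cf f m = cf (schur_expansion d a') m" using f expansion_Sym[of d a'] lm[OF p(2)] by simp
	qed
	with s that show ?thesis by blast
qed

text \<open>\<open>omega\<close> is a choice, so a map with these properties has to be exhibited: it
  conjugates the indices in the unique Schur expansion.\<close>

lemma omega_properties:
	"(\<forall>f\<in>Sym. \<forall>g\<in>Sym. omega (f + g) = omega f + omega g) &
	 (\<forall>c. \<forall>f\<in>Sym. omega (Const c * f) = Const c * omega f) &
	 (\<forall>lam. is_partition lam --> omega (schur lam) = schur (conjugate lam))"
proof -
	define w where "w = (%f. THE g. \<exists>d a. supp_below d a & f = schur_expansion d a & g = dual_expansion d a)"
	have w: "w (schur_expansion d a) = dual_expansion d a" if a: "supp_below d a" for d a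
		unfolding w_def
	proof (rule the_equality)
		show "\<exists>d' a'. supp_below d' a' & schur_expansion d a = schur_expansion d' a' & dual_expansion d a = dual_expansion d' a'"
			using a by blast
		fix g assume "\<exists>d' a'. supp_below d' a' & schur_expansion d a = schur_expansion d' a' & g = dual_expansion d' a'"
		then obtain d' a' where a': "supp_below d' a'" "schur_expansion d a = schur_expansion d' a'" "g = dual_expansion d' a'" by blast
		have e: "a = a'" by (rule expansion_unique[OF a a'(1,2)])
		show "g = dual_expansion d a"
			using expansion_mono(3)[OF a, of "max d d'"] expansion_mono(3)[OF a'(1), of "max d d'"] a'(3) e by simp
	qed
	have "w (f + g) = w f + w g" if fg: "f : Sym" "g : Sym" for f g
	proof -
		obtain d a where a: "supp_below d a" "f = schur_expansion d a" using Sym_expansion[OF fg(1)] .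
		obtain e b where b: "supp_below e b" "g = schur_expansion e b" using Sym_expansion[OF fg(2)] .
		let ?d = "max d e"
		note A = expansion_mono[OF a(1), of ?d, simplified] and B = expansion_mono[OF b(1), of ?d, simplified]
		have s: "supp_below ?d (%ka. a ka + b ka)" using A(1) B(1) by (simp add: supp_below_def)
		have "f + g = schur_expansion ?d (%ka. a ka + b ka)"
			unfolding a(2) b(2) A(2)[symmetric] B(2)[symmetric]
			by (simp add: schur_expansion_def Const_add distrib_right sum.distrib)
		moreover have "dual_expansion ?d (%ka. a ka + b ka) = dual_expansion d a + dual_expansion e b"
			unfolding A(3)[symmetric] B(3)[symmetric]
			by (simp add: dual_expansion_def Const_add distrib_right sum.distrib)
		ultimately show ?thesis using w[OF s] w[OF a(1)] w[OF b(1)] a(2) b(2) by simp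
	qed
	moreover have "w (Const c * f) = Const c * w f" if f: "f : Sym" for c f
	proof -
		obtain d a where a: "supp_below d a" "f = schur_expansion d a" using Sym_expansion[OF f] .
		have s: "supp_below d (%ka. c * a ka)" using a(1) by (simp add: supp_below_def)
		have "Const c * f = schur_expansion d (%ka. c * a ka)" "dual_expansion d (%ka. c * a ka) = Const c * dual_expansion d a"
			by (simp_all add: a(2) schur_expansion_def dual_expansion_def Const_mult sum_distrib_left mult.assoc)
		then show ?thesis using w[OF s] w[OF a(1)] a(2) by simp
	qed
	moreover have "w (schur lam) = schur (conjugate lam)" if lam: "is_partition lam" for lam
	proof -
		define a where "a = (%ka. if ka = lam then 1 else 0 :: int poly)"
		have l: "lam : below Par (sz lam)" using lam by (simp add: below_def)
		have s: "supp_below (sz lam) a" using l by (auto simp: supp_below_def a_def)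
		have d: "(\<Sum>ka\<in>below Par (sz lam). Const (a ka) * g ka) = g lam" for g
		proof -
			have "(\<Sum>ka\<in>below Par (sz lam). Const (a ka) * g ka) = (\<Sum>ka\<in>below Par (sz lam). if ka = lam then g ka else 0)"
				by (rule sum.cong) (auto simp: a_def)
			then show ?thesis using l by (simp add: sum.delta)
		qed
		show ?thesis using w[OF s] unfolding schur_expansion_def dual_expansion_def d .
	qed
	ultimately have "(\<forall>f\<in>Sym. \<forall>g\<in>Sym. w (f + g) = w f + w g) &
		 (\<forall>c. \<forall>f\<in>Sym. w (Const c * f) = Const c * w f) &
		 (\<forall>lam. is_partition lam --> w (schur lam) = schur (conjugate lam))" (is "?P w") by simp
	then show ?thesis unfolding omega_def by (rule someI[of ?P w])
qed

lemma omega_expansion: "omega (schur_expansion d a) = dual_expansion d a"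
proof -
	have "omega (\<Sum>ka\<in>F. Const (a ka) * schur ka) = (\<Sum>ka\<in>F. Const (a ka) * schur (conjugate ka))" if "finite F" "F <= Par" for F
		using that
	proof (induction F rule: finite_induct)
		case empty
		have "omega (Const 0 * 0) = Const 0 * omega 0" using omega_properties Sym_0 by blast
		then show ?case by simp
	next
		case (insert x F)
		have x: "x : Par" using insert.prems by simp
		have 1: "schur x : Sym" "Const (a x) * schur x : Sym" "(\<Sum>ka\<in>F. Const (a ka) * schur ka) : Sym"
			using insert.prems by (auto intro!: schur_Sym Sym_scale Sym_sum)
		have "omega (Const (a x) * schur x + (\<Sum>ka\<in>F. Const (a ka) * schur ka)) =
				omega (Const (a x) * schur x) + omega (\<Sum>ka\<in>F. Const (a ka) * schur ka)"
			using omega_properties 1 by blast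
		also have "omega (Const (a x) * schur x) = Const (a x) * omega (schur x)" using omega_properties 1 by blast
		also have "omega (schur x) = schur (conjugate x)" using omega_properties x by blast
		finally show ?case using insert by simp
	qed
	moreover have "below Par d <= Par" unfolding below_def by blast
	ultimately show ?thesis unfolding schur_expansion_def dual_expansion_def using Par.finite_below by blast
qed

section \<open>The Cauchy kernel\<close>

text \<open>This is z_i = x_i / (1 + beta x_i), the negative of \<open>xbar\<close>.\<close>

definition zvar :: "nat => int poly mpseries" where
	"zvar i = Var i * emb i (geom (- beta))"

lemma geom_beta: "(1 + Const beta * Var i) * emb i (geom (- beta)) = 1"
proof -
	have "emb i ((1 - fps_const (- beta) * fps_X) * geom (- beta)) = emb i 1" by (simp only: geom_inverse)
	then show ?thesis by (simp only: emb_mult emb_diff emb_const emb_X emb_1 Const_uminus) simp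
qed

lemma zvar_mult: "(1 + Const beta * Var i) * zvar i = Var i"
proof -
	have "(1 + Const beta * Var i) * zvar i = Var i * ((1 + Const beta * Var i) * emb i (geom (- beta)))"
		unfolding zvar_def by (simp only: mult_ac)
	then show ?thesis unfolding geom_beta by simp
qed

lemma xbar_zvar: "xbar i = - Const (zvar i)"
proof -
	have "(1 + Const (Const beta) * xvar i) * Const (emb i (geom (- beta))) = Const ((1 + Const beta * Var i) * emb i (geom (- beta)))"
		by (simp only: Const_mult Const_add Const_1)
	then have "(1 + Const (Const beta) * xvar i) * Const (emb i (geom (- beta))) = 1" unfolding geom_beta by simp
	then have "unit_inv (1 + Const (Const beta) * xvar i) = Const (emb i (geom (- beta)))" by (rule mpseries_mult_unit_inv)
	then show ?thesis by (simp add: xbar_def zvar_def Const_mult)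
qed

lemma emb_geom: "(1 - Const a * Var j) * emb j (geom a) = 1"
proof -
	have "emb j ((1 - fps_const a * fps_X) * geom a) = emb j 1" by (simp only: geom_inverse)
	then show ?thesis by (simp only: emb_mult emb_diff emb_const emb_X emb_1)
qed

lemma kernel_factor: "(1 - xbar i * yvar j) * unit_inv (1 - xvar i * yvar j) =
		emb j (geom (Var i) * (1 + fps_const (zvar i) * fps_X))"
	unfolding mpseries_mult_unit_inv[OF emb_geom] xbar_zvar emb_mult emb_add emb_1 emb_const emb_X by (simp add: mult.commute)

text \<open>Two operators per x-variable, numbered alternately: horizontal strips with x_i account
  for 1 / (1 - x_i y), vertical strips with z_i for 1 + z_i y. The primed versions interchange
  horizontal and vertical.\<close>

definition kstep :: "nat => nat list => nat list => int poly mpseries" where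
	"kstep k = (if even k then hor_step (Var (k div 2)) else ver_step (zvar (k div 2)))"

definition kfac :: "nat => int poly mpseries fps" where
	"kfac k = (if even k then geom (Var (k div 2)) else 1 + fps_const (zvar (k div 2)) * fps_X)"

definition kstep' :: "nat => nat list => nat list => int poly mpseries" where
	"kstep' k = (if even k then ver_step (Var (k div 2)) else hor_step (zvar (k div 2)))"

definition kfac' :: "nat => int poly mpseries fps" where
	"kfac' k = (if even k then 1 + fps_const (Var (k div 2)) * fps_X else geom (zvar (k div 2)))"

lemma commutes_kstep: "step_operator.commutes Par (hor_step fps_X) (kstep k) (kfac k)"
	and commutes_kstep': "step_operator.commutes Par (hor_step fps_X) (kstep' k) (kfac' k)"
	by (simp_all add: kstep_def kfac_def kstep'_def kfac'_def commutes_hor commutes_ver)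

lemma prod_pairs: "(\<Prod>k<2 * M. f k) = (\<Prod>i<M. f (2 * i) * f (Suc (2 * i)) :: 'a::comm_ring_1)"
	by (induction M) (simp_all add: mult.assoc)

lemma kernel_upto_eq: "kernel_upto M = (\<Prod>j<M. emb j (\<Prod>k<2 * M. kfac k))"
proof -
	have "(\<Prod>k<2 * M. kfac k) = (\<Prod>i<M. geom (Var i) * (1 + fps_const (zvar i) * fps_X))"
		unfolding prod_pairs by (rule prod.cong) (simp_all add: kfac_def)
	note p = this
	show ?thesis unfolding kernel_upto_def kernel_factor p emb_prod by (rule prod.swap)
qed

text \<open>Here the y-variables are the series variables, and the x-variables belong to the
  coefficient ring, so the coefficient of y^n is a series in x.\<close>

lemma kernel_cauchy:
	assumes n: "mdegree n <= d"
	shows "cf (\<Prod>j<M. emb j (\<Prod>k<2 * M'. kfac k)) n =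
			(\<Sum>ka\<in>below Par d. cf (vchain Par (hor_step fps_X) 1 M ka) n * chain Par kstep (2 * M') [] ka)"
		and "cf (\<Prod>j<M. emb j (\<Prod>k<2 * M'. kfac' k)) n =
			(\<Sum>ka\<in>below Par d. cf (vchain Par (hor_step fps_X) 1 M ka) n * chain Par kstep' (2 * M') [] ka)"
proof -
	have "(\<Sum>ka\<in>below Par d. cf (vchain Par (hor_step fps_X) 1 M ka) n * chain Par kstep (2 * M') [] ka) =
			cf (vchain Par (hor_step fps_X) (1 * (\<Prod>k<2 * M'. kfac k)) M []) n"
		by (rule step_operator.cauchy_chain[OF step_operator_hor commutes_kstep TrueI Par.nil n])
	then show "cf (\<Prod>j<M. emb j (\<Prod>k<2 * M'. kfac k)) n =
			(\<Sum>ka\<in>below Par d. cf (vchain Par (hor_step fps_X) 1 M ka) n * chain Par kstep (2 * M') [] ka)"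
		unfolding step_operator.V_nil[OF step_operator_hor] mult_1_left by (rule sym)
	have "(\<Sum>ka\<in>below Par d. cf (vchain Par (hor_step fps_X) 1 M ka) n * chain Par kstep' (2 * M') [] ka) =
			cf (vchain Par (hor_step fps_X) (1 * (\<Prod>k<2 * M'. kfac' k)) M []) n"
		by (rule step_operator.cauchy_chain[OF step_operator_hor commutes_kstep' TrueI Par.nil n])
	then show "cf (\<Prod>j<M. emb j (\<Prod>k<2 * M'. kfac' k)) n =
			(\<Sum>ka\<in>below Par d. cf (vchain Par (hor_step fps_X) 1 M ka) n * chain Par kstep' (2 * M') [] ka)"
		unfolding step_operator.V_nil[OF step_operator_hor] mult_1_left by (rule sym)
qed

lemma Par_eq_if_rows_le:
	assumes "ka : Par" "lam : Par" "\<And>i. row ka i <= row lam i" "sz ka = sz lam"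
	shows "ka = lam"
proof (rule row_inj[OF assms(1,2)])
	fix i
	let ?n = "length ka + length lam + Suc i"
	have "(\<Sum>i<?n. row ka i) = (\<Sum>i<?n. row lam i)"
		using sum_row[of ka ?n] sum_row[of lam ?n] assms(4) by simp
	then show "row ka i = row lam i"
		by (rule sum_mono_inv[of "row ka" "{..<?n}" "row lam"]) (use assms(3) in simp_all)
qed

text \<open>A strip without boxes has weight 1, and any other strip has weight a positive power of
  0.\<close>

lemma step_0:
	assumes "ka : Par" "lam : Par"
	shows "hor_step 0 ka lam = (if ka = lam then 1 else 0)" "ver_step 0 ka lam = (if ka = lam then 1 else 0)"
proof -
	have r: "hor ka ka" "ver ka ka" using row_antimono[OF assms(1)] by (auto simp: hor_def ver_def)
	have h: "sz ka < sz lam" if "hor ka lam \<or> ver ka lam" "ka ~= lam"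
	proof -
		have le: "row ka i <= row lam i" for i using that(1) by (auto simp: hor_def ver_def)
		have "sz ka ~= sz lam" using Par_eq_if_rows_le[OF assms le] that(2) by blast
		then show ?thesis using sum_list_row_mono[of ka lam] le by (simp add: order.order_iff_strict)
	qed
	show "hor_step 0 ka lam = (if ka = lam then 1 else 0)"
		using r h by (cases "ka = lam"; cases "hor ka lam") (simp_all add: hor_step_def power_0_left)
	show "ver_step 0 ka lam = (if ka = lam then 1 else 0)"
		using r h by (cases "ka = lam"; cases "ver ka lam") (simp_all add: ver_step_def power_0_left)
qed

lemma chain_identity_tail:
	assumes A: "\<And>k ka lam. K <= k ==> ka : Par ==> lam : Par ==> A k ka lam = (if ka = lam then 1 else 0)"
		and lam: "lam : Par"
	shows "chain Par A (K + n) mu lam = chain Par A K mu lam"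
proof (induction n)
	case (Suc n)
	have "chain Par A (K + Suc n) mu lam = (\<Sum>ka\<in>below Par (sz lam). if ka = lam then chain Par A (K + n) mu ka else 0)"
		unfolding add_Suc_right chain.simps
		by (rule sum.cong[OF refl]) (use A[of "K + n"] lam in \<open>simp add: below_def\<close>)
	also have "... = chain Par A (K + n) mu lam"
	proof -
		have "lam : below Par (sz lam)" using lam by (simp add: below_def)
		then show ?thesis by (simp add: sum.delta)
	qed
	finally show ?case using Suc by simp
qed simp

text \<open>Setting the variables from index \<open>N\<close> on to zero turns the later steps into
  identities. So the coefficients become constant, as the eventual value in
  \<open>kernel_coeff\<close> requires.\<close>

lemma coeff_chain_kstep:
	assumes m: "keys m <= {..<N}" and NM: "N <= M" and lam: "lam : Par"
	shows "cf (chain Par kstep (2 * M) [] lam) m = cf (chain Par kstep (2 * N) [] lam) m"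
proof -
	let ?A = "%k ka lam. trunc N (kstep k ka lam)"
	have t: "trunc N (chain Par kstep K [] lam) = chain Par ?A K [] lam" for K
		by (rule chain_hom[OF trunc_add trunc_mult trunc_0 trunc_1])
	have "?A k ka lam = (if ka = lam then 1 else 0)" if "2 * N <= k" "ka : Par" "lam : Par" for k ka lam
	proof -
		have v: "trunc N (Var (k div 2) :: int poly mpseries) = 0" using that(1) by (simp add: trunc_Var)
		then have z: "trunc N (zvar (k div 2)) = 0" by (simp add: zvar_def trunc_mult)
		have "trunc N (kstep k ka lam) = (if even k then hor_step 0 ka lam else ver_step 0 ka lam)"
			unfolding kstep_def by (simp add: hor_step_hom[of "trunc N", OF trunc_mult trunc_0 trunc_1] v z)
		then show ?thesis unfolding step_0[OF that(2,3)] by simp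
	qed
	then have "chain Par ?A (2 * N + (2 * M - 2 * N)) [] lam = chain Par ?A (2 * N) [] lam"
		by (rule chain_identity_tail[OF _ lam])
	then have "trunc N (chain Par kstep (2 * M) [] lam) = trunc N (chain Par kstep (2 * N) [] lam)"
		using NM by (simp add: t)
	then have "cf (trunc N (chain Par kstep (2 * M) [] lam)) m = cf (trunc N (chain Par kstep (2 * N) [] lam)) m" by simp
	then show ?thesis using m by (simp add: coeff_trunc)
qed

lemma of_nat_Const: "of_nat c = (Const (of_nat c) :: 'a::comm_ring_1 mpseries)"
	by (induction c) (simp_all add: Const_add)

lemma coeff_of_nat_mult: "cf (of_nat c * f) m = of_nat c * cf (f :: 'a::comm_ring_1 mpseries) m"
	unfolding of_nat_Const[of c] by simp

lemma kernel_coeff_eq: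
	assumes m: "keys m <= {..<N}" and n: "keys n <= {..<N}" and d: "mdegree n <= d"
	shows "kernel_coeff m n = (\<Sum>ka\<in>below Par d. cf (schur ka) n * cf (chain Par kstep (2 * N) [] ka) m)"
proof -
	let ?c = "\<Sum>ka\<in>below Par d. cf (schur ka) n * cf (chain Par kstep (2 * N) [] ka) m"
	have e: "cf (cf (kernel_upto M) n) m = ?c" if M: "N <= M" for M
	proof -
		have nM: "keys n <= {..<M}" using n M by auto
		have "cf (kernel_upto M) n = (\<Sum>ka\<in>below Par d. of_nat (ssyt_count ka n) * chain Par kstep (2 * M) [] ka)"
			unfolding kernel_upto_eq kernel_cauchy(1)[OF d]
			by (rule sum.cong[OF refl]) (use nM in \<open>simp add: coeff_vchain_hor below_def\<close>)
		then have "cf (cf (kernel_upto M) n) m =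
				(\<Sum>ka\<in>below Par d. of_nat (ssyt_count ka n) * cf (chain Par kstep (2 * M) [] ka) m)"
			by (simp only: coeff_sum coeff_of_nat_mult)
		also have "... = ?c"
			by (rule sum.cong[OF refl]) (simp add: coeff_schur coeff_chain_kstep[OF m M] below_def)
		finally show ?thesis .
	qed
	have ev: "eventually (%M. cf (cf (kernel_upto M) n) m = ?c) sequentially"
		using e by (rule eventually_sequentiallyI)
	show ?thesis unfolding kernel_coeff_def
	proof (rule the_equality)
		show "eventually (%M. cf (cf (kernel_upto M) n) m = ?c) sequentially" by (rule ev)
		fix c assume "eventually (%M. cf (cf (kernel_upto M) n) m = c) sequentially"
		with ev have "eventually (%M. c = ?c) sequentially" by eventually_elim simp
		then show "c = ?c" by simp
	qed
qed

text \<open>Interchanges outer and inner variables. The Cauchy identity of GP and jq-comb has the GP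
  variables outside, whereas the Schur expansion of the kernel has the other set outside.\<close>

definition swap :: "int poly mpseries mpseries => int poly mpseries mpseries" where
	"swap f = Abs_mpseries (%n. Abs_mpseries (%m. cf (cf f m) n))"

lemma coeff_swap [simp]: "cf (cf (swap f) n) m = cf (cf f m) n"
	by (simp add: swap_def)

lemma mpseries2_eqI:
	assumes "\<And>m n. cf (cf f m) n = cf (cf g m) n" shows "f = g"
	by (intro mpseries_eqI assms)

lemma swap_add: "swap (f + g) = swap f + swap g"
	and swap_diff: "swap (f - g) = swap f - swap g"
	by (intro mpseries2_eqI; simp add: coeff_simps)+

lemma swap_mult: "swap (f * g) = swap f * swap g"
proof (rule mpseries2_eqI)
	fix n m
	have "cf (cf (swap (f * g)) n) m =
			(\<Sum>p\<in>splits m. \<Sum>q\<in>splits n. cf (cf f (fst p)) (fst q) * cf (cf g (snd p)) (snd q))"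
		by (simp add: coeff_mult coeff_sum case_prod_unfold)
	also have "... = (\<Sum>q\<in>splits n. \<Sum>p\<in>splits m. cf (cf f (fst p)) (fst q) * cf (cf g (snd p)) (snd q))"
		by (rule sum.swap)
	also have "... = cf (cf (swap f * swap g) n) m"
		by (simp add: coeff_mult coeff_sum case_prod_unfold)
	finally show "cf (cf (swap (f * g)) n) m = cf (cf (swap f * swap g) n) m" .
qed

lemma swap_1: "swap 1 = 1"
	and swap_Const2: "swap (Const (Const c)) = Const (Const c)"
	and swap_Var: "swap (Var i) = Const (Var i)"
	and swap_Const_Var: "swap (Const (Var i)) = Var i"
	by (intro mpseries2_eqI; auto simp: coeff_simps Const.rep_eq Var.rep_eq)+

lemma swap_prod: "swap (prod f A) = (\<Prod>x\<in>A. swap (f x))"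
	by (induction A rule: infinite_finite_induct) (simp_all add: swap_1 swap_mult)

text \<open>Everything rests on 1 - (y - beta) x = (1 + beta x) (1 - z y). The inverses of the two
  sides are compared by multiplying with the polynomials they invert.\<close>

lemma swap_jq_factor:
	"swap (emb i (jq_factor (Const beta) (Var j))) = emb j ((1 + fps_const (Var i) * fps_X) * geom (zvar i))"
proof -
	let ?x = "xvar i" and ?y = "yvar j" and ?b = "Const (Const beta) :: int poly mpseries mpseries" and ?z = "Const (zvar i)"
	define W where "W = swap (emb i (geom (Var j - Const beta)))"
	define G where "G = emb j (geom (zvar i))"
	have "swap ((1 - Const (Var j - Const beta) * Var i) * emb i (geom (Var j - Const beta))) = swap 1"
		by (simp only: emb_geom)
	then have W: "(1 - (?y - ?b) * ?x) * W = 1"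
		by (simp only: swap_mult swap_diff swap_1 Const_diff swap_Const_Var swap_Const2 swap_Var W_def)
	have G: "(1 - ?z * ?y) * G = 1" unfolding G_def by (rule emb_geom)
	have "Const ((1 + Const beta * Var i) * zvar i) = ?x" by (simp only: zvar_mult)
	then have z: "(1 + ?b * ?x) * ?z = ?x" by (simp only: Const_mult Const_add Const_1)
	have "1 - (?y - ?b) * ?x = (1 + ?b * ?x) - ?x * ?y" by (simp add: algebra_simps)
	also have "... = (1 + ?b * ?x) - (1 + ?b * ?x) * ?z * ?y" by (simp only: z)
	also have "... = (1 + ?b * ?x) * (1 - ?z * ?y)" by (simp add: algebra_simps)
	finally have f: "1 - (?y - ?b) * ?x = (1 + ?b * ?x) * (1 - ?z * ?y)" .
	have "G = G * ((1 - (?y - ?b) * ?x) * W)" by (simp only: W mult_1_right)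
	also have "... = ((1 - ?z * ?y) * G) * ((1 + ?b * ?x) * W)" unfolding f by (simp only: mult_ac)
	also have "... = (1 + ?b * ?x) * W" by (simp only: G mult_1_left)
	finally have GW: "G = (1 + ?b * ?x) * W" .
	have "swap (emb i (jq_factor (Const beta) (Var j))) = (1 + ?x * ?y) * (1 + ?b * ?x) * W"
		unfolding jq_factor_def emb_mult emb_add emb_1 emb_const emb_X swap_mult swap_add swap_1 swap_Var swap_Const_Var swap_Const2 W_def ..
	also have "... = (1 + ?x * ?y) * G" unfolding GW by (simp only: mult.assoc)
	also have "... = emb j ((1 + fps_const (Var i) * fps_X) * geom (zvar i))"
		unfolding G_def emb_mult emb_add emb_1 emb_const emb_X ..
	finally show ?thesis .
qed

lemma swap_jq_product:
	"swap (\<Prod>i<N. emb i (\<Prod>j<N. jq_factor (Const beta) (Var j))) = (\<Prod>j<N. emb j (\<Prod>k<2 * N. kfac' k))"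
proof -
	have "(\<Prod>k<2 * N. kfac' k) = (\<Prod>i<N. (1 + fps_const (Var i) * fps_X) * geom (zvar i))"
		unfolding prod_pairs by (rule prod.cong) (simp_all add: kfac'_def)
	note p = this
	show ?thesis unfolding p emb_prod swap_prod swap_jq_factor by (rule prod.swap)
qed

subsection \<open>Order of the kernel coefficients\<close>

definition order_ge :: "nat => int poly mpseries => bool" where
	"order_ge k f \<longleftrightarrow> (\<forall>m. cf f m ~= 0 --> k <= mdegree m)"

lemma mdegree_add: "mdegree (a + b) = mdegree a + mdegree b"
proof -
	obtain N where N: "\<forall>i\<in>keys a \<union> keys b. i < N"
		using finite_nat_set_iff_bounded[of "keys a \<union> keys b"] by auto
	then have "keys a <= {..<N}" "keys b <= {..<N}" "keys (a + b) <= {..<N}"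
		by (auto simp: keys_add_nat)
	then show ?thesis by (simp add: mdegree_eq_sum lookup_add sum.distrib)
qed

lemma order_ge_mult:
	assumes "order_ge k f" "order_ge l g" shows "order_ge (k + l) (f * g)"
	unfolding order_ge_def
proof (intro allI impI)
	fix m assume "cf (f * g) m ~= 0"
	then have "(\<Sum>p\<in>splits m. cf f (fst p) * cf g (snd p)) ~= 0" by (simp add: coeff_mult case_prod_unfold)
	then obtain p where p: "p : splits m" "cf f (fst p) * cf g (snd p) ~= 0" by (rule sum.not_neutral_contains_not_neutral)
	have "m = fst p + snd p" using p(1) by (auto simp: splits_def)
	moreover have "k <= mdegree (fst p)" "l <= mdegree (snd p)" using mult_neq_zeroD[OF p(2)] assms by (auto simp: order_ge_def)
	ultimately show "k + l <= mdegree m" by (simp add: mdegree_add)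
qed

lemma order_ge_0 [simp]: "order_ge 0 f" "order_ge k 0"
	by (simp_all add: order_ge_def coeff_simps)

lemma order_ge_sum:
	assumes "\<And>x. x : A ==> order_ge k (f x)" shows "order_ge k (sum f A)"
	unfolding order_ge_def
proof (intro allI impI)
	fix m assume "cf (sum f A) m ~= 0"
	then have "(\<Sum>x\<in>A. cf (f x) m) ~= 0" by (simp add: coeff_sum)
	then obtain x where "x : A" "cf (f x) m ~= 0" by (rule sum.not_neutral_contains_not_neutral)
	then show "k <= mdegree m" using assms by (auto simp: order_ge_def)
qed

lemma order_ge_power: "order_ge 1 x ==> order_ge n (x ^ n)"
proof (induction n)
	case (Suc n)
	then show ?case using order_ge_mult[of 1 x n "x ^ n"] by simp
qed simp

lemma order_ge_Var: "order_ge 1 (Var i)"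
	by (simp add: order_ge_def Var.rep_eq mdegree_def)

lemma order_ge_zvar: "order_ge 1 (zvar i)"
	using order_ge_mult[OF order_ge_Var order_ge_0(1)] by (simp add: zvar_def)

lemma order_ge_kstep: "order_ge (sz lam - sz ka) (kstep k ka lam)"
	by (cases "even k")
		 (simp_all add: kstep_def hor_step_def ver_step_def order_ge_power[OF order_ge_Var] order_ge_power[OF order_ge_zvar])

text \<open>Each added box costs at least one degree in x, because z_i also starts in degree 1.
  Hence a given x-monomial meets only finitely many Schur functions.\<close>

lemma order_ge_chain_kstep: "order_ge (sz lam) (chain Par kstep K [] lam)"
proof (induction K arbitrary: lam)
	case 0
	show ?case by auto
next
	case (Suc K)
	show ?case unfolding chain.simps
	proof (rule order_ge_sum)
		fix ka assume "ka : below Par (sz lam)"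
		then have "sz lam = sz ka + (sz lam - sz ka)" by (simp add: below_def)
		then show "order_ge (sz lam) (chain Par kstep K [] ka * kstep K ka lam)"
			using order_ge_mult[OF Suc order_ge_kstep] by metis
	qed
qed

lemma chain_kstep_conjugate:
	assumes "lam : Par"
	shows "chain Par kstep' K [] (conjugate lam) = chain Par kstep K [] lam"
proof -
	have nil: "conjugate [] = []" by (simp add: conjugate_def)
	have "chain Par kstep' K (conjugate []) (conjugate lam) = chain Par kstep K [] lam"
	proof (rule chain_conjugate[OF _ Par.nil assms])
		fix i
		show "(\<exists>t. kstep i = hor_step t & kstep' i = ver_step t) \<or> (\<exists>t. kstep i = ver_step t & kstep' i = hor_step t)"
		proof (cases "even i")
			case True
			then have "kstep i = hor_step (Var (i div 2)) & kstep' i = ver_step (Var (i div 2))" by (simp add: kstep_def kstep'_def)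
			then show ?thesis by blast
		next
			case False
			then have "kstep i = ver_step (zvar (i div 2)) & kstep' i = hor_step (zvar (i div 2))" by (simp add: kstep_def kstep'_def)
			then show ?thesis by blast
		qed
	qed
	then show ?thesis unfolding nil .
qed

section \<open>The dual basis and its image under omega\<close>

text \<open>For a partition \<open>ka\<close>, the coefficient of x^m in the factor of s_ka(y) in
  the kernel. Every bound on the variables of \<open>m\<close> gives the same value
  (\<open>kmat_eq\<close>); taking the least one makes it a function of \<open>m\<close>.\<close>

definition kmat :: "monomial => nat list => int poly" where
	"kmat m ka = (if ka : Par then cf (chain Par kstep (2 * (LEAST N. keys m <= {..<N})) [] ka) m else 0)"

lemma kmat_eq:
	assumes "keys m <= {..<N}" "ka : Par"
	shows "kmat m ka = cf (chain Par kstep (2 * N) [] ka) m"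
proof -
	let ?L = "LEAST N. keys m <= {..<N}"
	have 1: "keys m <= {..<?L}" by (rule LeastI[of "%N. keys m <= {..<N}" N]) (rule assms(1))
	have 2: "?L <= N" by (rule Least_le[of "%N. keys m <= {..<N}" N]) (rule assms(1))
	show ?thesis using coeff_chain_kstep[OF 1 2 assms(2)] assms(2) by (simp add: kmat_def)
qed

lemma supp_kmat: "supp_below (mdegree m) (kmat m)"
	unfolding supp_below_def
proof (intro allI impI)
	fix ka assume "ka ~: below Par (mdegree m)"
	then show "kmat m ka = 0"
		using order_ge_chain_kstep[of ka] by (auto simp: kmat_def below_def order_ge_def)
qed

lemma two_keys_bounded:
	obtains N where "keys (m :: monomial) <= {..<N}" "keys (n :: monomial) <= {..<N}"
proof -
	obtain N1 where N1: "keys m <= {..<N1}" by (rule keys_bounded)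
	obtain N2 where N2: "keys n <= {..<N2}" by (rule keys_bounded)
	have "keys m <= {..<max N1 N2}" "keys n <= {..<max N1 N2}" using N1 N2 by auto
	then show ?thesis by (rule that)
qed

lemma kernel_coeff_expansion: "kernel_coeff m n = cf (schur_expansion (mdegree m) (kmat m)) n"
proof -
	obtain N where N: "keys m <= {..<N}" "keys n <= {..<N}" by (rule two_keys_bounded)
	let ?d = "max (mdegree m) (mdegree n)"
	have "kernel_coeff m n = (\<Sum>ka\<in>below Par ?d. cf (schur ka) n * cf (chain Par kstep (2 * N) [] ka) m)"
		by (rule kernel_coeff_eq[OF N]) simp
	also have "... = (\<Sum>ka\<in>below Par ?d. kmat m ka * cf (schur ka) n)"
		by (rule sum.cong[OF refl]) (simp add: kmat_eq[OF N(1)] below_def mult.commute)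
	also have "... = cf (schur_expansion ?d (kmat m)) n" by (simp add: coeff_schur_expansion)
	also have "schur_expansion ?d (kmat m) = schur_expansion (mdegree m) (kmat m)"
		by (rule expansion_mono(2)[OF supp_kmat]) simp
	finally show ?thesis .
qed

lemma sum_below_conjugate: "(\<Sum>ka\<in>below Par d. f (conjugate ka)) = (\<Sum>ka\<in>below Par d. f ka)"
	by (rule sum.reindex_bij_betw[OF conjugate_below])

text \<open>The product in the GP/jq-comb identity is expanded by the chains of
  \<open>kstep'\<close>, whose entries are those of \<open>kstep\<close> at conjugate partitions.
  Compared with \<open>kernel_coeff_expansion\<close>, only the indices of the Schur functions are
  conjugated.\<close>

lemma gp_jq_cauchy:
	assumes d: "mdegree m <= d"
	shows "(\<Sum>lam\<in>below Strict d. cf (GP lam) m * cf (jq_comb lam []) n) =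
		cf (dual_expansion (mdegree m) (kmat m)) n"
proof -
	obtain N where N: "keys m <= {..<N}" "keys n <= {..<N}" by (rule two_keys_bounded)
	let ?J = "%lam. chain Strict (%j. jq_step (- Const beta) (Var j :: int poly mpseries)) N [] lam"
	let ?d = "max (mdegree m) (mdegree n)"
	have nil: "[] : Strict" by (rule Strict.nil)
	have J: "cf (?J lam) n = cf (jq_comb lam []) n" if "lam : Strict" for lam
		using coeff_chain_jq[of lam "[]" n N] that nil N(2) by (simp add: Const_uminus)
	have "(\<Sum>lam\<in>below Strict d. cf (vchain Strict (gp_step (fps_const (Const beta)) fps_X) 1 N lam) m * ?J lam) =
			cf (\<Prod>i<N. emb i (\<Prod>j<N. jq_factor (Const beta) (Var j))) m"
	proof -
		have "(\<Sum>lam\<in>below Strict d. cf (vchain Strict (gp_step (fps_const (Const beta)) fps_X) 1 N lam) m * ?J lam) =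
				cf (vchain Strict (gp_step (fps_const (Const beta)) fps_X) (1 * (\<Prod>j<N. jq_factor (Const beta) (Var j))) N []) m"
			by (rule step_operator.cauchy_chain[OF step_operator_gp commutes_jq TrueI nil d])
		then show ?thesis unfolding step_operator.V_nil[OF step_operator_gp] mult_1_left .
	qed
	moreover have "(\<Sum>lam\<in>below Strict d. cf (vchain Strict (gp_step (fps_const (Const beta)) fps_X) 1 N lam) m * ?J lam) =
			(\<Sum>lam\<in>below Strict d. Const (cf (GP lam) m) * ?J lam)"
		by (rule sum.cong[OF refl]) (use N(1) in \<open>simp add: coeff_vchain_GP(2) below_def\<close>)
	ultimately have "cf (\<Sum>lam\<in>below Strict d. Const (cf (GP lam) m) * ?J lam) n =
			cf (cf (\<Prod>i<N. emb i (\<Prod>j<N. jq_factor (Const beta) (Var j))) m) n" by simp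
	also have "... = cf (cf (\<Prod>j<N. emb j (\<Prod>k<2 * N. kfac' k)) n) m"
		unfolding swap_jq_product[symmetric] by simp
	also have "... = (\<Sum>ka\<in>below Par ?d. cf (schur ka) n * cf (chain Par kstep' (2 * N) [] ka) m)"
	proof -
		have "cf (\<Prod>j<N. emb j (\<Prod>k<2 * N. kfac' k)) n = (\<Sum>ka\<in>below Par ?d. of_nat (ssyt_count ka n) * chain Par kstep' (2 * N) [] ka)"
			unfolding kernel_cauchy(2)[OF max.cobounded2[of "mdegree n" "mdegree m"]]
			by (rule sum.cong[OF refl]) (use N(2) in \<open>simp add: coeff_vchain_hor below_def\<close>)
		then show ?thesis by (simp only: coeff_sum coeff_of_nat_mult coeff_schur)
	qed
	also have "... = (\<Sum>ka\<in>below Par ?d. cf (schur (conjugate ka)) n * cf (chain Par kstep' (2 * N) [] (conjugate ka)) m)"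
		by (rule sum_below_conjugate[symmetric])
	also have "... = (\<Sum>ka\<in>below Par ?d. kmat m ka * cf (schur (conjugate ka)) n)"
		by (rule sum.cong[OF refl]) (simp add: kmat_eq[OF N(1)] chain_kstep_conjugate below_def mult.commute)
	also have "... = cf (dual_expansion ?d (kmat m)) n" by (simp add: coeff_dual_expansion)
	also have "dual_expansion ?d (kmat m) = dual_expansion (mdegree m) (kmat m)"
		by (rule expansion_mono(3)[OF supp_kmat]) simp
	finally show ?thesis using J by (simp add: coeff_sum below_def)
qed

text \<open>The graph of \<open>omega\<close> in terms of expansions. As a relation it can be used
  from right to left, to produce preimages of the jq-comb.\<close>

definition omega_pair :: "int poly mpseries => int poly mpseries => bool" where
	"omega_pair f g \<longleftrightarrow> (\<exists>d a. supp_below d a & f = schur_expansion d a & g = dual_expansion d a)"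

lemma omega_pair_omega: "omega_pair f g ==> omega f = g"
	using omega_expansion by (auto simp: omega_pair_def)

lemma omega_pair_0: "omega_pair 0 0"
	unfolding omega_pair_def
	by (rule exI[of _ 0], rule exI[of _ "%_. 0"]) (simp add: supp_below_def schur_expansion_def dual_expansion_def)

lemma omega_pair_add:
	assumes "omega_pair f g" "omega_pair f' g'" shows "omega_pair (f + f') (g + g')"
proof -
	obtain d a where a: "supp_below d a" "f = schur_expansion d a" "g = dual_expansion d a"
		using assms(1) unfolding omega_pair_def by blast
	obtain e b where b: "supp_below e b" "f' = schur_expansion e b" "g' = dual_expansion e b"
		using assms(2) unfolding omega_pair_def by blast
	let ?d = "max d e"
	note A = expansion_mono[OF a(1), of ?d, simplified] and B = expansion_mono[OF b(1), of ?d, simplified]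
	have "supp_below ?d (%ka. a ka + b ka)" using A(1) B(1) by (simp add: supp_below_def)
	moreover have "f + f' = schur_expansion ?d (%ka. a ka + b ka)" "g + g' = dual_expansion ?d (%ka. a ka + b ka)"
		unfolding a(2,3) b(2,3) A(2,3)[symmetric] B(2,3)[symmetric]
		by (simp_all add: schur_expansion_def dual_expansion_def Const_add distrib_right sum.distrib)
	ultimately show ?thesis unfolding omega_pair_def by blast
qed

lemma omega_pair_scale:
	assumes "omega_pair f g" shows "omega_pair (Const c * f) (Const c * g)"
proof -
	obtain d a where a: "supp_below d a" "f = schur_expansion d a" "g = dual_expansion d a"
		using assms unfolding omega_pair_def by blast
	have "supp_below d (%ka. c * a ka)" using a(1) by (simp add: supp_below_def)
	moreover have "Const c * f = schur_expansion d (%ka. c * a ka)" "Const c * g = dual_expansion d (%ka. c * a ka)"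
		by (simp_all add: a(2,3) schur_expansion_def dual_expansion_def Const_mult sum_distrib_left mult.assoc)
	ultimately show ?thesis unfolding omega_pair_def by blast
qed

lemma omega_pair_sum:
	"(\<And>x. x : A ==> omega_pair (f x) (g x)) ==> omega_pair (\<Sum>x\<in>A. Const (c x) * f x) (\<Sum>x\<in>A. Const (c x) * g x)"
	by (induction A rule: infinite_finite_induct) (simp_all add: omega_pair_0 omega_pair_add omega_pair_scale)

lemma omega_pair_kernel: "omega_pair (schur_expansion (mdegree m) (kmat m)) (dual_expansion (mdegree m) (kmat m))"
	unfolding omega_pair_def using supp_kmat by blast

text \<open>Conjugating the indices turns a dual expansion into an ordinary Schur expansion, whose
  coefficients are unique.\<close>

lemma omega_pair_unique:
	assumes "omega_pair f g" "omega_pair f' g" shows "f = f'"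
proof -
	obtain d a where a: "supp_below d a" "f = schur_expansion d a" "g = dual_expansion d a"
		using assms(1) unfolding omega_pair_def by blast
	obtain e b where b: "supp_below e b" "f' = schur_expansion e b" "g = dual_expansion e b"
		using assms(2) unfolding omega_pair_def by blast
	define c where "c = (%a ka. if ka : Par then a (conjugate ka) else (0 :: int poly))"
	have cs: "supp_below d (c a)" "dual_expansion d a = schur_expansion d (c a)" if "supp_below d a" for d a
	proof -
		show "supp_below d (c a)" unfolding supp_below_def
		proof (intro allI impI)
			fix ka assume k: "ka ~: below Par d"
			have "conjugate ka ~: below Par d" if "ka : Par" using k that by (simp add: below_def)
			then show "c a ka = 0" using that by (simp add: c_def supp_below_def)
		qed
		have "schur_expansion d (c a) = (\<Sum>ka\<in>below Par d. Const (c a (conjugate ka)) * schur (conjugate ka))"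
			unfolding schur_expansion_def by (rule sum_below_conjugate[symmetric])
		also have "... = dual_expansion d a"
			unfolding dual_expansion_def
		proof (rule sum.cong[OF refl])
			fix ka assume "ka : below Par d"
			then have k: "ka : Par" by (simp add: below_def)
			have "c a (conjugate ka) = a ka" unfolding c_def using conjugate(1)[OF k] conjugate_conjugate[OF k] by simp
			then show "Const (c a (conjugate ka)) * schur (conjugate ka) = Const (a ka) * schur (conjugate ka)" by simp
		qed
		finally show "dual_expansion d a = schur_expansion d (c a)" by simp
	qed
	have ce: "c a = c b"
		by (rule expansion_unique[OF cs(1)[OF a(1)] cs(1)[OF b(1)]]) (use cs(2)[OF a(1)] cs(2)[OF b(1)] a(3) b(3) in simp)
	have "a = b"
	proof
		fix ka
		show "a ka = b ka"
		proof (cases "ka : Par")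
			case True
			have "c a (conjugate ka) = c b (conjugate ka)" by (simp only: ce)
			then show ?thesis unfolding c_def using conjugate(1)[OF True] conjugate_conjugate[OF True] by simp
		next
			case False
			then have "ka ~: below Par d" "ka ~: below Par e" by (simp_all add: below_def)
			then show ?thesis using a(1) b(1) by (simp add: supp_below_def)
		qed
	qed
	then show ?thesis
		unfolding a(2) b(2) using expansion_mono(2)[OF a(1), of "max d e"] expansion_mono(2)[OF b(1), of "max d e"] by simp
qed

section \<open>Unitriangularity of GP and the identification of jq\<close>

lemma lead_gp: "lam : Strict ==> step_operator.lead (gp_step (fps_const b) (fps_X :: 'a::comm_ring_1 fps)) lam = 1"
	unfolding step_operator.lead_def[OF step_operator_gp] by (rule prod.neutral) (simp add: gp_step_lead)

lemma lead_jq: "lam : Strict ==> step_operator.lead (jq_step (fps_const b) (fps_X :: 'a::comm_ring_1 fps)) lam = 2 ^ length lam"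
proof -
	assume lam: "lam : Strict"
	have "step_operator.lead (jq_step (fps_const b) (fps_X :: 'a fps)) lam = (\<Prod>j<length lam. 2)"
		unfolding step_operator.lead_def[OF step_operator_jq] by (rule prod.cong[OF refl]) (use lam in \<open>simp add: jq_step_lead\<close>)
	then show ?thesis by simp
qed

lemma GP_list_monom:
	assumes "ka : Strict"
	shows "cf (GP ka) (list_monom lam) = cf (vchain Strict (gp_step (fps_const beta) fps_X) 1 (length lam) ka) (list_monom lam)"
	using coeff_vchain_GP(1)[of ka "length lam" "list_monom lam"] assms keys_list_monom[of lam] by simp

lemma GP_degree: "lam : Strict ==> cf (GP lam) m ~= 0 ==> sz lam <= mdegree m"
proof -
	assume a: "lam : Strict" "cf (GP lam) m ~= 0"
	obtain N where N: "keys m <= {..<N}" by (rule keys_bounded)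
	have ne: "cf (vchain Strict (gp_step (fps_const beta) fps_X) 1 N lam) m ~= 0"
		using coeff_vchain_GP(1)[of lam N m] a N by simp
	show ?thesis by (rule step_operator.V_degree[OF step_operator_gp a(1) ne TrueI])
qed

text \<open>The coefficient of x^lam in \<open>gp_jq_cauchy\<close> is jq-comb_lam plus multiples of
  jq-comb_ka for shapes \<open>ka\<close> that are smaller or higher in dominance order. Solving for
  jq-comb_lam gives a preimage by induction.\<close>

lemma omega_pair_jq_comb:
	assumes "lam : Strict"
	shows "\<exists>f. omega_pair f (jq_comb lam [])"
	using assms
proof (induction lam rule: wf_induct[OF wf_measures[of "[sz, %lam. Suc (sz lam) * sz lam - Strict.top_sums lam]"]])
	case (1 lam)
	let ?m = "list_monom lam" and ?d = "sz lam"
	let ?F = "{ka : below Strict ?d - {lam}. cf (GP ka) ?m ~= 0}"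
	have lam: "lam : Strict" using 1 by blast
	have ex: "\<exists>f. omega_pair f (jq_comb ka [])" if k: "ka : ?F" for ka
	proof -
		have ks: "ka : Strict" "ka ~= lam" using k by (auto simp: below_def)
		have "cf (vchain Strict (gp_step (fps_const beta) fps_X) 1 (length lam) ka) ?m ~= 0"
			using k GP_list_monom[OF ks(1), of lam] by simp
		then have "sz ka < sz lam \<or> (sz ka = sz lam & Strict.top_sums lam < Strict.top_sums ka)"
			using step_operator.V_triangular[OF step_operator_gp lam ks(1)] ks(2) by auto
		moreover have "Strict.top_sums ka <= Suc (sz ka) * sz ka" by (rule Strict.top_sums_le)
		ultimately have "(ka, lam) : measures [sz, %lam. Suc (sz lam) * sz lam - Strict.top_sums lam]" by auto
		then show ?thesis using 1 ks(1) by blast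
	qed
	define h where "h = (%ka. SOME f. omega_pair f (jq_comb ka []))"
	have h: "omega_pair (h ka) (jq_comb ka [])" if "ka : ?F" for ka
		unfolding h_def using ex[OF that] by (rule someI_ex)
	have one: "cf (GP lam) ?m = 1"
		using GP_list_monom[OF lam, of lam] step_operator.V_lead[OF step_operator_gp lam, of beta] lead_gp[OF lam, of beta] by simp
	have "jq_comb lam [] = dual_expansion (mdegree ?m) (kmat ?m) + (\<Sum>ka\<in>?F. Const (- cf (GP ka) ?m) * jq_comb ka [])"
	proof (rule mpseries_eqI)
		fix n
		let ?t = "%ka. cf (GP ka) ?m * cf (jq_comb ka []) n"
		have "cf (dual_expansion (mdegree ?m) (kmat ?m)) n = (\<Sum>ka\<in>below Strict ?d. ?t ka)"
			by (rule gp_jq_cauchy[symmetric]) (simp add: mdegree_list_monom)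
		also have "... = ?t lam + (\<Sum>ka\<in>below Strict ?d - {lam}. ?t ka)"
			by (rule sum.remove[OF Strict.finite_below]) (use lam in \<open>simp add: below_def\<close>)
		also have "(\<Sum>ka\<in>below Strict ?d - {lam}. ?t ka) = (\<Sum>ka\<in>?F. ?t ka)"
			by (rule sum.mono_neutral_right) auto
		finally show "cf (jq_comb lam []) n =
				cf (dual_expansion (mdegree ?m) (kmat ?m) + (\<Sum>ka\<in>?F. Const (- cf (GP ka) ?m) * jq_comb ka [])) n"
			unfolding plus_mpseries.rep_eq coeff_sum_Const_mult by (simp add: one sum_negf)
	qed
	moreover have "omega_pair (schur_expansion (mdegree ?m) (kmat ?m) + (\<Sum>ka\<in>?F. Const (- cf (GP ka) ?m) * h ka))
		 (dual_expansion (mdegree ?m) (kmat ?m) + (\<Sum>ka\<in>?F. Const (- cf (GP ka) ?m) * jq_comb ka []))"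
		by (intro omega_pair_add omega_pair_kernel omega_pair_sum h)
	ultimately show ?case by metis
qed

lemma dual_to_GP_iff: "dual_to_GP g \<longleftrightarrow>
		(\<forall>m n. (\<Sum>lam\<in>below Strict (mdegree m). cf (GP lam) m * cf (g lam) n) = kernel_coeff m n)"
proof -
	have "(\<Sum>lam | strict_partition lam & cf (GP lam) m ~= 0. cf (GP lam) m * cf (g lam) n) =
			(\<Sum>lam\<in>below Strict (mdegree m). cf (GP lam) m * cf (g lam) n)" for m n
	proof (rule sum.mono_neutral_left[OF Strict.finite_below])
		show "{lam. strict_partition lam & cf (GP lam) m ~= 0} <= below Strict (mdegree m)"
			using GP_degree by (auto simp: below_def)
	qed (auto simp: below_def)
	then show ?thesis by (simp add: dual_to_GP_def)
qed

lemma GP_sum_extend: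
	assumes "mdegree m <= d"
	shows "(\<Sum>lam\<in>below Strict d. cf (GP lam) m * f lam) = (\<Sum>lam\<in>below Strict (mdegree m). cf (GP lam) m * f lam)"
proof (rule sum.mono_neutral_right[OF Strict.finite_below below_mono[OF assms]])
	show "\<forall>lam\<in>below Strict d - below Strict (mdegree m). cf (GP lam) m * f lam = 0"
	proof
		fix lam assume "lam : below Strict d - below Strict (mdegree m)"
		then have "cf (GP lam) m = 0" using GP_degree[of lam m] by (auto simp: below_def)
		then show "cf (GP lam) m * f lam = 0" by simp
	qed
qed

text \<open>For each x-monomial the preimages of the jq-comb combine to the Schur expansion of the
  kernel, by \<open>omega_pair_unique\<close>; so they satisfy the identity that defines
  \<open>gq\<close>. Independence of the GP identifies them with the chosen
  \<open>gq\<close>.\<close>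

lemma jq_eq:
	assumes lam: "lam : Strict"
	shows "jq lam = jq_comb lam []"
proof -
	define g where "g = (%lam. SOME f. omega_pair f (jq_comb lam []))"
	have g: "omega_pair (g lam) (jq_comb lam [])" if "lam : Strict" for lam
		unfolding g_def using omega_pair_jq_comb[OF that] by (rule someI_ex)
	have dual: "dual_to_GP g" unfolding dual_to_GP_iff
	proof (intro allI)
		fix m n
		let ?B = "below Strict (mdegree m)"
		have 1: "omega_pair (\<Sum>lam\<in>?B. Const (cf (GP lam) m) * g lam) (\<Sum>lam\<in>?B. Const (cf (GP lam) m) * jq_comb lam [])"
			by (rule omega_pair_sum, rule g) (simp add: below_def)
		have 2: "(\<Sum>lam\<in>?B. Const (cf (GP lam) m) * jq_comb lam []) = dual_expansion (mdegree m) (kmat m)"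
			by (rule mpseries_eqI) (simp only: coeff_sum_Const_mult gp_jq_cauchy[OF order_refl])
		have "(\<Sum>lam\<in>?B. Const (cf (GP lam) m) * g lam) = schur_expansion (mdegree m) (kmat m)"
			by (rule omega_pair_unique[OF 1[unfolded 2] omega_pair_kernel])
		then have "cf (\<Sum>lam\<in>?B. Const (cf (GP lam) m) * g lam) n = kernel_coeff m n"
			by (simp only: kernel_coeff_expansion)
		then show "(\<Sum>lam\<in>?B. cf (GP lam) m * cf (g lam) n) = kernel_coeff m n"
			unfolding coeff_sum_Const_mult .
	qed
	have gq: "dual_to_GP gq" unfolding gq_def by (rule someI[of dual_to_GP, OF dual])
	have "gq lam = g lam"
	proof (rule mpseries_eqI)
		fix n
		have "cf (gq lam) n - cf (g lam) n = 0"
		proof (rule step_operator.independent_up[OF step_operator_gp TrueI, of beta "sz lam" "%lam. cf (gq lam) n - cf (g lam) n"])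
			fix N m assume m: "mdegree m <= sz lam"
			have "(\<Sum>ka\<in>below Strict (sz lam). cf (GP ka) m * (cf (gq ka) n - cf (g ka) n)) = 0"
				using dual gq unfolding dual_to_GP_iff GP_sum_extend[OF m] by (simp add: right_diff_distrib sum_subtractf)
			moreover have "(\<Sum>ka\<in>below Strict (sz lam). cf (vchain Strict (gp_step (fps_const beta) fps_X) 1 N ka) m * (cf (gq ka) n - cf (g ka) n)) =
				(\<Sum>ka\<in>below Strict (sz lam). if keys m <= {..<N} then cf (GP ka) m * (cf (gq ka) n - cf (g ka) n) else 0)"
				by (rule sum.cong[OF refl]) (simp add: coeff_vchain_GP(1) below_def)
			ultimately show "(\<Sum>ka\<in>below Strict (sz lam). cf (vchain Strict (gp_step (fps_const beta) fps_X) 1 N ka) m * (cf (gq ka) n - cf (g ka) n)) = 0"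
				by (cases "keys m <= {..<N}") simp_all
		qed (use lam lead_gp in \<open>simp_all add: below_def\<close>)
		then show "cf (gq lam) n = cf (g lam) n" by simp
	qed
	then show ?thesis unfolding jq_def using omega_pair_omega[OF g[OF lam]] by simp
qed

section \<open>Skew functions\<close>

abbreviation jq_chain :: "(nat => nat) => nat => nat list => nat list => int poly mpseries" where
	"jq_chain s \<equiv> chain Strict (%j. jq_step (Const (- beta)) (Var (s j)))"

lemma rename_jq_chain:
	assumes bij: "bij \<pi>"
	shows "rename \<pi> (jq_chain s N mu lam) = jq_chain (%j. \<pi> (s j)) N mu lam"
proof -
	have r1: "rename \<pi> (1 :: int poly mpseries) = 1" by (metis Const_1 rename_Const bij)
	note h = rename_add rename_mult[OF bij] rename_0 r1
	show ?thesis unfolding chain_hom[of "rename \<pi>", OF h] jq_step_hom[of "rename \<pi>", OF h] using bij by simp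
qed

lemma jq_chain_permute:
	assumes pi: "\<pi> permutes {..<N}" and s: "mu : Strict" "lam : Strict"
	shows "jq_chain \<pi> N mu lam = jq_chain (%j. j) N mu lam"
proof -
	have c: "step_operator.commutes Strict (gp_step (fps_const (Const beta)) fps_X)
			(jq_step (Const (- beta)) (Var j)) (jq_factor (Const beta) (Var j :: int poly mpseries))" for j
		unfolding Const_uminus by (rule commutes_jq)
	show ?thesis
		by (rule step_operator.chain_permute[OF step_operator_gp c TrueI _ pi s]) (rule lead_gp)
qed

text \<open>The restrictions of a monomial to the two variable sets can be prescribed independently.
  In the uniqueness proof the y-part is fixed while the x-part varies.\<close>

lemma even_odd_monomial:
	obtains k :: monomial where "evens k = m" "odds k = n"
proof -
	let ?f = "%i. if even i then lookup m (i div 2) else lookup n (i div 2)"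
	obtain N where N: "keys m <= {..<N}" "keys n <= {..<N}" by (rule two_keys_bounded)
	have "{i. ?f i ~= 0} <= {..<2 * N}"
	proof
		fix i assume "i : {i. ?f i ~= 0}"
		then have "i div 2 : keys m \<or> i div 2 : keys n" by (auto simp: in_keys_iff split: if_splits)
		then have "i div 2 < N" using N by blast
		then show "i : {..<2 * N}" by simp
	qed
	then have "finite {i. ?f i ~= 0}" by (rule finite_subset) simp
	then have l: "lookup (Abs_poly_mapping ?f) = ?f" by (rule Abs_poly_mapping_inverse[OF CollectI])
	have inj: "inj (%i :: nat. 2 * i)" "inj (%i :: nat. 2 * i + 1)" by (auto simp: inj_def)
	show ?thesis
	proof (rule that[of "Abs_poly_mapping ?f"])
		show "evens (Abs_poly_mapping ?f) = m"
			by (rule poly_mapping_eqI) (simp add: lookup_map_key[OF inj(1)] l)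
		show "odds (Abs_poly_mapping ?f) = n"
			by (rule poly_mapping_eqI) (simp only: lookup_map_key[OF inj(2)] l, simp)
	qed
qed

text \<open>A bijection cannot send all variables to even ones. Therefore \<open>\<pi>\<close> and
  \<open>\<rho>\<close> are prescribed only below \<open>N\<close>, where the variables of
  \<open>P\<close> and \<open>Q\<close> lie.\<close>

lemma coeff_interleave:
	assumes k: "keys k <= {..<2 * N}"
		and P: "\<And>m. cf P m ~= 0 ==> keys m <= {..<N}"
		and Q: "\<And>m. cf Q m ~= 0 ==> keys m <= {..<N}"
		and pi: "bij \<pi>" "\<And>j. j < N ==> \<pi> j = 2 * j" and rho: "bij \<rho>" "\<And>j. j < N ==> \<rho> j = 2 * j + 1"
	shows "cf (rename \<pi> P * rename \<rho> (Q :: int poly mpseries)) k =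
		cf P (evens k) * cf Q (odds k)"
proof -
	have inj: "inj (%i :: nat. 2 * i)" "inj (%i :: nat. 2 * i + 1)" by (auto simp: inj_def)
	note injp = bij_is_inj[OF pi(1)] bij_is_inj[OF rho(1)]
	let ?e = "%i. if even i then lookup k i else 0" and ?o = "%i. if even i then 0 else lookup k i"
	have fin: "finite {i. ?e i ~= 0}" "finite {i. ?o i ~= 0}"
		by (rule finite_subset[OF _ finite_keys[of k]], auto simp: in_keys_iff split: if_splits)+
	\<comment> \<open>The even and the odd part of \<open>k\<close> form the only splitting that can
	  contribute.\<close>
	define a b where "a = Abs_poly_mapping ?e" and "b = Abs_poly_mapping ?o"
	have la: "lookup a = ?e" and lb: "lookup b = ?o"
		unfolding a_def b_def using fin by (simp_all add: Abs_poly_mapping_inverse)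
	have ab: "(a, b) : splits k"
		unfolding splits_def by (simp, rule poly_mapping_eqI) (simp add: lookup_add la lb)
	have lk: "lookup k i = 0" if "2 * N <= i" for i
	proof -
		have "i ~: keys k" using k that by (meson lessThan_iff not_less subsetD)
		then show ?thesis by (simp add: in_keys_iff)
	qed
	have supp: "\<exists>j<N. i = \<tau> j" if "keys (map_key \<tau> x) <= {..<N}" "bij \<tau>" "lookup x i ~= 0" for \<tau> i and x :: monomial
	proof -
		have "\<exists>j. i = \<tau> j" using that(2) by (metis bij_pointE)
		then obtain j where j: "i = \<tau> j" by blast
		then have "j : keys (map_key \<tau> x)"
			using that(3) by (simp add: in_keys_iff lookup_map_key[OF bij_is_inj[OF that(2)]])
		then have "j < N" using that(1) by blast
		then show ?thesis using j by blast
	qed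
	have uniq: "p = (a, b)" if p: "p : splits k" "cf P (map_key \<pi> (fst p)) * cf Q (map_key \<rho> (snd p)) ~= 0" for p
	proof -
		obtain x y where xy: "p = (x, y)" by fastforce
		have sum: "lookup x i + lookup y i = lookup k i" for i
			using p(1) by (auto simp: xy splits_def lookup_add)
		have nz: "cf P (map_key \<pi> x) ~= 0" "cf Q (map_key \<rho> y) ~= 0"
			using mult_neq_zeroD[OF p(2)] by (simp_all add: xy)
		have x0: "lookup x i = 0" if "odd i" for i
		proof (rule ccontr)
			assume "lookup x i ~= 0"
			then obtain j where "j < N" "i = \<pi> j" using supp[OF P[OF nz(1)] pi(1)] by blast
			then show False using pi(2) that by simp
		qed
		have y0: "lookup y i = 0" if "even i" for i
		proof (rule ccontr)
			assume "lookup y i ~= 0"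
			then obtain j where "j < N" "i = \<rho> j" using supp[OF Q[OF nz(2)] rho(1)] by blast
			then show False using rho(2) that by simp
		qed
		have "lookup x i = lookup a i" for i using sum[of i] x0[of i] y0[of i] by (cases "even i") (simp_all add: la)
		moreover have "lookup y i = lookup b i" for i using sum[of i] x0[of i] y0[of i] by (cases "even i") (simp_all add: lb)
		ultimately show ?thesis unfolding xy by (simp add: poly_mapping_eqI)
	qed
	have ma: "map_key \<pi> a = evens k"
	proof (rule poly_mapping_eqI)
		fix i
		show "lookup (map_key \<pi> a) i = lookup (evens k) i"
		proof (cases "i < N")
			case True then show ?thesis using pi(2)[OF True] by (simp add: lookup_map_key[OF injp(1)] lookup_map_key[OF inj(1)] la)
		next
			case False
			have "?e (\<pi> i) = 0"
			proof (cases "even (\<pi> i) & \<pi> i < 2 * N")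
				case True
				then obtain j where j: "\<pi> i = 2 * j" "j < N" by (auto elim: evenE)
				then have "\<pi> i = \<pi> j" using pi(2) by simp
				then have "i = j" using injp(1) by (metis injD)
				with j False show ?thesis by simp
			qed (use lk in auto)
			then show ?thesis using False lk[of "2 * i"] by (simp add: lookup_map_key[OF injp(1)] lookup_map_key[OF inj(1)] la)
		qed
	qed
	have mb: "map_key \<rho> b = odds k"
	proof (rule poly_mapping_eqI)
		fix i
		show "lookup (map_key \<rho> b) i = lookup (odds k) i"
		proof (cases "i < N")
			case True
			have "lookup (map_key \<rho> b) i = ?o (\<rho> i)" by (simp only: lookup_map_key[OF injp(2)] lb)
			also have "... = lookup k (2 * i + 1)" using rho(2)[OF True] by simp
			finally show ?thesis by (simp only: lookup_map_key[OF inj(2)])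
		next
			case False
			have "?o (\<rho> i) = 0"
			proof (cases "odd (\<rho> i) & \<rho> i < 2 * N")
				case True
				then obtain j where j: "\<rho> i = 2 * j + 1" "j < N" by (auto elim: oddE)
				then have "\<rho> i = \<rho> j" using rho(2) by simp
				then have "i = j" using injp(2) by (metis injD)
				with j False show ?thesis by simp
			qed (use lk in auto)
			moreover have "lookup k (2 * i + 1) = 0" using False by (intro lk) simp
			ultimately show ?thesis by (simp only: lookup_map_key[OF injp(2)] lookup_map_key[OF inj(2)] lb)
		qed
	qed
	have "cf (rename \<pi> P * rename \<rho> Q) k =
			(\<Sum>p\<in>splits k. cf P (map_key \<pi> (fst p)) * cf Q (map_key \<rho> (snd p)))"
		by (simp add: coeff_mult coeff_rename case_prod_unfold)
	also have "... = (\<Sum>p\<in>{(a, b)}. cf P (map_key \<pi> (fst p)) * cf Q (map_key \<rho> (snd p)))"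
		by (rule sum.mono_neutral_right[OF finite_splits]) (use ab uniq in blast)+
	finally show ?thesis by (simp only: sum.insert[OF finite.emptyI] sum.empty fst_conv snd_conv ma mb empty_iff not_False_eq_True add_0_right if_True)
qed

lemma jq_comb_nonzero: "jq_comb lam mu ~= 0 ==> SD mu <= SD lam"
	by (rule ccontr) (auto simp: jq_comb_def zero_mpseries_def)

lemma jq_comb_below: "mu : Strict ==> jq_comb lam mu ~= 0 ==> mu : below Strict (sz lam)"
	using SD_subset_sum[OF jq_comb_nonzero] by (simp add: below_def)

text \<open>Symmetry in \<open>2 * N\<close> variables allows the steps with even variables to come
  first. Cutting the reordered chain in the middle gives jq-comb_mu in the even variables and the
  skew function in the odd ones.\<close>

lemma jq_comb_split:
	assumes lam: "lam : Strict"
	shows "cf (jq_comb lam []) k = (\<Sum>mu\<in>below Strict (sz lam).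
		cf (jq_comb mu []) (evens k) * cf (jq_comb lam mu) (odds k))"
proof -
	obtain N where N: "keys k <= {..<N}" by (rule keys_bounded)
	then have k: "keys k <= {..<2 * N}" by auto
	\<comment> \<open>The first \<open>N\<close> steps receive the even variables, the last
	  \<open>N\<close> the odd ones. \<open>\<rho>\<close> is a bijection that agrees with this second
	  half after shifting its indices to start at 0.\<close>
	define \<pi> where "\<pi> = (%i. if i < N then 2 * i else if i < 2 * N then 2 * (i - N) + 1 else i)"
	define \<rho> where "\<rho> = (%i. if i < N then 2 * i + 1 else if i < 2 * N then 2 * (i - N) else i)"
	have perm: "\<tau> permutes {..<2 * N}" if "inj_on \<tau> {..<2 * N}" "\<tau> ` {..<2 * N} <= {..<2 * N}" "\<And>i. 2 * N <= i ==> \<tau> i = i" for \<tau>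
	proof (rule bij_imp_permutes)
		show "bij_betw \<tau> {..<2 * N} {..<2 * N}" using that(1,2) by (simp add: bij_betw_def endo_inj_surj)
	qed (use that(3) in simp)
	have pp: "\<pi> permutes {..<2 * N}"
	proof (rule perm)
		show "inj_on \<pi> {..<2 * N}" unfolding inj_on_def \<pi>_def by (auto split: if_splits) presburger+
	qed (auto simp: \<pi>_def)
	have pr: "\<rho> permutes {..<2 * N}"
	proof (rule perm)
		show "inj_on \<rho> {..<2 * N}" unfolding inj_on_def \<rho>_def by (auto split: if_splits) presburger+
	qed (auto simp: \<rho>_def)
	have bij: "bij \<pi>" "bij \<rho>" using permutes_bij[OF pp] permutes_bij[OF pr] .
	have nil: "[] : Strict" by (rule Strict.nil)
	have low: "jq_step (Const (- beta)) (Var (\<pi> i)) ka nu ~= 0 ==> sz ka <= sz nu" for i ka nu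
		using SD_subset_sum[OF jq_step_subset] .
	have P: "jq_chain \<pi> N [] mu = rename \<pi> (jq_chain (%j. j) N [] mu)" for mu
		unfolding rename_jq_chain[OF bij(1)] ..
	have Q: "jq_chain (%j. \<pi> (N + j)) N mu lam = rename \<rho> (jq_chain (%j. j) N mu lam)" for mu
		unfolding rename_jq_chain[OF bij(2)] by (rule chain_cong) (simp add: \<pi>_def \<rho>_def)
	have "cf (jq_comb lam []) k = cf (jq_chain (%j. j) (N + N) [] lam) k"
		by (rule coeff_chain_jq[symmetric]) (use lam nil k in \<open>simp_all add: mult_2\<close>)
	also have "jq_chain (%j. j) (N + N) [] lam = jq_chain \<pi> (N + N) [] lam"
		using jq_chain_permute[OF pp nil lam] by (simp add: mult_2)
	also have "... = (\<Sum>mu\<in>below Strict (sz lam). jq_chain \<pi> N [] mu * jq_chain (%j. \<pi> (N + j)) N mu lam)"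
		by (rule chain_split[OF Strict.finite_below low nil lam])
	also have "... = (\<Sum>mu\<in>below Strict (sz lam). rename \<pi> (jq_chain (%j. j) N [] mu) * rename \<rho> (jq_chain (%j. j) N mu lam))"
		unfolding P Q ..
	finally have "cf (jq_comb lam []) k = (\<Sum>mu\<in>below Strict (sz lam).
			cf (rename \<pi> (jq_chain (%j. j) N [] mu) * rename \<rho> (jq_chain (%j. j) N mu lam)) k)"
		by (simp only: coeff_sum)
	also have "... = (\<Sum>mu\<in>below Strict (sz lam).
		cf (jq_comb mu []) (evens k) * cf (jq_comb lam mu) (odds k))"
	proof (rule sum.cong[OF refl])
		fix mu assume "mu : below Strict (sz lam)"
		then have mu: "mu : Strict" by (simp add: below_def)
		have C: "cf (jq_chain (%j. j) N rho sig) m = (if keys m <= {..<N} then cf (jq_comb sig rho) m else 0)"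
			if "rho : Strict" "sig : Strict" for rho sig m
			by (rule coeff_chain_jq_all) (use that in simp_all)
		have inj: "inj (%i :: nat. 2 * i)" "inj (%i :: nat. 2 * i + 1)" by (auto simp: inj_def)
		have keys: "keys (evens k) <= {..<N}" "keys (odds k) <= {..<N}"
		proof -
			have "i < N" if "2 * i : keys k \<or> 2 * i + 1 : keys k" for i
			proof -
				have "2 * i < N \<or> 2 * i + 1 < N" using that N by blast
				then show ?thesis by linarith
			qed
			then show "keys (evens k) <= {..<N}" "keys (odds k) <= {..<N}"
				by (auto simp only: in_keys_iff lookup_map_key[OF inj(1)] lookup_map_key[OF inj(2)] lessThan_iff subset_iff)
		qed
		have "cf (rename \<pi> (jq_chain (%j. j) N [] mu) * rename \<rho> (jq_chain (%j. j) N mu lam)) k =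
			cf (jq_chain (%j. j) N [] mu) (evens k) *
			cf (jq_chain (%j. j) N mu lam) (odds k)"
		proof (rule coeff_interleave[OF k _ _ bij(1) _ bij(2)])
			show "keys m <= {..<N}" if "cf (jq_chain (%j. j) N [] mu) m ~= 0" for m
				using that unfolding C[OF nil mu] by (metis (full_types))
			show "keys m <= {..<N}" if "cf (jq_chain (%j. j) N mu lam) m ~= 0" for m
				using that unfolding C[OF mu lam] by (metis (full_types))
		qed (simp_all add: \<pi>_def \<rho>_def)
		then show "cf (rename \<pi> (jq_chain (%j. j) N [] mu) * rename \<rho> (jq_chain (%j. j) N mu lam)) k =
			cf (jq_comb mu []) (evens k) * cf (jq_comb lam mu) (odds k)"
			unfolding C[OF nil mu] C[OF mu lam] if_P[OF keys(1)] if_P[OF keys(2)] .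
	qed
	finally show ?thesis .
qed

lemma is_skew_family_jq_comb:
	assumes lam: "lam : Strict"
	shows "is_skew_family lam (jq_comb lam)"
	unfolding is_skew_family_def
proof (intro conjI allI)
	let ?S = "{mu. strict_partition mu & jq_comb lam mu ~= 0}"
	have sub: "?S <= below Strict (sz lam)" using jq_comb_below by blast
	then show "finite ?S" by (rule finite_subset) simp
	fix k
	have "cf (jq lam) k = (\<Sum>mu\<in>below Strict (sz lam).
		cf (jq_comb mu []) (evens k) * cf (jq_comb lam mu) (odds k))"
		unfolding jq_eq[OF lam] by (rule jq_comb_split[OF lam])
	also have "... = (\<Sum>mu\<in>?S.
		cf (jq_comb mu []) (evens k) * cf (jq_comb lam mu) (odds k))"
	proof (rule sum.mono_neutral_right[OF Strict.finite_below sub], rule ballI)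
		fix mu assume "mu : below Strict (sz lam) - ?S"
		then have "jq_comb lam mu = 0" by (auto simp: below_def)
		then show "cf (jq_comb mu []) (evens k) * cf (jq_comb lam mu) (odds k) = 0"
			by (simp add: zero_mpseries.rep_eq)
	qed
	also have "... = (\<Sum>mu\<in>?S.
		cf (jq mu) (evens k) * cf (jq_comb lam mu) (odds k))"
		by (rule sum.cong[OF refl]) (simp add: jq_eq)
	finally show "cf (jq lam) k = (\<Sum>mu\<in>?S.
		cf (jq mu) (evens k) * cf (jq_comb lam mu) (odds k))" .
qed

text \<open>For a fixed y-monomial the difference of the two families is a linear relation between
  the jq_mu. These are independent, because their leading coefficients 2^length can be cancelled
  over the integer polynomials. The supports may differ, so both sums are first extended to a common
  finite set \<open>F\<close>.\<close>

lemma is_skew_family_unique: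
	assumes f: "is_skew_family lam f" and g: "is_skew_family lam g" and mu: "mu : Strict"
	shows "f mu = g mu"
proof (rule mpseries_eqI)
	fix n
	define F where "F = {mu. strict_partition mu & f mu ~= 0} \<union> {mu. strict_partition mu & g mu ~= 0} \<union> {mu}"
	have finF: "finite F" and FS: "F <= Strict" using f g mu by (auto simp: F_def is_skew_family_def)
	have ext: "cf (jq lam) k = (\<Sum>mu\<in>F. cf (jq mu) (evens k) *
			cf (h mu) (odds k))" if h: "is_skew_family lam h" "h = f \<or> h = g" for h k
	proof -
		have "cf (jq lam) k = (\<Sum>mu | strict_partition mu & h mu ~= 0. cf (jq mu) (evens k) *
			cf (h mu) (odds k))" using h(1) unfolding is_skew_family_def by blast
		also have "... = (\<Sum>mu\<in>F. cf (jq mu) (evens k) *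
			cf (h mu) (odds k))"
		proof (rule sum.mono_neutral_left[OF finF])
			show "{mu. strict_partition mu & h mu ~= 0} <= F" using h(2) unfolding F_def by blast
			show "\<forall>mu\<in>F - {mu. strict_partition mu & h mu ~= 0}. cf (jq mu) (evens k) *
				cf (h mu) (odds k) = 0"
			proof
				fix mu assume "mu : F - {mu. strict_partition mu & h mu ~= 0}"
				then have "h mu = 0" using FS by blast
				then show "cf (jq mu) (evens k) * cf (h mu) (odds k) = 0"
					by (simp add: zero_mpseries.rep_eq)
			qed
		qed
		finally show ?thesis .
	qed
	have "cf (f mu) n - cf (g mu) n = 0"
	proof (rule step_operator.independent_down[OF step_operator_jq not_False_eq_True[THEN iffD2, OF TrueI] _ finF FS, of "- beta" "%mu. cf (f mu) n - cf (g mu) n"])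
		fix N m
		obtain k where k: "evens k = m" "odds k = n"
			by (rule even_odd_monomial)
		have "(\<Sum>ka\<in>F. cf (jq ka) m * cf (f ka) n) = (\<Sum>ka\<in>F. cf (jq ka) m * cf (g ka) n)"
			using ext[OF f disjI1[OF refl], of k] ext[OF g disjI2[OF refl], of k] unfolding k by simp
		then have z: "(\<Sum>ka\<in>F. cf (jq ka) m * (cf (f ka) n - cf (g ka) n)) = 0"
			by (simp add: right_diff_distrib sum_subtractf)
		have v: "cf (vchain Strict (jq_step (fps_const (- beta)) fps_X) 1 N ka) m = (if keys m <= {..<N} then cf (jq ka) m else 0)"
			if "ka : F" for ka
		proof -
			have s: "ka : Strict" using that FS by blast
			show ?thesis unfolding vchain_jq jq_eq[OF s] by (rule coeff_chain_jq_all) (use s Strict.nil in simp_all)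
		qed
		have "(\<Sum>ka\<in>F. cf (vchain Strict (jq_step (fps_const (- beta)) fps_X) 1 N ka) m * (cf (f ka) n - cf (g ka) n)) =
			(\<Sum>ka\<in>F. if keys m <= {..<N} then cf (jq ka) m * (cf (f ka) n - cf (g ka) n) else 0)"
			by (rule sum.cong[OF refl]) (simp add: v)
		also have "... = 0" using z by (cases "keys m <= {..<N}") simp_all
		finally show "(\<Sum>ka\<in>F. cf (vchain Strict (jq_step (fps_const (- beta)) fps_X) 1 N ka) m * (cf (f ka) n - cf (g ka) n)) = 0" .
	next
		show "mu : F" by (simp add: F_def)
		fix nu and x :: "int poly" assume "nu : Strict" "step_operator.lead (jq_step (fps_const (- beta)) fps_X) nu * x = 0"
		then show "x = 0" by (simp add: lead_jq)
	qed
	then show "cf (f mu) n = cf (g mu) n" by simp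
qed

theorem theorem4p13:
  fixes lam mu :: "nat list"
  assumes "strict_partition mu" and "strict_partition lam"
  shows "jq_skew lam mu = jq_comb lam mu"
proof -
  have lam: "lam \<in> Strict" and mu: "mu \<in> Strict" using assms by simp_all
  have "is_skew_family lam (jq_skew lam)"
    unfolding jq_skew_def by (rule someI[of "is_skew_family lam", OF is_skew_family_jq_comb[OF lam]])
  then show ?thesis by (rule is_skew_family_unique[OF _ is_skew_family_jq_comb[OF lam] mu])
qed

end
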